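(* Let $f$ satisfy (F1)–(F3) and $G$ satisfy (G1)–(G2) (conditions stated in the context), and assume that $$\Big(L_1+\frac{L_6}{2}\Big)\vee\Big(L_2+\frac{L_7}{2}\Big)<\lambda_1 .$$ Then for any $\tau\in(0,1)$ and $h\in(0,1)$, the Galerkin drift-implicit Euler scheme $$X^h_{m+1}=X^h_m+\tau A_hX^h_{m+1}+\tau\mathcal P_hF(X^h_{m+1})+\mathcal P_hG(X^h_m)\,\delta_mW,\qquad m\in\mathbb N,\qquad X_0^h=\mathcal P_hX_0,$$ possesses a unique invariant measure $\pi^h_\tau$ in $V_h$, and it is exponentially mixing: for any $m\in\mathbb N$, $x\in H$ and $\phi\in\mathrm{Lip}_b(H)$, $$|P^h_m\phi(x)-\pi^h_\tau(\phi)|\le\exp(-\gamma_6t_m/2)\,|\phi|_{\mathrm{Lip}}\int_H\|x-y\|\,\pi^h_\tau(\mathrm dy),$$ where $\gamma_6:=\dfrac{2(\lambda_1-L_1)-L_6}{2(\lambda_1-L_1)+1}>0$.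
   Context: Setting. $\mathbb N=\{0,1,2,\dots\}$, $a\vee b=\max(a,b)$. Let $d\in\{1,2,3\}$ and let $\mathscr O\subset\mathbb R^d$ be a bounded open set with smooth boundary. $H=L^2(\mathscr O)$ with inner product $\langle\cdot,\cdot\rangle$ and norm $\|\cdot\|$. $A$ is the Dirichlet Laplacian on $\mathscr O$ and $\lambda_1>0$ is the first eigenvalue of $-A$. $\dot H^1$ is the Sobolev space of functions vanishing on $\partial\mathscr O$ with norm $\|x\|_1=\|(-A)^{1/2}x\|=\|\nabla x\|$, $\dot H^{-1}$ is its dual, and ${}_1\langle\cdot,\cdot\rangle_{-1}$ is the duality product. Noise. $\mathbf Q$ is a self-adjoint, positive definite, trace-class operator on $H$ with orthonormal basis of eigenvectors $\{g_k\}$ and eigenvalues $\{q_k\}$; $W(t)=\sum_k\sqrt{q_k}\,g_k\beta_k(t)$ is an $H$-valued $\mathbf Q$-Wiener process on a filtered probability space $(\Omega,\mathscr F,(\mathscr F_t)_{t\ge0},\mathbb P)$, with $\beta_k$ independent one-dimensional Brownian motions. $H_0=\mathbf Q^{1/2}H$ with norm $\|\mathbf Q^{-1/2}\cdot\|$, and $\mathcal L_2^0$ is the space of Hilbert–Schmidt operators from $H_0$ to $H$. Drift. $f:\mathbb R\to\mathbb R$ is differentiable, and there are scalars $L_1,\dots,L_5\in\mathbb R$ and $q\ge1$ (with $q\in[1,3]$ if $d=3$) such that for all $\xi,\eta\in\mathbb R$: (F1) $(f(\xi)-f(\eta))(\xi-\eta)\le L_1(\xi-\eta)^2$; (F2)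 $f(\xi)\xi\le L_2|\xi|^2+L_3$; (F3) $|f'(\xi)|\le L_4|\xi|^{q-1}+L_5$. $F(x)(\xi)=f(x(\xi))$ is the associated Nemytskii operator, mapping $\dot H^1$ into $\dot H^{-1}$. Diffusion. $G:H\to\mathcal L_2^0$ is the Nemytskii operator $G(x)g_k(\xi)=g(x(\xi))g_k(\xi)$ associated with a function $g:\mathbb R\to\mathbb R$, and there are nonnegative constants $L_6,L_7,L_8$ such that for all $x,y\in H$: (G1) $\|G(x)-G(y)\|_{\mathcal L_2^0}^2\le L_6\|x-y\|^2$; (G2) $\|G(x)\|_{\mathcal L_2^0}^2\le L_7\|x\|^2+L_8$. Galerkin discretization. For $h\in(0,1)$, $\mathcal T_h$ is a regular family of partitions of $\mathscr O$ with maximal length $h$, and $V_h\subset\dot H^1$ is the space of continuous functions on $\overline{\mathscr O}$ which are piecewise linear over $\mathcal T_h$ and vanish on $\partial\mathscr O$. $A_h:V_h\to V_h$ and $\mathcal P_h:\dot H^{-1}\to V_h$ are defined by $\langle v^h,A_hx^h\rangle=-\langle\nabla x^h,\nabla v^h\rangle$ and $\langle v^h,\mathcal P_hz\rangle={}_1\langle v^h,z\rangle_{-1}$ for $x^h,v^h\in V_h$, $z\in\dot H^{-1}$. For $\tau\in(0,1)$ put $t_m=m\tau$ and $\delta_mW=W(t_{m+1})-W(t_m)$. The standing well-posedness assumption $(L_1-\lambda_1)\tau<1$ is automatic here since $L_1<\lambda_1$. Markov semigroup. $X^{h,x}_m$ is the solution of the scheme with $X_0=x\in H$, i.e. $X^{h,x}_0=\mathcal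 P_hx$, and $P_m^h\phi(x)=\mathbb E\,\phi(X_m^{h,x})$. $\mathrm{Lip}_b(H)$ is the set of bounded Lipschitz functions $H\to\mathbb R$, with $|\phi|_{\mathrm{Lip}}=\sup_{x\ne y}|\phi(x)-\phi(y)|/\|x-y\|$. A Borel probability measure $\mu$ on $V_h$ is invariant if $\int_{V_h}P^h_m\phi\,\mathrm d\mu=\mu(\phi):=\int_{V_h}\phi\,\mathrm d\mu$ for all bounded continuous $\phi$ and $m\in\mathbb N$; a measure on $V_h$ is regarded as a measure on $H$ supported on $V_h$. *)

theory Defs
  imports "HOL-Probability.Probability"
begin

section \<open>The real Hilbert space of square-integrable functions\<close>

definition square_integrable :: "('a::euclidean_space \<Rightarrow> real) \<Rightarrow> bool" where
  "square_integrable f \<longleftrightarrow>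
     f \<in> borel_measurable lebesgue \<and> integrable lebesgue (\<lambda>x. (f x)\<^sup>2)"

lemma square_integrable_zero [simp]: "square_integrable (\<lambda>x. 0)"
  by (simp add: square_integrable_def)

lemma square_integrable_scale:
  "square_integrable f \<Longrightarrow> square_integrable (\<lambda>x. c * f x)"
  by (auto simp: square_integrable_def power_mult_distrib)

lemma square_integrable_add:
  assumes f: "square_integrable f" and g: "square_integrable g"
  shows "square_integrable (\<lambda>x. f x + g x)"
proof -
  have [measurable]: "f \<in> borel_measurable lebesgue" "g \<in> borel_measurable lebesgue"
    using f g by (auto simp: square_integrable_def)
  have *: "(a + b)\<^sup>2 \<le> 2 * a\<^sup>2 + 2 * b\<^sup>2" for a b :: real
    using zero_le_power2[of "a - b"] by (simp add: power2_sum power2_diff)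
  have "integrable lebesgue (\<lambda>x. (f x + g x)\<^sup>2)"
    by (rule Bochner_Integration.integrable_bound[of lebesgue "\<lambda>x. 2 * (f x)\<^sup>2 + 2 * (g x)\<^sup>2"])
      (use f g * in \<open>auto simp: square_integrable_def\<close>)
  then show ?thesis by (simp add: square_integrable_def)
qed

lemma square_integrable_diff:
  assumes "square_integrable f" "square_integrable g"
  shows "square_integrable (\<lambda>x. f x - g x)"
  using square_integrable_add[OF assms(1) square_integrable_scale[OF assms(2), of "-1"]] by simp

lemma square_integrable_mult:
  assumes f: "square_integrable f" and g: "square_integrable g"
  shows "integrable lebesgue (\<lambda>x. f x * g x)"
proof -
  have [measurable]: "f \<in> borel_measurable lebesgue" "g \<in> borel_measurable lebesgue"
    using f g by (auto simp: square_integrable_def)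
  have *: "\<bar>a * b\<bar> \<le> a\<^sup>2 + b\<^sup>2" for a b :: real
  proof -
    have "2 * (\<bar>a\<bar> * \<bar>b\<bar>) \<le> \<bar>a\<bar>\<^sup>2 + \<bar>b\<bar>\<^sup>2"
      using sum_squares_bound[of "\<bar>a\<bar>" "\<bar>b\<bar>"] by simp
    moreover have "0 \<le> \<bar>a\<bar> * \<bar>b\<bar>" by simp
    ultimately show ?thesis unfolding abs_mult power2_abs by linarith
  qed
  show ?thesis
    by (rule Bochner_Integration.integrable_bound[of lebesgue "\<lambda>x. (f x)\<^sup>2 + (g x)\<^sup>2"])
      (use f g * in \<open>auto simp: square_integrable_def\<close>)
qed

definition ae_eq :: "('a::euclidean_space \<Rightarrow> real) \<Rightarrow> ('a \<Rightarrow> real) \<Rightarrow> bool" where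
  "ae_eq f g \<longleftrightarrow>
     square_integrable f \<and> square_integrable g \<and> (AE x in lebesgue. f x = g x)"

quotient_type (overloaded) 'a L2 = "'a::euclidean_space \<Rightarrow> real" / partial: ae_eq
proof (rule part_equivpI)
  show "\<exists>f::'a \<Rightarrow> real. ae_eq f f"
    by (rule exI[of _ "\<lambda>x. 0"]) (simp add: ae_eq_def)
  show "symp (ae_eq :: ('a \<Rightarrow> real) \<Rightarrow> _)"
    by (auto simp: symp_def ae_eq_def elim: eventually_mono)
  show "transp (ae_eq :: ('a \<Rightarrow> real) \<Rightarrow> _)"
    by (auto simp: transp_def ae_eq_def)
qed

lemma ae_eq_integral_cong:
  assumes "ae_eq f f'" "ae_eq g g'"
  shows "(LINT x|lebesgue. f x * g x) = (LINT x|lebesgue. f' x * g' x)"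
proof (rule integral_cong_AE)
  show "(\<lambda>x. f x * g x) \<in> borel_measurable lebesgue" "(\<lambda>x. f' x * g' x) \<in> borel_measurable lebesgue"
    using assms by (auto simp: ae_eq_def square_integrable_def)
  show "AE x in lebesgue. f x * g x = f' x * g' x"
    using assms by (auto simp: ae_eq_def)
qed

instantiation L2 :: (euclidean_space) real_vector
begin

lift_definition zero_L2 :: "'a L2" is "\<lambda>x. 0"
  by (simp add: ae_eq_def)

lift_definition plus_L2 :: "'a L2 \<Rightarrow> 'a L2 \<Rightarrow> 'a L2" is "\<lambda>f g x. f x + g x"
  by (auto simp: ae_eq_def square_integrable_add)

lift_definition minus_L2 :: "'a L2 \<Rightarrow> 'a L2 \<Rightarrow> 'a L2" is "\<lambda>f g x. f x - g x"
  by (auto simp: ae_eq_def square_integrable_diff)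

lift_definition uminus_L2 :: "'a L2 \<Rightarrow> 'a L2" is "\<lambda>f x. - f x"
  by (auto simp: ae_eq_def dest: square_integrable_scale[where c = "-1"])

lift_definition scaleR_L2 :: "real \<Rightarrow> 'a L2 \<Rightarrow> 'a L2" is "\<lambda>c f x. c * f x"
  by (auto simp: ae_eq_def square_integrable_scale)

instance
proof
  fix u v w :: "'a L2" and a b :: real
  show "u + v + w = u + (v + w)" "u + v = v + u" "0 + u = u" "- u + u = 0" "u - v = u + - v"
    by (transfer, auto simp: ae_eq_def square_integrable_add square_integrable_diff
          square_integrable_scale[where c = "-1", simplified] algebra_simps)+
  show "a *\<^sub>R (u + v) = a *\<^sub>R u + a *\<^sub>R v" "(a + b) *\<^sub>R u = a *\<^sub>R u + b *\<^sub>R u"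
    "a *\<^sub>R b *\<^sub>R u = (a * b) *\<^sub>R u"
    by (transfer, auto simp: ae_eq_def square_integrable_add square_integrable_scale algebra_simps)+
  show "1 *\<^sub>R u = u"
    by (transfer, auto simp: ae_eq_def)
qed

end

instantiation L2 :: (euclidean_space) real_inner
begin

lift_definition inner_L2 :: "'a L2 \<Rightarrow> 'a L2 \<Rightarrow> real" is "\<lambda>f g. LINT x|lebesgue. f x * g x"
  by (rule ae_eq_integral_cong)

definition norm_L2 :: "'a L2 \<Rightarrow> real" where "norm_L2 u = sqrt (inner u u)"
definition dist_L2 :: "'a L2 \<Rightarrow> 'a L2 \<Rightarrow> real" where "dist_L2 u v = norm (u - v)"
definition sgn_L2 :: "'a L2 \<Rightarrow> 'a L2" where "sgn_L2 u = inverse (norm u) *\<^sub>R u"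
definition uniformity_L2 :: "('a L2 \<times> 'a L2) filter" where
  "uniformity_L2 = (INF e\<in>{0<..}. principal {(u, v). dist u v < e})"
definition open_L2 :: "'a L2 set \<Rightarrow> bool" where
  "open_L2 U \<longleftrightarrow> (\<forall>u\<in>U. eventually (\<lambda>(u', v). u' = u \<longrightarrow> v \<in> U) uniformity)"

instance
proof
  fix u v w :: "'a L2" and c :: real and U :: "'a L2 set"
  show "dist u v = norm (u - v)" "sgn u = u /\<^sub>R norm u" "norm u = sqrt (inner u u)"
    by (simp_all add: dist_L2_def sgn_L2_def norm_L2_def divide_inverse_commute)
  show "uniformity = (INF e\<in>{0<..}. principal {(u::'a L2, v). dist u v < e})"
    by (simp add: uniformity_L2_def)
  show "open U \<longleftrightarrow> (\<forall>u\<in>U. eventually (\<lambda>(u', v). u' = u \<longrightarrow> v \<in> U) uniformity)"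
    by (simp add: open_L2_def)
  show "inner u v = inner v u"
    by transfer (simp add: mult.commute)
  show "inner (u + v) w = inner u w + inner v w"
    by transfer (simp add: ae_eq_def distrib_right square_integrable_mult)
  show "inner (c *\<^sub>R u) v = c * inner u v"
    by transfer (simp add: mult.assoc)
  show "0 \<le> inner u u"
    by transfer simp
  show "inner u u = 0 \<longleftrightarrow> u = 0"
  proof (transfer, unfold ae_eq_def)
    fix f :: "'a \<Rightarrow> real"
    assume f: "square_integrable f \<and> square_integrable f \<and> (AE x in lebesgue. f x = f x)"
    then have "integrable lebesgue (\<lambda>x. f x * f x)"
      by (simp add: square_integrable_mult)
    then have "(LINT x|lebesgue. f x * f x) = 0 \<longleftrightarrow> (AE x in lebesgue. f x * f x = 0)"
      by (intro integral_nonneg_eq_0_iff_AE) auto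
    then show "(LINT x|lebesgue. f x * f x) = 0 \<longleftrightarrow>
       square_integrable f \<and> square_integrable (\<lambda>x::'a. 0) \<and> (AE x in lebesgue. f x = 0)"
      using f by simp
  qed
qed

end

text \<open>
  \<open>L2_on \<O>\<close> is \<open>H = L\<^sup>2(\<O>)\<close>, embedded in \<open>L\<^sup>2(\<real>\<^sup>d)\<close> by extension by zero.
  \<^term>\<open>rep_L2 u\<close> is some representative of the class \<open>u\<close>, and \<^term>\<open>abs_L2 f\<close> is meaningful
  only for square-integrable \<open>f\<close>.
\<close>

definition L2_on :: "'a::euclidean_space set \<Rightarrow> 'a L2 set" where
  "L2_on \<O> = {u. AE x in lebesgue. x \<notin> \<O> \<longrightarrow> rep_L2 u x = 0}"


section \<open>Smooth domains, Sobolev spaces and the Dirichlet Laplacian\<close>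

primrec C_k_on :: "nat \<Rightarrow> 'a::euclidean_space set \<Rightarrow> ('a \<Rightarrow> real) \<Rightarrow> bool" where
  "C_k_on 0 U \<phi> \<longleftrightarrow> continuous_on U \<phi>"
| "C_k_on (Suc k) U \<phi> \<longleftrightarrow> (\<forall>x\<in>U. \<phi> differentiable (at x)) \<and>
     (\<forall>b\<in>Basis. C_k_on k U (\<lambda>x. frechet_derivative \<phi> (at x) b))"

definition smooth_on :: "'a::euclidean_space set \<Rightarrow> ('a \<Rightarrow> real) \<Rightarrow> bool" where
  "smooth_on U \<phi> \<longleftrightarrow> (\<forall>k. C_k_on k U \<phi>)"

text \<open>Smoothness of the boundary is expressed by local defining functions.\<close>

definition smooth_boundary :: "'a::euclidean_space set \<Rightarrow> bool" where
  "smooth_boundary \<O> \<longleftrightarrow> (\<forall>p\<in>frontier \<O>. \<exists>U \<rho>. open U \<and> p \<in> U \<and> smooth_on U \<rho> \<and>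
     (\<forall>x\<in>U. \<exists>b. frechet_derivative \<rho> (at x) b \<noteq> 0) \<and> \<O> \<inter> U = {x\<in>U. \<rho> x < 0})"

definition test_fun :: "'a::euclidean_space set \<Rightarrow> ('a \<Rightarrow> real) \<Rightarrow> bool" where
  "test_fun \<O> \<phi> \<longleftrightarrow> smooth_on UNIV \<phi> \<and>
     (\<exists>K. compact K \<and> K \<subseteq> \<O> \<and> (\<forall>x. x \<notin> K \<longrightarrow> \<phi> x = 0))"

definition pderiv_dir :: "'a::euclidean_space \<Rightarrow> ('a \<Rightarrow> real) \<Rightarrow> 'a \<Rightarrow> real" where
  "pderiv_dir b \<phi> = (\<lambda>x. frechet_derivative \<phi> (at x) b)"

definition has_weak_deriv ::
    "'a::euclidean_space set \<Rightarrow> 'a \<Rightarrow> 'a L2 \<Rightarrow> 'a L2 \<Rightarrow> bool" where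
  "has_weak_deriv \<O> b u w \<longleftrightarrow> w \<in> L2_on \<O> \<and>
     (\<forall>\<phi>. test_fun \<O> \<phi> \<longrightarrow> inner u (abs_L2 (pderiv_dir b \<phi>)) = - inner w (abs_L2 \<phi>))"

definition weak_deriv :: "'a::euclidean_space set \<Rightarrow> 'a \<Rightarrow> 'a L2 \<Rightarrow> 'a L2" where
  "weak_deriv \<O> b u = (THE w. has_weak_deriv \<O> b u w)"

definition sobolev_H1 :: "'a::euclidean_space set \<Rightarrow> 'a L2 set" where
  "sobolev_H1 \<O> = {u\<in>L2_on \<O>. \<forall>b\<in>Basis. \<exists>w. has_weak_deriv \<O> b u w}"

definition sobolev_H10 :: "'a::euclidean_space set \<Rightarrow> 'a L2 set" where
  "sobolev_H10 \<O> = {u\<in>sobolev_H1 \<O>. \<exists>\<phi>. (\<forall>n::nat. test_fun \<O> (\<phi> n)) \<and>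
     (\<lambda>n. abs_L2 (\<phi> n)) \<longlonglongrightarrow> u \<and>
     (\<forall>b\<in>Basis. (\<lambda>n. abs_L2 (pderiv_dir b (\<phi> n))) \<longlonglongrightarrow> weak_deriv \<O> b u)}"

definition grad_inner :: "'a::euclidean_space set \<Rightarrow> 'a L2 \<Rightarrow> 'a L2 \<Rightarrow> real" where
  "grad_inner \<O> u v = (\<Sum>b\<in>Basis. inner (weak_deriv \<O> b u) (weak_deriv \<O> b v))"

text \<open>The graph of the (unbounded) operator \<open>A\<close>: \<open>u\<close> is in its domain and \<open>A u = w\<close>.\<close>

definition dirichlet_laplacian :: "'a::euclidean_space set \<Rightarrow> 'a L2 \<Rightarrow> 'a L2 \<Rightarrow> bool" where
  "dirichlet_laplacian \<O> u w \<longleftrightarrow> u \<in> sobolev_H10 \<O> \<and> w \<in> L2_on \<O> \<and>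
     (\<forall>v\<in>sobolev_H10 \<O>. inner w v = - grad_inner \<O> u v)"

definition first_eigenvalue :: "'a::euclidean_space set \<Rightarrow> real" where
  "first_eigenvalue \<O> = (LEAST l. \<exists>u. u \<noteq> 0 \<and> dirichlet_laplacian \<O> u (- l *\<^sub>R u))"


section \<open>Finite elements\<close>

text \<open>
  A domain with smooth boundary is in general not a union of simplices. The mesh \<open>T\<close> therefore is a
  conforming triangulation by \<open>d\<close>-simplices of a set covering \<open>closure \<O>\<close>, and the cells of the
  partition of the domain are the sets \<open>S \<inter> closure \<O>\<close> with \<open>S \<in> T\<close>. This includes the usual
  construction in which the functions are piecewise linear on an inscribed polyhedron and vanish
  in the skin between the polyhedron and the boundary.
\<close>

definition is_mesh :: "'a::euclidean_space set \<Rightarrow> real \<Rightarrow> 'a set set \<Rightarrow> bool" where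
  "is_mesh \<O> h T \<longleftrightarrow> triangulation T \<and> (\<forall>S\<in>T. int DIM('a) simplex S) \<and>
     closure \<O> \<subseteq> \<Union>T \<and> Max (diameter ` T) = h"

text \<open>Regularity: the ratio of diameter and inradius is bounded uniformly over all meshes.\<close>

definition regular_mesh_family :: "'a::euclidean_space set \<Rightarrow> (real \<Rightarrow> 'a set set) \<Rightarrow> bool" where
  "regular_mesh_family \<O> T \<longleftrightarrow> (\<forall>h\<in>{0<..<1}. is_mesh \<O> h (T h)) \<and>
     (\<exists>\<sigma>>0. \<forall>h\<in>{0<..<1}. \<forall>S\<in>T h. \<exists>c. cball c (diameter S / \<sigma>) \<subseteq> S)"

definition fe_space :: "'a::euclidean_space set \<Rightarrow> 'a set set \<Rightarrow> 'a L2 set" where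
  "fe_space \<O> T = {abs_L2 (\<lambda>x. if x \<in> \<O> then v x else 0) | v.
     continuous_on (closure \<O>) v \<and>
     (\<forall>S\<in>T. \<exists>a c. \<forall>x\<in>S \<inter> closure \<O>. v x = inner a x + c) \<and>
     (\<forall>x\<in>frontier \<O>. v x = 0)}"

text \<open>
  Elements \<open>z\<close> of the dual of \<open>sobolev_H10 \<O>\<close> are represented by the functionals \<open>v \<mapsto> \<langle>v, z\<rangle>\<close>.
  In particular \<open>L2_functional\<close> is the embedding of \<open>H\<close> into this dual. In the following, \<open>V\<close>
  stands for the finite element space.
\<close>

definition L2_functional :: "'a::euclidean_space L2 \<Rightarrow> 'a L2 \<Rightarrow> real" where
  "L2_functional y = (\<lambda>v. inner v y)"

definition galerkin_proj :: "'a::euclidean_space L2 set \<Rightarrow> ('a L2 \<Rightarrow> real) \<Rightarrow> 'a L2" where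
  "galerkin_proj V z = (THE w. w \<in> V \<and> (\<forall>v\<in>V. inner v w = z v))"

definition discrete_laplacian ::
    "'a::euclidean_space set \<Rightarrow> 'a L2 set \<Rightarrow> 'a L2 \<Rightarrow> 'a L2" where
  "discrete_laplacian \<O> V x = (THE w. w \<in> V \<and> (\<forall>v\<in>V. inner v w = - grad_inner \<O> x v))"

definition nemytskii_drift ::
    "'a::euclidean_space set \<Rightarrow> (real \<Rightarrow> real) \<Rightarrow> 'a L2 \<Rightarrow> 'a L2 \<Rightarrow> real" where
  "nemytskii_drift \<O> f x = (\<lambda>v. LINT \<xi>:\<O>|lebesgue. f (rep_L2 x \<xi>) * rep_L2 v \<xi>)"


section \<open>The noise\<close>

definition orthonormal_basis_of :: "'a::euclidean_space L2 set \<Rightarrow> (nat \<Rightarrow> 'a L2) \<Rightarrow> bool" where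
  "orthonormal_basis_of H e \<longleftrightarrow> range e \<subseteq> H \<and>
     (\<forall>i j. inner (e i) (e j) = (if i = j then 1 else 0)) \<and> H \<subseteq> closure (span (range e))"

definition bounded_linear_between ::
    "'a::real_normed_vector set \<Rightarrow> ('a \<Rightarrow> real) \<Rightarrow> 'b::real_normed_vector set \<Rightarrow> ('a \<Rightarrow> 'b) \<Rightarrow> bool" where
  "bounded_linear_between E nrm E' R \<longleftrightarrow> R ` E \<subseteq> E' \<and>
     (\<forall>u\<in>E. \<forall>v\<in>E. R (u + v) = R u + R v) \<and> (\<forall>c. \<forall>u\<in>E. R (c *\<^sub>R u) = c *\<^sub>R R u) \<and>
     (\<exists>C. \<forall>u\<in>E. norm (R u) \<le> C * nrm u)"

definition covariance_operator ::
    "'a::euclidean_space L2 set \<Rightarrow> ('a L2 \<Rightarrow> 'a L2) \<Rightarrow> (nat \<Rightarrow> 'a L2) \<Rightarrow> (nat \<Rightarrow> real) \<Rightarrow> bool" where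
  "covariance_operator H Q e qk \<longleftrightarrow> bounded_linear_between H norm H Q \<and>
     (\<forall>u\<in>H. \<forall>v\<in>H. inner (Q u) v = inner u (Q v)) \<and>
     (\<forall>u\<in>H. u \<noteq> 0 \<longrightarrow> 0 < inner (Q u) u) \<and>
     orthonormal_basis_of H e \<and> (\<forall>k. Q (e k) = qk k *\<^sub>R e k) \<and>
     summable (\<lambda>k. inner (Q (e k)) (e k))"

text \<open>\<open>Q\<^sup>1\<^sup>/\<^sup>2\<close>, by functional calculus in the eigenbasis \<open>e\<close> with eigenvalues \<open>qk\<close>\<close>

definition cov_sqrt :: "(nat \<Rightarrow> 'a::euclidean_space L2) \<Rightarrow> (nat \<Rightarrow> real) \<Rightarrow> 'a L2 \<Rightarrow> 'a L2" where
  "cov_sqrt e qk u = (\<Sum>k. (sqrt (qk k) * inner u (e k)) *\<^sub>R e k)"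

definition H0_space ::
    "'a::euclidean_space L2 set \<Rightarrow> (nat \<Rightarrow> 'a L2) \<Rightarrow> (nat \<Rightarrow> real) \<Rightarrow> 'a L2 set" where
  "H0_space H e qk = cov_sqrt e qk ` H"

definition H0_norm ::
    "'a::euclidean_space L2 set \<Rightarrow> (nat \<Rightarrow> 'a L2) \<Rightarrow> (nat \<Rightarrow> real) \<Rightarrow> 'a L2 \<Rightarrow> real" where
  "H0_norm H e qk u = norm (inv_into H (cov_sqrt e qk) u)"

text \<open>
  Hilbert-Schmidt operators from \<open>H\<^sub>0\<close> to \<open>H\<close>, with their norm computed in the orthonormal basis
  \<open>Q\<^sup>1\<^sup>/\<^sup>2 e\<^sub>k\<close> of \<open>H\<^sub>0\<close>.
\<close>

definition L20 ::
    "'a::euclidean_space L2 set \<Rightarrow> (nat \<Rightarrow> 'a L2) \<Rightarrow> (nat \<Rightarrow> real) \<Rightarrow> ('a L2 \<Rightarrow> 'a L2) set" where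
  "L20 H e qk = {R. bounded_linear_between (H0_space H e qk) (H0_norm H e qk) H R \<and>
     summable (\<lambda>k. (norm (R (cov_sqrt e qk (e k))))\<^sup>2)}"

definition L20_norm ::
    "(nat \<Rightarrow> 'a::euclidean_space L2) \<Rightarrow> (nat \<Rightarrow> real) \<Rightarrow> ('a L2 \<Rightarrow> 'a L2) \<Rightarrow> real" where
  "L20_norm e qk R = sqrt (\<Sum>k. (norm (R (cov_sqrt e qk (e k))))\<^sup>2)"

definition nemytskii_diffusion ::
    "'a::euclidean_space set \<Rightarrow> (nat \<Rightarrow> 'a L2) \<Rightarrow> (nat \<Rightarrow> real) \<Rightarrow> (real \<Rightarrow> real) \<Rightarrow>
     ('a L2 \<Rightarrow> 'a L2 \<Rightarrow> 'a L2) \<Rightarrow> bool" where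
  "nemytskii_diffusion \<O> e qk g G \<longleftrightarrow> (\<forall>x\<in>L2_on \<O>. G x \<in> L20 (L2_on \<O>) e qk \<and>
     (\<forall>k. AE \<xi> in lebesgue. \<xi> \<in> \<O> \<longrightarrow>
        rep_L2 (G x (e k)) \<xi> = g (rep_L2 x \<xi>) * rep_L2 (e k) \<xi>))"

text \<open>Time-dependent objects are indexed by \<^typ>\<open>real\<close>, but only times \<open>t \<ge> 0\<close> matter.\<close>

definition filtered_prob_space :: "'w measure \<Rightarrow> (real \<Rightarrow> 'w measure) \<Rightarrow> bool" where
  "filtered_prob_space M F \<longleftrightarrow> prob_space M \<and> (\<forall>t\<ge>0. subalgebra M (F t)) \<and>
     (\<forall>s t. 0 \<le> s \<and> s \<le> t \<longrightarrow> sets (F s) \<subseteq> sets (F t))"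

definition brownian_motion :: "'w measure \<Rightarrow> (real \<Rightarrow> 'w \<Rightarrow> real) \<Rightarrow> bool" where
  "brownian_motion M B \<longleftrightarrow>
     (\<forall>t\<ge>0. B t \<in> borel_measurable M) \<and>
     (AE \<omega> in M. B 0 \<omega> = 0) \<and>
     (AE \<omega> in M. continuous_on {0..} (\<lambda>t. B t \<omega>)) \<and>
     (\<forall>s t. 0 \<le> s \<and> s < t \<longrightarrow> distributed M lborel (\<lambda>\<omega>. B t \<omega> - B s \<omega>)
        (\<lambda>x. ennreal (normal_density 0 (sqrt (t - s)) x))) \<and>
     (\<forall>n (ts :: nat \<Rightarrow> real). 0 \<le> ts 0 \<and> mono ts \<longrightarrow>
        prob_space.indep_vars M (\<lambda>_. borel) (\<lambda>i \<omega>. B (ts (Suc i)) \<omega> - B (ts i) \<omega>) {..<n})"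

definition wiener_process ::
    "'w measure \<Rightarrow> (real \<Rightarrow> 'w measure) \<Rightarrow> (nat \<Rightarrow> 'a::euclidean_space L2) \<Rightarrow> (nat \<Rightarrow> real) \<Rightarrow>
     (nat \<Rightarrow> real \<Rightarrow> 'w \<Rightarrow> real) \<Rightarrow> (real \<Rightarrow> 'w \<Rightarrow> 'a L2) \<Rightarrow> bool" where
  "wiener_process M F e qk \<beta> W \<longleftrightarrow>
     (\<forall>k. brownian_motion M (\<beta> k)) \<and>
     prob_space.indep_vars M (\<lambda>_. Pi\<^sub>M {0..} (\<lambda>_. borel)) (\<lambda>k \<omega>. \<lambda>t\<in>{0..}. \<beta> k t \<omega>) UNIV \<and>
     (\<forall>t\<ge>0. AE \<omega> in M. (\<lambda>k. (sqrt (qk k) * \<beta> k t \<omega>) *\<^sub>R e k) sums W t \<omega>) \<and>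
     (AE \<omega> in M. continuous_on {0..} (\<lambda>t. W t \<omega>)) \<and>
     (\<forall>t\<ge>0. W t \<in> borel_measurable (F t)) \<and>
     (\<forall>s t. 0 \<le> s \<and> s \<le> t \<longrightarrow> prob_space.indep_set M (sets (F s))
        {(\<lambda>\<omega>. W t \<omega> - W s \<omega>) -` B \<inter> space M | B. B \<in> sets borel})"


section \<open>The scheme, its Markov semigroup and invariant measures\<close>

text \<open>
  \<open>Z = R \<Delta>\<close> for a random operator \<open>R\<close> from \<open>H\<^sub>0\<close> to \<open>H\<close> and a Wiener increment \<open>\<Delta>\<close>. Since \<open>\<Delta>\<close> has
  values in \<open>H\<close> but not in \<open>H\<^sub>0\<close>, the product is the Ito integral, that is, the mean-square limit of
  \<open>\<Sum>k<n. \<langle>\<Delta>, e\<^sub>k\<rangle> R e\<^sub>k\<close>.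
\<close>

definition is_stochastic_product ::
    "'w measure \<Rightarrow> (nat \<Rightarrow> 'a::euclidean_space L2) \<Rightarrow> ('w \<Rightarrow> 'a L2 \<Rightarrow> 'a L2) \<Rightarrow> ('w \<Rightarrow> 'a L2) \<Rightarrow>
     ('w \<Rightarrow> 'a L2) \<Rightarrow> bool" where
  "is_stochastic_product M e R \<Delta> Z \<longleftrightarrow> Z \<in> borel_measurable M \<and>
     (\<lambda>n. \<integral>\<^sup>+\<omega>. ennreal ((norm (Z \<omega> - (\<Sum>k<n. inner (\<Delta> \<omega>) (e k) *\<^sub>R R \<omega> (e k))))\<^sup>2) \<partial>M) \<longlonglongrightarrow> 0"

definition scheme_solution ::
    "'a::euclidean_space set \<Rightarrow> (real \<Rightarrow> real) \<Rightarrow> ('a L2 \<Rightarrow> 'a L2 \<Rightarrow> 'a L2) \<Rightarrow> (nat \<Rightarrow> 'a L2) \<Rightarrow>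
     'w measure \<Rightarrow> (real \<Rightarrow> 'w measure) \<Rightarrow> (real \<Rightarrow> 'w \<Rightarrow> 'a L2) \<Rightarrow> real \<Rightarrow> 'a L2 set \<Rightarrow>
     'a L2 \<Rightarrow> (nat \<Rightarrow> 'w \<Rightarrow> 'a L2) \<Rightarrow> bool" where
  "scheme_solution \<O> f G e M F W \<tau> V x X \<longleftrightarrow>
     (\<forall>m. X m \<in> borel_measurable (F (real m * \<tau>)) \<and> (\<forall>\<omega>\<in>space M. X m \<omega> \<in> V)) \<and>
     (\<forall>\<omega>\<in>space M. X 0 \<omega> = galerkin_proj V (L2_functional x)) \<and>
     (\<forall>m. \<exists>Z.
        is_stochastic_product M e (\<lambda>\<omega>. G (X m \<omega>))
          (\<lambda>\<omega>. W (real (Suc m) * \<tau>) \<omega> - W (real m * \<tau>) \<omega>) Z \<and>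
        (AE \<omega> in M. X (Suc m) \<omega> = X m \<omega>
           + \<tau> *\<^sub>R discrete_laplacian \<O> V (X (Suc m) \<omega>)
           + \<tau> *\<^sub>R galerkin_proj V (nemytskii_drift \<O> f (X (Suc m) \<omega>))
           + galerkin_proj V (L2_functional (Z \<omega>))))"

text \<open>
  The solution started in \<open>x\<close> is unique up to null sets, so that the choice made here does not
  affect expectations.
\<close>

definition scheme_process ::
    "'a::euclidean_space set \<Rightarrow> (real \<Rightarrow> real) \<Rightarrow> ('a L2 \<Rightarrow> 'a L2 \<Rightarrow> 'a L2) \<Rightarrow> (nat \<Rightarrow> 'a L2) \<Rightarrow>
     'w measure \<Rightarrow> (real \<Rightarrow> 'w measure) \<Rightarrow> (real \<Rightarrow> 'w \<Rightarrow> 'a L2) \<Rightarrow> real \<Rightarrow> 'a L2 set \<Rightarrow>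
     'a L2 \<Rightarrow> nat \<Rightarrow> 'w \<Rightarrow> 'a L2" where
  "scheme_process \<O> f G e M F W \<tau> V x = (SOME X. scheme_solution \<O> f G e M F W \<tau> V x X)"

definition scheme_semigroup ::
    "'a::euclidean_space set \<Rightarrow> (real \<Rightarrow> real) \<Rightarrow> ('a L2 \<Rightarrow> 'a L2 \<Rightarrow> 'a L2) \<Rightarrow> (nat \<Rightarrow> 'a L2) \<Rightarrow>
     'w measure \<Rightarrow> (real \<Rightarrow> 'w measure) \<Rightarrow> (real \<Rightarrow> 'w \<Rightarrow> 'a L2) \<Rightarrow> real \<Rightarrow> 'a L2 set \<Rightarrow>
     nat \<Rightarrow> ('a L2 \<Rightarrow> real) \<Rightarrow> 'a L2 \<Rightarrow> real" where
  "scheme_semigroup \<O> f G e M F W \<tau> V m \<phi> x =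
     (LINT \<omega>|M. \<phi> (scheme_process \<O> f G e M F W \<tau> V x m \<omega>))"

definition invariant_measure ::
    "'a::euclidean_space L2 set \<Rightarrow> (nat \<Rightarrow> ('a L2 \<Rightarrow> real) \<Rightarrow> 'a L2 \<Rightarrow> real) \<Rightarrow> 'a L2 measure \<Rightarrow> bool" where
  "invariant_measure V P \<mu> \<longleftrightarrow> prob_space \<mu> \<and> sets \<mu> = sets (restrict_space borel V) \<and>
     (\<forall>\<phi> m. continuous_on V \<phi> \<and> bounded (\<phi> ` V) \<longrightarrow>
        (LINT x|\<mu>. P m \<phi> x) = (LINT x|\<mu>. \<phi> x))"

definition Lip_b :: "'a::metric_space set \<Rightarrow> ('a \<Rightarrow> real) set" where
  "Lip_b H = {\<phi>. bounded (\<phi> ` H) \<and> (\<exists>C. C-lipschitz_on H \<phi>)}"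

definition Lip_seminorm :: "'a::real_normed_vector set \<Rightarrow> ('a \<Rightarrow> real) \<Rightarrow> real" where
  "Lip_seminorm H \<phi> =
     Sup {\<bar>\<phi> x - \<phi> y\<bar> / norm (x - y) | x y. x \<in> H \<and> y \<in> H \<and> x \<noteq> y}"

end

theory Submission
  imports Defs
begin

text \<open>
  One step of the scheme maps \<open>x\<close> to \<open>\<Psi> (x + Z(x, \<xi>))\<close>. Here \<open>\<Psi>\<close> is the \<open>L\<^sup>2\<close>-projection to the finite
  element space followed by the inverse of \<open>x \<mapsto> x - \<tau> A\<^sub>h x - \<tau> P\<^sub>h F(x)\<close>, and \<open>Z(x, \<xi>)\<close> is a series in
  independent Gaussians \<open>\<xi>\<^sub>k\<close>. With \<open>\<kappa> = \<lambda>\<^sub>1 - L\<^sub>1\<close>, the Poincare inequality and the one-sided Lipschitz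
  condition give \<open>\<parallel>\<Psi> x - \<Psi> y\<parallel> \<le> \<parallel>x - y\<parallel> / (1 + \<tau> \<kappa>)\<close>, and the Ito isometry gives
  \<open>E \<parallel>x - y + Z(x, \<xi>) - Z(y, \<xi>)\<parallel>\<^sup>2 \<le> (1 + \<tau> L\<^sub>6) \<parallel>x - y\<parallel>\<^sup>2\<close>. Driven by the same noise, two solutions hence
  approach each other in mean square at the rate \<open>(1 + \<tau> L\<^sub>6) / (1 + \<tau> \<kappa>)\<^sup>2 \<le> exp (- \<gamma>\<^sub>6 \<tau>)\<close>. The invariant
  measure is the law of the almost sure limit of the backward iterates of this random contraction.
  As \<open>first_eigenvalue\<close> is defined as a least eigenvalue, the Poincare inequality with this constant
  needs Rellich's theorem: the infimum of the Rayleigh quotient has to be attained.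
\<close>

section \<open>The Hilbert space \<open>L\<^sup>2\<close>\<close>

text \<open>The finite element space is a set inside the type of L^2 classes, while kernels and
  measures are handled most easily on a whole type. The step is therefore extended to all of H by
  the orthogonal projection \<open>pr\<close>, the chain is studied there, and its invariant law is
  shown to be carried by the finite element space. The main obstacle is measurability in the state.
  For a fixed state the noise series is a mean-square limit, hence determined up to a null set that
  depends on the state, whereas a Markov kernel needs one function measurable in state and noise
  jointly. Truncating the series at an index depending on the state produces it. Independence of the
  state from the next increment then allows freezing the state in expectations, and uniqueness of
  mean-square limits identifies every solution of the scheme with the iterated random map. L6 must
  enter with no extra factor, so limits of the isometry are taken with a weighted Young inequality.
  The denominator of \<gamma>6 is 1 + 2 \<tau> \<kappa> at the extreme step size \<tau> = 1, which
  makes the rate uniform in \<tau>.\<close>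

lemma ae_eq_rep_L2: "ae_eq (rep_L2 u) (rep_L2 u)"
  by (rule Quotient_rep_reflp[OF Quotient_L2])

lemma square_integrable_rep_L2 [simp, intro]: "square_integrable (rep_L2 u)"
  using ae_eq_rep_L2[of u] by (simp add: ae_eq_def)

lemma ae_eq_refl: "square_integrable f \<Longrightarrow> ae_eq f f"
  by (simp add: ae_eq_def)

lemma rep_L2_measurable [measurable]: "rep_L2 u \<in> borel_measurable lebesgue"
  using square_integrable_rep_L2[of u] by (simp add: square_integrable_def)

lemma abs_L2_rep [simp]: "abs_L2 (rep_L2 u) = u"
  by (rule Quotient_abs_rep[OF Quotient_L2])

lemma abs_L2_eqI: "ae_eq f g \<Longrightarrow> abs_L2 f = abs_L2 g"
  by (rule Quotient_rel_abs[OF Quotient_L2])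

lemma rep_abs_L2:
  assumes "square_integrable f"
  shows "AE x in lebesgue. rep_L2 (abs_L2 f) x = f x"
  using Quotient_rep_abs[OF Quotient_L2, of f] assms by (simp add: ae_eq_def)

lemma L2_eqI:
  assumes "AE x in lebesgue. rep_L2 u x = rep_L2 v x"
  shows "u = v"
  using abs_L2_eqI[of "rep_L2 u" "rep_L2 v"] assms by (simp add: ae_eq_def)

lemma abs_L2_add:
  "square_integrable f \<Longrightarrow> square_integrable g \<Longrightarrow> abs_L2 f + abs_L2 g = abs_L2 (\<lambda>x. f x + g x)"
  by (simp add: plus_L2.abs_eq ae_eq_refl)

lemma abs_L2_diff:
  "square_integrable f \<Longrightarrow> square_integrable g \<Longrightarrow> abs_L2 f - abs_L2 g = abs_L2 (\<lambda>x. f x - g x)"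
  by (simp add: minus_L2.abs_eq ae_eq_refl)

lemma abs_L2_scaleR:
  "square_integrable f \<Longrightarrow> c *\<^sub>R abs_L2 f = abs_L2 (\<lambda>x. c * f x)"
  by (simp add: scaleR_L2.abs_eq ae_eq_refl)

lemma rep_L2_add: "AE x in lebesgue. rep_L2 (u + v) x = rep_L2 u x + rep_L2 v x"
  using rep_abs_L2[OF square_integrable_add[of "rep_L2 u" "rep_L2 v"]]
    abs_L2_add[of "rep_L2 u" "rep_L2 v"] by simp

lemma rep_L2_diff: "AE x in lebesgue. rep_L2 (u - v) x = rep_L2 u x - rep_L2 v x"
  using rep_abs_L2[OF square_integrable_diff[of "rep_L2 u" "rep_L2 v"]]
    abs_L2_diff[of "rep_L2 u" "rep_L2 v"] by simp

lemma rep_L2_scaleR: "AE x in lebesgue. rep_L2 (c *\<^sub>R u) x = c * rep_L2 u x"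
  using rep_abs_L2[OF square_integrable_scale[of "rep_L2 u" c]]
    abs_L2_scaleR[of "rep_L2 u" c] by simp

lemma rep_L2_zero: "AE x in lebesgue. rep_L2 0 x = 0"
  using rep_abs_L2[of "\<lambda>x. 0"] by (simp add: zero_L2.abs_eq)

lemma inner_L2_rep: "inner u v = (LINT x|lebesgue. rep_L2 u x * rep_L2 v x)"
  using inner_L2.abs_eq[OF ae_eq_rep_L2[of v] ae_eq_rep_L2[of u]]
    inner_L2.abs_eq[OF ae_eq_rep_L2[of u] ae_eq_rep_L2[of v]] by simp

lemma inner_abs_L2:
  "square_integrable f \<Longrightarrow> square_integrable g \<Longrightarrow>
    inner (abs_L2 f) (abs_L2 g) = (LINT x|lebesgue. f x * g x)"
  by (simp add: inner_L2.abs_eq ae_eq_refl)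

lemma inner_abs_L2_right:
  "square_integrable g \<Longrightarrow> inner u (abs_L2 g) = (LINT x|lebesgue. rep_L2 u x * g x)"
  using inner_abs_L2[of "rep_L2 u" g] by simp

lemma power2_norm_abs_L2:
  "square_integrable f \<Longrightarrow> (norm (abs_L2 f))\<^sup>2 = (LINT x|lebesgue. (f x)\<^sup>2)"
  unfolding power2_norm_eq_inner by (simp add: inner_abs_L2 power2_eq_square)

lemma power2_norm_L2: "(norm u)\<^sup>2 = (LINT x|lebesgue. (rep_L2 u x)\<^sup>2)"
  using power2_norm_abs_L2[of "rep_L2 u"] by simp

lemma nn_integral_rep_L2: "(\<integral>\<^sup>+x. ennreal ((rep_L2 u x)\<^sup>2) \<partial>lebesgue) = ennreal ((norm u)\<^sup>2)"
  unfolding power2_norm_L2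
  by (rule nn_integral_eq_integral) (use square_integrable_rep_L2[of u] in \<open>auto simp: square_integrable_def\<close>)

text \<open>The weights \<open>2 ^ j\<close> replace Minkowski's inequality in the proof of the Riesz-Fischer theorem.\<close>

lemma AE_convergent_of_fast:
  fixes S :: "nat \<Rightarrow> 'w \<Rightarrow> 'b::{second_countable_topology, banach}"
  assumes [measurable]: "\<And>j. S j \<in> borel_measurable M"
    and fast: "\<And>j. (\<integral>\<^sup>+w. ennreal ((norm (S (Suc j) w - S j w))\<^sup>2) \<partial>M) \<le> ennreal (C * (1/4)^j)"
    and C: "0 \<le> C"
  shows "AE w in M. convergent (\<lambda>j. S j w)"
proof -
  define d where "d j w = norm (S (Suc j) w - S j w)" for j w
  have [measurable]: "d j \<in> borel_measurable M" for j
    unfolding d_def by measurable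
  have "(\<integral>\<^sup>+w. (\<Sum>j. ennreal (2^j * (d j w)\<^sup>2)) \<partial>M) = (\<Sum>j. \<integral>\<^sup>+w. ennreal (2^j * (d j w)\<^sup>2) \<partial>M)"
    by (rule nn_integral_suminf) measurable
  also have "\<dots> \<le> (\<Sum>j. ennreal (C * (1/2)^j))"
  proof (rule suminf_le)
    fix j
    have "(\<integral>\<^sup>+w. ennreal (2^j * (d j w)\<^sup>2) \<partial>M) = ennreal (2^j) * (\<integral>\<^sup>+w. ennreal ((d j w)\<^sup>2) \<partial>M)"
      by (subst nn_integral_cmult[symmetric]) (auto simp: ennreal_mult)
    also have "\<dots> \<le> ennreal (2^j) * ennreal (C * (1/4)^j)"
      using fast[of j] by (intro mult_left_mono) (auto simp: d_def)
    also have "\<dots> = ennreal (C * (1/2)^j)"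
      using C by (subst ennreal_mult[symmetric]) (auto simp: power_divide field_simps simp flip: power_mult_distrib)
    finally show "(\<integral>\<^sup>+w. ennreal (2^j * (d j w)\<^sup>2) \<partial>M) \<le> ennreal (C * (1/2)^j)" .
  qed auto
  also have "\<dots> = ennreal (\<Sum>j. C * (1/2)^j)"
    using C by (intro suminf_ennreal2) (auto intro!: summable_mult summable_geometric)
  finally have "(\<integral>\<^sup>+w. (\<Sum>j. ennreal (2^j * (d j w)\<^sup>2)) \<partial>M) \<noteq> \<infinity>"
    by (auto simp: top_unique)
  then have "AE w in M. (\<Sum>j. ennreal (2^j * (d j w)\<^sup>2)) \<noteq> \<infinity>"
    by (intro nn_integral_PInf_AE) auto
  then show ?thesis
  proof eventually_elim
    case (elim w)
    then have "summable (\<lambda>j. 2^j * (d j w)\<^sup>2)"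
      by (intro summable_suminf_not_top) auto
    \<comment> \<open>Terms tending to zero are enough: from some j on, \<open>d j w\<close> is at
      most 2^(-j/2), so the increments are absolutely summable.\<close>
    then have "(\<lambda>j. 2^j * (d j w)\<^sup>2) \<longlonglongrightarrow> 0"
      by (rule summable_LIMSEQ_zero)
    then have "eventually (\<lambda>j. 2^j * (d j w)\<^sup>2 < 1) sequentially"
      by (rule order_tendstoD) simp
    then have ev: "eventually (\<lambda>j. norm (d j w) \<le> (1 / sqrt 2)^j) sequentially"
    proof eventually_elim
      case (elim j)
      have "((1 / sqrt 2)^j)\<^sup>2 = (1/2 :: real)^j"
        by (simp add: power_divide power2_eq_square flip: power_mult_distrib)
      then have "2^j * ((1 / sqrt 2)^j)\<^sup>2 = (1::real)"
        by (simp add: power_divide)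
      with elim have "2^j * (d j w)\<^sup>2 \<le> 2^j * ((1 / sqrt 2)^j)\<^sup>2"
        by linarith
      then have "(d j w)\<^sup>2 \<le> ((1 / sqrt 2)^j)\<^sup>2"
        by simp
      then have "d j w \<le> (1 / sqrt 2)^j"
        by (rule power2_le_imp_le) simp
      then show ?case by (simp add: d_def)
    qed
    have "summable (\<lambda>j. d j w)"
      by (rule summable_comparison_test_ev[OF ev]) (auto intro!: summable_geometric)
    then have "summable (\<lambda>j. S (Suc j) w - S j w)"
      unfolding d_def by (rule summable_norm_cancel)
    then have "convergent (\<lambda>n. \<Sum>j<n. S (Suc j) w - S j w)"
      by (simp add: summable_iff_convergent)
    then have "convergent (\<lambda>n. S n w - S 0 w)"
      by (subst (asm) sum_lessThan_telescope)
    then have "convergent (\<lambda>n. (S n w - S 0 w) + S 0 w)"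
      by (intro convergent_add convergent_const)
    then show ?case
      by simp
  qed
qed

text \<open>A Cauchy sequence converges as soon as one subsequence does, and the subsequence may be
  taken as fast as desired. The rate (1/2)^j squares to the (1/4)^j that
  \<open>AE_convergent_of_fast\<close> asks for.\<close>

lemma convergent_of_fast_subseq:
  fixes X :: "nat \<Rightarrow> 'a::metric_space"
  assumes X: "Cauchy X"
    and fast: "\<And>r. strict_mono r \<Longrightarrow> (\<And>j. dist (X (r (Suc j))) (X (r j)) \<le> (1/2)^j) \<Longrightarrow> convergent (X \<circ> r)"
  shows "convergent X"
proof -
  have "\<exists>N. \<forall>m\<ge>N. \<forall>n\<ge>N. dist (X m) (X n) < (1/2)^j" for j :: nat
    using X by (auto simp: Cauchy_def)
  then obtain N where N: "\<And>j m n. N j \<le> m \<Longrightarrow> N j \<le> n \<Longrightarrow> dist (X m) (X n) < (1/2)^j"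
    by metis
  \<comment> \<open>Summing makes \<open>r\<close> dominate every \<open>N j\<close>, and the
    successor makes it strictly increasing.\<close>
  define r where "r j = (\<Sum>i\<le>j. Suc (N i))" for j
  have r: "strict_mono r"
    by (rule strict_monoI_Suc) (simp add: r_def)
  have "N j \<le> r j" for j
    unfolding r_def by (induction j) auto
  moreover have "r j \<le> r (Suc j)" for j
    by (simp add: r_def)
  ultimately have "convergent (X \<circ> r)"
    by (intro fast r) (meson N less_imp_le order_trans)
  then show ?thesis
    using X r by (auto simp: convergent_def intro: Cauchy_converges_subseq)
qed

text \<open>Riesz-Fischer. Representatives of a fast subsequence converge almost everywhere; Fatou's
  lemma then shows both that the limit is square integrable and that the convergence holds in
  norm.\<close>

instance L2 :: (euclidean_space) complete_space
proof
  fix X :: "nat \<Rightarrow> 'a L2"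
  assume X: "Cauchy X"
  show "convergent X"
  proof (rule convergent_of_fast_subseq[OF X])
    fix r :: "nat \<Rightarrow> nat"
    assume r: "strict_mono r" and fast: "dist (X (r (Suc j))) (X (r j)) \<le> (1/2)^j" for j
    define S where "S j = rep_L2 (X (r j))" for j
    have [measurable]: "S j \<in> borel_measurable lebesgue" for j
      by (simp add: S_def)
    \<comment> \<open>Representatives are arbitrary choices, so a difference of two of them agrees
      with the representative of the difference only almost everywhere.\<close>
    have diff: "(\<integral>\<^sup>+x. ennreal ((S i x - S j x)\<^sup>2) \<partial>lebesgue) = ennreal ((dist (X (r i)) (X (r j)))\<^sup>2)" for i j
    proof -
      have "(\<integral>\<^sup>+x. ennreal ((S i x - S j x)\<^sup>2) \<partial>lebesgue)
          = (\<integral>\<^sup>+x. ennreal ((rep_L2 (X (r i) - X (r j)) x)\<^sup>2) \<partial>lebesgue)"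
        by (rule nn_integral_cong_AE) (use rep_L2_diff[of "X (r i)" "X (r j)"] in \<open>auto simp: S_def\<close>)
      then show ?thesis
        by (simp add: nn_integral_rep_L2 dist_norm)
    qed
    have "AE x in lebesgue. convergent (\<lambda>j. S j x)"
    proof (rule AE_convergent_of_fast[where C = 1])
      fix j
      have "(dist (X (r (Suc j))) (X (r j)))\<^sup>2 \<le> ((1/2)^j)\<^sup>2"
        by (rule power_mono[OF fast]) simp
      also have "((1/2)^j)\<^sup>2 = 1 * (1/4::real)^j"
        by (simp add: power2_eq_square flip: power_mult_distrib)
      finally show "(\<integral>\<^sup>+x. ennreal ((norm (S (Suc j) x - S j x))\<^sup>2) \<partial>lebesgue) \<le> ennreal (1 * (1/4)^j)"
        by (simp add: diff ennreal_leI)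
    qed auto
    define Z where "Z x = lim (\<lambda>j. S j x)" for x
    have [measurable]: "Z \<in> borel_measurable lebesgue"
      unfolding Z_def by measurable
    have lim: "AE x in lebesgue. (\<lambda>j. S j x) \<longlonglongrightarrow> Z x"
      using \<open>AE x in lebesgue. convergent (\<lambda>j. S j x)\<close> by (auto simp: Z_def convergent_LIMSEQ_iff)
    have Zbound: "(\<integral>\<^sup>+x. ennreal ((Z x - S j x)\<^sup>2) \<partial>lebesgue) \<le> ennreal (e\<^sup>2)"
      if "0 \<le> e" "\<And>i. i \<ge> j \<Longrightarrow> dist (X (r i)) (X (r j)) \<le> e" for j e
    proof -
      have "(\<integral>\<^sup>+x. ennreal ((Z x - S j x)\<^sup>2) \<partial>lebesgue)
          = (\<integral>\<^sup>+x. liminf (\<lambda>i. ennreal ((S i x - S j x)\<^sup>2)) \<partial>lebesgue)"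
      proof (rule nn_integral_cong_AE, use lim in eventually_elim)
        case (elim x)
        then have "(\<lambda>i. ennreal ((S i x - S j x)\<^sup>2)) \<longlonglongrightarrow> ennreal ((Z x - S j x)\<^sup>2)"
          by (intro tendsto_ennrealI tendsto_intros)
        then show ?case
          by (intro lim_imp_Liminf[symmetric]) auto
      qed
      also have "\<dots> \<le> liminf (\<lambda>i. \<integral>\<^sup>+x. ennreal ((S i x - S j x)\<^sup>2) \<partial>lebesgue)"
        by (rule nn_integral_liminf) measurable
      also have "\<dots> \<le> ennreal (e\<^sup>2)"
        unfolding diff
      proof (rule Liminf_le)
        show "\<forall>\<^sub>F i in sequentially. ennreal ((dist (X (r i)) (X (r j)))\<^sup>2) \<le> ennreal (e\<^sup>2)"
          using eventually_ge_at_top[of j] by eventually_elim (auto intro!: ennreal_leI power_mono that)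
      qed simp
      finally show ?thesis .
    qed
    have sqd: "square_integrable (\<lambda>x. Z x - S j x)" if "0 \<le> e" "\<And>i. i \<ge> j \<Longrightarrow> dist (X (r i)) (X (r j)) \<le> e" for j e
      using Zbound[OF that]
      by (auto simp: square_integrable_def integrable_iff_bounded intro: order.strict_trans1)
    have ev: "\<exists>N. \<forall>j\<ge>N. \<forall>i\<ge>j. dist (X (r i)) (X (r j)) \<le> e" if "e > 0" for e
    proof -
      obtain N where "\<And>m n. m \<ge> N \<Longrightarrow> n \<ge> N \<Longrightarrow> dist (X m) (X n) < e"
        using X \<open>e > 0\<close> unfolding Cauchy_def by blast
      then show ?thesis
        using seq_suble[OF r] by (meson less_imp_le order_trans)
    qed
    obtain N where "\<And>j i. j \<ge> N \<Longrightarrow> i \<ge> j \<Longrightarrow> dist (X (r i)) (X (r j)) \<le> 1"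
      using ev[of 1] by auto
    from square_integrable_add[OF sqd[OF _ this, of N, simplified] square_integrable_rep_L2[of "X (r N)"]]
    have Z: "square_integrable Z"
      by (simp add: S_def)
    have norm_diff: "(norm (abs_L2 Z - X (r j)))\<^sup>2 = (LINT x|lebesgue. (Z x - S j x)\<^sup>2)" for j
      using power2_norm_abs_L2[OF square_integrable_diff[OF Z square_integrable_rep_L2[of "X (r j)"]]]
        abs_L2_diff[OF Z square_integrable_rep_L2[of "X (r j)"]] by (simp add: S_def)
    have "(X \<circ> r) \<longlonglongrightarrow> abs_L2 Z"
    proof (rule metric_LIMSEQ_I)
      fix e :: real
      assume "e > 0"
      then obtain N where N: "\<And>j i. j \<ge> N \<Longrightarrow> i \<ge> j \<Longrightarrow> dist (X (r i)) (X (r j)) \<le> e / 2"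
        using ev[of "e/2"] by auto
      have "dist ((X \<circ> r) j) (abs_L2 Z) < e" if "j \<ge> N" for j
      proof -
        have "integrable lebesgue (\<lambda>x. (Z x - S j x)\<^sup>2)"
          using square_integrable_diff[OF Z square_integrable_rep_L2[of "X (r j)"]]
          by (simp add: S_def square_integrable_def)
        then have "ennreal (LINT x|lebesgue. (Z x - S j x)\<^sup>2) \<le> ennreal ((e/2)\<^sup>2)"
          using Zbound[of "e/2" j] N[OF that] \<open>e > 0\<close> by (simp add: nn_integral_eq_integral)
        then have "(norm (abs_L2 Z - X (r j)))\<^sup>2 \<le> (e/2)\<^sup>2"
          unfolding norm_diff by (simp add: ennreal_le_iff)
        then have "norm (abs_L2 Z - X (r j)) \<le> e/2"
          by (rule power2_le_imp_le) (use \<open>e > 0\<close> in auto)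
        then show ?thesis
          using \<open>e > 0\<close> by (simp add: dist_norm norm_minus_commute)
      qed
      then show "\<exists>N. \<forall>j\<ge>N. dist ((X \<circ> r) j) (abs_L2 Z) < e"
        by blast
    qed
    then show "convergent (X \<circ> r)"
      by (auto simp: convergent_def)
  qed
qed

instance L2 :: (euclidean_space) banach ..

text \<open>The nearest-point argument: a minimizing sequence in \<open>S\<close> is Cauchy by the parallelogram law.\<close>

lemma subspace_dense_if_trivial_complement:
  fixes S :: "'b::{real_inner, complete_space} set"
  assumes S: "subspace S" and triv: "\<And>w. (\<And>s. s \<in> S \<Longrightarrow> inner w s = 0) \<Longrightarrow> w = 0"
  shows "closure S = UNIV"
proof -
  have "x \<in> closure S" for x
  proof -
    define d where "d = infdist x S"
    have ne: "S \<noteq> {}" using S by (auto simp: subspace_def)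
    have low: "d \<le> norm (x - s)" if "s \<in> S" for s
      using infdist_le[OF that, of x] by (simp add: d_def dist_norm)
    have d0: "0 \<le> d" by (simp add: d_def infdist_nonneg)
    have "\<exists>s\<in>S. norm (x - s) < d + 1 / Suc n" for n
    proof (rule ccontr)
      assume "\<not> (\<exists>s\<in>S. norm (x - s) < d + 1 / Suc n)"
      then have "d + 1 / Suc n \<le> infdist x S"
        using ne by (auto simp: infdist_def dist_norm not_less intro!: cINF_greatest)
      then show False by (simp add: d_def)
    qed
    then obtain s where sS: "\<And>n. s n \<in> S" and s: "\<And>n. norm (x - s n) < d + 1 / Suc n"
      by metis
    have "(norm (s n - s m))\<^sup>2 \<le> 4 * (2 * d + 1) / Suc (min m n)" for m n
    proof -
      have par: "(norm (s n - s m))\<^sup>2 = 2 * (norm (x - s n))\<^sup>2 + 2 * (norm (x - s m))\<^sup>2 - 4 * (norm (x - (1/2) *\<^sub>R (s n + s m)))\<^sup>2"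
        unfolding power2_norm_eq_inner by (simp add: algebra_simps inner_commute)
      have "(1/2) *\<^sub>R (s n + s m) \<in> S"
        using S sS by (intro subspace_scale subspace_add) auto
      then have "d\<^sup>2 \<le> (norm (x - (1/2) *\<^sub>R (s n + s m)))\<^sup>2"
        using d0 by (intro power_mono low)
      moreover have *: "(norm (x - s k))\<^sup>2 \<le> d\<^sup>2 + (2 * d + 1) / Suc (min m n)" if "k = m \<or> k = n" for k
      proof -
        have le: "1 / real (Suc k) \<le> 1 / Suc (min m n)" using that by (auto simp: field_simps)
        have "(norm (x - s k))\<^sup>2 \<le> (d + 1 / Suc (min m n))\<^sup>2"
          using s[of k] le by (intro power_mono) auto
        also have "\<dots> = d\<^sup>2 + 2 * d * (1 / Suc (min m n)) + (1 / Suc (min m n)) * (1 / Suc (min m n))"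
          by (simp add: power2_eq_square algebra_simps)
        also have "\<dots> \<le> d\<^sup>2 + 2 * d * (1 / Suc (min m n)) + (1 / Suc (min m n)) * 1"
          by (intro add_left_mono mult_left_mono) auto
        also have "\<dots> = d\<^sup>2 + (2 * d + 1) / Suc (min m n)"
          by (simp add: add_divide_distrib)
        finally show ?thesis .
      qed
      ultimately show ?thesis
        using *[of n] *[of m] unfolding par times_divide_eq_right[symmetric] by linarith
    qed
    note bound = this
    have "Cauchy s"
    proof (rule metric_CauchyI)
      fix e :: real
      assume "e > 0"
      obtain N where "4 * (2 * d + 1) / e\<^sup>2 < real N"
        using reals_Archimedean2 by blast
      then have N: "4 * (2 * d + 1) / e\<^sup>2 < real (Suc N)" by simp
      show "\<exists>N. \<forall>m\<ge>N. \<forall>n\<ge>N. dist (s m) (s n) < e"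
      proof (intro exI allI impI)
        fix m n assume "N \<le> m" "N \<le> n"
        then have le: "real (Suc N) \<le> real (Suc (min n m))" by simp
        have "(norm (s m - s n))\<^sup>2 \<le> 4 * (2 * d + 1) / Suc (min n m)" by (rule bound)
        also have "\<dots> \<le> 4 * (2 * d + 1) / Suc N"
          using le d0 by (intro divide_left_mono) auto
        also have "\<dots> < e\<^sup>2"
          using N \<open>e > 0\<close> by (simp add: field_simps)
        finally show "dist (s m) (s n) < e"
          using \<open>e > 0\<close> by (simp add: dist_norm power2_less_imp_less)
      qed
    qed
    then obtain y where y: "s \<longlonglongrightarrow> y"
      using Cauchy_convergent_iff convergent_def by blast
    have yS: "y \<in> closure S"
      using y sS by (auto simp: closure_sequential)
    have "norm (x - y) \<le> d"
    proof (rule LIMSEQ_le)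
      show "(\<lambda>n. norm (x - s n)) \<longlonglongrightarrow> norm (x - y)"
        by (intro tendsto_intros y)
      show "(\<lambda>n. d + 1 / Suc n) \<longlonglongrightarrow> d"
        using LIMSEQ_inverse_real_of_nat_add[of d] by (simp add: inverse_eq_divide)
    qed (use s less_imp_le in blast)
    moreover have "d \<le> norm (x - y - v)" if "v \<in> S" for v
    proof (rule LIMSEQ_le_const)
      show "(\<lambda>n. norm (x - s n - v)) \<longlonglongrightarrow> norm (x - y - v)"
        by (intro tendsto_intros y)
      show "\<exists>N. \<forall>n\<ge>N. d \<le> norm (x - s n - v)"
        using low[OF subspace_add[OF S sS that]] by (auto simp: diff_diff_eq)
    qed
    ultimately have min: "norm (x - y) \<le> norm (x - y - v)" if "v \<in> S" for v
      using that by (meson order_trans)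
    have "inner (x - y) v = 0" if "v \<in> S" for v
    proof (cases "v = 0")
      case False
      \<comment> \<open>\<open>t\<close> is the coefficient of the projection of
        \<open>x - y\<close> onto \<open>v\<close>: moving \<open>y\<close> by
        \<open>t *\<^sub>R v\<close> would shorten the distance unless the inner product
        vanishes.\<close>
      define t where "t = inner (x - y) v / inner v v"
      have "inner (x - y) (x - y) \<le> inner (x - y - t *\<^sub>R v) (x - y - t *\<^sub>R v)"
        using min[OF subspace_scale[OF S that, of t]] by (simp add: norm_le)
      also have "\<dots> = inner (x - y) (x - y) - 2 * t * inner (x - y) v + t * (t * inner v v)"
        by (simp add: inner_diff_left inner_diff_right inner_commute algebra_simps)
      also have "t * inner v v = inner (x - y) v"
        using False by (simp add: t_def)
      finally have "t * inner (x - y) v \<le> 0" by simp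
      then have "(inner (x - y) v)\<^sup>2 / inner v v \<le> 0"
        by (simp add: t_def power2_eq_square)
      moreover have "0 < inner v v"
        using False by simp
      ultimately have "(inner (x - y) v)\<^sup>2 \<le> 0"
        by (metis divide_le_0_iff not_less)
      then show ?thesis by simp
    qed simp
    then have "x - y = 0"
      by (rule triv)
    with yS show ?thesis by simp
  qed
  then show ?thesis by auto
qed


text \<open>The positive and the negative part of \<open>w\<close> are densities of two finite
  measures that agree on the intersection-stable generator \<open>E\<close>, hence everywhere. Equal
  densities force both parts to vanish, as they are never positive at the same point.\<close>

lemma AE_zero_if_generator_integrals_zero:
  fixes w :: "'a::euclidean_space \<Rightarrow> real"
  assumes w: "integrable lebesgue w"
    and E: "Int_stable E" "sets borel = sigma_sets UNIV E" "UNIV \<in> E"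
    and zero: "\<And>A. A \<in> E \<Longrightarrow> (LINT x|lebesgue. indicator A x * w x) = 0"
  shows "AE x in lebesgue. w x = 0"
proof -
  \<comment> \<open>The generator argument takes place on Borel sets, so the Lebesgue measurable
    \<open>w\<close> is first replaced by a Borel version.\<close>
  obtain w' where w'[measurable]: "w' \<in> borel_measurable lborel" and AE: "AE x in lborel. w x = w' x"
    using completion_ex_borel_measurable_real[of w lborel] w by auto
  have AE': "AE x in lebesgue. w x = w' x"
    using AE by (rule AE_completion)
  have "integrable lebesgue w'"
    using w AE' measurable_completion[OF w'] by (subst integrable_cong_AE[symmetric, OF _ _ AE']) auto
  then have int: "integrable lborel w'"
    by (simp add: integrable_completion)
  have Esub: "A \<in> sets borel" if "A \<in> E" for A
    using that E(2) by auto
  have zero': "(LINT x|lborel. indicator A x * w' x) = 0" if "A \<in> E" for A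
  proof -
    have [measurable]: "A \<in> sets borel" using Esub that by simp
    have "(LINT x|lborel. indicator A x * w' x) = (LINT x|lebesgue. indicator A x * w' x)"
      by (rule integral_completion[symmetric]) measurable
    also have "\<dots> = (LINT x|lebesgue. indicator A x * w x)"
    proof (rule integral_cong_AE)
      have "A \<in> sets lebesgue" by simp
      then show "(\<lambda>x. indicator A x * w x) \<in> borel_measurable lebesgue" "(\<lambda>x. indicator A x * w' x) \<in> borel_measurable lebesgue"
        using w \<open>integrable lebesgue w'\<close> by (auto intro!: borel_measurable_times borel_measurable_indicator)
    qed (use AE' in auto)
    finally show ?thesis using zero[OF that] by simp
  qed
  let ?p = "\<lambda>x. ennreal (max 0 (w' x))" and ?n = "\<lambda>x. ennreal (max 0 (- w' x))"
  have fin: "(\<integral>\<^sup>+x. ?p x \<partial>lborel) \<noteq> \<infinity>" "(\<integral>\<^sup>+x. ?n x \<partial>lborel) \<noteq> \<infinity>"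
  proof -
    have "(\<integral>\<^sup>+x. ?p x \<partial>lborel) \<le> (\<integral>\<^sup>+x. ennreal (norm (w' x)) \<partial>lborel)"
      "(\<integral>\<^sup>+x. ?n x \<partial>lborel) \<le> (\<integral>\<^sup>+x. ennreal (norm (w' x)) \<partial>lborel)"
      by (intro nn_integral_mono ennreal_leI; simp)+
    moreover have "(\<integral>\<^sup>+x. ennreal (norm (w' x)) \<partial>lborel) < \<infinity>"
      using int by (simp add: integrable_iff_bounded)
    ultimately show "(\<integral>\<^sup>+x. ?p x \<partial>lborel) \<noteq> \<infinity>" "(\<integral>\<^sup>+x. ?n x \<partial>lborel) \<noteq> \<infinity>"
      by (auto simp: top_unique)
  qed
  have "density lborel ?p = density lborel ?n"
  proof (rule measure_eqI_generator_eq[OF E(1)])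
    fix A assume A: "A \<in> E"
    have [measurable]: "A \<in> sets borel" using Esub A by simp
    have i: "integrable lborel (\<lambda>x. indicator A x * max 0 (w' x))" "integrable lborel (\<lambda>x. indicator A x * max 0 (- w' x))"
      by (rule Bochner_Integration.integrable_bound[OF int]; auto simp: indicator_def)+
    have "0 = (LINT x|lborel. indicator A x * w' x)"
      using zero'[OF A] by simp
    also have "\<dots> = (LINT x|lborel. indicator A x * max 0 (w' x) - indicator A x * max 0 (- w' x))"
      by (rule Bochner_Integration.integral_cong) (auto simp: max_def algebra_simps)
    also have "\<dots> = (LINT x|lborel. indicator A x * max 0 (w' x)) - (LINT x|lborel. indicator A x * max 0 (- w' x))"
      by (rule Bochner_Integration.integral_diff[OF i])
    finally have eq: "(LINT x|lborel. indicator A x * max 0 (w' x)) = (LINT x|lborel. indicator A x * max 0 (- w' x))"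
      by simp
    have em: "emeasure (density lborel (\<lambda>x. ennreal (max 0 (v x)))) A = ennreal (LINT x|lborel. indicator A x * max 0 (v x))"
      if [measurable]: "v \<in> borel_measurable lborel" and "integrable lborel (\<lambda>x. indicator A x * max 0 (v x))" for v
    proof -
      have "emeasure (density lborel (\<lambda>x. ennreal (max 0 (v x)))) A = (\<integral>\<^sup>+x. ennreal (indicator A x * max 0 (v x)) \<partial>lborel)"
        by (subst emeasure_density) (auto intro!: nn_integral_cong simp: indicator_def)
      also have "\<dots> = ennreal (LINT x|lborel. indicator A x * max 0 (v x))"
        by (rule nn_integral_eq_integral[OF that(2)]) auto
      finally show ?thesis .
    qed
    show "emeasure (density lborel ?p) A = emeasure (density lborel ?n) A"
      using em[of w'] em[of "\<lambda>x. - w' x"] i eq by simp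
  next
    show "range (\<lambda>_. UNIV) \<subseteq> E" using E(3) by auto
    show "emeasure (density lborel ?p) ((\<lambda>_. UNIV) i) \<noteq> \<infinity>" for i :: nat
      using fin by (simp add: emeasure_density)
  qed (use E(2) in auto)
  then have "AE x in lborel. ?p x = ?n x"
    using fin by (subst (asm) finite_density_unique) auto
  then have "AE x in lborel. w' x = 0"
    by eventually_elim (auto simp: max_def split: if_splits)
  then show ?thesis
    using AE_completion AE' by (auto dest: AE_completion)
qed

text \<open>Finite intersections of a countable basis; the empty intersection supplies the whole
  space. Countability of the generator is what turns the preceding uniqueness statement into
  separability of L^2.\<close>

lemma borel_eq_countable_Int_stable:
  obtains E :: "'a::second_countable_topology set set" where
    "countable E" "Int_stable E" "sets borel = sigma_sets UNIV E" "UNIV \<in> E"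
proof -
  obtain B :: "'a set set" where B: "countable B" "topological_basis B"
    using ex_countable_basis by blast
  define E where "E = Inter ` {F. finite F \<and> F \<subseteq> B}"
  have "countable E"
    unfolding E_def using B(1) countable_Collect_finite_subset by blast
  moreover have "Int_stable E"
    unfolding Int_stable_def E_def
  proof (intro ballI)
    fix a b assume "a \<in> Inter ` {F. finite F \<and> F \<subseteq> B}" "b \<in> Inter ` {F. finite F \<and> F \<subseteq> B}"
    then obtain F F' where "finite F" "F \<subseteq> B" "a = \<Inter>F" "finite F'" "F' \<subseteq> B" "b = \<Inter>F'"
      by auto
    then show "a \<inter> b \<in> Inter ` {F. finite F \<and> F \<subseteq> B}"
      by (intro image_eqI[of _ _ "F \<union> F'"]) auto
  qed
  moreover have "UNIV \<in> E"
    unfolding E_def by (rule image_eqI[of _ _ "{}"]) auto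
  moreover have "sets borel = sigma_sets UNIV E"
  proof
    have "B \<subseteq> E"
      unfolding E_def by (auto intro!: image_eqI[of _ _ "{_}"])
    then have "sigma_sets UNIV B \<subseteq> sigma_sets UNIV E"
      by (rule sigma_sets_mono')
    then show "sets borel \<subseteq> sigma_sets UNIV E"
      by (subst borel_eq_countable_basis[OF B]) (simp add: sets_measure_of)
    have "A \<in> sets borel" if "A \<in> E" for A
      using that topological_basis_open[OF B(2)] unfolding E_def
      by (auto intro!: borel_open open_Inter)
    then show "sigma_sets UNIV E \<subseteq> sets borel"
      using sets.sigma_sets_subset[of E borel] by auto
  qed
  ultimately show ?thesis using that by blast
qed

lemma separable_imp_second_countable_basis:
  fixes D :: "'a::metric_space set"
  assumes D: "countable D" "closure D = UNIV"
  shows "\<exists>B::'a set set. countable B \<and> open = generate_topology B"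
proof -
  define B where "B = (\<lambda>(d, n::nat). ball d (1 / Suc n)) ` (D \<times> UNIV)"
  have "topological_basis B"
  proof (rule topological_basisI)
    fix U and x :: 'a
    assume "open U" "x \<in> U"
    then obtain e where e: "e > 0" "ball x e \<subseteq> U"
      by (meson open_contains_ball)
    obtain n where n: "1 / real (Suc n) < e / 2"
      using nat_approx_posE[of "e/2"] e by auto
    obtain d where d: "d \<in> D" "dist d x < 1 / real (Suc n)"
      using D(2) closure_approachable[THEN iffD1, rule_format, of x D "1 / real (Suc n)"] by auto
    have "ball d (1 / real (Suc n)) \<subseteq> ball x e"
    proof
      fix y assume "y \<in> ball d (1 / real (Suc n))"
      then show "y \<in> ball x e"
        using d n dist_triangle[of x y d] by (auto simp: dist_commute)
    qed
    then show "\<exists>B'\<in>B. x \<in> B' \<and> B' \<subseteq> U"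
      using d e by (intro bexI[of _ "ball d (1 / real (Suc n))"]) (auto simp: B_def)
  qed (auto simp: B_def)
  moreover have "countable B"
    unfolding B_def using D by auto
  ultimately show ?thesis
    using topological_basis_imp_subbasis by blast
qed

text \<open>Rational combinations are coded as lists of coefficient-vector pairs: repetitions are
  harmless, addition is concatenation, and countability comes from lists over a countable
  set.\<close>

lemma countable_dense_in_span:
  fixes S :: "'b::real_normed_vector set"
  assumes "countable S"
  obtains D where "countable D" "D \<subseteq> span S" "span S \<subseteq> closure D"
proof -
  define comb where "comb l = (\<Sum>(q, s)\<leftarrow>l. real_of_rat q *\<^sub>R s)" for l :: "(rat \<times> 'b) list"
  define D where "D = comb ` lists (UNIV \<times> S)"
  have cs: "countable D"
    unfolding D_def using assms by (intro countable_image countable_lists) auto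
  have D: "D \<subseteq> span S"
  proof -
    have "comb l \<in> span S" if "l \<in> lists (UNIV \<times> S)" for l
      using that unfolding comb_def by (induction l) (auto intro!: span_add intro: span_scale span_base span_zero)
    then show ?thesis by (auto simp: D_def)
  qed
  have add: "x + y \<in> D" if "x \<in> D" "y \<in> D" for x y
  proof -
    obtain l where "l \<in> lists (UNIV \<times> S)" "x = comb l"
      using \<open>x \<in> D\<close> unfolding D_def by (rule imageE)
    moreover obtain l' where "l' \<in> lists (UNIV \<times> S)" "y = comb l'"
      using \<open>y \<in> D\<close> unfolding D_def by (rule imageE)
    ultimately show ?thesis
      unfolding D_def by (intro image_eqI[of _ _ "l @ l'"]) (auto simp: comb_def)
  qed
  have cl: "x + c *\<^sub>R s \<in> closure D" if "x \<in> closure D" "s \<in> S" for x c s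
    unfolding closure_approachable
  proof (intro allI impI)
    fix e :: real assume "e > 0"
    then obtain y where y: "y \<in> D" "dist y x < e / 2"
      using closure_approachable[THEN iffD1, rule_format, OF \<open>x \<in> closure D\<close>, of "e/2"] by auto
    have "0 < norm s + 1"
      using norm_ge_zero[of s] by linarith
    then have "0 < 2 * (norm s + 1)"
      by simp
    with \<open>e > 0\<close> have "0 < e / (2 * (norm s + 1))"
      by (rule divide_pos_pos)
    then have "c - e / (2 * (norm s + 1)) < c"
      by simp
    from of_rat_dense[OF this] obtain q where "c - e / (2 * (norm s + 1)) < real_of_rat q" "real_of_rat q < c"
      by (elim exE conjE)
    then have q: "\<bar>c - real_of_rat q\<bar> < e / (2 * (norm s + 1))"
      by linarith
    have "real_of_rat q *\<^sub>R s \<in> D"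
      unfolding D_def using that(2) by (intro image_eqI[of _ _ "[(q, s)]"]) (auto simp: comb_def)
    then have "y + real_of_rat q *\<^sub>R s \<in> D"
      using add y by blast
    moreover have "dist (y + real_of_rat q *\<^sub>R s) (x + c *\<^sub>R s) < e"
    proof -
      have "dist (y + real_of_rat q *\<^sub>R s) (x + c *\<^sub>R s) = norm ((y - x) - (c - real_of_rat q) *\<^sub>R s)"
        by (simp add: dist_norm algebra_simps)
      also have "\<dots> \<le> norm (y - x) + \<bar>c - real_of_rat q\<bar> * norm s"
        by (rule order_trans[OF norm_triangle_ineq4]) simp
      also have "\<bar>c - real_of_rat q\<bar> * norm s \<le> e / (2 * (norm s + 1)) * (norm s + 1)"
        using q by (intro mult_mono) auto
      also have "\<dots> = e / 2"
        using \<open>0 < 2 * (norm s + 1)\<close> by (simp add: field_simps)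
      finally show ?thesis using y by (simp add: dist_norm)
    qed
    ultimately show "\<exists>y\<in>D. dist y (x + c *\<^sub>R s) < e" by blast
  qed
  have "0 \<in> D" unfolding D_def by (intro image_eqI[of _ _ "[]"]) (auto simp: comb_def)
  then have "0 \<in> closure D" using closure_subset by blast
  then have "span S \<subseteq> closure D"
  proof (intro subsetI)
    fix x assume "x \<in> span S"
    then show "x \<in> closure D"
    proof (induction rule: span_induct_alt)
      case (step c x y)
      then show ?case using cl[of y x c] by (simp add: add.commute)
    qed fact
  qed
  with cs D show ?thesis using that by blast
qed

text \<open>Only an orthogonal complement has to be computed: an element orthogonal to the
  indicators of all generator sets cut off by cubes vanishes on every cube. The cubes make the
  indicators square integrable and the element integrable. Separability is what makes sums and
  products of L^2-valued random variables measurable.\<close>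

instance L2 :: (euclidean_space) second_countable_topology
proof
  obtain E :: "'a set set" where E: "countable E" "Int_stable E" "sets borel = sigma_sets UNIV E" "UNIV \<in> E"
    by (rule borel_eq_countable_Int_stable)
  define cube where "cube n = cbox (- real n *\<^sub>R One) (real n *\<^sub>R One :: 'a)" for n :: nat
  define S where "S = (\<lambda>(A, n). abs_L2 (indicator (A \<inter> cube n)) :: 'a L2) ` (E \<times> UNIV)"
  have sq: "square_integrable (indicator (A \<inter> cube n) :: 'a \<Rightarrow> real)" if "A \<in> E" for A n
  proof -
    have "A \<in> sets borel" using that E(3) by auto
    then have *: "A \<inter> cube n \<in> sets borel" by (auto simp: cube_def)
    have "emeasure lborel (A \<inter> cube n) \<le> emeasure lborel (cube n)"
      using * by (intro emeasure_mono) (auto simp: cube_def)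
    also have "\<dots> < \<infinity>" by (simp add: cube_def emeasure_lborel_cbox_finite)
    finally have "integrable lborel (indicator (A \<inter> cube n) :: 'a \<Rightarrow> real)"
      using * by (simp add: less_top)
    then have "integrable lebesgue (indicator (A \<inter> cube n) :: 'a \<Rightarrow> real)"
      using * by (subst integrable_completion) auto
    moreover have "(\<lambda>x. (indicator (A \<inter> cube n) x :: real)\<^sup>2) = indicator (A \<inter> cube n)"
      by (auto simp: indicator_def fun_eq_iff)
    ultimately show ?thesis by (auto simp: square_integrable_def)
  qed
  have "closure (span S) = UNIV"
  proof (rule subspace_dense_if_trivial_complement[OF subspace_span])
    fix w :: "'a L2"
    assume "\<And>s. s \<in> span S \<Longrightarrow> inner w s = 0"
    then have orth: "inner w (abs_L2 (indicator (A \<inter> cube n))) = 0" if "A \<in> E" for A n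
      using that by (intro \<open>\<And>s. s \<in> span S \<Longrightarrow> inner w s = 0\<close> span_base) (auto simp: S_def)
    have "AE x in lebesgue. indicator (cube n) x * rep_L2 w x = 0" for n
    proof (rule AE_zero_if_generator_integrals_zero[OF _ E(2-4)])
      have "integrable lebesgue (\<lambda>x. indicator (UNIV \<inter> cube n) x * rep_L2 w x)"
        by (rule square_integrable_mult[OF sq[OF E(4)] square_integrable_rep_L2])
      then show "integrable lebesgue (\<lambda>x. indicator (cube n) x * rep_L2 w x)" by simp
      fix A assume "A \<in> E"
      show "(LINT x|lebesgue. indicator A x * (indicator (cube n) x * rep_L2 w x)) = 0"
        using orth[OF \<open>A \<in> E\<close>, of n] sq[OF \<open>A \<in> E\<close>, of n]
        by (simp add: inner_abs_L2_right indicator_inter_arith mult_ac)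
    qed
    then have "AE x in lebesgue. \<forall>n. indicator (cube n) x * rep_L2 w x = 0"
      by (subst AE_all_countable) blast
    then have "AE x in lebesgue. rep_L2 w x = rep_L2 0 x"
      using rep_L2_zero
    proof eventually_elim
      case (elim x)
      obtain n where n: "norm x \<le> real n" using real_arch_simple by blast
      have "x \<in> cube n"
        unfolding cube_def mem_box
      proof
        fix i :: 'a assume i: "i \<in> Basis"
        have "\<bar>x \<bullet> i\<bar> \<le> real n" using Basis_le_norm[OF i, of x] n by linarith
        then show "(- real n *\<^sub>R One) \<bullet> i \<le> x \<bullet> i \<and> x \<bullet> i \<le> (real n *\<^sub>R One) \<bullet> i"
          using i by (simp add: abs_le_iff)
      qed
      with elim(1) have "rep_L2 w x = 0" by (metis indicator_simps(1) mult_1)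
      with elim(2) show ?case by simp
    qed
    then show "w = 0" by (rule L2_eqI)
  qed
  moreover have "countable S"
    using E(1) by (simp add: S_def)
  then obtain D where "countable D" "span S \<subseteq> closure D"
    by (rule countable_dense_in_span)
  ultimately have "countable D" "closure D = UNIV"
    using closure_mono[of "span S" "closure D"] by auto
  then show "\<exists>B::'a L2 set set. countable B \<and> open = generate_topology B"
    by (rule separable_imp_second_countable_basis)
qed


text \<open>Tent functions around a closed set decrease to its indicator, since points off the set
  have positive distance from it. \<open>C\<close> must be nonempty because \<open>infdist\<close>
  to the empty set is 0.\<close>

lemma lipschitz_indicator_approx:
  fixes C :: "'a::metric_space set"
  assumes C: "closed C" "C \<noteq> {}"
  defines "\<phi> \<equiv> \<lambda>n x. max 0 (1 - real n * infdist x C)"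
  shows "(real n)-lipschitz_on UNIV (\<phi> n)" and "0 \<le> \<phi> n x" and "\<phi> n x \<le> 1"
    and "(\<lambda>n. \<phi> n x) \<longlonglongrightarrow> indicator C x"
proof -
  show "(real n)-lipschitz_on UNIV (\<phi> n)"
  proof (rule lipschitz_onI)
    fix x y
    have "\<bar>infdist x C - infdist y C\<bar> \<le> dist x y"
      by (rule infdist_triangle_abs)
    then have "real n * \<bar>infdist x C - infdist y C\<bar> \<le> real n * dist x y"
      by (intro mult_left_mono) auto
    moreover have "\<bar>real n * infdist x C - real n * infdist y C\<bar> = real n * \<bar>infdist x C - infdist y C\<bar>"
      by (simp add: abs_mult flip: right_diff_distrib)
    ultimately show "dist (\<phi> n x) (\<phi> n y) \<le> real n * dist x y"
      by (auto simp: \<phi>_def dist_real_def max_def)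
  qed simp
  show "0 \<le> \<phi> n x" "\<phi> n x \<le> 1"
    by (auto simp: \<phi>_def infdist_nonneg)
  show "(\<lambda>n. \<phi> n x) \<longlonglongrightarrow> indicator C x"
  proof (cases "x \<in> C")
    case True
    then show ?thesis by (simp add: \<phi>_def)
  next
    case False
    then have pos: "infdist x C > 0"
      using C by (simp add: infdist_pos_not_in_closed)
    obtain N where N: "1 / infdist x C < real N"
      using reals_Archimedean2 by blast
    have "\<phi> n x = 0" if "n \<ge> N" for n
    proof -
      have "1 / infdist x C < real n"
        using N that by (meson less_le_trans of_nat_mono)
      then have "1 < real n * infdist x C"
        using pos by (simp add: field_simps)
      then show ?thesis by (simp add: \<phi>_def)
    qed
    then show ?thesis
      using False by (auto intro!: tendsto_eventually eventually_sequentiallyI)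
  qed
qed

lemma Int_stable_closed: "Int_stable (Collect closed)"
  by (auto simp: Int_stable_def)

lemma sets_borel_eq_closed: "sets borel = sigma_sets UNIV (Collect closed)"
  by (subst borel_eq_closed) (simp add: sets_measure_of)

lemma lipschitz_on_borel_measurable:
  fixes \<phi> :: "'a::metric_space \<Rightarrow> real"
  assumes "L-lipschitz_on UNIV \<phi>"
  shows "\<phi> \<in> borel_measurable borel"
  using assms by (intro borel_measurable_continuous_onI lipschitz_on_continuous_on)

text \<open>Closed sets form an intersection-stable generator, and their measures are limits of
  integrals of tent functions. This form fits the uniqueness of the invariant measure, where
  Lipschitz observables are controlled.\<close>

lemma measure_eqI_lipschitz:
  fixes M N :: "'a::metric_space measure"
  assumes "finite_measure M" "finite_measure N" and sets: "sets M = sets borel" "sets N = sets borel"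
    and eq: "\<And>(\<phi> :: 'a \<Rightarrow> real) L. L-lipschitz_on UNIV \<phi> \<Longrightarrow> (\<And>x. 0 \<le> \<phi> x \<and> \<phi> x \<le> 1) \<Longrightarrow>
      (LINT x|M. \<phi> x) = (LINT x|N. \<phi> x)"
  shows "M = N"
proof (rule measure_eqI_generator_eq[OF Int_stable_closed, of UNIV])
  interpret M: finite_measure M by fact
  interpret N: finite_measure N by fact
  have lim: "(\<lambda>n. LINT x|K. max 0 (1 - real n * infdist x C)) \<longlonglongrightarrow> measure K C"
    if "closed C" "C \<noteq> {}" "finite_measure K" "sets K = sets borel" for C and K :: "'a measure"
  proof -
    interpret finite_measure K by fact
    have "(\<lambda>n. LINT x|K. max 0 (1 - real n * infdist x C)) \<longlonglongrightarrow> (LINT x|K. indicator C x)"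
    proof (rule integral_dominated_convergence[where w = "\<lambda>_. 1"])
      show "(\<lambda>x. max 0 (1 - real n * infdist x C)) \<in> borel_measurable K" for n
        using lipschitz_on_borel_measurable[OF lipschitz_indicator_approx(1)[OF that(1,2), of n]] that(4)
        by (simp cong: measurable_cong_sets)
      show "indicator C \<in> borel_measurable K"
        using that(1,4) by (intro borel_measurable_indicator) simp
    qed (use lipschitz_indicator_approx[OF that(1,2)] in auto)
    then show ?thesis
      using that sets_eq_imp_space_eq[OF that(4)] by simp
  qed
  fix C :: "'a set"
  assume "C \<in> Collect closed"
  then have C: "closed C" by simp
  show "emeasure M C = emeasure N C"
  proof (cases "C = {}")
    case False
    have "(\<lambda>n. LINT x|M. max 0 (1 - real n * infdist x C)) = (\<lambda>n. LINT x|N. max 0 (1 - real n * infdist x C))"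
      by (intro ext eq[OF lipschitz_indicator_approx(1)[OF C False]] conjI
          lipschitz_indicator_approx(2,3)[OF C False])
    then have "measure M C = measure N C"
      using lim[OF C False assms(1) sets(1)] lim[OF C False assms(2) sets(2)]
      by (metis LIMSEQ_unique)
    then show ?thesis
      by (simp add: M.emeasure_eq_measure N.emeasure_eq_measure)
  qed simp
next
  show "sets M = sigma_sets UNIV (Collect closed)" "sets N = sigma_sets UNIV (Collect closed)"
    using sets sets_borel_eq_closed by auto
  show "range (\<lambda>_::nat. UNIV) \<subseteq> Collect closed" by auto
  show "emeasure M UNIV \<noteq> \<infinity>" for i :: nat
    using finite_measure.emeasure_finite[OF assms(1)] by simp
qed auto

text \<open>The same tent functions with a signed density in place of a measure; the absolute value
  of \<open>w\<close> dominates all products.\<close>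

lemma AE_zero_if_lipschitz_integrals_zero:
  fixes w :: "'a::euclidean_space \<Rightarrow> real"
  assumes w: "integrable lebesgue w"
    and zero: "\<And>\<phi> L. L-lipschitz_on UNIV \<phi> \<Longrightarrow> (\<And>x. 0 \<le> \<phi> x \<and> \<phi> x \<le> 1) \<Longrightarrow>
      (LINT x|lebesgue. \<phi> x * w x) = 0"
  shows "AE x in lebesgue. w x = 0"
proof (rule AE_zero_if_generator_integrals_zero[OF w Int_stable_closed sets_borel_eq_closed])
  fix C :: "'a set"
  assume "C \<in> Collect closed"
  then have C: "closed C" by simp
  show "(LINT x|lebesgue. indicator C x * w x) = 0"
  proof (cases "C = {}")
    case False
    note L = lipschitz_indicator_approx[OF C False]
    have "(\<lambda>n. LINT x|lebesgue. max 0 (1 - real n * infdist x C) * w x) \<longlonglongrightarrow> (LINT x|lebesgue. indicator C x * w x)"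
    proof (rule integral_dominated_convergence[where w = "\<lambda>x. norm (w x)"])
      have [measurable]: "w \<in> borel_measurable lebesgue" using w by auto
      have [measurable]: "(\<lambda>x. max 0 (1 - real n * infdist x C)) \<in> borel_measurable lebesgue" for n
        using lipschitz_on_borel_measurable[OF L(1)[of n]] by (intro measurable_completion) simp
      have [measurable]: "C \<in> sets lebesgue" using C by simp
      show "(\<lambda>x. indicator C x * w x) \<in> borel_measurable lebesgue"
        "(\<lambda>x. max 0 (1 - real n * infdist x C) * w x) \<in> borel_measurable lebesgue" for n
        by measurable
      show "AE x in lebesgue. (\<lambda>n. max 0 (1 - real n * infdist x C) * w x) \<longlonglongrightarrow> indicator C x * w x"
        by (intro always_eventually allI tendsto_intros L(4))
      show "AE x in lebesgue. norm (max 0 (1 - real n * infdist x C) * w x) \<le> norm (w x)" for n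
        using L(2,3)[of n] by (intro always_eventually allI) (simp add: abs_mult mult_left_le_one_le)
    qed (use w in simp)
    then show ?thesis
      using zero[OF L(1) conjI[OF L(2,3)]] by (simp add: LIMSEQ_const_iff)
  qed simp
qed simp

section \<open>Test functions and mollification\<close>

lemma C_k_on_Suc_pderiv:
  "C_k_on (Suc k) UNIV \<phi> \<longleftrightarrow> (\<forall>x. \<phi> differentiable (at x)) \<and> (\<forall>b\<in>Basis. C_k_on k UNIV (pderiv_dir b \<phi>))"
  by (simp add: pderiv_dir_def)

lemma pderiv_dir_eqI: "(\<phi> has_derivative \<phi>') (at x) \<Longrightarrow> pderiv_dir b \<phi> x = \<phi>' b"
  unfolding pderiv_dir_def by (metis frechet_derivative_at)

lemma has_derivative_pderiv_dir:
  assumes "\<phi> differentiable (at x)"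
  shows "(\<phi> has_derivative (\<lambda>h. \<Sum>b\<in>Basis. (h \<bullet> b) * pderiv_dir b \<phi> x)) (at x)"
proof -
  have d: "(\<phi> has_derivative frechet_derivative \<phi> (at x)) (at x)"
    using assms frechet_derivative_works by blast
  then have l: "linear (frechet_derivative \<phi> (at x))"
    by (rule has_derivative_linear)
  have "frechet_derivative \<phi> (at x) h = (\<Sum>b\<in>Basis. (h \<bullet> b) * pderiv_dir b \<phi> x)" for h
  proof -
    have "frechet_derivative \<phi> (at x) h = frechet_derivative \<phi> (at x) (\<Sum>b\<in>Basis. (h \<bullet> b) *\<^sub>R b)"
      by (simp add: euclidean_representation)
    then show ?thesis
      by (simp add: linear_sum[OF l] linear_cmul[OF l] pderiv_dir_def)
  qed
  then have "frechet_derivative \<phi> (at x) = (\<lambda>h. \<Sum>b\<in>Basis. (h \<bullet> b) * pderiv_dir b \<phi> x)" by auto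
  with d show ?thesis by simp
qed

lemma C_k_on_SucI:
  assumes "\<And>x. (\<phi> has_derivative \<phi>' x) (at x)"
    and "\<And>b. b \<in> Basis \<Longrightarrow> C_k_on k UNIV (\<lambda>x. \<phi>' x b)"
  shows "C_k_on (Suc k) UNIV \<phi>"
  unfolding C_k_on_Suc_pderiv
proof (intro conjI allI ballI)
  show "\<phi> differentiable (at x)" for x
    using assms(1) by (auto simp: differentiable_def)
  show "C_k_on k UNIV (pderiv_dir b \<phi>)" if "b \<in> Basis" for b
  proof -
    have "pderiv_dir b \<phi> = (\<lambda>x. \<phi>' x b)"
      using pderiv_dir_eqI[OF assms(1)] by auto
    then show ?thesis
      using assms(2)[OF that] by simp
  qed
qed

lemma C_k_on_const: "C_k_on k UNIV (\<lambda>x::'a::euclidean_space. c)"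
proof (induction k arbitrary: c)
  case (Suc k)
  show ?case by (rule C_k_on_SucI[OF has_derivative_const]) (rule Suc)
qed simp

lemma C_k_on_mono_Suc: "C_k_on (Suc k) UNIV \<phi> \<Longrightarrow> C_k_on k UNIV \<phi>"
proof (induction k arbitrary: \<phi>)
  case 0
  then show ?case
    by (auto intro!: continuous_at_imp_continuous_on differentiable_imp_continuous_within)
next
  case (Suc k)
  then show ?case unfolding C_k_on_Suc_pderiv by blast
qed

lemma C_k_on_add:
  "C_k_on k UNIV \<phi> \<Longrightarrow> C_k_on k UNIV \<psi> \<Longrightarrow> C_k_on k UNIV (\<lambda>x. \<phi> x + \<psi> x)"
proof (induction k arbitrary: \<phi> \<psi>)
  case (Suc k)
  have d: "((\<lambda>x. \<phi> x + \<psi> x) has_derivative (\<lambda>h. frechet_derivative \<phi> (at x) h + frechet_derivative \<psi> (at x) h)) (at x)" for x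
    using Suc.prems by (intro has_derivative_add) (auto simp: frechet_derivative_works)
  show ?case
    by (rule C_k_on_SucI[OF d]) (use Suc in auto)
qed (auto intro: continuous_on_add)

lemma C_k_on_mult:
  "C_k_on k UNIV \<phi> \<Longrightarrow> C_k_on k UNIV \<psi> \<Longrightarrow> C_k_on k UNIV (\<lambda>x. \<phi> x * \<psi> x)"
proof (induction k arbitrary: \<phi> \<psi>)
  case (Suc k)
  have d: "((\<lambda>x. \<phi> x * \<psi> x) has_derivative (\<lambda>h. \<phi> x * frechet_derivative \<psi> (at x) h + frechet_derivative \<phi> (at x) h * \<psi> x)) (at x)" for x
    using Suc.prems by (intro has_derivative_mult) (auto simp: frechet_derivative_works)
  show ?case
    by (rule C_k_on_SucI[OF d], intro C_k_on_add Suc.IH)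
      (use Suc.prems C_k_on_mono_Suc[of k \<phi>] C_k_on_mono_Suc[of k \<psi>] in auto)
qed (auto intro: continuous_on_mult)

lemma C_k_on_prod:
  "finite I \<Longrightarrow> (\<And>i. i \<in> I \<Longrightarrow> C_k_on k UNIV (\<phi> i)) \<Longrightarrow> C_k_on k UNIV (\<lambda>x. \<Prod>i\<in>I. \<phi> i x)"
  by (induction I rule: finite_induct) (auto intro: C_k_on_const C_k_on_mult)

text \<open>A sequence of functions, each the derivative of the one before, lets the induction on
  \<open>k\<close> run for all \<open>n\<close> at once; the chain rule contributes only constant
  factors.\<close>

lemma C_k_on_compose_affine:
  fixes F :: "nat \<Rightarrow> real \<Rightarrow> real" and c :: "'a::euclidean_space"
  assumes F: "\<And>n t. (F n has_real_derivative F (Suc n) t) (at t)"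
  shows "C_k_on k UNIV (\<lambda>x. F n (c \<bullet> x + d))"
proof (induction k arbitrary: n)
  case 0
  have "isCont (F n) t" for t
    using F by (rule DERIV_isCont)
  then show ?case
    unfolding C_k_on.simps
    by (intro continuous_on_compose2[OF continuous_at_imp_continuous_on[of UNIV "F n"]]
        continuous_intros subset_UNIV) auto
next
  case (Suc k)
  have d: "((\<lambda>x. F n (c \<bullet> x + d)) has_derivative (\<lambda>h. F (Suc n) (c \<bullet> x + d) * (c \<bullet> h))) (at x)" for x
  proof -
    have "((\<lambda>x. c \<bullet> x + d) has_derivative (\<lambda>h. c \<bullet> h)) (at x)"
      by (auto intro!: derivative_eq_intros)
    from has_derivative_compose[OF this, of "F n" "(*) (F (Suc n) (c \<bullet> x + d))"] F show ?thesis
      by (simp add: has_field_derivative_def)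
  qed
  show ?case
    by (rule C_k_on_SucI[OF d], intro C_k_on_mult Suc C_k_on_const)
qed

text \<open>Up to a polynomial factor in \<open>1 / t\<close>, all derivatives of \<open>t \<mapsto> exp (- 1 / t)\<close> have the same form.\<close>

definition flat_exp :: "real poly \<Rightarrow> real \<Rightarrow> real" where
  "flat_exp p t = (if t > 0 then poly p (1 / t) * exp (- 1 / t) else 0)"

lemma poly_times_exp_tendsto_zero: "((\<lambda>s::real. poly p s * exp (- s)) \<longlongrightarrow> 0) at_top"
proof -
  have "((\<lambda>s::real. \<Sum>i\<le>degree p. coeff p i * (s ^ i / exp s)) \<longlongrightarrow> (\<Sum>i\<le>degree p. coeff p i * 0)) at_top"
    by (intro tendsto_intros tendsto_power_div_exp_0)
  then show ?thesis
    by (simp add: poly_altdef sum_distrib_right sum_distrib_left exp_minus divide_inverse mult_ac)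
qed

text \<open>The substitution s = 1 / t moves the right-hand limit to infinity, where the exponential
  beats the polynomial; on the left the function is zero.\<close>

lemma flat_exp_tendsto_zero: "(flat_exp p \<longlongrightarrow> 0) (at 0)"
proof -
  have "((\<lambda>t. poly p (inverse t) * exp (- inverse t)) \<longlongrightarrow> 0) (at_right (0::real))"
    using filterlim_compose[OF poly_times_exp_tendsto_zero filterlim_inverse_at_top_right, of p] by simp
  then have "(flat_exp p \<longlongrightarrow> 0) (at_right 0)"
    by (rule tendsto_cong[THEN iffD1, rotated])
      (auto simp: flat_exp_def eventually_at_filter inverse_eq_divide)
  moreover have "(flat_exp p \<longlongrightarrow> 0) (at_left 0)"
    by (rule tendsto_eventually) (auto simp: flat_exp_def eventually_at_filter)
  ultimately show ?thesis
    by (simp add: filterlim_at_split)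
qed

text \<open>With s = 1 / t, differentiation in t is - s^2 times differentiation in s, which turns
  p(s) exp(-s) into s^2 (p - p')(s) exp(-s). The polynomial \<open>[:0, 0, 1:]\<close> is the factor
  s^2.\<close>

lemma DERIV_flat_exp: "(flat_exp p has_real_derivative flat_exp ([:0, 0, 1:] * (p - pderiv p)) t) (at t)"
proof -
  consider "t > 0" | "t < 0" | "t = 0" by linarith
  then show ?thesis
  proof cases
    case 1
    have "((\<lambda>t. poly p (1 / t) * exp (- 1 / t)) has_real_derivative flat_exp ([:0, 0, 1:] * (p - pderiv p)) t) (at t)"
      using 1 by (auto intro!: derivative_eq_intros poly_DERIV[THEN DERIV_chain2] simp: flat_exp_def field_simps power2_eq_square)
    then show ?thesis
      by (rule has_field_derivative_transform_within_open[where S = "{0<..}"]) (use 1 in \<open>auto simp: flat_exp_def\<close>)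
  next
    case 2
    have "((\<lambda>t. 0) has_real_derivative flat_exp ([:0, 0, 1:] * (p - pderiv p)) t) (at t)"
      using 2 by (auto simp: flat_exp_def)
    then show ?thesis
      by (rule has_field_derivative_transform_within_open[where S = "{..<0}"]) (use 2 in \<open>auto simp: flat_exp_def\<close>)
  next
    case 3
    \<comment> \<open>Dividing by h multiplies the polynomial in 1 / h by its variable, so the
      difference quotient at 0 has the same form again.\<close>
    have "(\<lambda>h. (flat_exp p (0 + h) - flat_exp p 0) / h) = flat_exp (pCons 0 p)"
      by (auto simp: flat_exp_def fun_eq_iff)
    then show ?thesis
      using flat_exp_tendsto_zero[of "pCons 0 p"] unfolding 3 DERIV_def by (simp add: flat_exp_def)
  qed
qed

text \<open>For \<delta> > 0, a product of one-dimensional factors that is positive exactly on the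
  open cube of points with all coordinates below \<delta> in absolute value. In this form smoothness
  needs only products and affine substitutions.\<close>

definition bump :: "real \<Rightarrow> 'a::euclidean_space \<Rightarrow> real" where
  "bump \<delta> x = (\<Prod>b\<in>Basis. flat_exp 1 ((b /\<^sub>R \<delta>) \<bullet> x + 1) * flat_exp 1 ((- b /\<^sub>R \<delta>) \<bullet> x + 1))"

lemma smooth_on_bump: "smooth_on UNIV (bump \<delta>)"
proof -
  define F where "F n = flat_exp (((\<lambda>p. [:0, 0, 1:] * (p - pderiv p)) ^^ n) 1)" for n
  have F: "(F n has_real_derivative F (Suc n) t) (at t)" for n t
    unfolding F_def funpow.simps o_def by (rule DERIV_flat_exp)
  have "C_k_on k UNIV (\<lambda>x. F 0 (c \<bullet> x + d))" for k c d
    using F by (rule C_k_on_compose_affine)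
  then show ?thesis
    unfolding smooth_on_def bump_def F_def funpow_0
    by (intro allI C_k_on_prod C_k_on_mult finite_Basis)
qed

lemma bump_nonneg: "0 \<le> bump \<delta> x"
  unfolding bump_def by (intro prod_nonneg) (auto simp: flat_exp_def)

lemma bump_pos_at_0: "0 < bump \<delta> 0"
  unfolding bump_def by (intro prod_pos) (auto simp: flat_exp_def)

lemma bump_nonzero_imp:
  assumes "bump \<delta> x \<noteq> 0" "\<delta> > 0" "b \<in> Basis"
  shows "\<bar>x \<bullet> b\<bar> < \<delta>"
proof -
  have "flat_exp 1 ((b /\<^sub>R \<delta>) \<bullet> x + 1) \<noteq> 0" "flat_exp 1 ((- b /\<^sub>R \<delta>) \<bullet> x + 1) \<noteq> 0"
    using assms by (auto simp: bump_def)
  then have "(b /\<^sub>R \<delta>) \<bullet> x + 1 > 0" "(- b /\<^sub>R \<delta>) \<bullet> x + 1 > 0"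
    by (auto simp: flat_exp_def split: if_splits)
  then have "- (x \<bullet> b) < \<delta>" "x \<bullet> b < \<delta>"
    using \<open>\<delta> > 0\<close> by (auto simp: field_simps inner_commute)
  then show ?thesis by linarith
qed

lemma bump_nonzero_imp_norm_less:
 fixes x :: "'a::euclidean_space" and \<delta> :: real
  assumes "bump \<delta> x \<noteq> 0" "\<delta> > 0"
  shows "norm x < DIM('a) * \<delta>"
proof -
  have "norm x \<le> (\<Sum>b\<in>Basis. \<bar>x \<bullet> b\<bar>)"
    by (rule norm_le_l1)
  also have "\<dots> < (\<Sum>b\<in>(Basis::'a set). \<delta>)"
    by (rule sum_strict_mono) (use bump_nonzero_imp[OF assms] in auto)
  finally show ?thesis by simp
qed

lemma smooth_on_pderiv_dir: "smooth_on UNIV \<phi> \<Longrightarrow> b \<in> Basis \<Longrightarrow> smooth_on UNIV (pderiv_dir b \<phi>)"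
  unfolding smooth_on_def by (metis C_k_on_Suc_pderiv)

lemma smooth_on_differentiable: "smooth_on UNIV \<phi> \<Longrightarrow> \<phi> differentiable (at x)"
  unfolding smooth_on_def by (metis C_k_on_Suc_pderiv)

lemma smooth_on_continuous: "smooth_on UNIV \<phi> \<Longrightarrow> continuous_on UNIV \<phi>"
  unfolding smooth_on_def by (metis C_k_on.simps(1))

text \<open>Differentiation under the integral over a compact box. All derivatives fall on \<psi>,
  so continuity of \<open>v\<close> is enough; \<open>D x y\<close> packs the total derivative as a
  bounded linear map, the form in which the Leibniz rule is applied.\<close>

lemma has_derivative_convolution:
  fixes \<psi> v :: "'a::euclidean_space \<Rightarrow> real"
  assumes \<psi>: "smooth_on UNIV \<psi>" and v: "continuous_on UNIV v"
  shows "((\<lambda>x. integral (cbox a b) (\<lambda>y. \<psi> (x - y) * v y)) has_derivative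
    (\<lambda>h. \<Sum>i\<in>Basis. (h \<bullet> i) * integral (cbox a b) (\<lambda>y. pderiv_dir i \<psi> (x - y) * v y))) (at x)"
proof -
  define D where "D x y = (\<Sum>i\<in>Basis. (pderiv_dir i \<psi> (x - y) * v y) *\<^sub>R blinfun_inner_left i)" for x y :: 'a
  have c: "continuous_on UNIV (\<lambda>p. pderiv_dir i \<psi> (fst p - snd p) * v (snd p))" if "i \<in> Basis" for i
    by (intro continuous_on_mult continuous_on_compose2[OF smooth_on_continuous[OF smooth_on_pderiv_dir[OF \<psi> that]]]
        continuous_on_compose2[OF v] continuous_intros subset_UNIV)
  have c0: "continuous_on UNIV (\<lambda>y. pderiv_dir i \<psi> (x - y) * v y)" if "i \<in> Basis" for i x
    by (intro continuous_on_mult continuous_on_compose2[OF smooth_on_continuous[OF smooth_on_pderiv_dir[OF \<psi> that]]]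
        v continuous_intros subset_UNIV)
  have "((\<lambda>x. integral (cbox a b) (\<lambda>y. \<psi> (x - y) * v y)) has_derivative integral (cbox a b) (D x)) (at x within UNIV)"
  proof (rule leibniz_rule)
    fix x t :: 'a
    have "((\<lambda>x. \<psi> (x - t)) has_derivative (\<lambda>h. \<Sum>b\<in>Basis. (h \<bullet> b) * pderiv_dir b \<psi> (x - t))) (at x)"
      by (rule has_derivative_compose[OF _ has_derivative_pderiv_dir[OF smooth_on_differentiable[OF \<psi>]], of "\<lambda>x. x - t", simplified])
        (auto intro!: derivative_eq_intros)
    then have "((\<lambda>x. \<psi> (x - t) * v t) has_derivative (\<lambda>h. (\<Sum>b\<in>Basis. (h \<bullet> b) * pderiv_dir b \<psi> (x - t)) * v t)) (at x)"
      by (rule has_derivative_mult_left)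
    moreover have "(\<lambda>h. (\<Sum>b\<in>Basis. (h \<bullet> b) * pderiv_dir b \<psi> (x - t)) * v t) = blinfun_apply (D x t)"
      by (auto simp: D_def fun_eq_iff blinfun.sum_left blinfun.scaleR_left sum_distrib_right intro!: sum.cong)
    ultimately show "((\<lambda>x. \<psi> (x - t) * v t) has_derivative blinfun_apply (D x t)) (at x within UNIV)"
      by simp
    show "(\<lambda>y. \<psi> (x - y) * v y) integrable_on cbox a b"
      by (intro integrable_continuous continuous_on_mult continuous_on_compose2[OF smooth_on_continuous[OF \<psi>]]
          continuous_on_subset[OF v] continuous_intros subset_UNIV)
    show "continuous_on (UNIV \<times> cbox a b) (\<lambda>(x, t). D x t)"
      unfolding D_def split_beta
      by (intro continuous_on_sum continuous_on_scaleR continuous_on_const continuous_on_subset[OF c] subset_UNIV)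
  qed auto
  moreover have "integral (cbox a b) (D x) h = (\<Sum>i\<in>Basis. (h \<bullet> i) * integral (cbox a b) (\<lambda>y. pderiv_dir i \<psi> (x - y) * v y))" for h
  proof -
    have i: "(\<lambda>y. pderiv_dir i \<psi> (x - y) * v y) integrable_on cbox a b" if "i \<in> Basis" for i
      using c0[OF that] by (intro integrable_continuous) (auto intro: continuous_on_subset)
    have "continuous_on (cbox a b) (D x)"
      unfolding D_def
      by (intro continuous_on_sum continuous_on_scaleR continuous_on_const continuous_on_subset[OF c0] subset_UNIV)
    then have "integral (cbox a b) (D x) h = integral (cbox a b) (\<lambda>y. D x y h)"
      by (intro blinfun_apply_integral integrable_continuous)
    also have "\<dots> = integral (cbox a b) (\<lambda>y. \<Sum>i\<in>Basis. (h \<bullet> i) * (pderiv_dir i \<psi> (x - y) * v y))"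
      by (simp add: D_def blinfun.sum_left blinfun.scaleR_left mult_ac)
    also have "\<dots> = (\<Sum>i\<in>Basis. (h \<bullet> i) * integral (cbox a b) (\<lambda>y. pderiv_dir i \<psi> (x - y) * v y))"
      by (subst integral_sum) (auto intro!: integrable_on_mult_right i)
    finally show ?thesis .
  qed
  then have "blinfun_apply (integral (cbox a b) (D x)) = (\<lambda>h. \<Sum>i\<in>Basis. (h \<bullet> i) * integral (cbox a b) (\<lambda>y. pderiv_dir i \<psi> (x - y) * v y))"
    by auto
  ultimately show ?thesis by simp
qed

text \<open>A partial derivative of a convolution is the convolution with a partial derivative of
  \<psi>, so the induction runs over all smooth \<psi>.\<close>

lemma C_k_on_convolution:
  assumes "smooth_on UNIV \<psi>" "continuous_on UNIV v"
  shows "C_k_on k UNIV (\<lambda>x. integral (cbox a b) (\<lambda>y. \<psi> (x - y) * v y))"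
  using assms(1)
proof (induction k arbitrary: \<psi>)
  case 0
  show ?case
    by (simp, intro continuous_at_imp_continuous_on ballI)
      (rule has_derivative_continuous[OF has_derivative_convolution[OF 0 assms(2)]])
next
  case (Suc k)
  show ?case
  proof (rule C_k_on_SucI[OF has_derivative_convolution[OF Suc.prems assms(2)]])
    fix c :: 'a assume c: "c \<in> Basis"
    have "(\<Sum>i\<in>Basis. (c \<bullet> i) * integral (cbox a b) (\<lambda>y. pderiv_dir i \<psi> (x - y) * v y))
        = integral (cbox a b) (\<lambda>y. pderiv_dir c \<psi> (x - y) * v y)" for x
      using c by (simp add: inner_Basis if_distrib[of "\<lambda>z. z * _"] cong: if_cong)
    then show "C_k_on k UNIV (\<lambda>x. \<Sum>i\<in>Basis. (c \<bullet> i) * integral (cbox a b) (\<lambda>y. pderiv_dir i \<psi> (x - y) * v y))"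
      using Suc.IH[OF smooth_on_pderiv_dir[OF Suc.prems c]] by simp
  qed
qed


section \<open>Test functions and integration by parts\<close>

lemma test_fun_smooth: "test_fun U \<phi> \<Longrightarrow> smooth_on UNIV \<phi>"
  by (simp add: test_fun_def)

lemma test_fun_differentiable: "test_fun U \<phi> \<Longrightarrow> \<phi> differentiable (at x)"
  by (simp add: test_fun_smooth smooth_on_differentiable)

lemma test_fun_continuous: "test_fun U \<phi> \<Longrightarrow> continuous_on S \<phi>"
  by (meson continuous_on_subset smooth_on_continuous subset_UNIV test_fun_smooth)

lemma test_fun_measurable: "test_fun U \<phi> \<Longrightarrow> \<phi> \<in> borel_measurable borel"
  by (intro borel_measurable_continuous_onI test_fun_continuous)

lemma test_fun_outside: "test_fun U \<phi> \<Longrightarrow> x \<notin> U \<Longrightarrow> \<phi> x = 0"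
  unfolding test_fun_def by blast

lemma test_fun_integrable:
  assumes "test_fun U \<phi>"
  shows "integrable lborel \<phi>"
proof -
  obtain K where K: "compact K" "\<And>x. x \<notin> K \<Longrightarrow> \<phi> x = 0"
    using assms unfolding test_fun_def by blast
  have "integrable lborel (\<lambda>x. indicator K x *\<^sub>R \<phi> x)"
    by (rule borel_integrable_compact[OF K(1) test_fun_continuous[OF assms]])
  moreover have "(\<lambda>x. indicator K x *\<^sub>R \<phi> x) = \<phi>"
    using K(2) by (auto simp: indicator_def fun_eq_iff)
  ultimately show ?thesis by simp
qed

lemma test_fun_mult:
  assumes "test_fun U \<phi>" "test_fun U \<psi>"
  shows "test_fun U (\<lambda>x. \<phi> x * \<psi> x)"
proof -
  obtain K where "compact K" "K \<subseteq> U" "\<And>x. x \<notin> K \<Longrightarrow> \<phi> x = 0"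
    using assms(1) unfolding test_fun_def by blast
  then show ?thesis
    using assms unfolding test_fun_def smooth_on_def by (auto intro!: C_k_on_mult)
qed

lemma test_fun_add:
  assumes "test_fun U \<phi>" "test_fun U \<psi>"
  shows "test_fun U (\<lambda>x. \<phi> x + \<psi> x)"
proof -
  obtain K where "compact K" "K \<subseteq> U" "\<And>x. x \<notin> K \<Longrightarrow> \<phi> x = 0"
    using assms(1) unfolding test_fun_def by blast
  moreover obtain K' where "compact K'" "K' \<subseteq> U" "\<And>x. x \<notin> K' \<Longrightarrow> \<psi> x = 0"
    using assms(2) unfolding test_fun_def by blast
  ultimately have "\<exists>K. compact K \<and> K \<subseteq> U \<and> (\<forall>x. x \<notin> K \<longrightarrow> \<phi> x + \<psi> x = 0)"
    by (intro exI[of _ "K \<union> K'"]) (auto intro: compact_Un)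
  then show ?thesis
    using assms unfolding test_fun_def smooth_on_def by (auto intro!: C_k_on_add)
qed

lemma test_fun_scale:
  assumes "test_fun U \<phi>"
  shows "test_fun U (\<lambda>x. c * \<phi> x)"
proof -
  obtain K where "compact K" "K \<subseteq> U" "\<And>x. x \<notin> K \<Longrightarrow> \<phi> x = 0"
    using assms unfolding test_fun_def by blast
  then show ?thesis
    using assms unfolding test_fun_def smooth_on_def by (auto intro!: C_k_on_mult C_k_on_const)
qed

lemma test_fun_zero: "test_fun U (\<lambda>x. 0)"
  unfolding test_fun_def smooth_on_def by (auto intro!: C_k_on_const exI[of _ "{}"])

lemma test_fun_pderiv_dir:
  assumes "test_fun U \<phi>" "b \<in> Basis"
  shows "test_fun U (pderiv_dir b \<phi>)"
proof -
  obtain K where K: "compact K" "K \<subseteq> U" "\<And>x. x \<notin> K \<Longrightarrow> \<phi> x = 0"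
    using assms unfolding test_fun_def by blast
  have "pderiv_dir b \<phi> x = 0" if "x \<notin> K" for x
  proof -
    have "((\<lambda>x. 0) has_derivative (\<lambda>h. 0)) (at x)" by simp
    then have "(\<phi> has_derivative (\<lambda>h. 0)) (at x)"
      by (rule has_derivative_transform_within_open[where s = "- K"])
        (use K that compact_imp_closed in auto)
    then show ?thesis by (rule pderiv_dir_eqI)
  qed
  with K show ?thesis
    using smooth_on_pderiv_dir[OF test_fun_smooth[OF assms(1)] assms(2)] unfolding test_fun_def by blast
qed

lemma test_fun_square_integrable:
  assumes "test_fun U \<phi>"
  shows "square_integrable \<phi>"
proof -
  have "integrable lborel (\<lambda>x. (\<phi> x)\<^sup>2)"
    using test_fun_integrable[OF test_fun_mult[OF assms assms]] by (simp add: power2_eq_square)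
  then show ?thesis
    using test_fun_measurable[OF assms] unfolding square_integrable_def
    by (auto simp: integrable_completion intro: measurable_completion)
qed

lemma lborel_integral_translate:
  fixes f :: "'a::euclidean_space \<Rightarrow> real"
  assumes [measurable]: "f \<in> borel_measurable borel"
  shows "(LINT x|lborel. f (c + x)) = (LINT x|lborel. f x)"
proof -
  have "(LINT x|lborel. f x) = (LINT x|distr lborel borel ((+) c). f x)"
    by (simp add: lborel_distr_plus)
  also have "\<dots> = (LINT x|lborel. f (c + x))"
    by (subst integral_distr) auto
  finally show ?thesis ..
qed

lemma lborel_integrable_translate:
  fixes f :: "'a::euclidean_space \<Rightarrow> real"
  assumes "integrable lborel f"
  shows "integrable lborel (\<lambda>x. f (c + x))"
proof -
  have [measurable]: "f \<in> borel_measurable borel" using assms by auto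
  have "integrable (distr lborel borel ((+) c)) f"
    using assms by (simp add: lborel_distr_plus)
  then show ?thesis
    by (subst (asm) integrable_distr_eq) auto
qed

lemma integral_lborel_eq_integral_cbox:
  fixes f :: "'a::euclidean_space \<Rightarrow> real"
  assumes "continuous_on UNIV f" "\<And>x. x \<notin> cbox a b \<Longrightarrow> f x = 0"
  shows "integrable lborel f" "(LINT x|lborel. f x) = integral (cbox a b) f"
proof -
  have "integrable lborel (\<lambda>x. indicator (cbox a b) x *\<^sub>R f x)"
    using assms(1) by (intro borel_integrable_compact) (auto intro: continuous_on_subset)
  moreover have eq: "(\<lambda>x. indicator (cbox a b) x *\<^sub>R f x) = f"
    using assms(2) by (auto simp: indicator_def fun_eq_iff)
  ultimately show i: "integrable lborel f" by simp
  have "(LINT x|lborel. f x) = integral UNIV f"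
    by (rule integral_lborel[OF i, symmetric])
  also have "\<dots> = integral UNIV (\<lambda>x. if x \<in> cbox a b then f x else 0)"
    using assms(2) by (intro integral_cong) auto
  also have "\<dots> = integral (cbox a b) f"
    by (rule integral_restrict_UNIV)
  finally show "(LINT x|lborel. f x) = integral (cbox a b) f" .
qed

text \<open>The integral of \<phi>(x + t b) over x does not depend on t by translation invariance;
  its derivative at t = 0, taken under the integral, is the integral in question.\<close>

lemma integral_pderiv_test_fun:
  fixes \<phi> :: "'a::euclidean_space \<Rightarrow> real"
  assumes \<phi>: "test_fun U \<phi>" and b: "b \<in> Basis"
  shows "(LINT x|lborel. pderiv_dir b \<phi> x) = 0"
proof -
  obtain K where K: "compact K" "\<And>x. x \<notin> K \<Longrightarrow> \<phi> x = 0"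
    using \<phi> unfolding test_fun_def by blast
  obtain B where "\<And>x. x \<in> K \<Longrightarrow> norm x \<le> B"
    using compact_imp_bounded[OF K(1)] by (auto simp: bounded_iff)
  then have "norm y \<le> B + 1" if "x \<in> K" "y \<in> cball x 1" for x y
    using that norm_triangle_ineq2[of y x] by (force simp: dist_norm norm_minus_commute)
  then have "bounded (\<Union>x\<in>K. cball x 1)"
    by (intro boundedI[of _ "B + 1"]) auto
  \<comment> \<open>The box contains a neighbourhood of radius 1 of the support, so one fixed box
    serves all shifts with \<bar>t\<bar> \<le> 1.\<close>
  then obtain c d where box: "(\<Union>x\<in>K. cball x 1) \<subseteq> cbox c d"
    using bounded_subset_cbox_symmetric by blast
  have out: "\<phi> (x + t *\<^sub>R b) = 0" if "x \<notin> cbox c d" "\<bar>t\<bar> \<le> 1" for x t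
  proof (rule K(2))
    have "x \<in> cball (x + t *\<^sub>R b) 1"
      using that b by (simp add: dist_norm)
    then show "x + t *\<^sub>R b \<notin> K"
      using box that(1) by blast
  qed
  have sm: "smooth_on UNIV \<phi>" using \<phi> by (rule test_fun_smooth)
  note c0 = smooth_on_continuous[OF sm] and c1 = smooth_on_continuous[OF smooth_on_pderiv_dir[OF sm b]]
  have "((\<lambda>t. integral (cbox c d) (\<lambda>x. \<phi> (x + t *\<^sub>R b))) has_real_derivative
      integral (cbox c d) (\<lambda>x. pderiv_dir b \<phi> (x + 0 *\<^sub>R b))) (at 0 within {-1..1})"
  proof (rule leibniz_rule_field_derivative)
    fix t x
    have "((\<lambda>t. \<phi> (x + t *\<^sub>R b)) has_derivative (\<lambda>h. \<Sum>i\<in>Basis. ((h *\<^sub>R b) \<bullet> i) * pderiv_dir i \<phi> (x + t *\<^sub>R b))) (at t)"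
      by (rule has_derivative_compose[OF _ has_derivative_pderiv_dir[OF smooth_on_differentiable[OF sm]], of "\<lambda>t. x + t *\<^sub>R b"])
        (auto intro!: derivative_eq_intros)
    moreover have "(\<Sum>i\<in>Basis. ((h *\<^sub>R b) \<bullet> i) * pderiv_dir i \<phi> (x + t *\<^sub>R b)) = pderiv_dir b \<phi> (x + t *\<^sub>R b) * h" for h :: real
      using b by (simp add: inner_Basis if_distrib[of "\<lambda>z. _ * z"] if_distrib[of "\<lambda>z. z * _"] cong: if_cong)
    ultimately show "((\<lambda>t. \<phi> (x + t *\<^sub>R b)) has_real_derivative pderiv_dir b \<phi> (x + t *\<^sub>R b)) (at t within {-1..1})"
      by (simp add: has_field_derivative_def has_derivative_at_withinI)
  next
    show "(\<lambda>x. \<phi> (x + t *\<^sub>R b)) integrable_on cbox c d" for t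
      by (intro integrable_continuous continuous_on_compose2[OF c0] continuous_intros subset_UNIV)
    show "continuous_on ({- 1..1} \<times> cbox c d) (\<lambda>(t, x). pderiv_dir b \<phi> (x + t *\<^sub>R b))"
      unfolding split_beta by (intro continuous_on_compose2[OF c1] continuous_intros subset_UNIV)
  qed auto
  moreover have "integral (cbox c d) (\<lambda>x. \<phi> (x + t *\<^sub>R b)) = (LINT x|lborel. \<phi> x)" if "t \<in> {-1..1}" for t
  proof -
    have "integral (cbox c d) (\<lambda>x. \<phi> (x + t *\<^sub>R b)) = (LINT x|lborel. \<phi> (x + t *\<^sub>R b))"
      using that by (intro integral_lborel_eq_integral_cbox(2)[symmetric] out continuous_on_compose2[OF c0] continuous_intros subset_UNIV) auto
    also have "\<dots> = (LINT x|lborel. \<phi> x)"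
      using lborel_integral_translate[OF test_fun_measurable[OF \<phi>], of "t *\<^sub>R b"] by (simp add: add.commute)
    finally show ?thesis .
  qed
  ultimately have "((\<lambda>t. LINT x|lborel. \<phi> x) has_real_derivative
      integral (cbox c d) (\<lambda>x. pderiv_dir b \<phi> (x + 0 *\<^sub>R b))) (at 0 within {-1..1})"
    by - (rule has_field_derivative_transform_within[where d = 1], assumption, auto)
  then have "((\<lambda>t. LINT x|lborel. \<phi> x) has_real_derivative integral (cbox c d) (\<lambda>x. pderiv_dir b \<phi> x)) (at (0::real))"
    by (simp add: at_within_Icc_at)
  from DERIV_unique[OF this DERIV_const] have "integral (cbox c d) (\<lambda>x. pderiv_dir b \<phi> x) = 0" .
  moreover have "(LINT x|lborel. pderiv_dir b \<phi> x) = integral (cbox c d) (pderiv_dir b \<phi>)"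
  proof (rule integral_lborel_eq_integral_cbox(2)[OF c1])
    fix x assume "x \<notin> cbox c d"
    then have "x \<notin> K" using box centre_in_cball[of x 1] by (meson UN_I subsetD zero_le_one)
    have "((\<lambda>x. 0) has_derivative (\<lambda>h. 0)) (at x)" by simp
    then have "(\<phi> has_derivative (\<lambda>h. 0)) (at x)"
      by (rule has_derivative_transform_within_open[where s = "- K"])
        (use K \<open>x \<notin> K\<close> compact_imp_closed in auto)
    then show "pderiv_dir b \<phi> x = 0" by (rule pderiv_dir_eqI)
  qed
  ultimately show ?thesis by simp
qed

lemma pderiv_dir_mult:
  assumes "\<phi> differentiable (at x)" "\<psi> differentiable (at x)"
  shows "pderiv_dir b (\<lambda>x. \<phi> x * \<psi> x) x = \<phi> x * pderiv_dir b \<psi> x + pderiv_dir b \<phi> x * \<psi> x"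
  using assms unfolding frechet_derivative_works
  by (intro pderiv_dir_eqI[THEN trans] has_derivative_mult) (auto simp: pderiv_dir_def)

lemma integral_by_parts_test_fun:
  assumes "test_fun U \<phi>" "test_fun U \<psi>" "b \<in> Basis"
  shows "(LINT x|lborel. \<phi> x * pderiv_dir b \<psi> x) = - (LINT x|lborel. pderiv_dir b \<phi> x * \<psi> x)"
proof -
  have "0 = (LINT x|lborel. \<phi> x * pderiv_dir b \<psi> x + pderiv_dir b \<phi> x * \<psi> x)"
    using integral_pderiv_test_fun[OF test_fun_mult[OF assms(1,2)] assms(3)]
      pderiv_dir_mult[OF test_fun_differentiable[OF assms(1)] test_fun_differentiable[OF assms(2)]]
    by simp
  also have "\<dots> = (LINT x|lborel. \<phi> x * pderiv_dir b \<psi> x) + (LINT x|lborel. pderiv_dir b \<phi> x * \<psi> x)"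
    by (intro Bochner_Integration.integral_add
        test_fun_integrable[OF test_fun_mult[OF assms(1) test_fun_pderiv_dir[OF assms(2,3)]]]
        test_fun_integrable[OF test_fun_mult[OF test_fun_pderiv_dir[OF assms(1,3)] assms(2)]])
  finally show ?thesis by simp
qed

lemma pderiv_dir_lipschitz_bound:
  assumes d: "\<phi> differentiable (at x)" and L: "L-lipschitz_on UNIV \<phi>" and b: "b \<in> Basis"
  shows "\<bar>pderiv_dir b \<phi> x\<bar> \<le> L"
proof -
  have "((\<lambda>t. \<phi> (x + t *\<^sub>R b)) has_derivative (\<lambda>h. frechet_derivative \<phi> (at (x + 0 *\<^sub>R b)) (h *\<^sub>R b))) (at 0)"
    by (rule has_derivative_compose[of "\<lambda>t. x + t *\<^sub>R b"])
      (use d in \<open>auto intro!: derivative_eq_intros simp: frechet_derivative_works\<close>)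
  moreover have "frechet_derivative \<phi> (at x) (h *\<^sub>R b) = pderiv_dir b \<phi> x * h" for h
    using linear_cmul[OF linear_frechet_derivative[OF d]] by (simp add: pderiv_dir_def)
  ultimately have "((\<lambda>t. \<phi> (x + t *\<^sub>R b)) has_real_derivative pderiv_dir b \<phi> x) (at 0)"
    by (simp add: has_field_derivative_def)
  then have "((\<lambda>t. (\<phi> (x + t *\<^sub>R b) - \<phi> x) / t) \<longlongrightarrow> pderiv_dir b \<phi> x) (at 0)"
    by (simp add: DERIV_def)
  then have "((\<lambda>t. \<bar>(\<phi> (x + t *\<^sub>R b) - \<phi> x) / t\<bar>) \<longlongrightarrow> \<bar>pderiv_dir b \<phi> x\<bar>) (at 0)"
    by (rule tendsto_rabs)
  moreover have "eventually (\<lambda>t. \<bar>(\<phi> (x + t *\<^sub>R b) - \<phi> x) / t\<bar> \<le> L) (at 0)"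
  proof (rule eventually_mono[of "\<lambda>t. t \<noteq> 0"])
    fix t :: real assume "t \<noteq> 0"
    have "\<bar>\<phi> (x + t *\<^sub>R b) - \<phi> x\<bar> \<le> L * \<bar>t\<bar>"
      using lipschitz_onD[OF L, of "x + t *\<^sub>R b" x] b by (simp add: dist_norm)
    then show "\<bar>(\<phi> (x + t *\<^sub>R b) - \<phi> x) / t\<bar> \<le> L"
      using \<open>t \<noteq> 0\<close> by (simp add: abs_divide field_simps)
  qed (simp add: eventually_at_filter)
  ultimately show ?thesis
    by (rule tendsto_upperbound) simp
qed

text \<open>Soft thresholding followed by mollification. Both keep the Lipschitz constant, which
  later bounds gradients uniformly; thresholding creates the room needed for a support in the
  compact set \<bar>v\<bar> \<ge> e / 4.\<close>

lemma lipschitz_test_fun_approx: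
  fixes v :: "'a::euclidean_space \<Rightarrow> real"
  assumes U: "open U" "bounded U" and L: "L-lipschitz_on UNIV v"
    and out: "\<And>x. x \<notin> U \<Longrightarrow> v x = 0" and e: "e > 0"
  obtains \<phi> where "test_fun U \<phi>" "L-lipschitz_on UNIV \<phi>" "\<And>x. \<bar>\<phi> x - v x\<bar> \<le> e"
proof -
  have L0: "0 \<le> L" using L by (rule lipschitz_on_nonneg)
  have vL: "\<bar>v x - v y\<bar> \<le> L * norm (x - y)" for x y
    using lipschitz_onD[OF L, of x y] by (simp add: dist_norm)
  \<comment> \<open>Soft thresholding at level e / 2: \<open>w\<close> vanishes where \<bar>v\<bar>
    \<le> e / 2, and is as Lipschitz as \<open>v\<close>.\<close>
  define w where "w x = v x - max (- (e/2)) (min (e/2) (v x))" for x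
  have wv: "\<bar>w x - v x\<bar> \<le> e/2" for x
    using e by (auto simp: w_def)
  have wL: "\<bar>w x - w y\<bar> \<le> L * norm (x - y)" for x y
    using vL[of x y] e unfolding w_def by (auto simp: max_def min_def)
  have w0: "\<bar>v x\<bar> > e/2" if "w x \<noteq> 0" for x
    using that e unfolding w_def by (auto simp: max_def min_def split: if_splits)
  have wout: "w x = 0" if "x \<notin> U" for x
    using out[OF that] e by (simp add: w_def)
  have wc: "continuous_on UNIV w"
    by (rule lipschitz_on_continuous_on[of L]) (use wL L0 in \<open>auto intro!: lipschitz_onI simp: dist_norm\<close>)
  \<comment> \<open>Over a distance \<open>r\<close> the function \<open>v\<close> changes by at
    most e / 4. Averaging over radius \<open>r\<close> thus stays within the remaining error e / 2
    and reaches no point with \<bar>v\<bar> < e / 4. The \<open>+ 1\<close> covers L = 0.\<close>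
  define r where "r = e / (4 * (L + 1))"
  have r: "r > 0" "L * r \<le> e / 4"
    using e L0 by (auto simp: r_def field_simps intro!: mult_nonneg_nonneg)
  define \<delta> where "\<delta> = r / DIM('a)"
  have \<delta>: "\<delta> > 0" "DIM('a) * \<delta> = r" using r by (auto simp: \<delta>_def)
  have b_norm: "norm x < r" if "bump \<delta> x \<noteq> 0" for x :: 'a
    using bump_nonzero_imp_norm_less[OF that \<delta>(1)] \<delta>(2) by simp
  have bc: "continuous_on UNIV (bump \<delta> :: 'a \<Rightarrow> real)"
    by (rule smooth_on_continuous[OF smooth_on_bump])
  have bint: "integrable lborel (\<lambda>y::'a. bump \<delta> (- y))"
  proof -
    obtain p q where pq: "cball 0 r \<subseteq> cbox p (q :: 'a)"
      using bounded_subset_cbox_symmetric[OF bounded_cball] by blast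
    have "bump \<delta> (- y) = 0" if "y \<notin> cbox p q" for y
    proof (rule ccontr)
      assume "bump \<delta> (- y) \<noteq> 0"
      from b_norm[OF this] have "y \<in> cball 0 r" by simp
      with pq that show False by blast
    qed
    then show ?thesis
      by (intro integral_lborel_eq_integral_cbox(1) continuous_on_compose2[OF bc] continuous_intros subset_UNIV)
  qed
  define c where "c = (LINT y|lborel. bump \<delta> (- y :: 'a))"
  \<comment> \<open>A nonnegative continuous function that is positive at 0 cannot vanish almost
    everywhere.\<close>
  have c: "c > 0"
  proof (rule ccontr)
    assume "\<not> c > 0"
    moreover have "0 \<le> c"
      unfolding c_def by (intro integral_nonneg_AE) (auto simp: bump_nonneg)
    ultimately have "c = 0" by simp
    then have "AE y in lborel. bump \<delta> (- y :: 'a) = 0"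
      unfolding c_def using integral_nonneg_eq_0_iff_AE[OF bint] by (simp add: bump_nonneg)
    then have "AE y in lebesgue. y \<in> {y. bump \<delta> (- y :: 'a) = 0}"
      by (auto intro: AE_completion)
    moreover have "closed {y. bump \<delta> (- y :: 'a) = 0}"
      by (intro closed_Collect_eq continuous_on_compose2[OF bc] continuous_intros subset_UNIV)
    ultimately have "(0 :: 'a) \<in> {y. bump \<delta> (- y :: 'a) = 0}"
      by (metis mem_closed_if_AE_lebesgue)
    moreover have "0 < bump \<delta> (0 :: 'a)"
      by (rule bump_pos_at_0)
    ultimately show False by simp
  qed
  obtain l u where box: "U \<subseteq> cbox l u"
    using bounded_subset_cbox_symmetric[OF U(2)] by blast
  define \<phi> where "\<phi> x = (1 / c) * integral (cbox l u) (\<lambda>y. bump \<delta> (x - y) * w y)" for x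
  have smooth: "smooth_on UNIV \<phi>"
    unfolding smooth_on_def \<phi>_def
    by (intro allI C_k_on_mult C_k_on_const C_k_on_convolution smooth_on_bump wc)
  have conv: "\<phi> x = (1 / c) * (LINT y|lborel. bump \<delta> (- y) * w (x + y))"
    and conv_int: "integrable lborel (\<lambda>y. bump \<delta> (- y) * w (x + y))" for x
  proof -
    have cont: "continuous_on UNIV (\<lambda>y. bump \<delta> (x - y) * w y)"
      by (intro continuous_on_mult continuous_on_compose2[OF bc] wc continuous_intros subset_UNIV)
    have z: "bump \<delta> (x - y) * w y = 0" if "y \<notin> cbox l u" for y
      using that box wout by auto
    have "integral (cbox l u) (\<lambda>y. bump \<delta> (x - y) * w y) = (LINT y|lborel. bump \<delta> (x - y) * w y)"
      by (rule integral_lborel_eq_integral_cbox(2)[OF cont z, symmetric])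
    also have "\<dots> = (LINT y|lborel. bump \<delta> (x - (x + y)) * w (x + y))"
      by (rule lborel_integral_translate[symmetric]) (intro borel_measurable_continuous_onI cont)
    finally show "\<phi> x = (1 / c) * (LINT y|lborel. bump \<delta> (- y) * w (x + y))"
      by (simp add: \<phi>_def)
    show "integrable lborel (\<lambda>y. bump \<delta> (- y) * w (x + y))"
      using lborel_integrable_translate[OF integral_lborel_eq_integral_cbox(1)[OF cont z], where c = x] by simp
  qed
  \<comment> \<open>Integrating against the bump divided by its mass \<open>c\<close> is averaging
    over the ball of radius \<open>r\<close>. This one bound yields both the distance to
    \<open>w\<close> and the Lipschitz constant.\<close>
  have avg: "\<bar>(1 / c) * (LINT y|lborel. bump \<delta> (- y) * f y)\<bar> \<le> B"
    if f: "integrable lborel (\<lambda>y. bump \<delta> (- y) * f y)" and B: "\<And>y. norm y < r \<Longrightarrow> \<bar>f y\<bar> \<le> B"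
    for f :: "'a \<Rightarrow> real" and B
  proof -
    have "\<bar>LINT y|lborel. bump \<delta> (- y) * f y\<bar> \<le> (LINT y|lborel. \<bar>bump \<delta> (- y) * f y\<bar>)"
      by (rule integral_abs_bound)
    also have "\<dots> \<le> (LINT y|lborel. bump \<delta> (- y :: 'a) * B)"
    proof (rule integral_mono)
      fix y :: 'a
      show "\<bar>bump \<delta> (- y) * f y\<bar> \<le> bump \<delta> (- y) * B"
        using B[of y] b_norm[of "- y"] bump_nonneg[of \<delta> "- y"]
        by (cases "bump \<delta> (- y) = 0") (auto simp: abs_mult intro: mult_left_mono)
    qed (use f bint in auto)
    also have "\<dots> = c * B"
      by (simp add: c_def)
    finally show ?thesis
      using c by (simp add: abs_mult field_simps)
  qed
  have \<phi>w: "\<bar>\<phi> x - w x\<bar> \<le> L * r" for x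
  proof -
    have "\<phi> x - w x = (1 / c) * (LINT y|lborel. bump \<delta> (- y) * w (x + y)) - (1 / c) * (LINT y|lborel. bump \<delta> (- y :: 'a) * w x)"
    proof -
      have "(LINT y|lborel. bump \<delta> (- y :: 'a) * w x) = c * w x"
        by (simp add: c_def)
      then show ?thesis unfolding conv by (simp only:) (use c in simp)
    qed
    also have "\<dots> = (1 / c) * (LINT y|lborel. bump \<delta> (- y :: 'a) * (w (x + y) - w x))"
      using conv_int[of x] bint by (simp add: right_diff_distrib)
    finally have eq: "\<phi> x - w x = (1 / c) * (LINT y|lborel. bump \<delta> (- y :: 'a) * (w (x + y) - w x))" .
    show ?thesis
      unfolding eq
    proof (rule avg)
      show "integrable lborel (\<lambda>y. bump \<delta> (- y) * (w (x + y) - w x))"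
        using conv_int[of x] bint by (simp add: right_diff_distrib)
      show "\<bar>w (x + y) - w x\<bar> \<le> L * r" if "norm y < r" for y
        using wL[of "x + y" x] mult_left_mono[OF less_imp_le[OF that] L0] by simp
    qed
  qed
  have "\<bar>\<phi> x - v x\<bar> \<le> e" for x
    using \<phi>w[of x] wv[of x] r(2) e by linarith
  moreover have "L-lipschitz_on UNIV \<phi>"
  proof (rule lipschitz_onI[OF _ L0])
    fix x x'
    have eq: "\<phi> x - \<phi> x' = (1 / c) * (LINT y|lborel. bump \<delta> (- y) * (w (x + y) - w (x' + y)))"
      using conv_int[of x] conv_int[of x'] by (simp add: right_diff_distrib conv)
    have "\<bar>\<phi> x - \<phi> x'\<bar> \<le> L * norm (x - x')"
      unfolding eq
    proof (rule avg)
      show "integrable lborel (\<lambda>y. bump \<delta> (- y) * (w (x + y) - w (x' + y)))"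
        using conv_int[of x] conv_int[of x'] by (simp add: right_diff_distrib)
      show "\<bar>w (x + y) - w (x' + y)\<bar> \<le> L * norm (x - x')" for y
        using wL[of "x + y" "x' + y"] by simp
    qed
    then show "dist (\<phi> x) (\<phi> x') \<le> L * dist x x'"
      by (simp add: dist_norm)
  qed
  moreover have "test_fun U \<phi>"
    unfolding test_fun_def
  proof (intro conjI exI[of _ "{x. e / 4 \<le> \<bar>v x\<bar>}"] allI impI smooth)
    have "continuous_on UNIV v"
      using L by (rule lipschitz_on_continuous_on)
    then have "closed {x. e / 4 \<le> \<bar>v x\<bar>}"
      by (intro closed_Collect_le continuous_intros)
    moreover show sub: "{x. e / 4 \<le> \<bar>v x\<bar>} \<subseteq> U"
      using out e by force
    ultimately show "compact {x. e / 4 \<le> \<bar>v x\<bar>}"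
      using U(2) bounded_subset compact_eq_bounded_closed by blast
    fix x assume "x \<notin> {x. e / 4 \<le> \<bar>v x\<bar>}"
    then have x: "\<bar>v x\<bar> < e / 4" by simp
    have "w (x + y) = 0" if "norm y < r" for y
    proof (rule ccontr)
      assume "w (x + y) \<noteq> 0"
      then have "\<bar>v (x + y)\<bar> > e / 2" by (rule w0)
      moreover have "\<bar>v (x + y) - v x\<bar> \<le> e / 4"
        using vL[of "x + y" x] mult_left_mono[OF less_imp_le[OF that] L0] r(2) by simp
      ultimately show False using x by linarith
    qed
    then have "bump \<delta> (- y) * w (x + y) = 0" for y
      using b_norm[of "- y"] by fastforce
    then have "(\<lambda>y. bump \<delta> (- y) * w (x + y)) = (\<lambda>y. 0)" by (rule ext)
    then show "\<phi> x = 0" unfolding conv by (simp only:) simp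
  qed
  ultimately show ?thesis using that by blast
qed

section \<open>Sobolev spaces\<close>

lemma L2_on_abs_L2:
  assumes "square_integrable f" "\<And>x. x \<notin> U \<Longrightarrow> f x = 0"
  shows "abs_L2 f \<in> L2_on U"
  unfolding L2_on_def using rep_abs_L2[OF assms(1)] assms(2) by auto

lemma L2_on_subspace: "subspace (L2_on U)"
proof (rule subspaceI)
  show "0 \<in> L2_on U"
    using rep_L2_zero unfolding L2_on_def by auto
  show "u + v \<in> L2_on U" if "u \<in> L2_on U" "v \<in> L2_on U" for u v
  proof -
    have "AE x in lebesgue. x \<notin> U \<longrightarrow> rep_L2 (u + v) x = 0"
      using that[unfolded L2_on_def mem_Collect_eq] rep_L2_add[of u v] by eventually_elim auto
    then show ?thesis by (simp add: L2_on_def)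
  qed
  show "c *\<^sub>R u \<in> L2_on U" if "u \<in> L2_on U" for c u
  proof -
    have "AE x in lebesgue. x \<notin> U \<longrightarrow> rep_L2 (c *\<^sub>R u) x = 0"
      using that[unfolded L2_on_def mem_Collect_eq] rep_L2_scaleR[of c u] by eventually_elim auto
    then show ?thesis by (simp add: L2_on_def)
  qed
qed

text \<open>Outside \<open>U\<close> the limit is at most as large as its difference to any term of
  the sequence.\<close>

lemma L2_on_closed:
  fixes U :: "'a::euclidean_space set"
  assumes [measurable]: "U \<in> sets borel"
  shows "closed (L2_on U)"
  unfolding closed_sequential_limits
proof (intro allI impI, elim conjE)
  fix u :: "nat \<Rightarrow> 'a L2" and l
  assume u: "\<forall>n. u n \<in> L2_on U" and lim: "u \<longlonglongrightarrow> l"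
  have [measurable]: "U \<in> sets lebesgue" by simp
  have "(\<integral>\<^sup>+x. ennreal ((rep_L2 l x)\<^sup>2 * indicator (- U) x) \<partial>lebesgue) \<le> ennreal ((norm (l - u n))\<^sup>2)" for n
  proof -
    have "(\<integral>\<^sup>+x. ennreal ((rep_L2 l x)\<^sup>2 * indicator (- U) x) \<partial>lebesgue) \<le> (\<integral>\<^sup>+x. ennreal ((rep_L2 (l - u n) x)\<^sup>2) \<partial>lebesgue)"
    proof (rule nn_integral_mono_AE)
      have "AE x in lebesgue. x \<notin> U \<longrightarrow> rep_L2 (u n) x = 0"
        using u by (auto simp: L2_on_def)
      then show "AE x in lebesgue. ennreal ((rep_L2 l x)\<^sup>2 * indicator (- U) x) \<le> ennreal ((rep_L2 (l - u n) x)\<^sup>2)"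
        using rep_L2_diff[of l "u n"] by eventually_elim (auto simp: indicator_def)
    qed
    then show ?thesis by (simp add: nn_integral_rep_L2)
  qed
  moreover have "(\<lambda>n. ennreal ((norm (l - u n))\<^sup>2)) \<longlonglongrightarrow> ennreal ((norm (l - l))\<^sup>2)"
    by (intro tendsto_ennrealI tendsto_intros lim)
  ultimately have "(\<integral>\<^sup>+x. ennreal ((rep_L2 l x)\<^sup>2 * indicator (- U) x) \<partial>lebesgue) \<le> 0"
    by (intro LIMSEQ_le_const[where X = "\<lambda>n. ennreal ((norm (l - u n))\<^sup>2)"]) auto
  then have "AE x in lebesgue. ennreal ((rep_L2 l x)\<^sup>2 * indicator (- U) x) = 0"
    by (subst (asm) le_zero_eq, subst (asm) nn_integral_0_iff_AE) auto
  then have "AE x in lebesgue. x \<notin> U \<longrightarrow> rep_L2 l x = 0"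
    by eventually_elim (auto simp: indicator_def split: if_splits)
  then show "l \<in> L2_on U" by (simp add: L2_on_def)
qed

lemma integrable_bounded_times_indicator:
  fixes f :: "'a::euclidean_space \<Rightarrow> real"
  assumes U: "U \<in> sets borel" "bounded U" and f: "f \<in> borel_measurable lebesgue"
    and B: "AE x in lebesgue. x \<in> U \<longrightarrow> \<bar>f x\<bar> \<le> B"
  shows "integrable lebesgue (\<lambda>x. indicator U x * f x)"
proof (rule Bochner_Integration.integrable_bound)
  have "emeasure lborel U < \<infinity>"
    by (rule emeasure_bounded_finite[OF U(2)])
  then have "integrable lborel (indicator U :: 'a \<Rightarrow> real)"
    using U(1) by simp
  then show "integrable lebesgue (\<lambda>x. indicator U x * B)"
    using U(1) by (subst integrable_completion) auto
  have "U \<in> sets lebesgue" using U(1) by simp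
  then show "(\<lambda>x. indicator U x * f x) \<in> borel_measurable lebesgue"
    using f by (intro borel_measurable_times borel_measurable_indicator)
  show "AE x in lebesgue. norm (indicator U x * f x) \<le> norm (indicator U x * B)"
    using B by eventually_elim (auto simp: indicator_def)
qed

lemma square_integrable_bounded_times_indicator:
  fixes f :: "'a::euclidean_space \<Rightarrow> real"
  assumes U: "U \<in> sets borel" "bounded U" and f: "f \<in> borel_measurable lebesgue"
    and B: "AE x in lebesgue. x \<in> U \<longrightarrow> \<bar>f x\<bar> \<le> B"
  shows "square_integrable (\<lambda>x. indicator U x * f x)"
  unfolding square_integrable_def
proof
  have "U \<in> sets lebesgue" using U(1) by simp
  then show "(\<lambda>x. indicator U x * f x) \<in> borel_measurable lebesgue"
    using f by (intro borel_measurable_times borel_measurable_indicator)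
  have "integrable lebesgue (\<lambda>x. indicator U x * (f x)\<^sup>2)"
  proof (rule integrable_bounded_times_indicator[OF U])
    show "AE x in lebesgue. x \<in> U \<longrightarrow> \<bar>(f x)\<^sup>2\<bar> \<le> B\<^sup>2"
      using B by eventually_elim (auto simp: abs_le_square_iff[symmetric] intro!: power2_le_iff_abs_le[THEN iffD2])
  qed (use f in auto)
  moreover have "(\<lambda>x. (indicator U x * f x)\<^sup>2) = (\<lambda>x. indicator U x * (f x)\<^sup>2)"
    by (auto simp: fun_eq_iff indicator_def)
  ultimately show "integrable lebesgue (\<lambda>x. (indicator U x * f x)\<^sup>2)" by simp
qed

lemma nonpos_if_le_multiples:
  fixes a C :: real
  assumes "\<And>e. e > 0 \<Longrightarrow> a \<le> e * C"
  shows "a \<le> 0"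
proof -
  have "((\<lambda>e. e * C) \<longlongrightarrow> 0 * C) (at_right 0)"
    by (intro tendsto_intros)
  moreover have "eventually (\<lambda>e. a \<le> e * C) (at_right 0)"
    using assms by (auto simp: eventually_at_filter)
  ultimately have "a \<le> 0 * C"
    by (rule tendsto_lowerbound) simp
  then show ?thesis by simp
qed

section \<open>Weak derivatives on a bounded open set\<close>

locale bounded_open =
  fixes U :: "'a::euclidean_space set"
  assumes open_U: "open U" and bounded_U: "bounded U"
begin

lemma U_borel: "U \<in> sets borel" and U_lebesgue [measurable]: "U \<in> sets lebesgue"
  using open_U by auto

lemma compl_U_nonempty: "- U \<noteq> {}"
  using bounded_U not_bounded_UNIV by (metis Compl_UNIV_eq double_compl)

lemma square_integrable_bounded:
  assumes "f \<in> borel_measurable lebesgue" "\<And>x. x \<notin> U \<Longrightarrow> f x = 0" "\<And>x. \<bar>f x\<bar> \<le> B"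
  shows "square_integrable f"
proof -
  have "square_integrable (\<lambda>x. indicator U x * f x)"
    using assms by (intro square_integrable_bounded_times_indicator[OF U_borel bounded_U]) auto
  moreover have "(\<lambda>x. indicator U x * f x) = f"
    using assms(2) by (auto simp: indicator_def fun_eq_iff)
  ultimately show ?thesis by simp
qed

lemma lipschitz_vanishing_bounded:
  assumes L: "L-lipschitz_on UNIV v" and out: "\<And>x. x \<notin> U \<Longrightarrow> v x = 0"
  obtains B where "\<And>x. \<bar>v x\<bar> \<le> (B :: real)"
proof -
  obtain y where y: "y \<notin> U" using compl_U_nonempty by blast
  obtain R where R: "\<And>x. x \<in> U \<Longrightarrow> dist x y \<le> R"
    using bounded_U unfolding bounded_any_center[where a = y] by (auto simp: dist_commute)
  have L0: "0 \<le> L" using L by (rule lipschitz_on_nonneg)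
  have "\<bar>v x\<bar> \<le> L * max R 0" for x
  proof (cases "x \<in> U")
    case True
    have "\<bar>v x\<bar> \<le> L * dist x y"
      using lipschitz_onD[OF L, of x y] out[OF y] by (simp add: dist_real_def)
    also have "\<dots> \<le> L * max R 0"
      using R[OF True] L0 by (intro mult_left_mono) auto
    finally show ?thesis .
  next
    case False
    then show ?thesis using out L0 by simp
  qed
  then show ?thesis using that by blast
qed

lemma square_integrable_lipschitz:
  assumes L: "L-lipschitz_on UNIV v" and out: "\<And>x. x \<notin> U \<Longrightarrow> v x = 0"
  shows "square_integrable (v :: 'a \<Rightarrow> real)"
proof -
  obtain B where "\<And>x. \<bar>v x\<bar> \<le> B"
    using lipschitz_vanishing_bounded[OF L out] by blast
  then show ?thesis
    using lipschitz_on_borel_measurable[OF L] out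
    by (intro square_integrable_bounded[of _ B] measurable_completion) auto
qed

lemma L2_on_integrable:
  assumes "w \<in> L2_on U"
  shows "integrable lebesgue (rep_L2 w)"
proof -
  have "square_integrable (\<lambda>x. indicator U x * (1::real))"
    by (rule square_integrable_bounded_times_indicator[OF U_borel bounded_U, of _ 1]) auto
  then have "integrable lebesgue (\<lambda>x. (indicator U x * 1) * rep_L2 w x)"
    by (rule square_integrable_mult) auto
  moreover have "AE x in lebesgue. (indicator U x * 1) * rep_L2 w x = rep_L2 w x"
    using assms[unfolded L2_on_def mem_Collect_eq] by eventually_elim (auto simp: indicator_def)
  ultimately show ?thesis
    by (subst (asm) integrable_cong_AE) auto
qed

text \<open>Fundamental lemma of the calculus of variations. Test functions approximate Lipschitz
  functions vanishing off \<open>U\<close> uniformly, and uniform approximation suffices because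
  \<open>w\<close> is integrable on the bounded set \<open>U\<close>. Cut-offs then remove the
  condition of vanishing off \<open>U\<close>.\<close>

lemma L2_on_eq_zero_if_orthogonal:
  assumes w: "w \<in> L2_on U" and orth: "\<And>\<phi>. test_fun U \<phi> \<Longrightarrow> inner w (abs_L2 \<phi>) = 0"
  shows "w = 0"
proof -
  note wint = L2_on_integrable[OF w]
  have lip0: "(LINT x|lebesgue. v x * rep_L2 w x) = 0"
    if L: "L-lipschitz_on UNIV v" and out: "\<And>x. x \<notin> U \<Longrightarrow> v x = 0" for v L
  proof -
    let ?C = "LINT x|lebesgue. \<bar>rep_L2 w x\<bar>"
    have sqv: "square_integrable v" by (rule square_integrable_lipschitz[OF L out])
    have "\<bar>LINT x|lebesgue. v x * rep_L2 w x\<bar> \<le> e * ?C" if "e > 0" for e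
    proof -
      obtain \<phi> where \<phi>: "test_fun U \<phi>" "\<And>x. \<bar>\<phi> x - v x\<bar> \<le> e"
        using lipschitz_test_fun_approx[OF open_U bounded_U L out \<open>e > 0\<close>] by blast
      note sq\<phi> = test_fun_square_integrable[OF \<phi>(1)]
      have "(LINT x|lebesgue. \<phi> x * rep_L2 w x) = 0"
        using orth[OF \<phi>(1)] by (simp add: inner_abs_L2_right[OF sq\<phi>] mult.commute)
      then have "(LINT x|lebesgue. v x * rep_L2 w x) = (LINT x|lebesgue. (v x - \<phi> x) * rep_L2 w x)"
        using square_integrable_mult[OF sqv square_integrable_rep_L2[of w]]
          square_integrable_mult[OF sq\<phi> square_integrable_rep_L2[of w]]
        by (simp add: left_diff_distrib)
      also have "\<bar>\<dots>\<bar> \<le> (LINT x|lebesgue. \<bar>(v x - \<phi> x) * rep_L2 w x\<bar>)"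
        by (rule integral_abs_bound)
      also have "\<dots> \<le> (LINT x|lebesgue. e * \<bar>rep_L2 w x\<bar>)"
      proof (rule integral_mono)
        show "integrable lebesgue (\<lambda>x. \<bar>(v x - \<phi> x) * rep_L2 w x\<bar>)"
          using square_integrable_mult[OF square_integrable_diff[OF sqv sq\<phi>] square_integrable_rep_L2[of w]]
          by (rule integrable_abs)
        show "\<bar>(v x - \<phi> x) * rep_L2 w x\<bar> \<le> e * \<bar>rep_L2 w x\<bar>" for x
          using \<phi>(2)[of x] by (auto simp: abs_mult abs_minus_commute intro!: mult_right_mono)
      qed (use wint in auto)
      finally show ?thesis by simp
    qed
    then have "\<bar>LINT x|lebesgue. v x * rep_L2 w x\<bar> \<le> 0"
      by (rule nonpos_if_le_multiples)
    then show ?thesis by simp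
  qed
  have "AE x in lebesgue. rep_L2 w x = 0"
  proof (rule AE_zero_if_lipschitz_integrals_zero[OF wint])
    fix \<psi> :: "'a \<Rightarrow> real" and L
    assume L: "L-lipschitz_on UNIV \<psi>" and \<psi>: "\<And>x. 0 \<le> \<psi> x \<and> \<psi> x \<le> 1"
    have C: "closed (- U)" using open_U by auto
    note A = lipschitz_indicator_approx[OF C compl_U_nonempty]
    \<comment> \<open>\<open>\<rho> n x\<close> is the minimum of 1 and n times the distance of x
      from the complement of \<open>U\<close>: a Lipschitz cut-off increasing to the indicator of
      \<open>U\<close>.\<close>
    define \<rho> where "\<rho> n x = 1 - max 0 (1 - real n * infdist x (- U))" for n x
    have \<rho>: "0 \<le> \<rho> n x" "\<rho> n x \<le> 1" for n x
      using A(2,3)[of n x] by (auto simp: \<rho>_def)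
    have zero: "(LINT x|lebesgue. (\<psi> x * \<rho> n x) * rep_L2 w x) = 0" for n
    proof (rule lip0)
      show "(L + real n)-lipschitz_on UNIV (\<lambda>x. \<psi> x * \<rho> n x)"
      proof (rule lipschitz_onI)
        fix x y
        have "\<bar>\<psi> x * \<rho> n x - \<psi> y * \<rho> n y\<bar> = \<bar>(\<psi> x - \<psi> y) * \<rho> n x + \<psi> y * (\<rho> n x - \<rho> n y)\<bar>"
          by (simp add: algebra_simps)
        also have "\<dots> \<le> \<bar>\<psi> x - \<psi> y\<bar> * \<rho> n x + \<psi> y * \<bar>\<rho> n x - \<rho> n y\<bar>"
          using \<rho> \<psi> by (intro order_trans[OF abs_triangle_ineq]) (auto simp: abs_mult)
        also have "\<dots> \<le> \<bar>\<psi> x - \<psi> y\<bar> * 1 + 1 * \<bar>\<rho> n x - \<rho> n y\<bar>"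
          using \<rho> \<psi> by (intro add_mono mult_mono) auto
        also have "\<dots> \<le> L * dist x y + real n * dist x y"
          using lipschitz_onD[OF L, of x y] lipschitz_onD[OF A(1)[of n], of x y]
          by (intro add_mono) (auto simp: \<rho>_def dist_real_def)
        finally show "dist (\<psi> x * \<rho> n x) (\<psi> y * \<rho> n y) \<le> (L + real n) * dist x y"
          by (simp add: dist_real_def distrib_right)
      qed (use lipschitz_on_nonneg[OF L] in simp)
      show "\<psi> x * \<rho> n x = 0" if "x \<notin> U" for x
        using that by (simp add: \<rho>_def)
    qed
    have [measurable]: "\<psi> \<in> borel_measurable lebesgue" "\<rho> n \<in> borel_measurable lebesgue" for n
      using lipschitz_on_borel_measurable[OF L] lipschitz_on_borel_measurable[OF A(1)[of n]]
      unfolding \<rho>_def by (auto intro!: measurable_completion borel_measurable_diff)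
    have [measurable]: "rep_L2 w \<in> borel_measurable lebesgue" by measurable
    have "(\<lambda>n. LINT x|lebesgue. (\<psi> x * \<rho> n x) * rep_L2 w x) \<longlonglongrightarrow> (LINT x|lebesgue. \<psi> x * rep_L2 w x)"
    proof (rule integral_dominated_convergence[where w = "\<lambda>x. \<bar>rep_L2 w x\<bar>"])
      show "AE x in lebesgue. (\<lambda>n. (\<psi> x * \<rho> n x) * rep_L2 w x) \<longlonglongrightarrow> \<psi> x * rep_L2 w x"
        using w[unfolded L2_on_def mem_Collect_eq]
      proof eventually_elim
        case (elim x)
        show ?case
        proof (cases "x \<in> U")
          case True
          have "(\<lambda>n. (\<psi> x * \<rho> n x) * rep_L2 w x) \<longlonglongrightarrow> (\<psi> x * (1 - indicator (- U) x)) * rep_L2 w x"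
            unfolding \<rho>_def by (intro tendsto_intros A(4))
          then show ?thesis using True by simp
        qed (use elim in simp)
      qed
      show "AE x in lebesgue. norm ((\<psi> x * \<rho> n x) * rep_L2 w x) \<le> \<bar>rep_L2 w x\<bar>" for n
        using \<psi> \<rho> by (intro always_eventually allI) (simp add: abs_mult mult_le_one mult_left_le_one_le)
    qed (use wint in \<open>auto intro!: borel_measurable_times\<close>)
    then show "(LINT x|lebesgue. \<psi> x * rep_L2 w x) = 0"
      by (simp add: zero LIMSEQ_const_iff)
  qed
  then have "AE x in lebesgue. rep_L2 w x = rep_L2 0 x"
    using rep_L2_zero by eventually_elim auto
  then show "w = 0" by (rule L2_eqI)
qed

text \<open>Gives the definite description in \<open>weak_deriv\<close> its meaning: both candidates
  live on \<open>U\<close>, where test functions separate.\<close>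

lemma has_weak_deriv_unique:
  assumes "has_weak_deriv U b u w" "has_weak_deriv U b u w'"
  shows "w = w'"
proof -
  have "w - w' = 0"
    by (rule L2_on_eq_zero_if_orthogonal)
      (use assms subspace_diff[OF L2_on_subspace] in \<open>auto simp: has_weak_deriv_def inner_diff_left\<close>)
  then show ?thesis by simp
qed

lemma weak_deriv_eq: "has_weak_deriv U b u w \<Longrightarrow> weak_deriv U b u = w"
  unfolding weak_deriv_def using has_weak_deriv_unique by blast

lemma has_weak_deriv_add:
  "has_weak_deriv U b u w \<Longrightarrow> has_weak_deriv U b u' w' \<Longrightarrow> has_weak_deriv U b (u + u') (w + w')"
  using subspace_add[OF L2_on_subspace] by (auto simp: has_weak_deriv_def inner_add_left)

lemma has_weak_deriv_scaleR:
  "has_weak_deriv U b u w \<Longrightarrow> has_weak_deriv U b (c *\<^sub>R u) (c *\<^sub>R w)"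
  using subspace_scale[OF L2_on_subspace] by (auto simp: has_weak_deriv_def)

lemma H1_has_weak_deriv:
  "u \<in> sobolev_H1 U \<Longrightarrow> b \<in> Basis \<Longrightarrow> has_weak_deriv U b u (weak_deriv U b u)"
  unfolding sobolev_H1_def using weak_deriv_eq by blast

lemma has_weak_deriv_test_fun:
  assumes "test_fun U \<phi>" "b \<in> Basis"
  shows "has_weak_deriv U b (abs_L2 \<phi>) (abs_L2 (pderiv_dir b \<phi>))"
  unfolding has_weak_deriv_def
proof (intro conjI allI impI)
  note d = test_fun_pderiv_dir[OF assms]
  show "abs_L2 (pderiv_dir b \<phi>) \<in> L2_on U"
    by (intro L2_on_abs_L2 test_fun_square_integrable[OF d] test_fun_outside[OF d])
  fix \<psi> assume \<psi>: "test_fun U \<psi>"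
  note d' = test_fun_pderiv_dir[OF \<psi> assms(2)]
  have c: "(LINT x|lebesgue. \<phi>1 x * \<phi>2 x) = (LINT x|lborel. \<phi>1 x * \<phi>2 x)"
    if "test_fun U \<phi>1" "test_fun U \<phi>2" for \<phi>1 \<phi>2
    by (rule integral_completion) (use test_fun_measurable[OF test_fun_mult[OF that]] in simp)
  show "inner (abs_L2 \<phi>) (abs_L2 (pderiv_dir b \<psi>)) = - inner (abs_L2 (pderiv_dir b \<phi>)) (abs_L2 \<psi>)"
    using integral_by_parts_test_fun[OF assms(1) \<psi> assms(2)]
    by (simp add: inner_abs_L2 test_fun_square_integrable[OF assms(1)] test_fun_square_integrable[OF \<psi>]
        test_fun_square_integrable[OF d] test_fun_square_integrable[OF d'] c assms(1) \<psi> d d')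
qed

lemma weak_deriv_test_fun:
  "test_fun U \<phi> \<Longrightarrow> b \<in> Basis \<Longrightarrow> weak_deriv U b (abs_L2 \<phi>) = abs_L2 (pderiv_dir b \<phi>)"
  by (rule weak_deriv_eq[OF has_weak_deriv_test_fun])

lemma sobolev_H1I:
  assumes "u \<in> L2_on U" "\<And>b. b \<in> Basis \<Longrightarrow> has_weak_deriv U b u (w b)"
  shows "u \<in> sobolev_H1 U"
  unfolding sobolev_H1_def using assms by blast

lemma test_fun_in_H1:
  assumes "test_fun U \<phi>"
  shows "abs_L2 \<phi> \<in> sobolev_H1 U"
  by (rule sobolev_H1I[OF L2_on_abs_L2[OF test_fun_square_integrable[OF assms] test_fun_outside[OF assms]]
        has_weak_deriv_test_fun[OF assms]])

lemma test_fun_in_H10: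
  assumes "test_fun U \<phi>"
  shows "abs_L2 \<phi> \<in> sobolev_H10 U"
  unfolding sobolev_H10_def mem_Collect_eq
proof (intro conjI test_fun_in_H1[OF assms] exI[of _ "\<lambda>_. \<phi>"] allI ballI assms)
  show "(\<lambda>n. abs_L2 (pderiv_dir b \<phi>)) \<longlonglongrightarrow> weak_deriv U b (abs_L2 \<phi>)" if "b \<in> Basis" for b
    by (simp add: weak_deriv_test_fun[OF assms that])
qed simp

lemma H10_sub_H1: "u \<in> sobolev_H10 U \<Longrightarrow> u \<in> sobolev_H1 U"
  by (simp add: sobolev_H10_def)

lemma H10_sub_L2_on: "u \<in> sobolev_H10 U \<Longrightarrow> u \<in> L2_on U"
  by (simp add: sobolev_H10_def sobolev_H1_def)

lemma H1_weak_deriv_add: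
  assumes "u \<in> sobolev_H1 U" "v \<in> sobolev_H1 U" "b \<in> Basis"
  shows "weak_deriv U b (u + v) = weak_deriv U b u + weak_deriv U b v"
  by (rule weak_deriv_eq[OF has_weak_deriv_add[OF H1_has_weak_deriv[OF assms(1,3)] H1_has_weak_deriv[OF assms(2,3)]]])

lemma H1_weak_deriv_scaleR:
  assumes "u \<in> sobolev_H1 U" "b \<in> Basis"
  shows "weak_deriv U b (c *\<^sub>R u) = c *\<^sub>R weak_deriv U b u"
  by (rule weak_deriv_eq[OF has_weak_deriv_scaleR[OF H1_has_weak_deriv[OF assms]]])

lemma H1_subspace: "subspace (sobolev_H1 U)"
proof (rule subspaceI)
  show "0 \<in> sobolev_H1 U"
    using test_fun_in_H1[OF test_fun_zero] by (simp add: zero_L2.abs_eq)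
  fix u v and c :: real
  assume u: "u \<in> sobolev_H1 U"
  then have uL: "u \<in> L2_on U" by (simp add: sobolev_H1_def)
  show "c *\<^sub>R u \<in> sobolev_H1 U"
    by (rule sobolev_H1I[OF subspace_scale[OF L2_on_subspace uL] has_weak_deriv_scaleR[OF H1_has_weak_deriv[OF u]]])
  assume v: "v \<in> sobolev_H1 U"
  then have vL: "v \<in> L2_on U" by (simp add: sobolev_H1_def)
  show "u + v \<in> sobolev_H1 U"
    by (rule sobolev_H1I[OF subspace_add[OF L2_on_subspace uL vL]
          has_weak_deriv_add[OF H1_has_weak_deriv[OF u] H1_has_weak_deriv[OF v]]])
qed

lemma H10E:
  assumes "u \<in> sobolev_H10 U"
  obtains \<phi> where "\<And>n::nat. test_fun U (\<phi> n)" "(\<lambda>n. abs_L2 (\<phi> n)) \<longlonglongrightarrow> u"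
    "\<And>b. b \<in> Basis \<Longrightarrow> (\<lambda>n. abs_L2 (pderiv_dir b (\<phi> n))) \<longlonglongrightarrow> weak_deriv U b u"
proof -
  have "\<exists>\<phi>. (\<forall>n::nat. test_fun U (\<phi> n)) \<and> (\<lambda>n. abs_L2 (\<phi> n)) \<longlonglongrightarrow> u \<and>
     (\<forall>b\<in>Basis. (\<lambda>n. abs_L2 (pderiv_dir b (\<phi> n))) \<longlonglongrightarrow> weak_deriv U b u)"
    using assms by (simp add: sobolev_H10_def)
  then obtain \<phi> where \<phi>: "\<forall>n::nat. test_fun U (\<phi> n)" "(\<lambda>n. abs_L2 (\<phi> n)) \<longlonglongrightarrow> u"
     "\<forall>b\<in>Basis. (\<lambda>n. abs_L2 (pderiv_dir b (\<phi> n))) \<longlonglongrightarrow> weak_deriv U b u"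
    by (elim exE conjE)
  show thesis
    by (rule that[of \<phi>, OF \<phi>(1)[rule_format] \<phi>(2) \<phi>(3)[rule_format]])
qed

lemma H10_subspace: "subspace (sobolev_H10 U)"
proof (rule subspaceI)
  show "0 \<in> sobolev_H10 U"
    using test_fun_in_H10[OF test_fun_zero] by (simp add: zero_L2.abs_eq)
next
  fix u v assume uv: "u \<in> sobolev_H10 U" "v \<in> sobolev_H10 U"
  obtain \<phi> where \<phi>: "\<And>n::nat. test_fun U (\<phi> n)" "(\<lambda>n. abs_L2 (\<phi> n)) \<longlonglongrightarrow> u"
    "\<And>b. b \<in> Basis \<Longrightarrow> (\<lambda>n. abs_L2 (pderiv_dir b (\<phi> n))) \<longlonglongrightarrow> weak_deriv U b u"
    by (rule H10E[OF uv(1)]) (rule that)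
  obtain \<psi> where \<psi>: "\<And>n::nat. test_fun U (\<psi> n)" "(\<lambda>n. abs_L2 (\<psi> n)) \<longlonglongrightarrow> v"
    "\<And>b. b \<in> Basis \<Longrightarrow> (\<lambda>n. abs_L2 (pderiv_dir b (\<psi> n))) \<longlonglongrightarrow> weak_deriv U b v"
    by (rule H10E[OF uv(2)]) (rule that)
  have s: "abs_L2 (\<lambda>x. \<phi> n x + \<psi> n x) = abs_L2 (\<phi> n) + abs_L2 (\<psi> n)" for n
    by (rule abs_L2_add[OF test_fun_square_integrable[OF \<phi>(1)] test_fun_square_integrable[OF \<psi>(1)], symmetric])
  have t: "test_fun U (\<lambda>x. \<phi> n x + \<psi> n x)" for n
    using \<phi>(1) \<psi>(1) by (rule test_fun_add)
  have "abs_L2 (pderiv_dir b (\<lambda>x. \<phi> n x + \<psi> n x)) = abs_L2 (pderiv_dir b (\<phi> n)) + abs_L2 (pderiv_dir b (\<psi> n))"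
    if "b \<in> Basis" for b n
    unfolding weak_deriv_test_fun[OF t that, symmetric] weak_deriv_test_fun[OF \<phi>(1) that, symmetric]
      weak_deriv_test_fun[OF \<psi>(1) that, symmetric] s
    by (rule H1_weak_deriv_add[OF H10_sub_H1[OF test_fun_in_H10[OF \<phi>(1)]] H10_sub_H1[OF test_fun_in_H10[OF \<psi>(1)]] that])
  then have "\<exists>\<phi>. (\<forall>n::nat. test_fun U (\<phi> n)) \<and> (\<lambda>n. abs_L2 (\<phi> n)) \<longlonglongrightarrow> u + v \<and>
     (\<forall>b\<in>Basis. (\<lambda>n. abs_L2 (pderiv_dir b (\<phi> n))) \<longlonglongrightarrow> weak_deriv U b (u + v))"
    using uv \<phi> \<psi> t by (intro exI[of _ "\<lambda>n x. \<phi> n x + \<psi> n x"])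
      (auto simp: s H1_weak_deriv_add H10_sub_H1 intro!: tendsto_add)
  then show "u + v \<in> sobolev_H10 U"
    using subspace_add[OF H1_subspace H10_sub_H1[OF uv(1)] H10_sub_H1[OF uv(2)]] by (simp add: sobolev_H10_def)
next
  fix u and c :: real assume u: "u \<in> sobolev_H10 U"
  obtain \<phi> where \<phi>: "\<And>n::nat. test_fun U (\<phi> n)" "(\<lambda>n. abs_L2 (\<phi> n)) \<longlonglongrightarrow> u"
    "\<And>b. b \<in> Basis \<Longrightarrow> (\<lambda>n. abs_L2 (pderiv_dir b (\<phi> n))) \<longlonglongrightarrow> weak_deriv U b u"
    by (rule H10E[OF u]) (rule that)
  have s: "abs_L2 (\<lambda>x. c * \<phi> n x) = c *\<^sub>R abs_L2 (\<phi> n)" for n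
    by (rule abs_L2_scaleR[OF test_fun_square_integrable[OF \<phi>(1)], symmetric])
  have t: "test_fun U (\<lambda>x. c * \<phi> n x)" for n
    using \<phi>(1) by (rule test_fun_scale)
  have pd: "abs_L2 (pderiv_dir b (\<lambda>x. c * \<phi> n x)) = c *\<^sub>R abs_L2 (pderiv_dir b (\<phi> n))"
    if "b \<in> Basis" for b n
    unfolding weak_deriv_test_fun[OF t that, symmetric] weak_deriv_test_fun[OF \<phi>(1) that, symmetric] s
    by (rule H1_weak_deriv_scaleR[OF H10_sub_H1[OF test_fun_in_H10[OF \<phi>(1)]] that])
  have "\<exists>\<phi>. (\<forall>n::nat. test_fun U (\<phi> n)) \<and> (\<lambda>n. abs_L2 (\<phi> n)) \<longlonglongrightarrow> c *\<^sub>R u \<and>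
     (\<forall>b\<in>Basis. (\<lambda>n. abs_L2 (pderiv_dir b (\<phi> n))) \<longlonglongrightarrow> weak_deriv U b (c *\<^sub>R u))"
  proof (intro exI[of _ "\<lambda>n x. c * \<phi> n x"] conjI allI ballI t)
    show "(\<lambda>n. abs_L2 (\<lambda>x. c * \<phi> n x)) \<longlonglongrightarrow> c *\<^sub>R u"
      unfolding s by (intro tendsto_intros \<phi>(2))
    show "(\<lambda>n. abs_L2 (pderiv_dir b (\<lambda>x. c * \<phi> n x))) \<longlonglongrightarrow> weak_deriv U b (c *\<^sub>R u)" if "b \<in> Basis" for b
      unfolding pd[OF that] H1_weak_deriv_scaleR[OF H10_sub_H1[OF u] that] by (intro tendsto_intros \<phi>(3) that)
  qed
  then show "c *\<^sub>R u \<in> sobolev_H10 U"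
    using subspace_scale[OF H1_subspace H10_sub_H1[OF u]] by (simp add: sobolev_H10_def)
qed

section \<open>The Dirichlet form\<close>

lemma grad_inner_commute: "grad_inner U u v = grad_inner U v u"
  by (simp add: grad_inner_def inner_commute)

lemma grad_inner_nonneg: "0 \<le> grad_inner U u u"
  unfolding grad_inner_def by (intro sum_nonneg) simp

lemma grad_inner_add_left:
  assumes "u \<in> sobolev_H10 U" "v \<in> sobolev_H10 U"
  shows "grad_inner U (u + v) w = grad_inner U u w + grad_inner U v w"
  using assms by (simp add: grad_inner_def H1_weak_deriv_add H10_sub_H1 inner_add_left sum.distrib)

lemma grad_inner_scaleR_left:
  assumes "u \<in> sobolev_H10 U"
  shows "grad_inner U (c *\<^sub>R u) w = c * grad_inner U u w"
  using assms by (simp add: grad_inner_def H1_weak_deriv_scaleR H10_sub_H1 sum_distrib_left)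

lemma grad_inner_diff_left:
  assumes "u \<in> sobolev_H10 U" "v \<in> sobolev_H10 U"
  shows "grad_inner U (u - v) w = grad_inner U u w - grad_inner U v w"
  using grad_inner_add_left[OF assms(1) subspace_scale[OF H10_subspace assms(2), of "-1"], of w]
    grad_inner_scaleR_left[OF assms(2), of "-1" w] by simp

lemma grad_inner_add_right:
  "u \<in> sobolev_H10 U \<Longrightarrow> v \<in> sobolev_H10 U \<Longrightarrow> grad_inner U w (u + v) = grad_inner U w u + grad_inner U w v"
  by (simp only: grad_inner_commute[of w] grad_inner_add_left)

lemma grad_inner_diff_right:
  "u \<in> sobolev_H10 U \<Longrightarrow> v \<in> sobolev_H10 U \<Longrightarrow> grad_inner U w (u - v) = grad_inner U w u - grad_inner U w v"
  by (simp only: grad_inner_commute[of w] grad_inner_diff_left)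

lemma grad_inner_scaleR_right:
  "u \<in> sobolev_H10 U \<Longrightarrow> grad_inner U w (c *\<^sub>R u) = c * grad_inner U w u"
  by (simp only: grad_inner_commute[of w] grad_inner_scaleR_left)

lemma grad_inner_parallelogram:
  assumes "u \<in> sobolev_H10 U" "v \<in> sobolev_H10 U"
  shows "grad_inner U (u - v) (u - v) = 2 * grad_inner U u u + 2 * grad_inner U v v - grad_inner U (u + v) (u + v)"
  using assms by (simp add: grad_inner_add_left grad_inner_diff_left grad_inner_add_right grad_inner_diff_right)

lemma weak_deriv_norm_le:
  assumes "b \<in> Basis"
  shows "(norm (weak_deriv U b u))\<^sup>2 \<le> grad_inner U u u"
  unfolding grad_inner_def power2_norm_eq_inner
  by (rule member_le_sum[OF assms, of "\<lambda>b. inner (weak_deriv U b u) (weak_deriv U b u)"]) auto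

lemma H1_weak_deriv_diff:
  assumes "u \<in> sobolev_H1 U" "v \<in> sobolev_H1 U" "b \<in> Basis"
  shows "weak_deriv U b (u - v) = weak_deriv U b u - weak_deriv U b v"
  using H1_weak_deriv_add[OF assms(1) subspace_scale[OF H1_subspace assms(2), of "-1"] assms(3)]
    H1_weak_deriv_scaleR[OF assms(2,3), of "-1"] by simp

text \<open>Weak differentiation is a closed operator: when functions and gradients converge in L^2,
  the integration by parts identity passes to the limit. The sequence consists of test functions
  because the definition of \<open>sobolev_H10\<close> asks for one.\<close>

lemma H10_limit:
  assumes \<phi>: "\<And>n::nat. test_fun U (\<phi> n)" and lim: "(\<lambda>n. abs_L2 (\<phi> n)) \<longlonglongrightarrow> u"
    and Cauchy: "\<And>e. e > 0 \<Longrightarrow> \<exists>N. \<forall>m\<ge>N. \<forall>n\<ge>N.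
      grad_inner U (abs_L2 (\<phi> m) - abs_L2 (\<phi> n)) (abs_L2 (\<phi> m) - abs_L2 (\<phi> n)) < e"
  shows "u \<in> sobolev_H10 U"
    and "(\<lambda>n. grad_inner U (abs_L2 (\<phi> n)) (abs_L2 (\<phi> n))) \<longlonglongrightarrow> grad_inner U u u"
proof -
  note H1 = H10_sub_H1[OF test_fun_in_H10[OF \<phi>]]
  have uL2: "u \<in> L2_on U"
    by (rule closed_sequentially[OF L2_on_closed[OF U_borel] _ lim]) (rule H10_sub_L2_on[OF test_fun_in_H10[OF \<phi>]])
  have "\<exists>w. (\<lambda>n. weak_deriv U b (abs_L2 (\<phi> n))) \<longlonglongrightarrow> w" if b: "b \<in> Basis" for b
  proof -
    have "Cauchy (\<lambda>n. weak_deriv U b (abs_L2 (\<phi> n)))"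
    proof (rule metric_CauchyI)
      fix e :: real assume "e > 0"
      then obtain N where N: "\<And>m n. m \<ge> N \<Longrightarrow> n \<ge> N \<Longrightarrow>
          grad_inner U (abs_L2 (\<phi> m) - abs_L2 (\<phi> n)) (abs_L2 (\<phi> m) - abs_L2 (\<phi> n)) < e\<^sup>2"
        using Cauchy[of "e\<^sup>2"] by (metis zero_less_power)
      show "\<exists>N. \<forall>m\<ge>N. \<forall>n\<ge>N. dist (weak_deriv U b (abs_L2 (\<phi> m))) (weak_deriv U b (abs_L2 (\<phi> n))) < e"
      proof (intro exI allI impI)
        fix m n assume "N \<le> m" "N \<le> n"
        have "(dist (weak_deriv U b (abs_L2 (\<phi> m))) (weak_deriv U b (abs_L2 (\<phi> n))))\<^sup>2 < e\<^sup>2"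
          unfolding dist_norm H1_weak_deriv_diff[OF H1 H1 b, symmetric]
          by (rule le_less_trans[OF weak_deriv_norm_le[OF b] N[OF \<open>N \<le> m\<close> \<open>N \<le> n\<close>]])
        then show "dist (weak_deriv U b (abs_L2 (\<phi> m))) (weak_deriv U b (abs_L2 (\<phi> n))) < e"
          using \<open>e > 0\<close> by (simp add: power2_less_imp_less)
      qed
    qed
    then show ?thesis by (simp add: Cauchy_convergent_iff convergent_def)
  qed
  then obtain w where w: "\<And>b. b \<in> Basis \<Longrightarrow> (\<lambda>n. weak_deriv U b (abs_L2 (\<phi> n))) \<longlonglongrightarrow> w b"
    by metis
  have wd: "has_weak_deriv U b u (w b)" if b: "b \<in> Basis" for b
    unfolding has_weak_deriv_def
  proof (intro conjI allI impI)
    note h = H1_has_weak_deriv[OF H1 b, unfolded has_weak_deriv_def]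
    show "w b \<in> L2_on U"
      by (rule closed_sequentially[OF L2_on_closed[OF U_borel] _ w[OF b]]) (rule conjunct1[OF h])
    fix \<psi> assume "test_fun U \<psi>"
    then have "inner (abs_L2 (\<phi> n)) (abs_L2 (pderiv_dir b \<psi>)) = - inner (weak_deriv U b (abs_L2 (\<phi> n))) (abs_L2 \<psi>)" for n
      using h by blast
    moreover have "(\<lambda>n. inner (abs_L2 (\<phi> n)) (abs_L2 (pderiv_dir b \<psi>))) \<longlonglongrightarrow> inner u (abs_L2 (pderiv_dir b \<psi>))"
      by (intro tendsto_intros lim)
    moreover have "(\<lambda>n. - inner (weak_deriv U b (abs_L2 (\<phi> n))) (abs_L2 \<psi>)) \<longlonglongrightarrow> - inner (w b) (abs_L2 \<psi>)"
      by (intro tendsto_intros w b)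
    ultimately show "inner u (abs_L2 (pderiv_dir b \<psi>)) = - inner (w b) (abs_L2 \<psi>)"
      by (simp add: LIMSEQ_unique)
  qed
  have u1: "u \<in> sobolev_H1 U"
    using uL2 wd by (auto simp: sobolev_H1_def)
  have lim': "(\<lambda>n. weak_deriv U b (abs_L2 (\<phi> n))) \<longlonglongrightarrow> weak_deriv U b u" if "b \<in> Basis" for b
    using w[OF that] weak_deriv_eq[OF wd[OF that]] by simp
  then show "u \<in> sobolev_H10 U"
    using u1 \<phi> lim unfolding sobolev_H10_def by (auto simp: weak_deriv_test_fun intro!: exI[of _ \<phi>])
  show "(\<lambda>n. grad_inner U (abs_L2 (\<phi> n)) (abs_L2 (\<phi> n))) \<longlonglongrightarrow> grad_inner U u u"
    unfolding grad_inner_def by (intro tendsto_intros lim')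
qed

end

context bounded_open begin

text \<open>Bounded gradients and convergence in \<open>L\<^sup>2\<close> suffice for a limit in \<open>sobolev_H10 U\<close>: elements of
  almost minimal energy in the convex hulls of the tails form a Cauchy sequence.\<close>

lemma H10_weak_limit:
  assumes \<phi>: "\<And>n::nat. test_fun U (\<phi> n)" and lim: "(\<lambda>n. abs_L2 (\<phi> n)) \<longlonglongrightarrow> u"
    and bound: "\<And>n. grad_inner U (abs_L2 (\<phi> n)) (abs_L2 (\<phi> n)) \<le> C"
  shows "u \<in> sobolev_H10 U"
proof -
  define q where "q v = grad_inner U v v" for v
  define D where "D = abs_L2 ` Collect (test_fun U)"
  have D: "subspace D"
  proof (rule subspaceI)
    show "0 \<in> D"
      unfolding D_def zero_L2.abs_eq using test_fun_zero by (intro imageI) simp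
    show "x + y \<in> D" if "x \<in> D" "y \<in> D" for x y
    proof -
      obtain \<phi> \<psi> where "test_fun U \<phi>" "x = abs_L2 \<phi>" "test_fun U \<psi>" "y = abs_L2 \<psi>"
        using \<open>x \<in> D\<close> \<open>y \<in> D\<close> unfolding D_def by (elim imageE) simp
      then show ?thesis
        unfolding D_def by (intro image_eqI[of _ _ "\<lambda>x. \<phi> x + \<psi> x"]) (simp_all add: abs_L2_add test_fun_square_integrable[where U = U] test_fun_add)
    qed
    show "c *\<^sub>R x \<in> D" if "x \<in> D" for c x
    proof -
      obtain \<phi> where "test_fun U \<phi>" "x = abs_L2 \<phi>"
        using \<open>x \<in> D\<close> unfolding D_def by (elim imageE) simp
      then show ?thesis
        unfolding D_def by (intro image_eqI[of _ _ "\<lambda>x. c * \<phi> x"]) (simp_all add: abs_L2_scaleR test_fun_square_integrable[where U = U] test_fun_scale)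
    qed
  qed
  have DH: "v \<in> sobolev_H10 U" if "v \<in> D" for v
    using that test_fun_in_H10 by (auto simp: D_def)
  define S where "S n = convex hull ((\<lambda>n. abs_L2 (\<phi> n)) ` {n..})" for n
  have SD: "S n \<subseteq> D" for n
    unfolding S_def using D \<phi> by (intro hull_minimal subspace_imp_convex) (auto simp: D_def)
  have Smono: "S m \<subseteq> S n" if "n \<le> m" for m n
    unfolding S_def using that by (intro hull_mono image_mono) auto
  have in_S: "abs_L2 (\<phi> n) \<in> S n" for n
    unfolding S_def by (rule hull_inc) auto
  have ne: "S n \<noteq> {}" for n
    using in_S by blast
  \<comment> \<open>Infima over shrinking hulls increase and stay below \<open>C\<close>, so they
    converge. This takes the place of weak compactness.\<close>
  define d where "d n = Inf (q ` S n)" for n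
  have q0: "0 \<le> q v" for v by (simp add: q_def grad_inner_nonneg)
  have bdd: "bdd_below (q ` S n)" for n
    by (rule bdd_belowI[of _ 0]) (auto simp: q0)
  have d_le: "d n \<le> q v" if "v \<in> S n" for n v
    unfolding d_def using that by (intro cInf_lower bdd) auto
  have "incseq d"
    unfolding incseq_def d_def using Smono ne by (intro allI impI cInf_superset_mono bdd image_mono) auto
  moreover have "d n \<le> C" for n
    using d_le[OF in_S[of n]] bound[of n] by (simp add: q_def)
  ultimately obtain d' where d': "d \<longlonglongrightarrow> d'" "\<And>n. d n \<le> d'"
    using incseq_convergent[of d C] by blast
  have "\<exists>v\<in>S n. q v < d n + 1 / Suc n" for n
  proof -
    have "Inf (q ` S n) < d n + 1 / Suc n" by (simp add: d_def)
    then show ?thesis using in_S[of n] bdd[of n] by (subst (asm) cInf_less_iff) auto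
  qed
  then obtain v where vS: "\<And>n. v n \<in> S n" and v: "\<And>n. q (v n) < d n + 1 / Suc n"
    by metis
  have vH: "v n \<in> sobolev_H10 U" for n
    using vS SD DH by blast
  have vD: "\<exists>\<psi>. test_fun U \<psi> \<and> v n = abs_L2 \<psi>" for n
    using vS[of n] SD[of n] by (auto simp: D_def)
  then obtain \<psi> where \<psi>: "\<And>n. test_fun U (\<psi> n)" "\<And>n. v n = abs_L2 (\<psi> n)"
    by metis
  have vlim: "v \<longlonglongrightarrow> u"
  proof (rule metric_LIMSEQ_I)
    fix e :: real assume "e > 0"
    then obtain N where N: "\<And>n. n \<ge> N \<Longrightarrow> dist (abs_L2 (\<phi> n)) u < e"
      using metric_LIMSEQ_D[OF lim] by blast
    \<comment> \<open>Balls are convex, so the hull of a tail stays as close to \<open>u\<close> as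
      the tail.\<close>
    have "S n \<subseteq> ball u e" if "n \<ge> N" for n
      unfolding S_def using N that by (intro hull_minimal convex_ball) (auto simp: dist_commute)
    then have "v n \<in> ball u e" if "n \<ge> N" for n
      using vS[of n] that by blast
    then show "\<exists>N. \<forall>n\<ge>N. dist (v n) u < e"
      by (auto simp: dist_commute)
  qed
  \<comment> \<open>For n \<le> m the midpoint of \<open>v n\<close> and \<open>v m\<close> lies in
    \<open>S n\<close>, so its energy is at least \<open>d n\<close>; the parallelogram law then
    bounds the energy of the difference.\<close>
  have close: "q (v n - v m) \<le> 2 * (d' - d n) + 4 / Suc n" if "n \<le> m" for n m
  proof -
    have mid: "(1/2) *\<^sub>R (v n + v m) \<in> S n"
      using convexD[OF convex_convex_hull vS[of n, unfolded S_def] subsetD[OF Smono[OF that] vS[of m], unfolded S_def], of "1/2" "1/2"]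
      by (simp add: S_def scaleR_add_right)
    have "4 * q ((1/2) *\<^sub>R (v n + v m)) = q (v n + v m)"
      using subspace_add[OF H10_subspace vH[of n] vH[of m]]
      by (simp only: q_def grad_inner_scaleR_left grad_inner_scaleR_right)
    then have "4 * d n \<le> q (v n + v m)"
      using d_le[OF mid] by linarith
    moreover have "q (v n - v m) = 2 * q (v n) + 2 * q (v m) - q (v n + v m)"
      unfolding q_def by (rule grad_inner_parallelogram[OF vH vH])
    moreover have "1 / real (Suc m) \<le> 1 / Suc n"
      using that by (simp add: field_simps)
    ultimately show ?thesis
      using v[of n] v[of m] d'(2)[of m] by simp
  qed
  have "(\<lambda>n. 2 * (d' - d n) + 4 * inverse (real (Suc n))) \<longlonglongrightarrow> 2 * (d' - d') + 4 * 0"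
    by (intro tendsto_intros d' LIMSEQ_inverse_real_of_nat)
  then have rate: "(\<lambda>n. 2 * (d' - d n) + 4 / real (Suc n)) \<longlonglongrightarrow> 0"
    by (simp add: divide_inverse)
  show ?thesis
  proof (rule H10_limit(1))
    show "(\<lambda>n. abs_L2 (\<psi> n)) \<longlonglongrightarrow> u" using vlim unfolding \<psi>(2) .
    fix e :: real assume "e > 0"
    obtain N where N: "\<And>n. n \<ge> N \<Longrightarrow> 2 * (d' - d n) + 4 / Suc n < e"
      using order_tendstoD(2)[OF rate \<open>e > 0\<close>] unfolding eventually_sequentially by blast
    have "q (v m - v n) < e" if "m \<ge> N" "n \<ge> N" for m n
    proof (cases "n \<le> m")
      case True
      have "q (v m - v n) = q (v n - v m)"
        using vH[of m] vH[of n] by (simp add: q_def grad_inner_diff_left grad_inner_diff_right)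
      then show ?thesis using close[OF True] N[OF that(2)] by linarith
    next
      case False
      then show ?thesis using close[of m n] N[OF that(1)] by linarith
    qed
    then show "\<exists>N. \<forall>m\<ge>N. \<forall>n\<ge>N. grad_inner U (abs_L2 (\<psi> m) - abs_L2 (\<psi> n)) (abs_L2 (\<psi> m) - abs_L2 (\<psi> n)) < e"
      unfolding q_def \<psi>(2) by auto
  qed (rule \<psi>(1))
qed

text \<open>The approximating test functions share the Lipschitz constant of \<open>v\<close>, so
  their gradients are bounded; convergence of the gradients is not known, which is the situation of
  \<open>H10_weak_limit\<close>. Finite element functions are covered by this case.\<close>

lemma lipschitz_in_H10:
  fixes v :: "'a \<Rightarrow> real"
  assumes L: "L-lipschitz_on UNIV v" and out: "\<And>x. x \<notin> U \<Longrightarrow> v x = 0"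
  shows "abs_L2 v \<in> sobolev_H10 U"
proof -
  have "\<exists>\<phi>. test_fun U \<phi> \<and> L-lipschitz_on UNIV \<phi> \<and> (\<forall>x. \<bar>\<phi> x - v x\<bar> \<le> 1 / Suc n)" for n :: nat
    using lipschitz_test_fun_approx[OF open_U bounded_U L out, of "1 / Suc n"] by (metis of_nat_0_less_iff zero_less_Suc zero_less_divide_1_iff)
  then obtain \<phi> where \<phi>: "\<And>n::nat. test_fun U (\<phi> n)" "\<And>n. L-lipschitz_on UNIV (\<phi> n)"
    and close: "\<And>n x. \<bar>\<phi> n x - v x\<bar> \<le> 1 / Suc n"
    by metis
  define m where "m = (LINT x|lebesgue. indicator U x :: real)"
  have Uint: "integrable lebesgue (indicator U :: 'a \<Rightarrow> real)"
    using integrable_bounded_times_indicator[OF U_borel bounded_U, of "\<lambda>_. 1" 1] by simp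
  have sqv: "square_integrable v" by (rule square_integrable_lipschitz[OF L out])
  have sup: "(norm (abs_L2 f))\<^sup>2 \<le> B\<^sup>2 * m" if f: "square_integrable f" "\<And>x. x \<notin> U \<Longrightarrow> f x = 0" "\<And>x. \<bar>f x\<bar> \<le> B" for f :: "'a \<Rightarrow> real" and B
  proof -
    have "(LINT x|lebesgue. (f x)\<^sup>2) \<le> (LINT x|lebesgue. B\<^sup>2 * indicator U x)"
    proof (rule integral_mono)
      show "(f x)\<^sup>2 \<le> B\<^sup>2 * indicator U x" for x
        using f(2)[of x] power_mono[OF f(3)[of x], of 2] by (cases "x \<in> U") auto
    qed (use f(1) Uint in \<open>auto simp: square_integrable_def\<close>)
    then show ?thesis
      by (simp add: power2_norm_abs_L2[OF f(1)] m_def)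
  qed
  have m0: "0 \<le> m" by (simp add: m_def)
  have lim: "(\<lambda>n. abs_L2 (\<phi> n)) \<longlonglongrightarrow> abs_L2 v"
  proof -
    have "(\<lambda>n. (norm (abs_L2 (\<phi> n) - abs_L2 v))\<^sup>2) \<longlonglongrightarrow> 0"
    proof (rule tendsto_sandwich[where f = "\<lambda>_. 0"])
      show "\<forall>\<^sub>F n in sequentially. (norm (abs_L2 (\<phi> n) - abs_L2 v))\<^sup>2 \<le> (1 / Suc n)\<^sup>2 * m"
        using sup[OF square_integrable_diff[OF test_fun_square_integrable[OF \<phi>(1)] sqv] _ close]
        by (simp add: abs_L2_diff test_fun_square_integrable[OF \<phi>(1)] sqv out test_fun_outside[OF \<phi>(1)])
      have "(\<lambda>n. (inverse (real (Suc n)))\<^sup>2 * m) \<longlonglongrightarrow> 0\<^sup>2 * m"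
        by (intro tendsto_intros LIMSEQ_inverse_real_of_nat)
      then show "(\<lambda>n. (1 / real (Suc n))\<^sup>2 * m) \<longlonglongrightarrow> 0" by (simp add: divide_inverse)
    qed auto
    then have "(\<lambda>n. norm (abs_L2 (\<phi> n) - abs_L2 v)) \<longlonglongrightarrow> 0"
      using tendsto_real_sqrt[of "\<lambda>n. (norm (abs_L2 (\<phi> n) - abs_L2 v))\<^sup>2" 0] by simp
    then show ?thesis by (simp add: LIM_zero_iff tendsto_norm_zero_iff)
  qed
  show ?thesis
  proof (rule H10_weak_limit[OF \<phi>(1) lim])
    fix n
    have "(norm (weak_deriv U b (abs_L2 (\<phi> n))))\<^sup>2 \<le> L\<^sup>2 * m" if b: "b \<in> Basis" for b
    proof -
      note t = test_fun_pderiv_dir[OF \<phi>(1)[of n] b]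
      show ?thesis
        unfolding weak_deriv_test_fun[OF \<phi>(1) b]
        by (rule sup[OF test_fun_square_integrable[OF t] test_fun_outside[OF t]
              pderiv_dir_lipschitz_bound[OF test_fun_differentiable[OF \<phi>(1)] \<phi>(2) b]])
    qed
    then show "grad_inner U (abs_L2 (\<phi> n)) (abs_L2 (\<phi> n)) \<le> (\<Sum>b\<in>(Basis::'a set). L\<^sup>2 * m)"
      unfolding grad_inner_def power2_norm_eq_inner[symmetric] by (intro sum_mono)
  qed
qed

end

section \<open>Compactness and the first eigenvalue\<close>

lemma integral_set_square_le:
  fixes g :: "'a \<Rightarrow> real"
  assumes A: "A \<in> sets M" "emeasure M A < \<infinity>"
    and g: "integrable M (\<lambda>x. indicator A x * g x)" "integrable M (\<lambda>x. indicator A x * (g x)\<^sup>2)"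
  shows "(LINT x|M. indicator A x * g x)\<^sup>2 \<le> measure M A * (LINT x|M. indicator A x * (g x)\<^sup>2)"
proof -
  define a where "a = (LINT x|M. indicator A x * g x)"
  define s where "s = (LINT x|M. indicator A x * (g x)\<^sup>2)"
  define m where "m = measure M A"
  have ind: "integrable M (indicator A :: 'a \<Rightarrow> real)" using A by simp
  \<comment> \<open>The variance of \<open>g\<close> over \<open>A\<close>, multiplied through by
    the measure \<open>m\<close> so that division is postponed and m = 0 can be treated
    apart.\<close>
  have "0 \<le> (LINT x|M. indicator A x * (m * g x - a)\<^sup>2)"
    by (intro integral_nonneg_AE) auto
  also have "\<dots> = (LINT x|M. m\<^sup>2 * (indicator A x * (g x)\<^sup>2) - 2 * m * a * (indicator A x * g x) + a\<^sup>2 * indicator A x)"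
    by (intro Bochner_Integration.integral_cong) (auto simp: power2_eq_square algebra_simps)
  also have "\<dots> = m\<^sup>2 * s - 2 * m * a * a + a\<^sup>2 * m"
    using g ind A by (simp add: a_def s_def m_def)
  also have "\<dots> = m * (m * s - a\<^sup>2)"
    by (simp add: power2_eq_square algebra_simps)
  finally have *: "0 \<le> m * (m * s - a\<^sup>2)" .
  show ?thesis
  proof (cases "m = 0")
    case True
    then have "emeasure M A = 0"
      using A by (auto simp: m_def measure_def enn2real_eq_0_iff)
    then have "AE x in M. x \<notin> A"
      using A by (intro AE_not_in) auto
    then have "AE x in M. indicator A x * g x = 0"
      by eventually_elim auto
    then have "a = 0"
      unfolding a_def by (rule integral_eq_zero_AE)
    then show ?thesis using True by (simp add: a_def m_def)
  next
    case False
    then have "m > 0" by (simp add: m_def less_le measure_nonneg)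
    with * have "0 \<le> m * s - a\<^sup>2" by (simp add: zero_le_mult_iff)
    then show ?thesis by (simp add: a_def s_def m_def)
  qed
qed

lemma nn_integral_lborel_translate:
  fixes f :: "'a::euclidean_space \<Rightarrow> ennreal"
  assumes [measurable]: "f \<in> borel_measurable borel"
  shows "(\<integral>\<^sup>+x. f (c + x) \<partial>lborel) = (\<integral>\<^sup>+x. f x \<partial>lborel)"
proof -
  have "(\<integral>\<^sup>+x. f x \<partial>lborel) = (\<integral>\<^sup>+x. f x \<partial>distr lborel borel ((+) c))"
    by (simp add: lborel_distr_plus)
  also have "\<dots> = (\<integral>\<^sup>+x. f (c + x) \<partial>lborel)"
    by (subst nn_integral_distr) auto
  finally show ?thesis ..
qed

text \<open>The fundamental theorem along the segment, then Cauchy-Schwarz in t and again in the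
  coordinates. Nonnegative integrals prepare the exchange of integrations in the next
  estimate.\<close>

lemma increment_square_le:
  fixes \<phi> :: "'a::euclidean_space \<Rightarrow> real"
  assumes \<phi>: "smooth_on UNIV \<phi>"
  shows "ennreal ((\<phi> (x + z) - \<phi> x)\<^sup>2) \<le>
    (\<integral>\<^sup>+t\<in>{0..1::real}. ennreal ((norm z)\<^sup>2 * (\<Sum>b\<in>Basis. (pderiv_dir b \<phi> (x + t *\<^sub>R z))\<^sup>2)) \<partial>lborel)"
proof -
  define g where "g t = (\<Sum>b\<in>Basis. (z \<bullet> b) * pderiv_dir b \<phi> (x + t *\<^sub>R z))" for t
  note pc = smooth_on_continuous[OF smooth_on_pderiv_dir[OF \<phi>]]
  have gc: "continuous_on UNIV g"
    unfolding g_def by (intro continuous_on_sum continuous_on_mult continuous_on_compose2[OF pc] continuous_intros subset_UNIV) auto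
  have "((\<lambda>t. \<phi> (x + t *\<^sub>R z)) has_real_derivative g t) (at t)" for t
  proof -
    have "((\<lambda>t. \<phi> (x + t *\<^sub>R z)) has_derivative (\<lambda>h. \<Sum>b\<in>Basis. ((h *\<^sub>R z) \<bullet> b) * pderiv_dir b \<phi> (x + t *\<^sub>R z))) (at t)"
      by (rule has_derivative_compose[OF _ has_derivative_pderiv_dir[OF smooth_on_differentiable[OF \<phi>]], of "\<lambda>t. x + t *\<^sub>R z"])
        (auto intro!: derivative_eq_intros)
    moreover have "(\<lambda>h. \<Sum>b\<in>Basis. ((h *\<^sub>R z) \<bullet> b) * pderiv_dir b \<phi> (x + t *\<^sub>R z)) = (*) (g t)"
      by (auto simp: g_def fun_eq_iff sum_distrib_right intro!: sum.cong)
    ultimately show ?thesis by (simp add: has_field_derivative_def)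
  qed
  then have FTC: "(LINT t|lborel. indicator {0..1} t * g t) = \<phi> (x + z) - \<phi> x"
    using integral_FTC_Icc_real[of 0 1 "\<lambda>t. \<phi> (x + t *\<^sub>R z)" g] gc
    by (simp add: mult.commute continuous_on_eq_continuous_at)
  have int: "integrable lborel (\<lambda>t. indicator {0..1} t * g t)" "integrable lborel (\<lambda>t. indicator {0..1} t * (g t)\<^sup>2)"
    using borel_integrable_compact[of "{0..1}" g] borel_integrable_compact[of "{0..1}" "\<lambda>t. (g t)\<^sup>2"] gc
    by (auto intro: continuous_on_subset continuous_on_power)
  have "(\<phi> (x + z) - \<phi> x)\<^sup>2 \<le> measure lborel {0..1::real} * (LINT t|lborel. indicator {0..1} t * (g t)\<^sup>2)"
    unfolding FTC[symmetric] by (rule integral_set_square_le) (use int in auto)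
  then have "ennreal ((\<phi> (x + z) - \<phi> x)\<^sup>2) \<le> ennreal (LINT t|lborel. indicator {0..1} t * (g t)\<^sup>2)"
    by (intro ennreal_leI) simp
  also have "\<dots> = (\<integral>\<^sup>+t. ennreal (indicator {0..1} t * (g t)\<^sup>2) \<partial>lborel)"
    by (rule nn_integral_eq_integral[symmetric, OF int(2)]) simp
  also have "\<dots> \<le> (\<integral>\<^sup>+t. ennreal ((norm z)\<^sup>2 * (\<Sum>b\<in>Basis. (pderiv_dir b \<phi> (x + t *\<^sub>R z))\<^sup>2)) * indicator {0..1} t \<partial>lborel)"
  proof (rule nn_integral_mono)
    fix t :: real
    have "(g t)\<^sup>2 \<le> (\<Sum>b\<in>Basis. (z \<bullet> b)\<^sup>2) * (\<Sum>b\<in>Basis. (pderiv_dir b \<phi> (x + t *\<^sub>R z))\<^sup>2)"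
      unfolding g_def by (rule Cauchy_Schwarz_ineq_sum)
    also have "(\<Sum>b\<in>Basis. (z \<bullet> b)\<^sup>2) = (norm z)\<^sup>2"
      unfolding power2_norm_eq_inner euclidean_inner[of z z] by (simp add: power2_eq_square)
    finally show "ennreal (indicator {0..1} t * (g t)\<^sup>2) \<le>
        ennreal ((norm z)\<^sup>2 * (\<Sum>b\<in>Basis. (pderiv_dir b \<phi> (x + t *\<^sub>R z))\<^sup>2)) * indicator {0..1} t"
      by (auto simp: indicator_def intro: ennreal_leI)
  qed
  finally show ?thesis .
qed

text \<open>After integration in x, translation invariance removes the shift t z inside the
  gradient, and nothing depends on t any more.\<close>

lemma translation_estimate:
  fixes \<phi> :: "'a::euclidean_space \<Rightarrow> real"
  assumes \<phi>: "test_fun U \<phi>"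
  shows "(\<integral>\<^sup>+x. ennreal ((\<phi> (x + z) - \<phi> x)\<^sup>2) \<partial>lborel) \<le>
    ennreal ((norm z)\<^sup>2 * (LINT x|lborel. (\<Sum>b\<in>Basis. (pderiv_dir b \<phi> x)\<^sup>2)))"
proof -
  define G where "G x = (\<Sum>b\<in>Basis. (pderiv_dir b \<phi> x)\<^sup>2)" for x
  have sm: "smooth_on UNIV \<phi>" using \<phi> by (rule test_fun_smooth)
  have [measurable]: "pderiv_dir b \<phi> \<in> borel_measurable borel" if "b \<in> Basis" for b
    using test_fun_measurable[OF test_fun_pderiv_dir[OF \<phi> that]] .
  have G[measurable]: "G \<in> borel_measurable borel"
    unfolding G_def by measurable
  have G0: "0 \<le> G x" for x by (simp add: G_def sum_nonneg)
  have Gint: "integrable lborel G"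
    unfolding G_def power2_eq_square
    by (intro Bochner_Integration.integrable_sum test_fun_integrable[OF test_fun_mult[OF test_fun_pderiv_dir[OF \<phi>] test_fun_pderiv_dir[OF \<phi>]]])
  have "(\<integral>\<^sup>+x. ennreal ((\<phi> (x + z) - \<phi> x)\<^sup>2) \<partial>lborel) \<le>
      (\<integral>\<^sup>+x. (\<integral>\<^sup>+t. ennreal ((norm z)\<^sup>2 * G (x + t *\<^sub>R z)) * indicator {0..1} t \<partial>lborel) \<partial>lborel)"
    using increment_square_le[OF sm] by (intro nn_integral_mono) (simp add: G_def)
  also have "\<dots> = (\<integral>\<^sup>+t. (\<integral>\<^sup>+x. ennreal ((norm z)\<^sup>2 * G (x + t *\<^sub>R z)) * indicator {0..1} t \<partial>lborel) \<partial>lborel)"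
    by (rule lborel_pair.Fubini') measurable
  also have "\<dots> = (\<integral>\<^sup>+t. (\<integral>\<^sup>+x. ennreal ((norm z)\<^sup>2 * G x) \<partial>lborel) * indicator {0..1::real} t \<partial>lborel)"
  proof (rule nn_integral_cong)
    fix t :: real
    have "(\<integral>\<^sup>+x. ennreal ((norm z)\<^sup>2 * G (t *\<^sub>R z + x)) \<partial>lborel) = (\<integral>\<^sup>+x. ennreal ((norm z)\<^sup>2 * G x) \<partial>lborel)"
      by (rule nn_integral_lborel_translate[of "\<lambda>x. ennreal ((norm z)\<^sup>2 * G x)" "t *\<^sub>R z"]) measurable
    then show "(\<integral>\<^sup>+x. ennreal ((norm z)\<^sup>2 * G (x + t *\<^sub>R z)) * indicator {0..1} t \<partial>lborel) =
        (\<integral>\<^sup>+x. ennreal ((norm z)\<^sup>2 * G x) \<partial>lborel) * indicator {0..1} t"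
      by (subst nn_integral_multc) (auto simp: add.commute)
  qed
  also have "\<dots> = (\<integral>\<^sup>+x. ennreal ((norm z)\<^sup>2 * G x) \<partial>lborel)"
    by (subst nn_integral_cmult) auto
  also have "\<dots> = ennreal (LINT x|lborel. (norm z)\<^sup>2 * G x)"
    using Gint G0 by (intro nn_integral_eq_integral) auto
  finally show ?thesis by (simp add: G_def)
qed

text \<open>The cell of the cubic grid of width \<open>\<delta>\<close> that contains \<open>x\<close>, given by its lower corner divided by \<open>\<delta>\<close>.\<close>

definition grid :: "real \<Rightarrow> 'a::euclidean_space \<Rightarrow> 'a" where
  "grid \<delta> x = (\<Sum>b\<in>Basis. of_int \<lfloor>(x \<bullet> b) / \<delta>\<rfloor> *\<^sub>R b)"

lemma grid_inner: "b \<in> Basis \<Longrightarrow> grid \<delta> x \<bullet> b = of_int \<lfloor>(x \<bullet> b) / \<delta>\<rfloor>"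
  by (simp add: grid_def inner_sum_left_Basis)

lemma grid_measurable [measurable]: "grid \<delta> \<in> borel_measurable borel"
  unfolding grid_def by measurable

lemma grid_eq_dist:
  assumes "grid \<delta> x = grid \<delta> y" "\<delta> > 0" "b \<in> Basis"
  shows "\<bar>(y - x) \<bullet> b\<bar> < \<delta>"
proof -
  have "\<lfloor>(x \<bullet> b) / \<delta>\<rfloor> = \<lfloor>(y \<bullet> b) / \<delta>\<rfloor>"
    using assms grid_inner[OF assms(3), of \<delta> x] grid_inner[OF assms(3), of \<delta> y] by simp
  then have "\<bar>(y \<bullet> b) / \<delta> - (x \<bullet> b) / \<delta>\<bar> < 1"
    by linarith
  then show ?thesis
    using \<open>\<delta> > 0\<close> by (simp add: inner_diff_left field_simps abs_less_iff flip: diff_divide_distrib)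
qed

text \<open>The cell is half-open, hence squeezed between an open and a closed box of equal
  volume.\<close>

lemma emeasure_grid_cell:
  fixes x :: "'a::euclidean_space"
  assumes \<delta>: "\<delta> > 0"
  shows "emeasure lborel {y. grid \<delta> y = grid \<delta> x} = ennreal (\<delta> ^ DIM('a))"
proof -
  define l where "l = \<delta> *\<^sub>R grid \<delta> x"
  define u where "u = l + \<delta> *\<^sub>R One"
  have le: "l \<bullet> b \<le> u \<bullet> b" if "b \<in> Basis" for b using that \<delta> by (simp add: u_def inner_add_left)
  have *: "(y \<bullet> b) / \<delta> \<in> {of_int k..<of_int k + 1} \<longleftrightarrow> \<lfloor>(y \<bullet> b) / \<delta>\<rfloor> = k" for y b k
    by (auto simp: floor_eq_iff)
  have cell: "grid \<delta> y = grid \<delta> x \<longleftrightarrow> (\<forall>b\<in>Basis. l \<bullet> b \<le> y \<bullet> b \<and> y \<bullet> b < u \<bullet> b)" for y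
  proof -
    have "grid \<delta> y = grid \<delta> x \<longleftrightarrow> (\<forall>b\<in>Basis. \<lfloor>(y \<bullet> b) / \<delta>\<rfloor> = \<lfloor>(x \<bullet> b) / \<delta>\<rfloor>)"
      by (subst euclidean_eq_iff) (auto simp: grid_inner)
    also have "\<dots> \<longleftrightarrow> (\<forall>b\<in>Basis. l \<bullet> b \<le> y \<bullet> b \<and> y \<bullet> b < u \<bullet> b)"
    proof (intro ball_cong refl)
      fix b :: 'a assume b: "b \<in> Basis"
      have lb: "l \<bullet> b = \<delta> * of_int \<lfloor>(x \<bullet> b) / \<delta>\<rfloor>" "u \<bullet> b = \<delta> * (of_int \<lfloor>(x \<bullet> b) / \<delta>\<rfloor> + 1)"
        using b by (simp_all add: l_def u_def grid_inner inner_add_left distrib_left)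
      show "(\<lfloor>(y \<bullet> b) / \<delta>\<rfloor> = \<lfloor>(x \<bullet> b) / \<delta>\<rfloor>) = (l \<bullet> b \<le> y \<bullet> b \<and> y \<bullet> b < u \<bullet> b)"
        unfolding lb floor_eq_iff using \<delta> by (simp add: field_simps)
    qed
    finally show ?thesis .
  qed
  have vol: "(\<Prod>b\<in>Basis. (u - l) \<bullet> b) = \<delta> ^ DIM('a)"
    by (simp add: u_def)
  have "emeasure lborel (box l u) \<le> emeasure lborel {y. grid \<delta> y = grid \<delta> x}"
    by (intro emeasure_mono) (auto simp: cell mem_box less_imp_le)
  moreover have "emeasure lborel {y. grid \<delta> y = grid \<delta> x} \<le> emeasure lborel (cbox l u)"
    by (intro emeasure_mono) (auto simp: cell mem_box less_imp_le)
  ultimately show ?thesis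
    using le vol by (simp add: emeasure_lborel_box_eq emeasure_lborel_cbox_eq)
qed

lemma finite_grid_image:
  fixes U :: "'a::euclidean_space set"
  assumes "bounded U" "\<delta> > 0"
  shows "finite (grid \<delta> ` U)"
proof -
  obtain B where B: "\<And>x. x \<in> U \<Longrightarrow> norm x \<le> B"
    using assms(1) by (auto simp: bounded_iff)
  define K where "K = {\<lfloor>- B / \<delta>\<rfloor>..\<lfloor>B / \<delta>\<rfloor>}"
  have "grid \<delta> ` U \<subseteq> (\<lambda>k. \<Sum>b\<in>Basis. of_int (k b) *\<^sub>R b) ` (Basis \<rightarrow>\<^sub>E K)"
  proof
    fix p assume "p \<in> grid \<delta> ` U"
    then obtain x where x: "x \<in> U" "p = grid \<delta> x" by blast
    have "\<lfloor>(x \<bullet> b) / \<delta>\<rfloor> \<in> K" if "b \<in> Basis" for b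
    proof -
      have "\<bar>x \<bullet> b\<bar> \<le> B" using Basis_le_norm[OF that, of x] B[OF x(1)] by linarith
      then have "- B / \<delta> \<le> (x \<bullet> b) / \<delta>" "(x \<bullet> b) / \<delta> \<le> B / \<delta>"
        using assms(2) by (intro divide_right_mono; simp)+
      then show ?thesis unfolding K_def by (auto intro: floor_mono)
    qed
    then show "p \<in> (\<lambda>k. \<Sum>b\<in>Basis. of_int (k b) *\<^sub>R b) ` (Basis \<rightarrow>\<^sub>E K)"
      by (intro image_eqI[of _ _ "\<lambda>b\<in>Basis. \<lfloor>(x \<bullet> b) / \<delta>\<rfloor>"]) (auto simp: x(2) grid_def intro!: sum.cong)
  qed
  then show ?thesis
    by (rule finite_subset) (intro finite_imageI finite_PiE, auto simp: K_def)
qed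


context bounded_open begin

text \<open>On a cell, \<phi>(x) is the mean of \<phi> minus the mean of \<phi>(y) - \<phi>(x) over
  y. The cell integrals remain as finitely many functionals; the increments are controlled by the
  gradient, with a factor that shrinks like \<delta>^2.\<close>

lemma grid_poincare:
  fixes \<delta> :: real
  assumes \<phi>: "test_fun U \<phi>" and \<delta>: "\<delta> > 0"
  shows "(LINT x|lborel. (\<phi> x)\<^sup>2) \<le>
    (\<Sum>p\<in>grid \<delta> ` U. 2 / \<delta> ^ DIM('a) * (LINT x|lborel. indicator {x. grid \<delta> x = p} x * \<phi> x)\<^sup>2)
    + 2 * 2 ^ DIM('a) * (DIM('a) * \<delta>)\<^sup>2 * (LINT x|lborel. (\<Sum>b\<in>Basis. (pderiv_dir b \<phi> x)\<^sup>2))"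
proof -
  define Q where "Q p = {x::'a. grid \<delta> x = p}" for p
  define a where "a p = (LINT x|lborel. indicator (Q p) x * \<phi> x)" for p
  define V where "V = \<delta> ^ DIM('a)"
  define G where "G = (LINT x|lborel. (\<Sum>b\<in>Basis. (pderiv_dir b \<phi> x)\<^sup>2))"
  have V: "V > 0" using \<delta> by (simp add: V_def)
  have G0: "0 \<le> G" unfolding G_def by (rule Bochner_Integration.integral_nonneg) (simp add: sum_nonneg)
  have [measurable]: "\<phi> \<in> borel_measurable borel" using \<phi> by (rule test_fun_measurable)
  have [measurable]: "Q p \<in> sets borel" for p unfolding Q_def by measurable
  have Qm: "emeasure lborel (Q (grid \<delta> x)) = ennreal V" for x
    unfolding Q_def V_def by (rule emeasure_grid_cell[OF \<delta>])
  have Qmm: "measure lborel (Q (grid \<delta> x)) = V" for x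
    using Qm[of x] V by (simp add: measure_def)
  have i1: "integrable lborel \<phi>" by (rule test_fun_integrable[OF \<phi>])
  have i2: "integrable lborel (\<lambda>x. (\<phi> x)\<^sup>2)"
    using test_fun_integrable[OF test_fun_mult[OF \<phi> \<phi>]] by (simp add: power2_eq_square)
  \<comment> \<open>Squaring mean minus mean increment costs the factor 2, and Cauchy-Schwarz on a
    cell of volume \<open>V\<close> leaves 1 / V in front of the squared increments.\<close>
  have point: "ennreal ((\<phi> x)\<^sup>2) \<le> (\<Sum>p\<in>grid \<delta> ` U. ennreal (2 / V\<^sup>2 * (a p)\<^sup>2) * indicator (Q p) x)
      + ennreal (2 / V) * (\<integral>\<^sup>+y. indicator (Q (grid \<delta> x)) y * ennreal ((\<phi> y - \<phi> x)\<^sup>2) \<partial>lborel)" for x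
  proof (cases "x \<in> U")
    case True
    let ?Q = "Q (grid \<delta> x)"
    have iQ: "integrable lborel (indicator ?Q :: 'a \<Rightarrow> real)"
      using Qm[of x] by (simp add: ennreal_less_top)
    have iQ1: "integrable lborel (\<lambda>y. indicator ?Q y * \<phi> y)"
      using i1 by (rule Bochner_Integration.integrable_bound) (auto simp: indicator_def)
    have iQ2: "integrable lborel (\<lambda>y. indicator ?Q y * (\<phi> y)\<^sup>2)"
      using i2 by (rule Bochner_Integration.integrable_bound) (auto simp: indicator_def)
    have e1: "(\<lambda>y. indicator ?Q y * (\<phi> y - \<phi> x)) = (\<lambda>y. indicator ?Q y * \<phi> y - \<phi> x * indicator ?Q y)"
      by (auto simp: fun_eq_iff algebra_simps)
    have e2: "(\<lambda>y. indicator ?Q y * (\<phi> y - \<phi> x)\<^sup>2) = (\<lambda>y. indicator ?Q y * (\<phi> y)\<^sup>2 - 2 * \<phi> x * (indicator ?Q y * \<phi> y) + (\<phi> x)\<^sup>2 * indicator ?Q y)"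
      by (auto simp: fun_eq_iff algebra_simps power2_eq_square)
    have j1: "integrable lborel (\<lambda>y. indicator ?Q y * (\<phi> y - \<phi> x))"
      unfolding e1 using iQ iQ1 by auto
    have j2: "integrable lborel (\<lambda>y. indicator ?Q y * (\<phi> y - \<phi> x)\<^sup>2)"
      unfolding e2 using iQ iQ1 iQ2 by auto
    define s where "s = (LINT y|lborel. indicator ?Q y * (\<phi> y - \<phi> x))"
    define S where "S = (LINT y|lborel. indicator ?Q y * (\<phi> y - \<phi> x)\<^sup>2)"
    have "s = a (grid \<delta> x) - \<phi> x * V"
      unfolding s_def e1 a_def using iQ iQ1 Qmm[of x] by simp
    then have fx: "\<phi> x = a (grid \<delta> x) / V - s / V"
      using V by (simp add: field_simps)
    have sS: "s\<^sup>2 \<le> V * S"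
      unfolding s_def S_def Qmm[of x, symmetric]
      by (rule integral_set_square_le) (use Qm[of x] j1 j2 in auto)
    have "(\<phi> x)\<^sup>2 \<le> 2 * (a (grid \<delta> x) / V)\<^sup>2 + 2 * (s / V)\<^sup>2"
      unfolding fx using zero_le_power2[of "a (grid \<delta> x) / V + s / V"] by (simp add: power2_sum power2_diff)
    also have "2 * (s / V)\<^sup>2 \<le> 2 / V * S"
      using sS V by (simp add: power2_eq_square field_simps)
    finally have "(\<phi> x)\<^sup>2 \<le> 2 / V\<^sup>2 * (a (grid \<delta> x))\<^sup>2 + 2 / V * S"
      by (simp add: power_divide)
    then have "ennreal ((\<phi> x)\<^sup>2) \<le> ennreal (2 / V\<^sup>2 * (a (grid \<delta> x))\<^sup>2 + 2 / V * S)"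
      by (rule ennreal_leI)
    also have S0: "0 \<le> S" unfolding S_def by (intro integral_nonneg_AE) auto
    have "ennreal (2 / V\<^sup>2 * (a (grid \<delta> x))\<^sup>2 + 2 / V * S) = ennreal (2 / V\<^sup>2 * (a (grid \<delta> x))\<^sup>2) + ennreal (2 / V * S)"
      using V S0 by (intro ennreal_plus) auto
    also have "ennreal (2 / V * S) = ennreal (2 / V) * ennreal S"
      using V S0 by (intro ennreal_mult) auto
    also have "ennreal S = (\<integral>\<^sup>+y. ennreal (indicator ?Q y * (\<phi> y - \<phi> x)\<^sup>2) \<partial>lborel)"
      unfolding S_def by (rule nn_integral_eq_integral[symmetric, OF j2]) simp
    also have "\<dots> = (\<integral>\<^sup>+y. indicator ?Q y * ennreal ((\<phi> y - \<phi> x)\<^sup>2) \<partial>lborel)"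
      by (intro nn_integral_cong) (auto simp: indicator_def)
    also have "ennreal (2 / V\<^sup>2 * (a (grid \<delta> x))\<^sup>2) = ennreal (2 / V\<^sup>2 * (a (grid \<delta> x))\<^sup>2) * indicator ?Q x"
      by (simp add: Q_def)
    also have "\<dots> \<le> (\<Sum>p\<in>grid \<delta> ` U. ennreal (2 / V\<^sup>2 * (a p)\<^sup>2) * indicator (Q p) x)"
      using True finite_grid_image[OF bounded_U \<delta>] by (intro member_le_sum) auto
    finally show ?thesis by (simp add: add_right_mono)
  qed (simp add: test_fun_outside[OF \<phi>])
  let ?C = "box (- \<delta> *\<^sub>R One) (\<delta> *\<^sub>R One) :: 'a set"
  \<comment> \<open>Two points of one cell differ by a vector of the cube \<open>?C\<close>.
    Admitting all such differences makes their range independent of x, so that y = x + z can be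
    substituted and the translation estimate applied for each z.\<close>
  have "(\<integral>\<^sup>+x. (\<integral>\<^sup>+y. indicator (Q (grid \<delta> x)) y * ennreal ((\<phi> y - \<phi> x)\<^sup>2) \<partial>lborel) \<partial>lborel)
      \<le> (\<integral>\<^sup>+x. (\<integral>\<^sup>+y. indicator ?C (y - x) * ennreal ((\<phi> y - \<phi> x)\<^sup>2) \<partial>lborel) \<partial>lborel)"
  proof (intro nn_integral_mono mult_right_mono)
    fix x y
    have "y - x \<in> ?C" if "grid \<delta> y = grid \<delta> x"
      unfolding mem_box
    proof
      fix i :: 'a assume i: "i \<in> Basis"
      have "\<bar>(y - x) \<bullet> i\<bar> < \<delta>" by (rule grid_eq_dist[OF that[symmetric] \<delta> i])
      then have "- \<delta> < (y - x) \<bullet> i" "(y - x) \<bullet> i < \<delta>" by linarith+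
      then show "(- \<delta> *\<^sub>R One) \<bullet> i < (y - x) \<bullet> i \<and> (y - x) \<bullet> i < (\<delta> *\<^sub>R One) \<bullet> i"
        using i by simp
    qed
    then show "(indicator (Q (grid \<delta> x)) y :: ennreal) \<le> indicator ?C (y - x)"
      by (auto simp: indicator_def Q_def)
  qed simp
  also have "\<dots> = (\<integral>\<^sup>+x. (\<integral>\<^sup>+z. indicator ?C z * ennreal ((\<phi> (x + z) - \<phi> x)\<^sup>2) \<partial>lborel) \<partial>lborel)"
  proof (rule nn_integral_cong)
    fix x :: 'a
    show "(\<integral>\<^sup>+y. indicator ?C (y - x) * ennreal ((\<phi> y - \<phi> x)\<^sup>2) \<partial>lborel) = (\<integral>\<^sup>+z. indicator ?C z * ennreal ((\<phi> (x + z) - \<phi> x)\<^sup>2) \<partial>lborel)"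
      by (subst nn_integral_lborel_translate[symmetric, where c = x]) auto
  qed
  also have "\<dots> = (\<integral>\<^sup>+z. (\<integral>\<^sup>+x. indicator ?C z * ennreal ((\<phi> (x + z) - \<phi> x)\<^sup>2) \<partial>lborel) \<partial>lborel)"
    by (rule lborel_pair.Fubini') measurable
  also have "\<dots> \<le> (\<integral>\<^sup>+z. indicator ?C z * ennreal ((DIM('a) * \<delta>)\<^sup>2 * G) \<partial>lborel)"
  proof (rule nn_integral_mono)
    fix z :: 'a
    have "(\<integral>\<^sup>+x. indicator ?C z * ennreal ((\<phi> (x + z) - \<phi> x)\<^sup>2) \<partial>lborel) = indicator ?C z * (\<integral>\<^sup>+x. ennreal ((\<phi> (x + z) - \<phi> x)\<^sup>2) \<partial>lborel)"
      by (rule nn_integral_cmult) measurable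
    also have "\<dots> \<le> indicator ?C z * ennreal ((norm z)\<^sup>2 * G)"
      unfolding G_def by (intro mult_left_mono translation_estimate[OF \<phi>]) simp
    also have "\<dots> \<le> indicator ?C z * ennreal ((DIM('a) * \<delta>)\<^sup>2 * G)"
    proof (cases "z \<in> ?C")
      case True
      have "norm z \<le> (\<Sum>b\<in>Basis. \<bar>z \<bullet> b\<bar>)" by (rule norm_le_l1)
      also have "\<dots> \<le> (\<Sum>b\<in>(Basis::'a set). \<delta>)"
      proof (rule sum_mono)
        fix b :: 'a assume b: "b \<in> Basis"
        then have "- \<delta> < z \<bullet> b" "z \<bullet> b < \<delta>" using True by (auto simp: mem_box)
        then show "\<bar>z \<bullet> b\<bar> \<le> \<delta>" by linarith
      qed
      finally have "(norm z)\<^sup>2 \<le> (DIM('a) * \<delta>)\<^sup>2"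
        by (intro power_mono) auto
      then show ?thesis
        using G0 by (intro mult_left_mono ennreal_leI mult_right_mono) auto
    qed simp
    finally show "(\<integral>\<^sup>+x. indicator ?C z * ennreal ((\<phi> (x + z) - \<phi> x)\<^sup>2) \<partial>lborel) \<le> indicator ?C z * ennreal ((DIM('a) * \<delta>)\<^sup>2 * G)" .
  qed
  also have "\<dots> = emeasure lborel ?C * ennreal ((DIM('a) * \<delta>)\<^sup>2 * G)"
    by (subst nn_integral_multc) auto
  \<comment> \<open>The factor \<open>V\<close> in the volume of the cube cancels the 1 / V of the
    pointwise bound.\<close>
  also have "emeasure lborel ?C = ennreal (2 ^ DIM('a) * V)"
  proof -
    have "(\<Prod>b\<in>Basis. (\<delta> *\<^sub>R One - - \<delta> *\<^sub>R One) \<bullet> (b::'a)) = 2 ^ DIM('a) * V"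
    proof -
      have "(\<Prod>b\<in>Basis. (\<delta> *\<^sub>R One - - \<delta> *\<^sub>R One) \<bullet> (b::'a)) = (\<Prod>b\<in>(Basis::'a set). 2 * \<delta>)"
        by (intro prod.cong refl) (simp add: inner_add_left)
      also have "\<dots> = 2 ^ DIM('a) * V"
        by (simp add: V_def power_mult_distrib)
      finally show ?thesis .
    qed
    moreover have "(- \<delta> *\<^sub>R One) \<bullet> b \<le> (\<delta> *\<^sub>R One) \<bullet> b" if "b \<in> Basis" for b :: 'a
      using that \<delta> by simp
    ultimately show ?thesis
      unfolding emeasure_lborel_box_eq by (simp only: if_P[OF ballI])
    qed
  finally have I: "(\<integral>\<^sup>+x. (\<integral>\<^sup>+y. indicator (Q (grid \<delta> x)) y * ennreal ((\<phi> y - \<phi> x)\<^sup>2) \<partial>lborel) \<partial>lborel)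
      \<le> ennreal (2 ^ DIM('a) * V * ((DIM('a) * \<delta>)\<^sup>2 * G))"
    using V G0 by (simp add: ennreal_mult)
  \<comment> \<open>Membership in the cell of x is rewritten as equality of grid points, which is
    measurable in the pair.\<close>
  have [measurable]: "(\<lambda>x. \<integral>\<^sup>+y. indicator (Q (grid \<delta> x)) y * ennreal ((\<phi> y - \<phi> x)\<^sup>2) \<partial>lborel) \<in> borel_measurable borel"
  proof -
    have "(\<lambda>(x, y). indicator (Q (grid \<delta> x)) y * ennreal ((\<phi> y - \<phi> x)\<^sup>2)) = (\<lambda>(x, y). (if grid \<delta> y = grid \<delta> x then 1 else 0) * ennreal ((\<phi> y - \<phi> x)\<^sup>2))"
      by (auto simp: Q_def fun_eq_iff)
    also have "\<dots> \<in> borel_measurable (borel \<Otimes>\<^sub>M lborel)" by measurable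
    finally show ?thesis
      by (intro lborel.borel_measurable_nn_integral) simp
  qed
  have "ennreal (LINT x|lborel. (\<phi> x)\<^sup>2) = (\<integral>\<^sup>+x. ennreal ((\<phi> x)\<^sup>2) \<partial>lborel)"
    by (rule nn_integral_eq_integral[symmetric, OF i2]) simp
  also have "\<dots> \<le> (\<integral>\<^sup>+x. (\<Sum>p\<in>grid \<delta> ` U. ennreal (2 / V\<^sup>2 * (a p)\<^sup>2) * indicator (Q p) x)
      + ennreal (2 / V) * (\<integral>\<^sup>+y. indicator (Q (grid \<delta> x)) y * ennreal ((\<phi> y - \<phi> x)\<^sup>2) \<partial>lborel) \<partial>lborel)"
    by (intro nn_integral_mono point)
  also have "\<dots> = (\<Sum>p\<in>grid \<delta> ` U. ennreal (2 / V\<^sup>2 * (a p)\<^sup>2) * emeasure lborel (Q p))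
      + ennreal (2 / V) * (\<integral>\<^sup>+x. (\<integral>\<^sup>+y. indicator (Q (grid \<delta> x)) y * ennreal ((\<phi> y - \<phi> x)\<^sup>2) \<partial>lborel) \<partial>lborel)"
    by (subst nn_integral_add, measurable, subst nn_integral_sum, measurable)
      (simp add: nn_integral_cmult nn_integral_cmult_indicator)
  also have "\<dots> \<le> (\<Sum>p\<in>grid \<delta> ` U. ennreal (2 / V * (a p)\<^sup>2))
      + ennreal (2 / V) * ennreal (2 ^ DIM('a) * V * ((DIM('a) * \<delta>)\<^sup>2 * G))"
  proof (intro add_mono sum_mono mult_left_mono I)
    fix p assume "p \<in> grid \<delta> ` U"
    then have "emeasure lborel (Q p) = ennreal V" using Qm by auto
    then show "ennreal (2 / V\<^sup>2 * (a p)\<^sup>2) * emeasure lborel (Q p) \<le> ennreal (2 / V * (a p)\<^sup>2)"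
      using V by (simp add: ennreal_mult[symmetric] power2_eq_square)
  qed simp
  also have "\<dots> = ennreal ((\<Sum>p\<in>grid \<delta> ` U. 2 / V * (a p)\<^sup>2) + 2 / V * (2 ^ DIM('a) * V * ((DIM('a) * \<delta>)\<^sup>2 * G)))"
    using V G0 by (simp add: sum_ennreal ennreal_mult[symmetric] ennreal_plus[symmetric] sum_nonneg del: ennreal_plus)
  finally have "(LINT x|lborel. (\<phi> x)\<^sup>2) \<le> (\<Sum>p\<in>grid \<delta> ` U. 2 / V * (a p)\<^sup>2) + 2 / V * (2 ^ DIM('a) * V * ((DIM('a) * \<delta>)\<^sup>2 * G))"
    using V G0 by (subst (asm) ennreal_le_iff) (auto intro!: add_nonneg_nonneg sum_nonneg)
  also have "2 / V * (2 ^ DIM('a) * V * ((DIM('a) * \<delta>)\<^sup>2 * G)) = 2 * 2 ^ DIM('a) * (DIM('a) * \<delta>)\<^sup>2 * G"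
    using V by simp
  finally show ?thesis
    by (simp only: V_def a_def Q_def G_def)
qed

text \<open>Compactness of the embedding in quantitative form: up to finitely many linear
  functionals, the squared L^2 norm is an arbitrarily small part of the energy. A sequence of
  bounded energy along which these functionals converge is then nearly Cauchy.\<close>

lemma rellich:
  assumes \<epsilon>: "\<epsilon> > 0"
  obtains I :: "'a set" and y where "finite I"
    "\<And>\<phi>. test_fun U \<phi> \<Longrightarrow> (norm (abs_L2 \<phi>))\<^sup>2 \<le>
      \<epsilon> * grad_inner U (abs_L2 \<phi>) (abs_L2 \<phi>) + (\<Sum>p\<in>I. (inner (abs_L2 \<phi>) (y p))\<^sup>2)"
proof -
  define K where "K = 2 * 2 ^ DIM('a) * (real DIM('a))\<^sup>2"
  have K: "K > 0" by (simp add: K_def)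
  \<comment> \<open>Chosen so that the gradient term of \<open>grid_poincare\<close> gets exactly
    the factor \<epsilon>; the weight in \<open>y\<close> turns the cell terms into squares of inner
    products.\<close>
  define \<delta> where "\<delta> = sqrt (\<epsilon> / K)"
  have \<delta>: "\<delta> > 0" using \<epsilon> K by (simp add: \<delta>_def)
  have K\<delta>: "2 * 2 ^ DIM('a) * (DIM('a) * \<delta>)\<^sup>2 = \<epsilon>"
    using \<epsilon> K by (simp add: \<delta>_def power_mult_distrib K_def)
  define Q where "Q p = {x::'a. grid \<delta> x = p}" for p
  define y where "y p = sqrt (2 / \<delta> ^ DIM('a)) *\<^sub>R abs_L2 (indicator (Q p))" for p
  show ?thesis
  proof (rule that[of "grid \<delta> ` U" y])
    show "finite (grid \<delta> ` U)" by (rule finite_grid_image[OF bounded_U \<delta>])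
    fix \<phi> assume \<phi>: "test_fun U \<phi>"
    note sq = test_fun_square_integrable[OF \<phi>]
    have "(norm (abs_L2 \<phi>))\<^sup>2 = (LINT x|lborel. (\<phi> x)\<^sup>2)"
      unfolding power2_norm_abs_L2[OF sq] using test_fun_measurable[OF \<phi>] by (intro integral_completion) simp
    moreover have "grad_inner U (abs_L2 \<phi>) (abs_L2 \<phi>) = (LINT x|lborel. (\<Sum>b\<in>Basis. (pderiv_dir b \<phi> x)\<^sup>2))"
    proof -
      have d: "inner (abs_L2 (pderiv_dir b \<phi>)) (abs_L2 (pderiv_dir b \<phi>)) = (LINT x|lborel. (pderiv_dir b \<phi> x)\<^sup>2)"
        and i: "integrable lborel (\<lambda>x. (pderiv_dir b \<phi> x)\<^sup>2)" if b: "b \<in> Basis" for b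
      proof -
        note t = test_fun_pderiv_dir[OF \<phi> b]
        show "inner (abs_L2 (pderiv_dir b \<phi>)) (abs_L2 (pderiv_dir b \<phi>)) = (LINT x|lborel. (pderiv_dir b \<phi> x)\<^sup>2)"
          unfolding power2_norm_eq_inner[symmetric] power2_norm_abs_L2[OF test_fun_square_integrable[OF t]]
          using test_fun_measurable[OF t] by (intro integral_completion) simp
        show "integrable lborel (\<lambda>x. (pderiv_dir b \<phi> x)\<^sup>2)"
          using test_fun_integrable[OF test_fun_mult[OF t t]] by (simp add: power2_eq_square)
      qed
      show ?thesis
        unfolding grad_inner_def using i by (simp add: weak_deriv_test_fun[OF \<phi>] d Bochner_Integration.integral_sum)
    qed
    moreover have "(inner (abs_L2 \<phi>) (y p))\<^sup>2 = 2 / \<delta> ^ DIM('a) * (LINT x|lborel. indicator {x. grid \<delta> x = p} x * \<phi> x)\<^sup>2"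
      if "p \<in> grid \<delta> ` U" for p
    proof -
      have Qb: "Q p \<in> sets borel" unfolding Q_def by measurable
      obtain x where "p = grid \<delta> x" using \<open>p \<in> grid \<delta> ` U\<close> by blast
      then have "emeasure lborel (Q p) < \<infinity>"
        using emeasure_grid_cell[OF \<delta>, of x] by (simp add: Q_def ennreal_less_top)
      then have "integrable lborel (indicator (Q p) :: 'a \<Rightarrow> real)" using Qb by simp
      then have "integrable lebesgue (indicator (Q p) :: 'a \<Rightarrow> real)"
        using Qb by (subst integrable_completion) auto
      moreover have "(\<lambda>x. (indicator (Q p) x :: real)\<^sup>2) = indicator (Q p)"
        by (auto simp: indicator_def fun_eq_iff)
      ultimately have sqQ: "square_integrable (indicator (Q p) :: 'a \<Rightarrow> real)"
        by (auto simp: square_integrable_def)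
      have "inner (abs_L2 \<phi>) (abs_L2 (indicator (Q p))) = (LINT x|lebesgue. indicator (Q p) x * \<phi> x)"
        by (simp add: inner_abs_L2[OF sq sqQ] mult.commute)
      also have "\<dots> = (LINT x|lborel. indicator (Q p) x * \<phi> x)"
        using test_fun_measurable[OF \<phi>] Qb by (intro integral_completion) auto
      finally show ?thesis
        using \<delta> by (simp add: y_def power_mult_distrib Q_def)
    qed
    ultimately show "(norm (abs_L2 \<phi>))\<^sup>2 \<le>
      \<epsilon> * grad_inner U (abs_L2 \<phi>) (abs_L2 \<phi>) + (\<Sum>p\<in>grid \<delta> ` U. (inner (abs_L2 \<phi>) (y p))\<^sup>2)"
      using grid_poincare[OF \<phi> \<delta>] by (simp add: K\<delta>)
  qed
qed

end

section \<open>Attainment of the Rayleigh quotient\<close>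

lemma finite_family_convergent_subseq:
  fixes s :: "'i \<Rightarrow> nat \<Rightarrow> real"
  assumes "finite I" "\<And>i. i \<in> I \<Longrightarrow> bounded (range (s i))"
  shows "\<exists>r. strict_mono r \<and> (\<forall>i\<in>I. convergent (s i \<circ> r))"
  using assms
proof (induction I rule: finite_induct)
  case empty
  show ?case by (intro exI[of _ id]) (simp add: strict_mono_id)
next
  case (insert i I)
  then have "\<exists>r. strict_mono r \<and> (\<forall>i\<in>I. convergent (s i \<circ> r))"
    by blast
  then obtain r where r: "strict_mono r" "\<And>j. j \<in> I \<Longrightarrow> convergent (s j \<circ> r)"
    by blast
  have "bounded (range (s i \<circ> r))"
    using insert.prems[of i] by (auto intro: bounded_subset)
  then obtain l r' where r': "strict_mono r'" "(s i \<circ> r \<circ> r') \<longlonglongrightarrow> l"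
    using bounded_imp_convergent_subsequence by blast
  have "convergent (s j \<circ> (r \<circ> r'))" if "j \<in> insert i I" for j
  proof (cases "j = i")
    case True
    then show ?thesis using r'(2) by (auto simp: convergent_def o_assoc)
  next
    case False
    then obtain l where "(s j \<circ> r) \<longlonglongrightarrow> l"
      using r(2)[of j] \<open>j \<in> insert i I\<close> by (auto simp: convergent_def)
    then show ?thesis
      using LIMSEQ_subseq_LIMSEQ[OF _ r'(1)] by (auto simp: convergent_def o_assoc)
  qed
  then show ?case
    using strict_mono_o[OF r(1) r'(1)] by blast
qed

context bounded_open begin

lemma norm_parallelogram: "(norm (u - v))\<^sup>2 = 2 * (norm u)\<^sup>2 + 2 * (norm v)\<^sup>2 - (norm (u + v :: 'a L2))\<^sup>2"
  unfolding power2_norm_eq_inner by (simp add: inner_diff_left inner_diff_right inner_add_left inner_add_right)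

text \<open>Along a subsequence, a minimizing sequence of normalized test functions is Cauchy in L^2
  and in energy together. The parallelogram law bounds the energy of a difference by
  \<open>lam\<close> times its squared norm plus a small term, and \<open>rellich\<close> bounds
  that squared norm by half of itself plus small terms.\<close>

lemma rayleigh_minimizer:
  assumes ne: "\<exists>\<phi>. test_fun U \<phi> \<and> abs_L2 \<phi> \<noteq> 0"
  obtains u where "u \<in> sobolev_H10 U" "norm u = 1"
    "\<And>v. v \<in> sobolev_H10 U \<Longrightarrow> grad_inner U u u * (norm v)\<^sup>2 \<le> grad_inner U v v"
proof -
  define q where "q v = grad_inner U v v" for v
  define E where "E = {q (abs_L2 \<phi>) | \<phi>. test_fun U \<phi> \<and> norm (abs_L2 \<phi>) = 1}"
  define lam where "lam = Inf E"
  have q0: "0 \<le> q v" for v by (simp add: q_def grad_inner_nonneg)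
  have bdd: "bdd_below E" by (rule bdd_belowI[of _ 0]) (auto simp: E_def q0)
  have qscale: "q (c *\<^sub>R v) = c\<^sup>2 * q v" if "v \<in> sobolev_H10 U" for c v
    using that by (simp add: q_def grad_inner_scaleR_left grad_inner_scaleR_right power2_eq_square)
  have normalize: "\<exists>\<psi>. test_fun U \<psi> \<and> abs_L2 \<psi> = (1 / norm (abs_L2 \<phi>)) *\<^sub>R abs_L2 \<phi> \<and> norm (abs_L2 \<psi>) = 1"
    if "test_fun U \<phi>" "abs_L2 \<phi> \<noteq> 0" for \<phi>
  proof (intro exI conjI)
    show "test_fun U (\<lambda>x. 1 / norm (abs_L2 \<phi>) * \<phi> x)" using that(1) by (rule test_fun_scale)
    show *: "abs_L2 (\<lambda>x. 1 / norm (abs_L2 \<phi>) * \<phi> x) = (1 / norm (abs_L2 \<phi>)) *\<^sub>R abs_L2 \<phi>"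
      by (rule abs_L2_scaleR[OF test_fun_square_integrable[OF that(1)], symmetric])
    show "norm (abs_L2 (\<lambda>x. 1 / norm (abs_L2 \<phi>) * \<phi> x)) = 1"
      unfolding * using that(2) by simp
  qed
  have Ene: "E \<noteq> {}"
    using ne normalize unfolding E_def by blast
  have lam0: "0 \<le> lam"
    unfolding lam_def by (rule cInf_greatest[OF Ene]) (auto simp: E_def q0)
  have low_test: "lam * (norm (abs_L2 \<phi>))\<^sup>2 \<le> q (abs_L2 \<phi>)" if \<phi>: "test_fun U \<phi>" for \<phi>
  proof (cases "abs_L2 \<phi> = 0")
    case False
    obtain \<psi> where \<psi>: "test_fun U \<psi>" "abs_L2 \<psi> = (1 / norm (abs_L2 \<phi>)) *\<^sub>R abs_L2 \<phi>" "norm (abs_L2 \<psi>) = 1"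
      using normalize[OF \<phi> False] by blast
    have "lam \<le> q (abs_L2 \<psi>)"
      unfolding lam_def
    proof (rule cInf_lower[OF _ bdd])
      show "q (abs_L2 \<psi>) \<in> E" unfolding E_def using \<psi>(1,3) by blast
    qed
    then have "lam \<le> (1 / norm (abs_L2 \<phi>))\<^sup>2 * q (abs_L2 \<phi>)"
      unfolding \<psi>(2) qscale[OF test_fun_in_H10[OF \<phi>]] .
    then show ?thesis
      using False by (simp add: power_divide field_simps)
  qed (simp add: q0)
  have low: "lam * (norm v)\<^sup>2 \<le> q v" if vH: "v \<in> sobolev_H10 U" for v
  proof -
    obtain \<phi> where \<phi>: "\<And>n::nat. test_fun U (\<phi> n)" "(\<lambda>n. abs_L2 (\<phi> n)) \<longlonglongrightarrow> v"
      "\<And>b. b \<in> Basis \<Longrightarrow> (\<lambda>n. abs_L2 (pderiv_dir b (\<phi> n))) \<longlonglongrightarrow> weak_deriv U b v"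
      by (rule H10E[OF vH]) (rule that)
    have q_lim: "(\<lambda>n. q (abs_L2 (\<phi> n))) \<longlonglongrightarrow> q v"
      unfolding q_def grad_inner_def
    proof (intro tendsto_sum tendsto_inner)
      fix b :: 'a assume b: "b \<in> Basis"
      show "(\<lambda>n. weak_deriv U b (abs_L2 (\<phi> n))) \<longlonglongrightarrow> weak_deriv U b v"
        using \<phi>(3)[OF b] by (simp add: weak_deriv_test_fun[OF \<phi>(1) b])
      then show "(\<lambda>n. weak_deriv U b (abs_L2 (\<phi> n))) \<longlonglongrightarrow> weak_deriv U b v" .
    qed
    have "(\<lambda>n. lam * (norm (abs_L2 (\<phi> n)))\<^sup>2) \<longlonglongrightarrow> lam * (norm v)\<^sup>2"
      by (intro tendsto_intros \<phi>)
    from LIMSEQ_le[OF this q_lim] show ?thesis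
      using low_test[OF \<phi>(1)] by auto
  qed
  have "\<exists>\<phi>. test_fun U \<phi> \<and> norm (abs_L2 \<phi>) = 1 \<and> q (abs_L2 \<phi>) < lam + 1 / Suc n" for n :: nat
  proof -
    have "Inf E < lam + 1 / Suc n" by (simp add: lam_def)
    from cInf_lessD[OF Ene this] obtain z where "z \<in> E" "z < lam + 1 / Suc n" by blast
    moreover from \<open>z \<in> E\<close> obtain \<phi> where "z = q (abs_L2 \<phi>)" "test_fun U \<phi>" "norm (abs_L2 \<phi>) = 1"
      unfolding E_def mem_Collect_eq by (elim exE conjE)
    ultimately show ?thesis by metis
  qed
  then obtain \<phi>0 where \<phi>0: "\<And>n::nat. test_fun U (\<phi>0 n)" "\<And>n. norm (abs_L2 (\<phi>0 n)) = 1"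
    "\<And>n. q (abs_L2 (\<phi>0 n)) < lam + 1 / Suc n"
    by metis
  \<comment> \<open>With \<epsilon> lam \<le> 1 / 2 the norm term coming from \<open>qdiff\<close>
    can be absorbed into the left-hand side; adding 1 covers lam = 0.\<close>
  define \<epsilon> where "\<epsilon> = 1 / (2 * (lam + 1))"
  have \<epsilon>: "\<epsilon> > 0" "\<epsilon> * lam \<le> 1 / 2" "\<epsilon> \<le> 1"
    using lam0 by (auto simp: \<epsilon>_def field_simps)
  obtain I :: "'a set" and y where I: "finite I" and rel: "\<And>\<phi>. test_fun U \<phi> \<Longrightarrow> (norm (abs_L2 \<phi>))\<^sup>2 \<le>
      \<epsilon> * grad_inner U (abs_L2 \<phi>) (abs_L2 \<phi>) + (\<Sum>p\<in>I. (inner (abs_L2 \<phi>) (y p))\<^sup>2)"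
    by (rule rellich[OF \<epsilon>(1)]) (rule that)
  have "\<exists>r. strict_mono r \<and> (\<forall>p\<in>I. convergent ((\<lambda>n. inner (abs_L2 (\<phi>0 n)) (y p)) \<circ> r))"
  proof (rule finite_family_convergent_subseq[OF I])
    fix p
    show "bounded (range (\<lambda>n. inner (abs_L2 (\<phi>0 n)) (y p)))"
      unfolding bounded_iff using Cauchy_Schwarz_ineq2[of "abs_L2 (\<phi>0 _)" "y p"] \<phi>0(2)
      by (intro exI[of _ "norm (y p)"]) auto
  qed
  then obtain s where s: "strict_mono s" "\<And>p. p \<in> I \<Longrightarrow> convergent (\<lambda>n. inner (abs_L2 (\<phi>0 (s n))) (y p))"
    by (auto simp: o_def)
  define u where "u n = abs_L2 (\<phi>0 (s n))" for n
  have uH: "u n \<in> sobolev_H10 U" for n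
    unfolding u_def by (rule test_fun_in_H10[OF \<phi>0(1)])
  have u1: "norm (u n) = 1" for n by (simp add: u_def \<phi>0)
  have uq: "q (u n) < lam + 1 / Suc n" for n
  proof -
    have "1 / real (Suc (s n)) \<le> 1 / Suc n"
      using seq_suble[OF s(1), of n] by (intro divide_left_mono) auto
    then show ?thesis using \<phi>0(3)[of "s n"] by (simp add: u_def)
  qed
  have diff_test: "\<exists>\<psi>. test_fun U \<psi> \<and> u n - u m = abs_L2 \<psi>" for n m
  proof (intro exI conjI)
    show "test_fun U (\<lambda>x. \<phi>0 (s n) x + (- 1) * \<phi>0 (s m) x)"
      by (intro test_fun_add test_fun_scale \<phi>0)
    show "u n - u m = abs_L2 (\<lambda>x. \<phi>0 (s n) x + (- 1) * \<phi>0 (s m) x)"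
      unfolding u_def using abs_L2_diff[OF test_fun_square_integrable[OF \<phi>0(1)] test_fun_square_integrable[OF \<phi>0(1)]] by simp
  qed
  \<comment> \<open>Two parallelogram laws combined: the energy of \<open>u n + u m\<close> is at
    least \<open>lam\<close> times its squared norm, which is 4 minus the squared norm of the
    difference. The terms 4 lam cancel.\<close>
  have qdiff: "q (u n - u m) \<le> lam * (norm (u n - u m))\<^sup>2 + 2 / Suc n + 2 / Suc m" for n m
  proof -
    have "q (u n - u m) = 2 * q (u n) + 2 * q (u m) - q (u n + u m)"
      unfolding q_def by (rule grad_inner_parallelogram[OF uH uH])
    moreover have "lam * (norm (u n + u m))\<^sup>2 \<le> q (u n + u m)"
      by (rule low[OF subspace_add[OF H10_subspace uH uH]])
    moreover have "(norm (u n + u m))\<^sup>2 = 4 - (norm (u n - u m))\<^sup>2"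
      using norm_parallelogram[of "u n" "u m"] u1 by simp
    ultimately show ?thesis
      using uq[of n] uq[of m] by (simp add: right_diff_distrib)
  qed
  have Cauchy_fun: "\<exists>N. \<forall>n\<ge>N. \<forall>m\<ge>N. (\<Sum>p\<in>I. (inner (u n - u m) (y p))\<^sup>2) < e" if "e > 0" for e
  proof -
    \<comment> \<open>Makes \<open>card I\<close> squares of size e'^2 add up to less than
      \<open>e\<close>, with the \<open>+ 1\<close> covering an empty \<open>I\<close>.\<close>
    define e' where "e' = sqrt (e / (2 * (card I + 1)))"
    have "e * real (card I) < e * (2 * (real (card I) + 1))"
      using that by (intro mult_strict_left_mono) auto
    then have e': "e' > 0" "e'\<^sup>2 * card I < e"
      using that by (simp_all add: e'_def pos_divide_less_eq add_nonneg_pos)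
    have "\<forall>p\<in>I. \<exists>N. \<forall>n\<ge>N. \<forall>m\<ge>N. \<bar>inner (u n) (y p) - inner (u m) (y p)\<bar> < e'"
    proof
      fix p assume "p \<in> I"
      then have "Cauchy (\<lambda>n. inner (u n) (y p))"
        using s(2) by (simp add: u_def Cauchy_convergent_iff)
      then show "\<exists>N. \<forall>n\<ge>N. \<forall>m\<ge>N. \<bar>inner (u n) (y p) - inner (u m) (y p)\<bar> < e'"
        using e'(1) by (simp add: Cauchy_def dist_real_def)
    qed
    from bchoice[OF this] obtain N where "\<forall>p\<in>I. \<forall>n\<ge>N p. \<forall>m\<ge>N p. \<bar>inner (u n) (y p) - inner (u m) (y p)\<bar> < e'"
      by (elim exE)
    then have N: "\<bar>inner (u n) (y p) - inner (u m) (y p)\<bar> < e'" if "p \<in> I" "n \<ge> N p" "m \<ge> N p" for p n m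
      using that by simp
    show ?thesis
    proof (intro exI allI impI)
      fix n m assume nm: "n \<ge> (\<Sum>p\<in>I. N p)" "m \<ge> (\<Sum>p\<in>I. N p)"
      have "(\<Sum>p\<in>I. (inner (u n - u m) (y p))\<^sup>2) \<le> (\<Sum>p\<in>I. e'\<^sup>2)"
      proof (rule sum_mono)
        fix p assume p: "p \<in> I"
        have "N p \<le> (\<Sum>p\<in>I. N p)" using p I by (intro member_le_sum) auto
        then have "\<bar>inner (u n - u m) (y p)\<bar> < e'"
          using N[OF p, of n m] nm by (simp add: inner_diff_left)
        then show "(inner (u n - u m) (y p))\<^sup>2 \<le> e'\<^sup>2"
          using e'(1) by (simp add: abs_le_square_iff[symmetric])
      qed
      also have "\<dots> < e" using e'(2) by (simp add: mult.commute)
      finally show "(\<Sum>p\<in>I. (inner (u n - u m) (y p))\<^sup>2) < e" .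
    qed
  qed
  have small: "\<exists>N. \<forall>n\<ge>N. \<forall>m\<ge>N. (norm (u n - u m))\<^sup>2 < e \<and> q (u n - u m) < e" if "e > 0" for e
  proof -
    \<comment> \<open>The squared norm of a difference will be below \<open>4 * e1\<close>, and the
      main part of its energy below \<open>lam * (4 * e1)\<close>; this \<open>e1\<close> keeps each
      of them within e / 2.\<close>
    define e1 where "e1 = e / (8 * (lam + 1))"
    have e1: "e1 > 0" "lam * (4 * e1) \<le> e / 2" "4 * e1 \<le> e / 2"
      using that lam0 by (auto simp: e1_def field_simps)
    obtain N1 where N1: "\<And>n m. n \<ge> N1 \<Longrightarrow> m \<ge> N1 \<Longrightarrow> (\<Sum>p\<in>I. (inner (u n - u m) (y p))\<^sup>2) < e1"
      using Cauchy_fun[OF e1(1)] by blast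
    obtain N2 where N2: "4 / e1 < real N2" using reals_Archimedean2 by blast
    have sm: "2 / real (Suc n) < e1 / 2" if "n \<ge> N2" for n
    proof -
      have "4 / e1 < real (Suc n)" using N2 that by simp
      then show ?thesis using e1(1) by (simp add: field_simps)
    qed
    have "(norm (u n - u m))\<^sup>2 < e \<and> q (u n - u m) < e" if "n \<ge> max N1 N2" "m \<ge> max N1 N2" for n m
    proof -
      obtain \<psi> where \<psi>: "test_fun U \<psi>" "u n - u m = abs_L2 \<psi>" using diff_test by blast
      have "(norm (u n - u m))\<^sup>2 \<le> \<epsilon> * q (u n - u m) + (\<Sum>p\<in>I. (inner (u n - u m) (y p))\<^sup>2)"
        using rel[OF \<psi>(1)] by (simp add: \<psi>(2) q_def)
      moreover have "\<epsilon> * q (u n - u m) \<le> \<epsilon> * (lam * (norm (u n - u m))\<^sup>2 + e1)"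
        using qdiff[of n m] sm[of n] sm[of m] that \<epsilon>(1) by (intro mult_left_mono) auto
      moreover have "\<epsilon> * (lam * (norm (u n - u m))\<^sup>2 + e1) \<le> 1 / 2 * (norm (u n - u m))\<^sup>2 + e1"
      proof -
        have "\<epsilon> * lam * (norm (u n - u m))\<^sup>2 \<le> 1 / 2 * (norm (u n - u m))\<^sup>2"
          by (intro mult_right_mono \<epsilon>(2)) simp
        moreover have "\<epsilon> * e1 \<le> 1 * e1"
          using e1(1) by (intro mult_right_mono \<epsilon>(3)) simp
        moreover have "\<epsilon> * (lam * (norm (u n - u m))\<^sup>2 + e1) = \<epsilon> * lam * (norm (u n - u m))\<^sup>2 + \<epsilon> * e1"
          by (simp add: distrib_left)
        ultimately show ?thesis by linarith
      qed
      moreover have "(\<Sum>p\<in>I. (inner (u n - u m) (y p))\<^sup>2) < e1"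
        using N1 that by simp
      ultimately have nrm: "(norm (u n - u m))\<^sup>2 < 4 * e1" by linarith
      then have "lam * (norm (u n - u m))\<^sup>2 \<le> lam * (4 * e1)"
        using lam0 by (intro mult_left_mono) auto
      then have "q (u n - u m) \<le> e / 2 + 2 / Suc n + 2 / Suc m"
        using qdiff[of n m] e1(2) by linarith
      then show ?thesis using nrm e1 sm[of n] sm[of m] that by simp
    qed
    then show ?thesis by blast
  qed
  have "Cauchy u"
  proof (rule metric_CauchyI)
    fix e :: real assume "e > 0"
    then have "e\<^sup>2 > 0" by simp
    from small[OF this] obtain N where "\<forall>n\<ge>N. \<forall>m\<ge>N. (norm (u n - u m))\<^sup>2 < e\<^sup>2 \<and> q (u n - u m) < e\<^sup>2"
      by (elim exE)
    then have N: "(norm (u n - u m))\<^sup>2 < e\<^sup>2" if "n \<ge> N" "m \<ge> N" for n m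
      using that by simp
    show "\<exists>N. \<forall>m\<ge>N. \<forall>n\<ge>N. dist (u m) (u n) < e"
    proof (intro exI allI impI)
      fix m n assume "m \<ge> N" "n \<ge> N"
      from N[OF this] show "dist (u m) (u n) < e"
        using \<open>e > 0\<close> by (simp add: dist_norm power2_less_imp_less)
    qed
  qed
  then obtain l where l: "u \<longlonglongrightarrow> l"
    by (auto simp: Cauchy_convergent_iff convergent_def)
  have lim: "l \<in> sobolev_H10 U" "(\<lambda>n. q (u n)) \<longlonglongrightarrow> q l"
  proof -
    have C: "\<exists>N. \<forall>m\<ge>N. \<forall>n\<ge>N. grad_inner U (abs_L2 (\<phi>0 (s m)) - abs_L2 (\<phi>0 (s n))) (abs_L2 (\<phi>0 (s m)) - abs_L2 (\<phi>0 (s n))) < e"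
      if "e > 0" for e
      using small[OF that] unfolding q_def u_def by blast
    show "l \<in> sobolev_H10 U"
      by (rule H10_limit(1)[OF \<phi>0(1) l[unfolded u_def] C])
    show "(\<lambda>n. q (u n)) \<longlonglongrightarrow> q l"
      unfolding q_def u_def by (rule H10_limit(2)[OF \<phi>0(1) l[unfolded u_def] C])
  qed
  have "(\<lambda>n. norm (u n)) \<longlonglongrightarrow> norm l" by (intro tendsto_intros l)
  then have l1: "norm l = 1" by (simp add: u1 LIMSEQ_const_iff)
  have "q l \<le> lam"
  proof (rule LIMSEQ_le[OF lim(2)])
    show "(\<lambda>n. lam + 1 / Suc n) \<longlonglongrightarrow> lam"
      using LIMSEQ_inverse_real_of_nat_add[of lam] by (simp add: inverse_eq_divide)
    show "\<exists>N. \<forall>n\<ge>N. q (u n) \<le> lam + 1 / real (Suc n)"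
      using uq less_imp_le by blast
  qed
  moreover have "lam \<le> q l" using low[OF lim(1)] l1 by simp
  ultimately have "q l = lam" by simp
  then show ?thesis
    using that[OF lim(1) l1] low by (simp add: q_def)
qed

text \<open>Minimality makes 2 t B + t^2 C nonnegative for all t, so the first variation B vanishes
  and \<open>u\<close> is an eigenfunction. Testing any eigenvalue equation with its own
  eigenfunction shows that the eigenvalue is a Rayleigh quotient, so none is smaller.\<close>

lemma first_eigenvalue_rayleigh:
  assumes u: "u \<in> sobolev_H10 U" "norm u = 1"
    and min: "\<And>v. v \<in> sobolev_H10 U \<Longrightarrow> grad_inner U u u * (norm v)\<^sup>2 \<le> grad_inner U v v"
  shows "first_eigenvalue U = grad_inner U u u"
  unfolding first_eigenvalue_def
proof (rule Least_equality)
  define lam where "lam = grad_inner U u u"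
  have weak: "grad_inner U u v = lam * inner u v" if v: "v \<in> sobolev_H10 U" for v
  proof -
    define B where "B = grad_inner U u v - lam * inner u v"
    define C where "C = grad_inner U v v - lam * (norm v)\<^sup>2"
    have *: "0 \<le> 2 * t * B + t\<^sup>2 * C" for t
    proof -
      have tv: "t *\<^sub>R v \<in> sobolev_H10 U" by (rule subspace_scale[OF H10_subspace v])
      have "lam * (norm (u + t *\<^sub>R v))\<^sup>2 \<le> grad_inner U (u + t *\<^sub>R v) (u + t *\<^sub>R v)"
        unfolding lam_def by (rule min[OF subspace_add[OF H10_subspace u(1) tv]])
      moreover have "grad_inner U (u + t *\<^sub>R v) (u + t *\<^sub>R v) = lam + 2 * t * grad_inner U u v + t\<^sup>2 * grad_inner U v v"
        using grad_inner_commute[of v u]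
        by (simp add: grad_inner_add_left[OF u(1) tv] grad_inner_add_right[OF u(1) tv] grad_inner_scaleR_left[OF v]
            grad_inner_scaleR_right[OF v] lam_def power2_eq_square algebra_simps)
      moreover have "(norm (u + t *\<^sub>R v))\<^sup>2 = 1 + 2 * t * inner u v + t\<^sup>2 * (norm v)\<^sup>2"
        using u(2) inner_commute[of v u] unfolding power2_norm_eq_inner
        by (simp add: inner_add_left inner_add_right norm_eq_1 power2_eq_square algebra_simps)
      ultimately show ?thesis by (simp add: B_def C_def algebra_simps)
    qed
    have "B = 0"
    proof (rule ccontr)
      assume "B \<noteq> 0"
      \<comment> \<open>At t = - B / k the quadratic takes the value (B^2 / k) (C / k - 2), which is
        negative because C < k.\<close>
      define k where "k = \<bar>C\<bar> + 1"
      have k: "k > 0" "C < k" by (auto simp: k_def)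
      have "2 * (- B / k) * B + (- B / k)\<^sup>2 * C = (B\<^sup>2 / k) * (C / k - 2)"
        using k(1) by (simp add: power2_eq_square field_simps)
      moreover have "C / k < 1" using k by (simp add: field_simps)
      moreover have "B\<^sup>2 / k > 0" using \<open>B \<noteq> 0\<close> k(1) by simp
      then have "(B\<^sup>2 / k) * (C / k - 2) < 0"
        using \<open>C / k < 1\<close> by (intro mult_pos_neg) auto
      ultimately have "2 * (- B / k) * B + (- B / k)\<^sup>2 * C < 0"
        by linarith
      with *[of "- B / k"] show False by linarith
    qed
    then show ?thesis by (simp add: B_def)
  qed
  have "u \<noteq> 0" using u(2) by auto
  moreover have "dirichlet_laplacian U u (- grad_inner U u u *\<^sub>R u)"
    unfolding dirichlet_laplacian_def
  proof (intro conjI ballI u(1) subspace_scale[OF L2_on_subspace H10_sub_L2_on[OF u(1)]])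
    fix v assume "v \<in> sobolev_H10 U"
    from weak[OF this] show "inner (- grad_inner U u u *\<^sub>R u) v = - grad_inner U u v"
      by (simp only: lam_def inner_scaleR_left mult_minus_left)
  qed
  ultimately show "\<exists>v. v \<noteq> 0 \<and> dirichlet_laplacian U v (- grad_inner U u u *\<^sub>R v)"
    by (intro exI[of _ u] conjI)
  fix l assume "\<exists>v. v \<noteq> 0 \<and> dirichlet_laplacian U v (- l *\<^sub>R v)"
  then obtain v where v1: "v \<noteq> 0" and d: "dirichlet_laplacian U v (- l *\<^sub>R v)"
    by (elim exE conjE)
  from d have v2: "v \<in> sobolev_H10 U"
    by (simp add: dirichlet_laplacian_def)
  then have v3: "inner (- l *\<^sub>R v) v = - grad_inner U v v"
    using d unfolding dirichlet_laplacian_def by (elim conjE) (rule bspec)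
  note v = v1 v2 v3
  have "grad_inner U u u * (norm v)\<^sup>2 \<le> l * (norm v)\<^sup>2"
    using min[OF v(2)] v(3) by (simp add: power2_norm_eq_inner)
  then show "grad_inner U u u \<le> l" using v(1) by simp
qed

text \<open>The minimizer is what gives the \<open>LEAST\<close> in \<open>first_eigenvalue\<close>
  its value. A nonzero \<open>v\<close>, being a limit of test functions, guarantees the nonzero
  test function that \<open>rayleigh_minimizer\<close> starts from.\<close>

theorem poincare_first_eigenvalue:
  assumes v: "v \<in> sobolev_H10 U"
  shows "first_eigenvalue U * (norm v)\<^sup>2 \<le> grad_inner U v v"
proof (cases "v = 0")
  case True
  then show ?thesis by (simp add: grad_inner_nonneg)
next
  case False
  obtain \<phi> where \<phi>: "\<And>n::nat. test_fun U (\<phi> n)" "(\<lambda>n. abs_L2 (\<phi> n)) \<longlonglongrightarrow> v"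
    "\<And>b. b \<in> Basis \<Longrightarrow> (\<lambda>n. abs_L2 (pderiv_dir b (\<phi> n))) \<longlonglongrightarrow> weak_deriv U b v"
    by (rule H10E[OF v]) (rule that)
  have "\<exists>n. abs_L2 (\<phi> n) \<noteq> 0"
  proof (rule ccontr)
    assume "\<nexists>n. abs_L2 (\<phi> n) \<noteq> 0"
    then have "(\<lambda>n. 0) \<longlonglongrightarrow> v" using \<phi>(2) by simp
    then show False using False by (simp add: LIMSEQ_const_iff)
  qed
  then have "\<exists>\<phi>. test_fun U \<phi> \<and> abs_L2 \<phi> \<noteq> 0" using \<phi>(1) by blast
  then obtain u where u: "u \<in> sobolev_H10 U" "norm u = 1"
    "\<And>v. v \<in> sobolev_H10 U \<Longrightarrow> grad_inner U u u * (norm v)\<^sup>2 \<le> grad_inner U v v"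
    by (rule rayleigh_minimizer) (rule that)
  show ?thesis
    using u(3)[OF v] first_eigenvalue_rayleigh[OF u] by simp
qed

end

section \<open>Finite-dimensional subspaces and monotone equations\<close>

lemma finite_dim_orthonormal_basis:
  fixes V :: "'b::real_inner set"
  assumes V: "subspace V" and S: "finite S" "V \<subseteq> span S"
  obtains E where "finite E" "span E = V" "\<And>e. e \<in> E \<Longrightarrow> norm e = 1"
    "\<And>e e'. e \<in> E \<Longrightarrow> e' \<in> E \<Longrightarrow> e \<noteq> e' \<Longrightarrow> inner e e' = 0"
proof -
  obtain B where B: "B \<subseteq> V" "independent B" "V \<subseteq> span B" "card B = dim V"
    by (rule basis_exists[of V]) (rule that)
  have "finite B"
    using independent_span_bound[OF S(1) B(2) order_trans[OF B(1) S(2)]] by simp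
  from basis_orthogonal[OF this] obtain C where C: "finite C" "card C \<le> card B" "span C = span B" "pairwise orthogonal C"
    by (elim exE conjE)
  have CV: "span C = V"
    unfolding C(3) using B V by (intro antisym span_minimal) auto
  \<comment> \<open>An orthogonal spanning set may contain 0, which has to be removed before
    normalizing.\<close>
  define E where "E = (\<lambda>x. x /\<^sub>R norm x) ` (C - {0})"
  have "span E = span C"
  proof (rule antisym)
    have "E \<subseteq> span C"
      unfolding E_def by (auto intro: span_scale span_base)
    then show "span E \<subseteq> span C" by (rule span_minimal) (rule subspace_span)
    have "x \<in> span E" if "x \<in> C" for x
    proof (cases "x = 0")
      case False
      then have "x /\<^sub>R norm x \<in> span E"
        using that by (intro span_base) (auto simp: E_def)
      then have "norm x *\<^sub>R (x /\<^sub>R norm x) \<in> span E" by (rule span_scale)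
      then show ?thesis using False by simp
    qed (simp add: span_zero)
    then show "span C \<subseteq> span E" by (intro span_minimal subspace_span) auto
  qed
  then have spE: "span E = V" using CV by simp
  have finite_E: "finite E" using C(1) by (simp add: E_def)
  have nE: "norm e = 1" if "e \<in> E" for e
  proof -
    obtain x where "e = x /\<^sub>R norm x" "x \<noteq> 0" using \<open>e \<in> E\<close> by (auto simp: E_def)
    then show ?thesis by simp
  qed
  have oE: "inner e e' = 0" if "e \<in> E" "e' \<in> E" "e \<noteq> e'" for e e'
  proof -
    obtain x x' where "x \<in> C" "e = x /\<^sub>R norm x" "x' \<in> C" "e' = x' /\<^sub>R norm x'"
      using \<open>e \<in> E\<close> \<open>e' \<in> E\<close> by (auto simp: E_def)
    then show ?thesis using \<open>e \<noteq> e'\<close> C(4) by (cases "x = x'") (auto simp: pairwise_def orthogonal_def)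
  qed
  show ?thesis
    by (rule that[OF finite_E spE nE oE])
qed

locale orthonormal_span =
  fixes E V :: "'b::{real_inner, complete_space} set"
  assumes finite_E: "finite E" and V_eq: "V = span E"
    and norm_E: "\<And>e. e \<in> E \<Longrightarrow> norm e = 1"
    and orth_E: "\<And>e e'. e \<in> E \<Longrightarrow> e' \<in> E \<Longrightarrow> e \<noteq> e' \<Longrightarrow> inner e e' = 0"
begin

text \<open>The orthogonal projection onto \<open>V\<close>, defined on the whole space: composing
  with it turns maps on the set \<open>V\<close> into maps on the type.\<close>

definition pr :: "'b \<Rightarrow> 'b" where "pr x = (\<Sum>e\<in>E. inner x e *\<^sub>R e)"

lemma V_subspace: "subspace V" unfolding V_eq by (rule subspace_span)

lemma E_in_V: "e \<in> E \<Longrightarrow> e \<in> V" unfolding V_eq by (rule span_base)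

lemma pr_in_V: "pr x \<in> V"
  unfolding pr_def by (intro subspace_sum[OF V_subspace] subspace_scale[OF V_subspace] E_in_V)

lemma inner_sum_E:
  assumes "e \<in> E"
  shows "inner e (\<Sum>e'\<in>E. c e' *\<^sub>R e') = c e"
proof -
  have "inner e (\<Sum>e'\<in>E. c e' *\<^sub>R e') = (\<Sum>e'\<in>E. if e' = e then c e else 0)"
    unfolding inner_sum_right using assms norm_E orth_E
    by (intro sum.cong refl) (auto simp: norm_eq_1)
  then show ?thesis using assms finite_E by simp
qed

lemma inner_pr:
  assumes "v \<in> V"
  shows "inner v (pr x) = inner v x"
  using assms unfolding V_eq
proof (induction rule: span_induct_alt)
  case (step c e v)
  have "inner e (pr x) = inner e x"
    using inner_sum_E[OF step(1), of "\<lambda>e. inner x e"] by (simp add: pr_def inner_commute)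
  then show ?case using step by (simp add: inner_add_left)
qed simp

lemma V_eqI:
  assumes "w \<in> V" "w' \<in> V" "\<And>v. v \<in> V \<Longrightarrow> inner v w = inner v w'"
  shows "w = w'"
proof -
  have "inner (w - w') (w - w') = 0"
    using assms(3)[OF subspace_diff[OF V_subspace assms(1,2)]] by (simp add: inner_diff_right)
  then show ?thesis by simp
qed

lemma pr_id: "v \<in> V \<Longrightarrow> pr v = v"
  by (rule V_eqI[OF pr_in_V _ inner_pr])

lemma pr_diff: "pr x - pr y = pr (x - y)"
  by (simp add: pr_def inner_diff_left scaleR_left_diff_distrib sum_subtractf)

lemma norm_pr_le: "norm (pr x) \<le> norm x"
proof (cases "pr x = 0")
  case False
  have "norm (pr x) * norm (pr x) = inner (pr x) x"
    using inner_pr[OF pr_in_V, of x x] unfolding power2_eq_square[symmetric] power2_norm_eq_inner .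
  also have "\<dots> \<le> norm (pr x) * norm x" by (rule norm_cauchy_schwarz)
  finally show ?thesis using False by simp
qed simp

lemma pr_lipschitz: "norm (pr x - pr y) \<le> norm (x - y)"
  unfolding pr_diff by (rule norm_pr_le)

lemma pr_continuous: "continuous_on S pr"
  by (rule lipschitz_on_continuous_on[of 1]) (auto intro!: lipschitz_onI simp: dist_norm pr_lipschitz)

lemma V_closed: "closed V"
proof -
  have "V = {x. pr x = x}" using pr_id pr_in_V by auto metis
  then show ?thesis
    using closed_Collect_eq[OF pr_continuous continuous_on_id] by simp
qed

lemma norm_le_sum_E:
  assumes "w \<in> V"
  shows "norm w \<le> (\<Sum>e\<in>E. \<bar>inner w e\<bar>)"
proof -
  have "w = (\<Sum>e\<in>E. inner w e *\<^sub>R e)" using pr_id[OF assms] by (simp add: pr_def)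
  then have "norm w \<le> (\<Sum>e\<in>E. norm (inner w e *\<^sub>R e))"
    by (metis norm_sum)
  also have "\<dots> = (\<Sum>e\<in>E. \<bar>inner w e\<bar>)"
    using norm_E by (intro sum.cong) auto
  finally show ?thesis .
qed

text \<open>A strongly monotone, locally Lipschitz equation is solved by a damped Picard iteration, which is
  a contraction of a large ball.\<close>

lemma monotone_equation_solvable:
  assumes \<Phi>: "\<And>x. x \<in> V \<Longrightarrow> \<Phi> x \<in> V" and c: "c > 0"
    and mono: "\<And>x y. x \<in> V \<Longrightarrow> y \<in> V \<Longrightarrow> c * (norm (x - y))\<^sup>2 \<le> inner (x - y) (\<Phi> x - \<Phi> y)"
    and lip: "\<And>R. \<exists>L. \<forall>x\<in>V. \<forall>y\<in>V. norm x \<le> R \<longrightarrow> norm y \<le> R \<longrightarrow> norm (\<Phi> x - \<Phi> y) \<le> L * norm (x - y)"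
    and y: "y \<in> V"
  shows "\<exists>x\<in>V. \<Phi> x = y"
proof -
  \<comment> \<open>With this radius, norm (T 0) = \<theta> norm (\<Phi> 0 - y) is at most (1 - k)
    R, so the k-contraction \<open>T\<close> maps the ball into itself. The \<open>+ 1\<close> keeps
    the radius positive.\<close>
  define R where "R = 2 * norm (\<Phi> 0 - y) / c + 1"
  obtain L0 where L0: "\<And>x z. x \<in> V \<Longrightarrow> z \<in> V \<Longrightarrow> norm x \<le> R \<Longrightarrow> norm z \<le> R \<Longrightarrow> norm (\<Phi> x - \<Phi> z) \<le> L0 * norm (x - z)"
    using lip[of R] by blast
  define L where "L = max L0 c"
  have L: "norm (\<Phi> x - \<Phi> z) \<le> L * norm (x - z)" if "x \<in> V" "z \<in> V" "norm x \<le> R" "norm z \<le> R" for x z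
    using L0[OF that] mult_right_mono[of L0 L "norm (x - z)"] by (simp add: L_def)
  have Lc: "c \<le> L" "L > 0" using c by (auto simp: L_def)
  \<comment> \<open>Minimizes 1 - 2 \<theta> c + \<theta>^2 L^2, the bound for the squared
    contraction factor; the minimum 1 - \<theta> c is at most k^2. Taking L \<ge> c ensures \<theta>
    c \<le> 1.\<close>
  define \<theta> where "\<theta> = c / L\<^sup>2"
  have \<theta>: "\<theta> > 0" using c Lc by (simp add: \<theta>_def)
  define k where "k = 1 - \<theta> * c / 2"
  have \<theta>c: "\<theta> * c \<le> 1"
  proof -
    have "c * c \<le> L * L" using c Lc by (intro mult_mono) auto
    then show ?thesis using Lc by (simp add: \<theta>_def power2_eq_square field_simps)
  qed
  have k: "0 \<le> k" "k < 1" using \<theta>c \<theta> c by (auto simp: k_def)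
  define T where "T x = x - \<theta> *\<^sub>R (\<Phi> x - y)" for x
  define X where "X = V \<inter> cball 0 R"
  have contr: "norm (T x - T z) \<le> k * norm (x - z)" if "x \<in> X" "z \<in> X" for x z
  proof -
    have xz: "x \<in> V" "z \<in> V" "norm x \<le> R" "norm z \<le> R" using that by (auto simp: X_def)
    define d where "d = norm (x - z)"
    have "(norm (\<Phi> x - \<Phi> z))\<^sup>2 \<le> (L * d)\<^sup>2"
      using L[OF xz] by (intro power_mono) (auto simp: d_def)
    then have "\<theta>\<^sup>2 * (norm (\<Phi> x - \<Phi> z))\<^sup>2 \<le> \<theta>\<^sup>2 * (L * d)\<^sup>2" by (intro mult_left_mono) auto
    also have "\<theta>\<^sup>2 * (L * d)\<^sup>2 = \<theta> * c * d\<^sup>2"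
      using Lc by (simp add: \<theta>_def power2_eq_square field_simps)
    finally have a: "\<theta>\<^sup>2 * (norm (\<Phi> x - \<Phi> z))\<^sup>2 \<le> \<theta> * c * d\<^sup>2" .
    have b: "\<theta> * (c * d\<^sup>2) \<le> \<theta> * inner (x - z) (\<Phi> x - \<Phi> z)"
      using mono[OF xz(1,2)] \<theta> by (intro mult_left_mono) (auto simp: d_def)
    have T_diff: "T x - T z = (x - z) - \<theta> *\<^sub>R (\<Phi> x - \<Phi> z)"
      by (simp add: T_def algebra_simps)
    have "(norm (T x - T z))\<^sup>2 = d\<^sup>2 - 2 * (\<theta> * inner (x - z) (\<Phi> x - \<Phi> z)) + \<theta>\<^sup>2 * (norm (\<Phi> x - \<Phi> z))\<^sup>2"
      unfolding T_diff d_def power2_norm_eq_inner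
      by (simp add: inner_diff_left inner_diff_right inner_commute power2_eq_square algebra_simps)
    also have "\<dots> \<le> d\<^sup>2 - \<theta> * c * d\<^sup>2" using a b by (simp add: mult.assoc)
    also have "\<dots> \<le> d\<^sup>2 - \<theta> * c * d\<^sup>2 + (\<theta> * c / 2)\<^sup>2 * d\<^sup>2" by simp
    also have "\<dots> = (k * d)\<^sup>2" by (simp add: k_def power2_eq_square algebra_simps)
    finally have "(norm (T x - T z))\<^sup>2 \<le> (k * d)\<^sup>2" .
    then show ?thesis
      unfolding d_def by (rule power2_le_imp_le) (use k in simp)
  qed
  have 0: "0 \<in> X" using c by (auto simp: X_def R_def subspace_0[OF V_subspace] intro!: add_nonneg_nonneg)
  have cX: "closed X"
    unfolding X_def using V_closed by auto
  have TX: "T ` X \<subseteq> X"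
  proof
    fix t assume "t \<in> T ` X"
    then obtain x where x: "x \<in> X" "t = T x" by blast
    have "norm (T x) \<le> norm (T x - T 0) + norm (T 0)"
      using norm_triangle_ineq[of "T x - T 0" "T 0"] by simp
    also have "norm (T x - T 0) \<le> k * R"
      using contr[OF x(1) 0] x(1) k by (auto simp: X_def intro: order_trans mult_left_mono)
    also have "norm (T 0) \<le> \<theta> * c / 2 * R"
    proof -
      have "norm (\<Phi> 0 - y) \<le> c / 2 * R" using c by (simp add: R_def field_simps)
      then have "\<theta> * norm (\<Phi> 0 - y) \<le> \<theta> * (c / 2 * R)" using \<theta> by (intro mult_left_mono) auto
      then show ?thesis using \<theta> by (simp add: T_def norm_minus_commute)
    qed
    finally have "norm (T x) \<le> R" by (simp add: k_def algebra_simps)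
    moreover have "T x \<in> V"
      unfolding T_def using x(1) \<Phi> y by (intro subspace_diff subspace_scale V_subspace) (auto simp: X_def)
    ultimately show "t \<in> X" by (simp add: x X_def)
  qed
  have "\<exists>!x\<in>X. T x = x"
    by (rule Banach_fix[OF complete_eq_closed[THEN iffD2, OF cX] _ k TX]) (use 0 contr in \<open>auto simp: dist_norm\<close>)
  then obtain x where "x \<in> X" "T x = x" by blast
  then have "x \<in> V" "\<Phi> x = y" using \<theta> by (auto simp: T_def X_def)
  then show ?thesis by blast
qed

end

section \<open>Finite element functions\<close>

context bounded_open begin

text \<open>Affine pieces are glued along segments: the preimages of the finitely many closed pieces
  cover [0, 1], and on each of them the function has one common Lipschitz constant. A cell cut by
  the closure of \<open>U\<close> may be disconnected, so gluing has to work for arbitrary closed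
  pieces.\<close>

lemma fe_function_lipschitz:
  assumes T: "finite T" "\<And>S. S \<in> T \<Longrightarrow> closed S" "closure U \<subseteq> \<Union>T"
    and aff: "\<And>S. S \<in> T \<Longrightarrow> \<exists>a c. \<forall>x\<in>S \<inter> closure U. v x = inner a x + c"
    and bd: "\<And>x. x \<in> frontier U \<Longrightarrow> v x = 0"
  obtains L where "L-lipschitz_on UNIV (\<lambda>x. if x \<in> U then v x else 0)"
proof -
  define w where "w x = (if x \<in> U then v x else 0)" for x
  obtain a c where ac: "\<And>S x. S \<in> T \<Longrightarrow> x \<in> S \<inter> closure U \<Longrightarrow> v x = inner (a S) x + c S"
    using aff by metis
  have wv: "w x = v x" if "x \<in> closure U" for x
    using that bd open_U by (auto simp: w_def frontier_def interior_open)
  define L where "L = (\<Sum>S\<in>T. norm (a S))"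
  have L0: "0 \<le> L" by (simp add: L_def sum_nonneg)
  \<comment> \<open>The complement of \<open>U\<close> is one more closed piece, on which the
    extension by zero vanishes; the zero boundary values make it consistent with the cells.\<close>
  define \<K> where "\<K> = insert (- U) ((\<lambda>S. S \<inter> closure U) ` T)"
  have K: "finite \<K>" "\<And>K. K \<in> \<K> \<Longrightarrow> closed K" "\<Union>\<K> = UNIV"
    using T open_U closure_subset[of U] by (auto simp: \<K>_def)
  have lipK: "\<bar>w x - w y\<bar> \<le> L * norm (x - y)" if K: "K \<in> \<K>" "x \<in> K" "y \<in> K" for K x y
  proof (cases "K = - U")
    case True
    then show ?thesis using that L0 by (simp add: w_def)
  next
    case False
    then obtain S where S: "S \<in> T" "K = S \<inter> closure U" using K by (auto simp: \<K>_def)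
    have "w x - w y = inner (a S) (x - y)"
      using ac[OF S(1), of x] ac[OF S(1), of y] wv K S by (simp add: inner_diff_right)
    then have "\<bar>w x - w y\<bar> \<le> norm (a S) * norm (x - y)"
      by (simp add: Cauchy_Schwarz_ineq2)
    also have "\<dots> \<le> L * norm (x - y)"
      unfolding L_def using S(1) T(1) by (intro mult_right_mono member_le_sum) auto
    finally show ?thesis .
  qed
  have "\<bar>w x - w y\<bar> \<le> L * norm (x - y)" for x y
  proof -
    define p where "p t = x + t *\<^sub>R (y - x)" for t :: real
    have pc: "continuous_on UNIV p" unfolding p_def by (intro continuous_intros)
    have "(L * norm (x - y))-lipschitz_on {0..1} (\<lambda>t. w (p t))"
    proof (rule lipschitz_on_closed_Union[where I = \<K> and U = "\<lambda>K. p -` K"])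
      fix K assume K': "K \<in> \<K>"
      show "closed (p -` K)"
        by (rule closed_vimage[OF K(2)[OF K'] pc])
      show "(L * norm (x - y))-lipschitz_on (p -` K) (\<lambda>t. w (p t))"
      proof (rule lipschitz_onI)
        fix s t assume "s \<in> p -` K" "t \<in> p -` K"
        then have "\<bar>w (p s) - w (p t)\<bar> \<le> L * norm (p s - p t)"
          by (intro lipK[OF K']) auto
        also have "p s - p t = (s - t) *\<^sub>R (y - x)" by (simp add: p_def algebra_simps)
        finally show "dist (w (p s)) (w (p t)) \<le> L * norm (x - y) * dist s t"
          by (simp add: dist_real_def norm_minus_commute mult_ac)
      qed (use L0 in simp)
    next
      show "{0..1} \<subseteq> (\<Union>K\<in>\<K>. p -` K)" using K(3) by blast
    qed (use K(1) L0 in auto)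
    from lipschitz_onD[OF this, of 0 1] show ?thesis by (simp add: p_def dist_real_def)
  qed
  then have "L-lipschitz_on UNIV w" using L0 by (intro lipschitz_onI) (auto simp: dist_norm)
  then show ?thesis by (intro that[of L]) (simp add: w_def[abs_def])
qed

end

locale fe_mesh = bounded_open U for U :: "'a::euclidean_space set" +
  fixes T :: "'a set set"
  assumes mesh: "finite T" "\<And>S. S \<in> T \<Longrightarrow> closed S" "closure U \<subseteq> \<Union>T"
begin

abbreviation "V \<equiv> fe_space U T"

lemma fe_spaceE:
  assumes "u \<in> V"
  obtains w L where "u = abs_L2 w" "L-lipschitz_on UNIV w" "\<And>x. x \<notin> U \<Longrightarrow> w x = 0"
    "continuous_on (closure U) w" "\<And>S. S \<in> T \<Longrightarrow> \<exists>a c. \<forall>x\<in>S \<inter> closure U. w x = inner a x + c"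
proof -
  obtain v where v: "u = abs_L2 (\<lambda>x. if x \<in> U then v x else 0)" "continuous_on (closure U) v"
     "\<forall>S\<in>T. \<exists>a c. \<forall>x\<in>S \<inter> closure U. v x = inner a x + c" "\<forall>x\<in>frontier U. v x = 0"
    using assms unfolding fe_space_def mem_Collect_eq by (elim exE conjE)
  obtain L where L: "L-lipschitz_on UNIV (\<lambda>x. if x \<in> U then v x else 0)"
  proof -
    have aff: "\<exists>a c. \<forall>x\<in>S \<inter> closure U. v x = inner a x + c" if "S \<in> T" for S
      using v(3) that by (rule bspec)
    have bd: "v x = 0" if "x \<in> frontier U" for x
      using v(4) that by (rule bspec)
    show thesis
      by (rule fe_function_lipschitz[where T = T and v = v, OF mesh aff bd]) (assumption | rule that | simp)+
  qed
  have wv: "(if x \<in> U then v x else 0) = v x" if "x \<in> closure U" for x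
    using that v(4) open_U by (auto simp: frontier_def interior_open)
  show ?thesis
  proof (rule that[OF v(1) L])
    show "continuous_on (closure U) (\<lambda>x. if x \<in> U then v x else 0)"
      using v(2) by (subst continuous_on_cong[OF refl wv]) auto
    fix S assume "S \<in> T"
    with v(3) have "\<exists>a c. \<forall>x\<in>S \<inter> closure U. v x = inner a x + c" by (rule bspec)
    then obtain a c where "\<forall>x\<in>S \<inter> closure U. v x = inner a x + c" by (elim exE)
    then show "\<exists>a c. \<forall>x\<in>S \<inter> closure U. (if x \<in> U then v x else 0) = inner a x + c"
      using wv by (intro exI[of _ a] exI[of _ c]) simp
  qed simp
qed

lemma fe_spaceI:
  assumes L: "L-lipschitz_on UNIV w" and out: "\<And>x. x \<notin> U \<Longrightarrow> w x = 0"
    and aff: "\<And>S. S \<in> T \<Longrightarrow> \<exists>a c. \<forall>x\<in>S \<inter> closure U. w x = inner a x + c"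
  shows "abs_L2 w \<in> V"
proof -
  have eq: "(\<lambda>x. if x \<in> U then w x else 0) = w" using out by auto
  show ?thesis
    unfolding fe_space_def
  proof (intro CollectI exI[of _ w] conjI ballI aff)
    show "abs_L2 w = abs_L2 (\<lambda>x. if x \<in> U then w x else 0)" unfolding eq ..
    show "continuous_on (closure U) w"
      by (rule continuous_on_subset[OF lipschitz_on_continuous_on[OF L] subset_UNIV])
    show "w x = 0" if "x \<in> frontier U" for x
      using that out open_U by (auto simp: frontier_def interior_open)
  qed
qed

lemma fe_space_H10: "u \<in> V \<Longrightarrow> u \<in> sobolev_H10 U"
  by (elim fe_spaceE) (simp add: lipschitz_in_H10)

lemma fe_space_L2_on: "u \<in> V \<Longrightarrow> u \<in> L2_on U"
  by (rule H10_sub_L2_on[OF fe_space_H10])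

lemma fe_space_bounded:
  assumes "u \<in> V"
  obtains B where "AE x in lebesgue. \<bar>rep_L2 u x\<bar> \<le> B"
proof -
  obtain w L where w: "u = abs_L2 w" "L-lipschitz_on UNIV w" "\<And>x. x \<notin> U \<Longrightarrow> w x = 0"
    by (rule fe_spaceE[OF assms]) (rule that)
  obtain B where B: "\<And>x. \<bar>w x\<bar> \<le> B" using lipschitz_vanishing_bounded[OF w(2,3)] by blast
  have sq: "square_integrable w" by (rule square_integrable_lipschitz[OF w(2,3)])
  have "AE x in lebesgue. \<bar>rep_L2 u x\<bar> \<le> B"
    using rep_abs_L2[OF sq] unfolding w(1) by eventually_elim (simp add: B)
  then show ?thesis by (rule that)
qed

lemma fe_space_subspace: "subspace V"
proof (rule subspaceI)
  have "abs_L2 (\<lambda>x. 0) \<in> V"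
    by (rule fe_spaceI[of 0]) (auto intro!: lipschitz_onI exI[of _ 0])
  then show "0 \<in> V" by (simp add: zero_L2.abs_eq)
next
  fix u v assume "u \<in> V" "v \<in> V"
  obtain w L where w: "u = abs_L2 w" "L-lipschitz_on UNIV w" "\<And>x. x \<notin> U \<Longrightarrow> w x = 0"
    "\<And>S. S \<in> T \<Longrightarrow> \<exists>a c. \<forall>x\<in>S \<inter> closure U. w x = inner a x + c"
    by (rule fe_spaceE[OF \<open>u \<in> V\<close>]) (rule that)
  obtain w' L' where w': "v = abs_L2 w'" "L'-lipschitz_on UNIV w'" "\<And>x. x \<notin> U \<Longrightarrow> w' x = 0"
    "\<And>S. S \<in> T \<Longrightarrow> \<exists>a c. \<forall>x\<in>S \<inter> closure U. w' x = inner a x + c"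
    by (rule fe_spaceE[OF \<open>v \<in> V\<close>]) (rule that)
  have "u + v = abs_L2 (\<lambda>x. w x + w' x)"
    unfolding w(1) w'(1) by (rule abs_L2_add[OF square_integrable_lipschitz[OF w(2,3)] square_integrable_lipschitz[OF w'(2,3)]])
  also have "\<dots> \<in> V"
  proof (rule fe_spaceI)
    show "(L + L')-lipschitz_on UNIV (\<lambda>x. w x + w' x)"
      using w(2) w'(2) by (rule lipschitz_on_add)
    show "w x + w' x = 0" if "x \<notin> U" for x using w(3) w'(3) that by simp
    fix S assume S: "S \<in> T"
    obtain a c where 1: "\<forall>x\<in>S \<inter> closure U. w x = inner a x + c" using w(4)[OF S] by (elim exE)
    obtain a' c' where 2: "\<forall>x\<in>S \<inter> closure U. w' x = inner a' x + c'" using w'(4)[OF S] by (elim exE)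
    show "\<exists>a c. \<forall>x\<in>S \<inter> closure U. w x + w' x = inner a x + c"
      using 1 2 by (intro exI[of _ "a + a'"] exI[of _ "c + c'"]) (simp add: inner_add_left)
  qed
  finally show "u + v \<in> V" .
next
  fix u and k :: real assume "u \<in> V"
  obtain w L where w: "u = abs_L2 w" "L-lipschitz_on UNIV w" "\<And>x. x \<notin> U \<Longrightarrow> w x = 0"
    "\<And>S. S \<in> T \<Longrightarrow> \<exists>a c. \<forall>x\<in>S \<inter> closure U. w x = inner a x + c"
    by (rule fe_spaceE[OF \<open>u \<in> V\<close>]) (rule that)
  have "k *\<^sub>R u = abs_L2 (\<lambda>x. k * w x)"
    unfolding w(1) by (rule abs_L2_scaleR[OF square_integrable_lipschitz[OF w(2,3)]])
  also have "\<dots> \<in> V"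
  proof (rule fe_spaceI)
    show "(\<bar>k\<bar> * L)-lipschitz_on UNIV (\<lambda>x. k * w x)"
      using lipschitz_on_cmult[OF w(2), of k] by simp
    show "k * w x = 0" if "x \<notin> U" for x using w(3) that by simp
    fix S assume S: "S \<in> T"
    obtain a c where 1: "\<forall>x\<in>S \<inter> closure U. w x = inner a x + c" using w(4)[OF S] by (elim exE)
    show "\<exists>a c. \<forall>x\<in>S \<inter> closure U. k * w x = inner a x + c"
      using 1 by (intro exI[of _ "k *\<^sub>R a"] exI[of _ "k * c"]) (simp add: distrib_left)
  qed
  finally show "k *\<^sub>R u \<in> V" .
qed

text \<open>The points of \<open>U\<close> are classified by the set of all cells of \<open>T\<close> that contain them.\<close>

lemma fe_space_finite_span:
  obtains S0 where "finite S0" "V \<subseteq> span S0"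
proof -
  define Q where "Q \<A> = {x\<in>U. {S\<in>T. x \<in> S} = \<A>}" for \<A>
  have Qb: "Q \<A> \<in> sets borel" if "\<A> \<subseteq> T" for \<A>
  proof -
    have eq: "Q \<A> = U \<inter> (\<Inter>S\<in>T. if S \<in> \<A> then S else - S)"
      using that by (auto simp: Q_def split: if_splits)
    show ?thesis
    proof (cases "T = {}")
      case False
      have "(if S \<in> \<A> then S else - S) \<in> sets borel" if "S \<in> T" for S
        using mesh(2)[OF that] by auto
      then have "(\<Inter>S\<in>T. if S \<in> \<A> then S else - S) \<in> sets borel"
        by (intro sets.finite_INT mesh(1) False)
      then show ?thesis unfolding eq by (rule sets.Int[OF U_borel])
    qed (use U_borel eq in simp)
  qed
  \<comment> \<open>The indicator of a class and its products with the coordinates span all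
    functions that are affine on this class and zero elsewhere.\<close>
  define g1 where "g1 \<A> = (\<lambda>x. indicator (Q \<A>) x :: real)" for \<A>
  define gb where "gb \<A> b = (\<lambda>x. indicator (Q \<A>) x * (x \<bullet> b))" for \<A> b
  obtain R where R: "\<And>x. x \<in> U \<Longrightarrow> norm x \<le> R" using bounded_U by (auto simp: bounded_iff)
  have sq1: "square_integrable (g1 \<A>)" if "\<A> \<subseteq> T" for \<A>
    unfolding g1_def using Qb[OF that]
    by (intro square_integrable_bounded[of _ 1] measurable_completion) (auto simp: Q_def indicator_def)
  have sqb: "square_integrable (gb \<A> b)" if "\<A> \<subseteq> T" "b \<in> Basis" for \<A> b
  proof (rule square_integrable_bounded[of _ "max R 0"])
    show "gb \<A> b \<in> borel_measurable lebesgue"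
    proof -
      have [measurable]: "Q \<A> \<in> sets borel" by (rule Qb[OF that(1)])
      have "gb \<A> b \<in> borel_measurable borel" unfolding gb_def by measurable
      then show ?thesis by (intro measurable_completion) simp
    qed
    show "gb \<A> b x = 0" if "x \<notin> U" for x using that by (simp add: gb_def Q_def)
    show "\<bar>gb \<A> b x\<bar> \<le> max R 0" for x
      using R[of x] Basis_le_norm[OF that(2), of x] by (auto simp: gb_def Q_def indicator_def)
  qed
  define S0 where "S0 = (\<lambda>\<A>. abs_L2 (g1 \<A>)) ` Pow T \<union> (\<lambda>(\<A>, b). abs_L2 (gb \<A> b)) ` (Pow T \<times> Basis)"
  have "u \<in> span S0" if "u \<in> V" for u
  proof -
    obtain w L where w: "u = abs_L2 w" "L-lipschitz_on UNIV w" "\<And>x. x \<notin> U \<Longrightarrow> w x = 0"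
      "\<And>S. S \<in> T \<Longrightarrow> \<exists>a c. \<forall>x\<in>S \<inter> closure U. w x = inner a x + c"
      by (rule fe_spaceE[OF \<open>u \<in> V\<close>]) (rule that)
    have sqw: "square_integrable w" by (rule square_integrable_lipschitz[OF w(2,3)])
    obtain a c where ac: "\<And>S x. S \<in> T \<Longrightarrow> x \<in> S \<inter> closure U \<Longrightarrow> w x = inner (a S) x + c S"
      using w(4) by metis
    \<comment> \<open>For a point of \<open>U\<close> the class is nonempty because the cells cover,
      and all its cells give the same value there, so any of them may supply the affine
      function.\<close>
    define sel where "sel \<A> = (SOME S. S \<in> \<A>)" for \<A> :: "'a set set"
    define z where "z \<A> = c (sel \<A>) *\<^sub>R abs_L2 (g1 \<A>) + (\<Sum>b\<in>Basis. (a (sel \<A>) \<bullet> b) *\<^sub>R abs_L2 (gb \<A> b))" for \<A>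
    have sum_rep: "AE x in lebesgue. rep_L2 (sum f I) x = (\<Sum>i\<in>I. rep_L2 (f i) x)" if "finite I" for f :: "'i \<Rightarrow> 'a L2" and I
      using that
    proof (induction I rule: finite_induct)
      case empty
      then show ?case using rep_L2_zero by simp
    next
      case (insert i I)
      show ?case using insert.IH rep_L2_add[of "f i" "sum f I"] by eventually_elim (simp add: insert.hyps)
    qed
    have zrep: "AE x in lebesgue. rep_L2 (z \<A>) x = indicator (Q \<A>) x * (inner (a (sel \<A>)) x + c (sel \<A>))" if \<A>: "\<A> \<subseteq> T" for \<A>
    proof -
      have "AE x in lebesgue. \<forall>b\<in>Basis. rep_L2 ((a (sel \<A>) \<bullet> b) *\<^sub>R abs_L2 (gb \<A> b)) x = (a (sel \<A>) \<bullet> b) * gb \<A> b x"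
      proof (rule AE_finite_allI[OF finite_Basis])
        fix b :: 'a assume "b \<in> Basis"
        show "AE x in lebesgue. rep_L2 ((a (sel \<A>) \<bullet> b) *\<^sub>R abs_L2 (gb \<A> b)) x = (a (sel \<A>) \<bullet> b) * gb \<A> b x"
          using rep_L2_scaleR[of "a (sel \<A>) \<bullet> b" "abs_L2 (gb \<A> b)"] rep_abs_L2[OF sqb[OF \<A> \<open>b \<in> Basis\<close>]]
          by eventually_elim simp
      qed
      then show ?thesis
        using rep_L2_add[of "c (sel \<A>) *\<^sub>R abs_L2 (g1 \<A>)" "\<Sum>b\<in>Basis. (a (sel \<A>) \<bullet> b) *\<^sub>R abs_L2 (gb \<A> b)"]
          rep_L2_scaleR[of "c (sel \<A>)" "abs_L2 (g1 \<A>)"] rep_abs_L2[OF sq1[OF \<A>]]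
          sum_rep[OF finite_Basis, of "\<lambda>b. (a (sel \<A>) \<bullet> b) *\<^sub>R abs_L2 (gb \<A> b)"]
      proof eventually_elim
        case (elim x)
        have "(\<Sum>b\<in>Basis. (a (sel \<A>) \<bullet> b) * gb \<A> b x) = indicator (Q \<A>) x * inner (a (sel \<A>)) x"
          by (simp add: gb_def euclidean_inner[of _ x] sum_distrib_left mult_ac)
        then show ?case
          using elim by (simp add: z_def g1_def distrib_left mult.commute)
      qed
    qed
    have "AE x in lebesgue. \<forall>\<A>\<in>Pow T. rep_L2 (z \<A>) x = indicator (Q \<A>) x * (inner (a (sel \<A>)) x + c (sel \<A>))"
    proof (rule AE_finite_allI)
      show "finite (Pow T)" using mesh(1) by simp
      fix \<A> assume "\<A> \<in> Pow T"
      then show "AE x in lebesgue. rep_L2 (z \<A>) x = indicator (Q \<A>) x * (inner (a (sel \<A>)) x + c (sel \<A>))"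
        by (intro zrep) simp
    qed
    then have "AE x in lebesgue. rep_L2 u x = rep_L2 (\<Sum>\<A>\<in>Pow T. z \<A>) x"
      using sum_rep[of "Pow T" z, OF finite_Pow_iff[THEN iffD2, OF mesh(1)]]
        rep_abs_L2[OF sqw]
    proof eventually_elim
      case (elim x)
      have "(\<Sum>\<A>\<in>Pow T. indicator (Q \<A>) x * (inner (a (sel \<A>)) x + c (sel \<A>))) = w x"
      proof (cases "x \<in> U")
        case True
        define B where "B = {S\<in>T. x \<in> S}"
        have "(\<Sum>\<A>\<in>Pow T. indicator (Q \<A>) x * (inner (a (sel \<A>)) x + c (sel \<A>)))
            = (\<Sum>\<A>\<in>Pow T. if \<A> = B then inner (a (sel B)) x + c (sel B) else 0)"
        proof (intro sum.cong refl)
          fix \<A>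
          have "x \<in> Q \<A> \<longleftrightarrow> \<A> = B" using True by (simp add: Q_def B_def eq_commute)
          then show "indicator (Q \<A>) x * (inner (a (sel \<A>)) x + c (sel \<A>)) = (if \<A> = B then inner (a (sel B)) x + c (sel B) else 0)"
            by (cases "\<A> = B") (auto simp: indicator_def)
        qed
        also have "\<dots> = inner (a (sel B)) x + c (sel B)"
          using mesh(1) by (simp add: B_def)
        also have "\<dots> = w x"
        proof -
          have xc: "x \<in> closure U" using True closure_subset by blast
          then have "B \<noteq> {}" using mesh(3) by (auto simp: B_def)
          then have "sel B \<in> B" by (simp add: sel_def some_in_eq)
          then show ?thesis using ac[of "sel B" x] xc by (simp add: B_def)
        qed
        finally show ?thesis .
      next
        case False
        then show ?thesis by (simp add: w(3) Q_def)
      qed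
      then show ?case using elim by (simp add: w(1))
    qed
    then have "u = (\<Sum>\<A>\<in>Pow T. z \<A>)" by (rule L2_eqI)
    also have "\<dots> \<in> span S0"
      unfolding z_def by (intro span_sum span_add span_scale span_base) (auto simp: S0_def)
    finally show ?thesis .
  qed
  moreover have "finite S0" using mesh(1) by (auto simp: S0_def)
  ultimately show ?thesis by (intro that[of S0]) auto
qed

end

section \<open>The drift-implicit Galerkin step\<close>

locale galerkin_step = fe_mesh U T for U :: "'a::euclidean_space set" and T +
  fixes f :: "real \<Rightarrow> real" and L1 \<tau> :: real
  assumes f_cont: "continuous_on UNIV f"
    and f_lip: "\<And>R. \<exists>K\<ge>0. \<forall>a b. \<bar>a\<bar> \<le> R \<longrightarrow> \<bar>b\<bar> \<le> R \<longrightarrow> \<bar>f a - f b\<bar> \<le> K * \<bar>a - b\<bar>"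
    and f_mono: "\<And>a b. (f a - f b) * (a - b) \<le> L1 * (a - b)\<^sup>2"
    and \<tau>_pos: "0 < \<tau>" and L1: "L1 < first_eigenvalue U"
begin

text \<open>Fixed by choice so that there is a term with which \<open>orthonormal_span\<close> can
  be instantiated as a sublocale.\<close>

definition E :: "'a L2 set" where
  "E = (SOME E. finite E \<and> span E = V \<and> (\<forall>e\<in>E. norm e = 1) \<and> (\<forall>e\<in>E. \<forall>e'\<in>E. e \<noteq> e' \<longrightarrow> inner e e' = 0))"

lemma E: "finite E" "span E = V" "e \<in> E \<Longrightarrow> norm e = 1" "e \<in> E \<Longrightarrow> e' \<in> E \<Longrightarrow> e \<noteq> e' \<Longrightarrow> inner e e' = 0"
proof -
  obtain S0 where S0: "finite S0" "V \<subseteq> span S0" by (rule fe_space_finite_span) (rule that)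
  have "\<exists>E. finite E \<and> span E = V \<and> (\<forall>e\<in>E. norm e = 1) \<and> (\<forall>e\<in>E. \<forall>e'\<in>E. e \<noteq> e' \<longrightarrow> inner e e' = 0)"
    by (rule finite_dim_orthonormal_basis[OF fe_space_subspace S0]) blast
  from someI_ex[OF this] have *: "finite E \<and> span E = V \<and> (\<forall>e\<in>E. norm e = 1) \<and> (\<forall>e\<in>E. \<forall>e'\<in>E. e \<noteq> e' \<longrightarrow> inner e e' = 0)"
    unfolding E_def .
  then show "finite E" "span E = V" by simp_all
  show "norm e = 1" if "e \<in> E" using * that by simp
  show "inner e e' = 0" if "e \<in> E" "e' \<in> E" "e \<noteq> e'" using * that by simp
qed

sublocale orthonormal_span E V
  by unfold_locales (simp_all add: E)

section \<open>Galerkin projection, discrete Laplacian and sup bounds\<close>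

lemma galerkin_proj_eqI:
  assumes "w \<in> V" "\<And>v. v \<in> V \<Longrightarrow> inner v w = z v"
  shows "galerkin_proj V z = w"
  unfolding galerkin_proj_def
proof (rule the_equality)
  show "w \<in> V \<and> (\<forall>v\<in>V. inner v w = z v)" using assms by simp
  show "w' = w" if "w' \<in> V \<and> (\<forall>v\<in>V. inner v w' = z v)" for w'
    using that assms by (intro V_eqI) auto
qed

lemma galerkin_proj_L2: "galerkin_proj V (L2_functional x) = pr x"
  by (rule galerkin_proj_eqI[OF pr_in_V]) (simp add: L2_functional_def inner_pr)

definition Ah :: "'a L2 \<Rightarrow> 'a L2" where "Ah x = (\<Sum>e\<in>E. - grad_inner U x e *\<^sub>R e)"

lemma Ah_in_V: "Ah x \<in> V"
  unfolding Ah_def by (intro subspace_sum[OF V_subspace] subspace_scale[OF V_subspace] E_in_V)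

lemma inner_Ah:
  assumes "v \<in> V"
  shows "inner v (Ah x) = - grad_inner U x v"
proof -
  have "v \<in> V \<and> inner v (Ah x) = - grad_inner U x v"
    using assms unfolding V_eq
  proof (induction rule: span_induct_alt)
    case base
    have "grad_inner U x 0 = 0"
      using grad_inner_scaleR_right[OF fe_space_H10[OF subspace_0[OF V_subspace]], of x 0] by simp
    then show ?case by (simp add: span_zero)
  next
    case (step c e v)
    have eV: "e \<in> V" by (rule E_in_V[OF step(1)])
    have vV: "v \<in> V" unfolding V_eq using step(2) by simp
    have "inner e (Ah x) = - grad_inner U x e"
      using inner_sum_E[OF step(1), of "\<lambda>e. - grad_inner U x e"] by (simp add: Ah_def)
    moreover have "grad_inner U x (c *\<^sub>R e + v) = c * grad_inner U x e + grad_inner U x v"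
      using subspace_scale[OF H10_subspace fe_space_H10[OF eV], of c]
      by (simp add: grad_inner_add_right[OF _ fe_space_H10[OF vV]] grad_inner_scaleR_right[OF fe_space_H10[OF eV]])
    moreover have "c *\<^sub>R e + v \<in> span E"
      using eV vV unfolding V_eq by (intro span_add span_scale)
    ultimately show ?case
      using step(2) by (simp add: inner_add_left)
  qed
  then show ?thesis ..
qed

lemma discrete_laplacian_eq: "discrete_laplacian U V x = Ah x"
  unfolding discrete_laplacian_def
proof (rule the_equality)
  show "Ah x \<in> V \<and> (\<forall>v\<in>V. inner v (Ah x) = - grad_inner U x v)"
    using Ah_in_V inner_Ah by blast
  show "w' = Ah x" if "w' \<in> V \<and> (\<forall>v\<in>V. inner v w' = - grad_inner U x v)" for w'
    using that Ah_in_V inner_Ah by (intro V_eqI) auto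
qed

text \<open>In finite dimension the sup norm is controlled by the L^2 norm, because each of the
  finitely many basis functions is bounded. This is what lets a merely locally Lipschitz
  \<open>f\<close> act on L^2.\<close>

lemma V_essentially_bounded: "\<exists>M. \<forall>x\<in>V. AE \<xi> in lebesgue. \<bar>rep_L2 x \<xi>\<bar> \<le> M * norm x"
proof -
  have "\<exists>B. \<forall>e\<in>E. AE \<xi> in lebesgue. \<bar>rep_L2 e \<xi>\<bar> \<le> B e"
    using fe_space_bounded[OF E_in_V] by (intro bchoice) blast
  then obtain B where B: "\<And>e. e \<in> E \<Longrightarrow> AE \<xi> in lebesgue. \<bar>rep_L2 e \<xi>\<bar> \<le> B e" by blast
  have sum_rep: "AE \<xi> in lebesgue. \<bar>rep_L2 (\<Sum>e\<in>F. inner x e *\<^sub>R e) \<xi>\<bar> \<le> (\<Sum>e\<in>F. \<bar>B e\<bar>) * norm x"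
    if "F \<subseteq> E" for F x
    using finite_subset[OF that finite_E] that
  proof (induction F rule: finite_induct)
    case empty
    then show ?case using rep_L2_zero by simp
  next
    case (insert e F)
    have e: "e \<in> E" using insert.prems by simp
    have "AE \<xi> in lebesgue. \<bar>rep_L2 (\<Sum>e\<in>F. inner x e *\<^sub>R e) \<xi>\<bar> \<le> (\<Sum>e\<in>F. \<bar>B e\<bar>) * norm x"
      using insert by simp
    then show ?case
      using rep_L2_add[of "inner x e *\<^sub>R e" "\<Sum>e\<in>F. inner x e *\<^sub>R e"] rep_L2_scaleR[of "inner x e" e] B[OF e]
    proof eventually_elim
      case (elim \<xi>)
      have "\<bar>inner x e\<bar> \<le> norm x" using Cauchy_Schwarz_ineq2[of x e] norm_E[OF e] by simp
      then have "\<bar>inner x e * rep_L2 e \<xi>\<bar> \<le> norm x * \<bar>B e\<bar>"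
        unfolding abs_mult using elim(4) by (intro mult_mono) auto
      then show ?case
        using elim insert.hyps abs_triangle_ineq[of "inner x e * rep_L2 e \<xi>" "rep_L2 (\<Sum>e\<in>F. inner x e *\<^sub>R e) \<xi>"]
        by (simp add: algebra_simps)
    qed
  qed
  show ?thesis
  proof (intro exI ballI)
    fix x assume "x \<in> V"
    then have "(\<Sum>e\<in>E. inner x e *\<^sub>R e) = x" using pr_id by (simp add: pr_def)
    then show "AE \<xi> in lebesgue. \<bar>rep_L2 x \<xi>\<bar> \<le> (\<Sum>e\<in>E. \<bar>B e\<bar>) * norm x"
      using sum_rep[of E x] by simp
  qed
qed

section \<open>The Nemytskii drift on the finite element space\<close>

lemma f_measurable [measurable]: "f \<in> borel_measurable borel"
  by (rule borel_measurable_continuous_onI[OF f_cont])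

text \<open>On bounded functions the drift is an honest L^2 element instead of a functional on the
  Sobolev space. The indicator is there because \<open>f 0\<close> may be nonzero, while
  representatives vanish off \<open>U\<close>.\<close>

definition FF :: "'a L2 \<Rightarrow> 'a L2" where
  "FF x = abs_L2 (\<lambda>\<xi>. indicator U \<xi> * f (rep_L2 x \<xi>))"

lemma FF_square_integrable:
  assumes "x \<in> V"
  shows "square_integrable (\<lambda>\<xi>. indicator U \<xi> * f (rep_L2 x \<xi>))"
proof -
  obtain M where M: "AE \<xi> in lebesgue. \<bar>rep_L2 x \<xi>\<bar> \<le> M * norm x"
    using V_essentially_bounded assms by blast
  obtain K where K: "0 \<le> K" "\<And>a b. \<bar>a\<bar> \<le> \<bar>M * norm x\<bar> \<Longrightarrow> \<bar>b\<bar> \<le> \<bar>M * norm x\<bar> \<Longrightarrow> \<bar>f a - f b\<bar> \<le> K * \<bar>a - b\<bar>"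
    using f_lip[of "\<bar>M * norm x\<bar>"] by blast
  show ?thesis
  proof (rule square_integrable_bounded_times_indicator[OF U_borel bounded_U])
    show "(\<lambda>\<xi>. f (rep_L2 x \<xi>)) \<in> borel_measurable lebesgue" by measurable
    show "AE \<xi> in lebesgue. \<xi> \<in> U \<longrightarrow> \<bar>f (rep_L2 x \<xi>)\<bar> \<le> \<bar>f 0\<bar> + K * \<bar>M * norm x\<bar>"
      using M
    proof eventually_elim
      case (elim \<xi>)
      have "\<bar>f (rep_L2 x \<xi>) - f 0\<bar> \<le> K * \<bar>rep_L2 x \<xi> - 0\<bar>"
        using elim by (intro K(2)) auto
      also have "\<dots> \<le> K * \<bar>M * norm x\<bar>"
        using elim K(1) by (intro mult_left_mono) auto
      finally show ?case by linarith
    qed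
  qed
qed

lemma nemytskii_eq:
  assumes "x \<in> V"
  shows "nemytskii_drift U f x v = inner v (FF x)"
  unfolding nemytskii_drift_def FF_def inner_abs_L2_right[OF FF_square_integrable[OF assms]] set_lebesgue_integral_def
  by (intro Bochner_Integration.integral_cong) auto

lemma galerkin_proj_drift: "x \<in> V \<Longrightarrow> galerkin_proj V (nemytskii_drift U f x) = pr (FF x)"
  by (rule galerkin_proj_eqI[OF pr_in_V]) (simp add: nemytskii_eq inner_pr)

lemma FF_diff_rep:
  assumes "x \<in> V" "y \<in> V"
  shows "AE \<xi> in lebesgue. rep_L2 (FF x - FF y) \<xi> = indicator U \<xi> * (f (rep_L2 x \<xi>) - f (rep_L2 y \<xi>))"
  using rep_L2_diff[of "FF x" "FF y"] rep_abs_L2[OF FF_square_integrable[OF assms(1)]] rep_abs_L2[OF FF_square_integrable[OF assms(2)]]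
  unfolding FF_def by eventually_elim (simp add: right_diff_distrib)

lemma FF_monotone:
  assumes xy: "x \<in> V" "y \<in> V"
  shows "inner (x - y) (FF x - FF y) \<le> L1 * (norm (x - y))\<^sup>2"
proof -
  have off: "AE \<xi> in lebesgue. \<xi> \<notin> U \<longrightarrow> rep_L2 (x - y) \<xi> = 0"
    using fe_space_L2_on[OF subspace_diff[OF V_subspace xy]] by (simp add: L2_on_def)
  have "inner (x - y) (FF x - FF y) = (LINT \<xi>|lebesgue. rep_L2 (x - y) \<xi> * rep_L2 (FF x - FF y) \<xi>)"
    by (rule inner_L2_rep)
  also have "\<dots> \<le> (LINT \<xi>|lebesgue. L1 * (rep_L2 (x - y) \<xi>)\<^sup>2)"
  proof (rule integral_mono_AE)
    show "integrable lebesgue (\<lambda>\<xi>. rep_L2 (x - y) \<xi> * rep_L2 (FF x - FF y) \<xi>)"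
      by (rule square_integrable_mult) auto
    show "integrable lebesgue (\<lambda>\<xi>. L1 * (rep_L2 (x - y) \<xi>)\<^sup>2)"
      using square_integrable_rep_L2[of "x - y"] by (auto simp: square_integrable_def)
    show "AE \<xi> in lebesgue. rep_L2 (x - y) \<xi> * rep_L2 (FF x - FF y) \<xi> \<le> L1 * (rep_L2 (x - y) \<xi>)\<^sup>2"
      using FF_diff_rep[OF xy] rep_L2_diff[of x y] off
    proof eventually_elim
      case (elim \<xi>)
      show ?case
      proof (cases "\<xi> \<in> U")
        case True
        then show ?thesis
          using f_mono[of "rep_L2 x \<xi>" "rep_L2 y \<xi>"] elim by (simp add: mult.commute)
      qed (use elim in simp)
    qed
  qed
  finally show ?thesis by (simp add: power2_norm_L2)
qed

text \<open>On a ball of the finite element space all values stay in one bounded interval, where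
  \<open>f\<close> is Lipschitz.\<close>

lemma FF_lipschitz:
  "\<exists>K\<ge>0. \<forall>x\<in>V. \<forall>y\<in>V. norm x \<le> R \<longrightarrow> norm y \<le> R \<longrightarrow> norm (FF x - FF y) \<le> K * norm (x - y)"
proof -
  obtain M where M: "\<And>x. x \<in> V \<Longrightarrow> AE \<xi> in lebesgue. \<bar>rep_L2 x \<xi>\<bar> \<le> M * norm x"
    using V_essentially_bounded by blast
  obtain K where K: "0 \<le> K" "\<And>a b. \<bar>a\<bar> \<le> \<bar>M\<bar> * R \<Longrightarrow> \<bar>b\<bar> \<le> \<bar>M\<bar> * R \<Longrightarrow> \<bar>f a - f b\<bar> \<le> K * \<bar>a - b\<bar>"
    using f_lip[of "\<bar>M\<bar> * R"] by blast
  have bd: "AE \<xi> in lebesgue. \<bar>rep_L2 x \<xi>\<bar> \<le> \<bar>M\<bar> * R" if "x \<in> V" "norm x \<le> R" for x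
    using M[OF that(1)]
  proof eventually_elim
    case (elim \<xi>)
    have "M * norm x \<le> \<bar>M\<bar> * R" using that(2) by (intro mult_mono) auto
    then show ?case using elim by linarith
  qed
  have "norm (FF x - FF y) \<le> K * norm (x - y)" if xy: "x \<in> V" "y \<in> V" "norm x \<le> R" "norm y \<le> R" for x y
  proof -
    have "(norm (FF x - FF y))\<^sup>2 \<le> (LINT \<xi>|lebesgue. K\<^sup>2 * (rep_L2 (x - y) \<xi>)\<^sup>2)"
      unfolding power2_norm_L2
    proof (rule integral_mono_AE)
      show "integrable lebesgue (\<lambda>\<xi>. (rep_L2 (FF x - FF y) \<xi>)\<^sup>2)"
        using square_integrable_rep_L2[of "FF x - FF y"] by (auto simp: square_integrable_def)
      show "integrable lebesgue (\<lambda>\<xi>. K\<^sup>2 * (rep_L2 (x - y) \<xi>)\<^sup>2)"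
        using square_integrable_rep_L2[of "x - y"] by (auto simp: square_integrable_def)
      show "AE \<xi> in lebesgue. (rep_L2 (FF x - FF y) \<xi>)\<^sup>2 \<le> K\<^sup>2 * (rep_L2 (x - y) \<xi>)\<^sup>2"
        using FF_diff_rep[OF xy(1,2)] rep_L2_diff[of x y] bd[OF xy(1,3)] bd[OF xy(2,4)]
      proof eventually_elim
        case (elim \<xi>)
        have "\<bar>rep_L2 (FF x - FF y) \<xi>\<bar> \<le> K * \<bar>rep_L2 (x - y) \<xi>\<bar>"
          using K(2)[OF elim(3,4)] K(1) elim(1,2) by (auto simp: indicator_def)
        then have "\<bar>rep_L2 (FF x - FF y) \<xi>\<bar>\<^sup>2 \<le> (K * \<bar>rep_L2 (x - y) \<xi>\<bar>)\<^sup>2"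
          by (intro power_mono) auto
        then show ?case by (simp add: power_mult_distrib)
      qed
    qed
    also have "\<dots> = (K * norm (x - y))\<^sup>2" by (simp add: power_mult_distrib power2_norm_L2)
    finally show ?thesis by (rule power2_le_imp_le) (use K(1) in simp)
  qed
  then show ?thesis using K(1) by blast
qed

lemma Ah_diff:
  assumes "x \<in> V" "y \<in> V"
  shows "Ah x - Ah y = Ah (x - y)"
  using grad_inner_diff_left[OF fe_space_H10[OF assms(1)] fe_space_H10[OF assms(2)]]
  by (simp add: Ah_def sum_subtractf[symmetric] scaleR_left_diff_distrib[symmetric])

lemma Ah_bounded: "\<exists>K. \<forall>x\<in>V. norm (Ah x) \<le> K * norm x"
proof (intro exI ballI)
  fix x assume x: "x \<in> V"
  have g: "\<bar>grad_inner U x e\<bar> \<le> (\<Sum>e'\<in>E. \<bar>grad_inner U e' e\<bar>) * norm x" for e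
  proof -
    have "grad_inner U (\<Sum>e'\<in>F. inner x e' *\<^sub>R e') e = (\<Sum>e'\<in>F. inner x e' * grad_inner U e' e)" if "F \<subseteq> E" for F
      using finite_subset[OF that finite_E] that
    proof (induction F rule: finite_induct)
      case empty
      show ?case
        using grad_inner_scaleR_left[OF fe_space_H10[OF subspace_0[OF V_subspace]], of 0 e] by simp
    next
      case (insert e' F)
      have "e' \<in> sobolev_H10 U" using insert.prems by (intro fe_space_H10 E_in_V) simp
      moreover have "(\<Sum>e'\<in>F. inner x e' *\<^sub>R e') \<in> sobolev_H10 U"
        using insert.prems by (intro subspace_sum[OF H10_subspace] subspace_scale[OF H10_subspace] fe_space_H10 E_in_V) auto
      ultimately show ?case
        using insert subspace_scale[OF H10_subspace, of e' "inner x e'"]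
        by (simp add: grad_inner_add_left grad_inner_scaleR_left)
    qed
    from this[of E] have "grad_inner U x e = (\<Sum>e'\<in>E. inner x e' * grad_inner U e' e)"
      using pr_id[OF x] by (simp add: pr_def)
    also have "\<bar>\<dots>\<bar> \<le> (\<Sum>e'\<in>E. \<bar>inner x e' * grad_inner U e' e\<bar>)" by (rule sum_abs)
    also have "\<dots> \<le> (\<Sum>e'\<in>E. norm x * \<bar>grad_inner U e' e\<bar>)"
    proof (rule sum_mono)
      fix e' assume "e' \<in> E"
      then have "\<bar>inner x e'\<bar> \<le> norm x" using Cauchy_Schwarz_ineq2[of x e'] norm_E by simp
      then show "\<bar>inner x e' * grad_inner U e' e\<bar> \<le> norm x * \<bar>grad_inner U e' e\<bar>"
        unfolding abs_mult by (intro mult_right_mono) auto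
    qed
    finally show ?thesis by (simp add: sum_distrib_left mult.commute)
  qed
  have "norm (Ah x) \<le> (\<Sum>e\<in>E. \<bar>grad_inner U x e\<bar>)"
    using norm_le_sum_E[OF Ah_in_V, of x] inner_Ah[OF E_in_V, of _ x] by (simp add: inner_commute cong: sum.cong)
  also have "\<dots> \<le> (\<Sum>e\<in>E. (\<Sum>e'\<in>E. \<bar>grad_inner U e' e\<bar>) * norm x)"
    by (intro sum_mono g)
  finally show "norm (Ah x) \<le> (\<Sum>e\<in>E. \<Sum>e'\<in>E. \<bar>grad_inner U e' e\<bar>) * norm x"
    by (simp add: sum_distrib_right)
qed

text \<open>The left-hand side of the implicit step once all terms with the new state are collected:
  the new state is mapped to the old state plus projected noise.\<close>

definition \<Phi> :: "'a L2 \<Rightarrow> 'a L2" where "\<Phi> x = x - \<tau> *\<^sub>R Ah x - \<tau> *\<^sub>R pr (FF x)"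

definition cc :: real where "cc = 1 + \<tau> * (first_eigenvalue U - L1)"

lemma cc_ge_1: "1 \<le> cc" using \<tau>_pos L1 by (simp add: cc_def)

lemma \<Phi>_in_V: "x \<in> V \<Longrightarrow> \<Phi> x \<in> V"
  unfolding \<Phi>_def by (intro subspace_diff subspace_scale V_subspace Ah_in_V pr_in_V)

text \<open>The discrete Laplacian contributes the Dirichlet form, at least \<lambda>1 times the
  squared norm by the Poincare inequality, and the drift takes away at most L1 times the squared
  norm.\<close>

lemma \<Phi>_monotone:
  assumes xy: "x \<in> V" "y \<in> V"
  shows "cc * (norm (x - y))\<^sup>2 \<le> inner (x - y) (\<Phi> x - \<Phi> y)"
proof -
  have d: "x - y \<in> V" by (rule subspace_diff[OF V_subspace xy])
  have "\<Phi> x - \<Phi> y = (x - y) - \<tau> *\<^sub>R Ah (x - y) - \<tau> *\<^sub>R pr (FF x - FF y)"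
    using Ah_diff[OF xy] pr_diff[of "FF x" "FF y"] by (simp add: \<Phi>_def scaleR_diff_right[symmetric] algebra_simps)
  then have "inner (x - y) (\<Phi> x - \<Phi> y) = (norm (x - y))\<^sup>2 + \<tau> * grad_inner U (x - y) (x - y) - \<tau> * inner (x - y) (FF x - FF y)"
    by (simp add: inner_diff_right[of "x - y" "_ - _" "_"] inner_Ah[OF d] inner_pr[OF d] power2_norm_eq_inner)
  moreover have "\<tau> * (first_eigenvalue U * (norm (x - y))\<^sup>2) \<le> \<tau> * grad_inner U (x - y) (x - y)"
    using \<tau>_pos by (intro mult_left_mono poincare_first_eigenvalue fe_space_H10 d) auto
  moreover have "\<tau> * inner (x - y) (FF x - FF y) \<le> \<tau> * (L1 * (norm (x - y))\<^sup>2)"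
    using \<tau>_pos by (intro mult_left_mono FF_monotone xy) auto
  ultimately show ?thesis by (simp add: cc_def algebra_simps)
qed

lemma \<Phi>_lipschitz:
  "\<exists>L. \<forall>x\<in>V. \<forall>y\<in>V. norm x \<le> R \<longrightarrow> norm y \<le> R \<longrightarrow> norm (\<Phi> x - \<Phi> y) \<le> L * norm (x - y)"
proof -
  obtain K1 where K1: "\<And>x. x \<in> V \<Longrightarrow> norm (Ah x) \<le> K1 * norm x" using Ah_bounded by blast
  obtain K2 where K2: "\<And>x y. x \<in> V \<Longrightarrow> y \<in> V \<Longrightarrow> norm x \<le> R \<Longrightarrow> norm y \<le> R \<Longrightarrow> norm (FF x - FF y) \<le> K2 * norm (x - y)"
    using FF_lipschitz[of R] by blast
  show ?thesis
  proof (intro exI ballI impI)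
    fix x y assume xy: "x \<in> V" "y \<in> V" "norm x \<le> R" "norm y \<le> R"
    have "\<Phi> x - \<Phi> y = (x - y) - \<tau> *\<^sub>R Ah (x - y) - \<tau> *\<^sub>R pr (FF x - FF y)"
      using Ah_diff[OF xy(1,2)] pr_diff[of "FF x" "FF y"] by (simp add: \<Phi>_def scaleR_diff_right[symmetric] algebra_simps)
    also have "norm \<dots> \<le> norm (x - y) + \<tau> * norm (Ah (x - y)) + \<tau> * norm (pr (FF x - FF y))"
      using \<tau>_pos norm_triangle_ineq4[of "x - y - \<tau> *\<^sub>R Ah (x - y)" "\<tau> *\<^sub>R pr (FF x - FF y)"]
        norm_triangle_ineq4[of "x - y" "\<tau> *\<^sub>R Ah (x - y)"] by simp
    also have "\<dots> \<le> norm (x - y) + \<tau> * (K1 * norm (x - y)) + \<tau> * (K2 * norm (x - y))"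
      using \<tau>_pos K1[OF subspace_diff[OF V_subspace xy(1,2)]] order_trans[OF norm_pr_le K2[OF xy]]
      by (intro add_mono mult_left_mono) auto
    finally show "norm (\<Phi> x - \<Phi> y) \<le> (1 + \<tau> * K1 + \<tau> * K2) * norm (x - y)"
      by (simp add: algebra_simps)
  qed
qed

definition \<Psi> :: "'a L2 \<Rightarrow> 'a L2" where "\<Psi> y = (SOME x. x \<in> V \<and> \<Phi> x = y)"

lemma \<Psi>:
  assumes "y \<in> V"
  shows "\<Psi> y \<in> V" "\<Phi> (\<Psi> y) = y"
proof -
  have "\<exists>x. x \<in> V \<and> \<Phi> x = y"
    using monotone_equation_solvable[OF \<Phi>_in_V _ \<Phi>_monotone \<Phi>_lipschitz assms] cc_ge_1 by auto
  from someI_ex[OF this] show "\<Psi> y \<in> V" "\<Phi> (\<Psi> y) = y" by (simp_all add: \<Psi>_def)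
qed

text \<open>Strong monotonicity of \<open>\<Phi>\<close> against Cauchy-Schwarz, divided by the norm
  of the difference. The factor \<open>cc\<close> is the whole source of contraction in the
  chain.\<close>

lemma \<Psi>_lipschitz:
  assumes "y \<in> V" "z \<in> V"
  shows "cc * norm (\<Psi> y - \<Psi> z) \<le> norm (y - z)"
proof (cases "\<Psi> y = \<Psi> z")
  case False
  have "cc * (norm (\<Psi> y - \<Psi> z))\<^sup>2 \<le> inner (\<Psi> y - \<Psi> z) (y - z)"
    using \<Phi>_monotone[OF \<Psi>(1)[OF assms(1)] \<Psi>(1)[OF assms(2)]] \<Psi>(2)[OF assms(1)] \<Psi>(2)[OF assms(2)] by simp
  also have "\<dots> \<le> norm (\<Psi> y - \<Psi> z) * norm (y - z)" by (rule norm_cauchy_schwarz)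
  finally have "norm (\<Psi> y - \<Psi> z) * (cc * norm (\<Psi> y - \<Psi> z)) \<le> norm (\<Psi> y - \<Psi> z) * norm (y - z)"
    by (simp add: power2_eq_square mult_ac)
  then show ?thesis using False by simp
qed simp

text \<open>Strong monotonicity leaves a single solution, so the choice in \<open>\<Psi>\<close> is
  harmless and the equation of the scheme can be replaced by a function of the right-hand
  side.\<close>

lemma step_eq_iff:
  assumes "y \<in> V" "x \<in> V"
  shows "x = y + \<tau> *\<^sub>R discrete_laplacian U V x + \<tau> *\<^sub>R galerkin_proj V (nemytskii_drift U f x) \<longleftrightarrow> x = \<Psi> y"
proof -
  have "x = y + \<tau> *\<^sub>R discrete_laplacian U V x + \<tau> *\<^sub>R galerkin_proj V (nemytskii_drift U f x) \<longleftrightarrow> \<Phi> x = y"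
    unfolding discrete_laplacian_eq galerkin_proj_drift[OF assms(2)] \<Phi>_def by (auto simp: algebra_simps)
  also have "\<dots> \<longleftrightarrow> x = \<Psi> y"
  proof
    assume "\<Phi> x = y"
    then have "cc * (norm (x - \<Psi> y))\<^sup>2 \<le> 0"
      using \<Phi>_monotone[OF assms(2) \<Psi>(1)[OF assms(1)]] \<Psi>(2)[OF assms(1)] by simp
    then show "x = \<Psi> y" using cc_ge_1 by (simp add: mult_le_0_iff)
  qed (simp add: \<Psi>(2)[OF assms(1)])
  finally show ?thesis .
qed

end

lemma locally_lipschitz_if_deriv_growth:
  fixes f :: "real \<Rightarrow> real"
  assumes d: "\<And>\<xi>. f differentiable (at \<xi>)" and q: "1 \<le> q"
    and growth: "\<And>\<xi>. \<bar>deriv f \<xi>\<bar> \<le> L4 * (if q = 1 then 1 else \<bar>\<xi>\<bar> powr (q - 1)) + L5"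
  shows "\<exists>K\<ge>0. \<forall>a b. \<bar>a\<bar> \<le> R \<longrightarrow> \<bar>b\<bar> \<le> R \<longrightarrow> \<bar>f a - f b\<bar> \<le> K * \<bar>a - b\<bar>"
proof -
  \<comment> \<open>The case q = 1 is separate because \<open>0 powr 0 = 0\<close>, while the zeroth
    power of \<bar>\<xi>\<bar> stands for 1.\<close>
  define m where "m = (if q = 1 then 1 else \<bar>R\<bar> powr (q - 1))"
  have bound: "\<bar>deriv f \<xi>\<bar> \<le> \<bar>L4\<bar> * m + \<bar>L5\<bar>" if "\<xi> \<in> {-R..R}" for \<xi>
  proof -
    have "0 \<le> (if q = 1 then 1 else \<bar>\<xi>\<bar> powr (q - 1))" "(if q = 1 then 1 else \<bar>\<xi>\<bar> powr (q - 1)) \<le> m"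
      using that q by (auto simp: m_def intro!: powr_mono2)
    then have "L4 * (if q = 1 then 1 else \<bar>\<xi>\<bar> powr (q - 1)) \<le> \<bar>L4\<bar> * m"
      by (intro mult_mono) auto
    then show ?thesis using growth[of \<xi>] by linarith
  qed
  have "\<bar>f a - f b\<bar> \<le> (\<bar>L4\<bar> * m + \<bar>L5\<bar>) * \<bar>a - b\<bar>" if "\<bar>a\<bar> \<le> R" "\<bar>b\<bar> \<le> R" for a b
  proof -
    have "norm (f a - f b) \<le> (\<bar>L4\<bar> * m + \<bar>L5\<bar>) * norm (a - b)"
    proof (rule field_differentiable_bound[of "{-R..R}" f "deriv f"])
      show "(f has_field_derivative deriv f z) (at z within {-R..R})" for z
        using d[of z] DERIV_deriv_iff_real_differentiable has_field_derivative_at_within by blast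
    qed (use that bound in auto)
    then show ?thesis by simp
  qed
  moreover have "0 \<le> \<bar>L4\<bar> * m + \<bar>L5\<bar>" by (auto simp: m_def)
  ultimately show ?thesis by blast
qed

section \<open>Contractive Markov kernels\<close>

lemma ennreal_le_plusI:
  assumes "a \<le> b + c" "0 \<le> b" "0 \<le> c"
  shows "ennreal a \<le> ennreal b + ennreal c"
  using ennreal_leI[OF assms(1)] ennreal_plus[OF assms(2,3)] by simp

text \<open>Contraction is in mean over the noise, not for individual noise values; pathwise limits
  therefore have to come from summable expected increments.\<close>

locale contractive_kernel = prob_space N for N :: "'n measure" +
  fixes \<Theta> :: "'b::{banach, second_countable_topology} \<Rightarrow> 'n \<Rightarrow> 'b" and r :: real
  assumes \<Theta>_measurable [measurable]: "(\<lambda>p. \<Theta> (fst p) (snd p)) \<in> borel_measurable (borel \<Otimes>\<^sub>M N)"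
    and \<Theta>_integrable: "(\<integral>\<^sup>+s. ennreal (norm (\<Theta> 0 s)) \<partial>N) < \<infinity>"
    and \<Theta>_contraction: "(\<integral>\<^sup>+s. ennreal (norm (\<Theta> x s - \<Theta> y s)) \<partial>N) \<le> ennreal (r * norm (x - y))"
    and r: "0 \<le> r" "r < 1"
begin

lemma \<Theta>_measurable1 [measurable]: "\<Theta> x \<in> borel_measurable N"
  using measurable_compose[OF measurable_Pair1'[of x borel N] \<Theta>_measurable] by simp

lemma \<Theta>_compose [measurable]:
  assumes [measurable]: "f \<in> borel_measurable M" "g \<in> measurable M N"
  shows "(\<lambda>w. \<Theta> (f w) (g w)) \<in> borel_measurable M"
  using measurable_compose[OF measurable_Pair[OF assms] \<Theta>_measurable] by simp

section \<open>The Markov operator and its Lipschitz bounds\<close>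

definition K :: "('b \<Rightarrow> real) \<Rightarrow> 'b \<Rightarrow> real" where
  "K \<phi> x = (LINT s|N. \<phi> (\<Theta> x s))"

lemma K_measurable [measurable]:
  assumes [measurable]: "\<phi> \<in> borel_measurable borel"
  shows "K \<phi> \<in> borel_measurable borel"
  unfolding K_def by measurable

lemma K_bounded:
  assumes "\<phi> \<in> borel_measurable borel" "\<And>x. \<bar>\<phi> x\<bar> \<le> B"
  shows "\<bar>K \<phi> x\<bar> \<le> B"
proof -
  have [measurable]: "\<phi> \<in> borel_measurable borel" by fact
  have i: "integrable N (\<lambda>s. \<phi> (\<Theta> x s))"
    by (rule integrable_const_bound[of _ B]) (use assms(2) in auto)
  have "\<bar>K \<phi> x\<bar> \<le> (LINT s|N. \<bar>\<phi> (\<Theta> x s)\<bar>)"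
    unfolding K_def by (rule integral_abs_bound)
  also have "\<dots> \<le> (LINT s|N. B)"
    using i assms(2) by (intro integral_mono) auto
  finally show ?thesis by (simp add: prob_space)
qed

lemma K_funpow:
  assumes "\<phi> \<in> borel_measurable borel" "\<And>x. \<bar>\<phi> x\<bar> \<le> B"
  shows "(K ^^ m) \<phi> \<in> borel_measurable borel" "\<bar>(K ^^ m) \<phi> x\<bar> \<le> B"
proof -
  have "(K ^^ m) \<phi> \<in> borel_measurable borel \<and> (\<forall>x. \<bar>(K ^^ m) \<phi> x\<bar> \<le> B)"
    using assms by (induction m) (auto intro: K_bounded)
  then show "(K ^^ m) \<phi> \<in> borel_measurable borel" "\<bar>(K ^^ m) \<phi> x\<bar> \<le> B" by auto
qed

lemma K_lipschitz:
  assumes "\<phi> \<in> borel_measurable borel" "\<And>x. \<bar>\<phi> x\<bar> \<le> B"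
    and L: "\<And>x y. \<bar>\<phi> x - \<phi> y\<bar> \<le> L * norm (x - y)" "0 \<le> L"
  shows "\<bar>K \<phi> x - K \<phi> y\<bar> \<le> L * r * norm (x - y)"
proof -
  have [measurable]: "\<phi> \<in> borel_measurable borel" by fact
  have i: "integrable N (\<lambda>s. \<phi> (\<Theta> x s))" for x
    by (rule integrable_const_bound[of _ B]) (use assms(2) in auto)
  have "ennreal \<bar>K \<phi> x - K \<phi> y\<bar> = ennreal \<bar>LINT s|N. \<phi> (\<Theta> x s) - \<phi> (\<Theta> y s)\<bar>"
    unfolding K_def using i by simp
  also have "\<dots> \<le> ennreal (LINT s|N. \<bar>\<phi> (\<Theta> x s) - \<phi> (\<Theta> y s)\<bar>)"
    by (intro ennreal_leI integral_abs_bound)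
  also have "\<dots> = (\<integral>\<^sup>+s. ennreal \<bar>\<phi> (\<Theta> x s) - \<phi> (\<Theta> y s)\<bar> \<partial>N)"
    using i by (intro nn_integral_eq_integral[symmetric]) auto
  also have "\<dots> \<le> (\<integral>\<^sup>+s. ennreal L * ennreal (norm (\<Theta> x s - \<Theta> y s)) \<partial>N)"
    using L by (intro nn_integral_mono) (auto simp: ennreal_mult[symmetric] intro!: ennreal_leI)
  also have "\<dots> = ennreal L * (\<integral>\<^sup>+s. ennreal (norm (\<Theta> x s - \<Theta> y s)) \<partial>N)"
    by (rule nn_integral_cmult) measurable
  also have "\<dots> \<le> ennreal L * ennreal (r * norm (x - y))"
    by (intro mult_left_mono \<Theta>_contraction) simp
  also have "\<dots> = ennreal (L * r * norm (x - y))"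
    using L r by (simp add: ennreal_mult[symmetric] mult.assoc)
  finally show ?thesis
    using L r by (subst (asm) ennreal_le_iff) auto
qed

lemma K_funpow_lipschitz:
  assumes "\<phi> \<in> borel_measurable borel" "\<And>x. \<bar>\<phi> x\<bar> \<le> B"
    and L: "\<And>x y. \<bar>\<phi> x - \<phi> y\<bar> \<le> L * norm (x - y)" "0 \<le> L"
  shows "\<bar>(K ^^ m) \<phi> x - (K ^^ m) \<phi> y\<bar> \<le> L * r ^ m * norm (x - y)"
proof (induction m arbitrary: x y)
  case (Suc m)
  have "\<bar>K ((K ^^ m) \<phi>) x - K ((K ^^ m) \<phi>) y\<bar> \<le> L * r ^ m * r * norm (x - y)"
    using K_funpow[OF assms(1,2)] Suc L r by (intro K_lipschitz[of _ B]) auto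
  then show ?case by (simp add: mult_ac)
qed (use L in simp)

section \<open>Backward iteration over noise streams\<close>

abbreviation S :: "'n stream measure" where "S \<equiv> stream_space N"

lemma S_prob: "prob_space S"
  by (rule prob_space_stream_space)

lemma pair_NS: "pair_sigma_finite N S"
proof -
  interpret S: prob_space S by (rule S_prob)
  show ?thesis by standard
qed

lemma Stream_measurable [measurable]: "(\<lambda>p. fst p ## snd p) \<in> measurable (N \<Otimes>\<^sub>M S) S"
  by measurable

text \<open>Prepending an independent letter leaves the law of the stream unchanged; this is the
  stationarity behind invariance.\<close>

lemma S_eq_distr: "distr (N \<Otimes>\<^sub>M S) S (\<lambda>p. fst p ## snd p) = S"
proof (rule measure_eqI)
  interpret S: prob_space S by (rule S_prob)
  fix A assume "A \<in> sets (distr (N \<Otimes>\<^sub>M S) S (\<lambda>p. fst p ## snd p))"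
  then have A[measurable]: "A \<in> sets S" by simp
  have "emeasure (distr (N \<Otimes>\<^sub>M S) S (\<lambda>p. fst p ## snd p)) A = (\<integral>\<^sup>+\<omega>. indicator A \<omega> \<partial>distr (N \<Otimes>\<^sub>M S) S (\<lambda>p. fst p ## snd p))"
    by simp
  also have "\<dots> = (\<integral>\<^sup>+p. indicator A (fst p ## snd p) \<partial>(N \<Otimes>\<^sub>M S))"
    by (rule nn_integral_distr) measurable
  also have "\<dots> = (\<integral>\<^sup>+x. \<integral>\<^sup>+X. indicator A (x ## X) \<partial>S \<partial>N)"
    by (subst S.nn_integral_fst[symmetric]) auto
  also have "\<dots> = (\<integral>\<^sup>+X. indicator A X \<partial>S)"
    by (rule nn_integral_stream_space[symmetric]) measurable
  finally show "emeasure (distr (N \<Otimes>\<^sub>M S) S (\<lambda>p. fst p ## snd p)) A = emeasure S A"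
    by simp
qed simp

text \<open>Backward iteration: unlike the forward iterates, the iterates with the newest noise applied first
  converge almost surely.\<close>

primrec biter :: "nat \<Rightarrow> 'n stream \<Rightarrow> 'b" where
  "biter 0 \<omega> = 0"
| "biter (Suc n) \<omega> = \<Theta> (biter n (stl \<omega>)) (shd \<omega>)"

lemma biter_measurable [measurable]: "biter n \<in> borel_measurable S"
proof (induction n)
  case (Suc n)
  have [measurable]: "biter n \<in> borel_measurable S" by fact
  show ?case by (subst measurable_cong[OF biter.simps(2)]) measurable
qed simp

lemma nn_integral_S:
  assumes [measurable]: "f \<in> borel_measurable S"
  shows "(\<integral>\<^sup>+\<omega>. f \<omega> \<partial>S) = (\<integral>\<^sup>+X. \<integral>\<^sup>+x. f (x ## X) \<partial>N \<partial>S)"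
proof -
  interpret pair_sigma_finite N S by (rule pair_NS)
  have "(\<integral>\<^sup>+\<omega>. f \<omega> \<partial>S) = (\<integral>\<^sup>+x. \<integral>\<^sup>+X. f (x ## X) \<partial>S \<partial>N)"
    by (rule nn_integral_stream_space) measurable
  also have "\<dots> = (\<integral>\<^sup>+X. \<integral>\<^sup>+x. f (x ## X) \<partial>N \<partial>S)"
    by (rule Fubini'[symmetric]) measurable
  finally show ?thesis .
qed

lemma nn_integral_\<Theta>_diff_le:
  assumes [measurable]: "f \<in> borel_measurable S" "g \<in> borel_measurable S"
  shows "(\<integral>\<^sup>+X. \<integral>\<^sup>+x. ennreal (norm (\<Theta> (f X) x - \<Theta> (g X) x)) \<partial>N \<partial>S) \<le>
    ennreal r * (\<integral>\<^sup>+X. ennreal (norm (f X - g X)) \<partial>S)"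
proof -
  have "(\<integral>\<^sup>+X. \<integral>\<^sup>+x. ennreal (norm (\<Theta> (f X) x - \<Theta> (g X) x)) \<partial>N \<partial>S) \<le>
      (\<integral>\<^sup>+X. ennreal r * ennreal (norm (f X - g X)) \<partial>S)"
    using r by (intro nn_integral_mono) (simp add: \<Theta>_contraction ennreal_mult[symmetric])
  also have "\<dots> = ennreal r * (\<integral>\<^sup>+X. ennreal (norm (f X - g X)) \<partial>S)"
    by (rule nn_integral_cmult) measurable
  finally show ?thesis .
qed

definition c0 :: real where "c0 = enn2real (\<integral>\<^sup>+s. ennreal (norm (\<Theta> 0 s)) \<partial>N)"

lemma c0: "0 \<le> c0" "(\<integral>\<^sup>+s. ennreal (norm (\<Theta> 0 s)) \<partial>N) = ennreal c0"
  using \<Theta>_integrable by (auto simp: c0_def less_top)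

text \<open>Both iterates apply the head letter as their outermost map, so integrating this letter
  first gains one factor r over the same pair evaluated at the tail of the stream.\<close>

lemma biter_diff: "(\<integral>\<^sup>+\<omega>. ennreal (norm (biter (Suc n) \<omega> - biter n \<omega>)) \<partial>S) \<le> ennreal (c0 * r ^ n)"
proof (induction n)
  case 0
  interpret S: prob_space S by (rule S_prob)
  have "(\<integral>\<^sup>+\<omega>. ennreal (norm (biter (Suc 0) \<omega> - biter 0 \<omega>)) \<partial>S) = (\<integral>\<^sup>+X. ennreal c0 \<partial>S)"
    by (subst nn_integral_S) (simp_all add: c0(2))
  then show ?case by (simp add: S.emeasure_space_1)
next
  case (Suc n)
  have "(\<integral>\<^sup>+\<omega>. ennreal (norm (biter (Suc (Suc n)) \<omega> - biter (Suc n) \<omega>)) \<partial>S)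
      = (\<integral>\<^sup>+X. \<integral>\<^sup>+x. ennreal (norm (\<Theta> (biter (Suc n) X) x - \<Theta> (biter n X) x)) \<partial>N \<partial>S)"
  proof -
    have m: "(\<lambda>\<omega>. ennreal (norm (biter (Suc (Suc n)) \<omega> - biter (Suc n) \<omega>))) \<in> borel_measurable S"
      by measurable
    show ?thesis unfolding nn_integral_S[OF m] by simp
  qed
  also have "\<dots> \<le> ennreal r * (\<integral>\<^sup>+X. ennreal (norm (biter (Suc n) X - biter n X)) \<partial>S)"
    by (rule nn_integral_\<Theta>_diff_le) measurable
  also have "\<dots> \<le> ennreal r * ennreal (c0 * r ^ n)"
    by (intro mult_left_mono Suc) simp
  also have "\<dots> = ennreal (c0 * r ^ Suc n)"
    using r c0 by (simp add: ennreal_mult[symmetric] mult_ac)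
  finally show ?case .
qed

definition Y :: "'n stream \<Rightarrow> 'b" where "Y \<omega> = lim (\<lambda>n. biter n \<omega>)"

lemma Y_measurable [measurable]: "Y \<in> borel_measurable S"
  unfolding Y_def by measurable

lemma biter_tendsto_Y: "AE \<omega> in S. (\<lambda>n. biter n \<omega>) \<longlonglongrightarrow> Y \<omega>"
proof -
  have "(\<integral>\<^sup>+\<omega>. (\<Sum>n. ennreal (norm (biter (Suc n) \<omega> - biter n \<omega>))) \<partial>S) = (\<Sum>n. \<integral>\<^sup>+\<omega>. ennreal (norm (biter (Suc n) \<omega> - biter n \<omega>)) \<partial>S)"
    by (rule nn_integral_suminf) measurable
  also have "\<dots> \<le> (\<Sum>n. ennreal (c0 * r ^ n))"
    by (intro suminf_le biter_diff) auto
  also have "\<dots> = ennreal (\<Sum>n. c0 * r ^ n)"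
    using c0 r by (intro suminf_ennreal2) (auto intro!: summable_mult summable_geometric)
  finally have "(\<integral>\<^sup>+\<omega>. (\<Sum>n. ennreal (norm (biter (Suc n) \<omega> - biter n \<omega>))) \<partial>S) \<noteq> \<infinity>"
    by (auto simp: top_unique)
  then have "AE \<omega> in S. (\<Sum>n. ennreal (norm (biter (Suc n) \<omega> - biter n \<omega>))) \<noteq> \<infinity>"
    by (intro nn_integral_PInf_AE) measurable
  then show ?thesis
  proof eventually_elim
    case (elim \<omega>)
    then have "summable (\<lambda>n. norm (biter (Suc n) \<omega> - biter n \<omega>))"
      by (intro summable_suminf_not_top) auto
    then have "summable (\<lambda>n. biter (Suc n) \<omega> - biter n \<omega>)"
      by (rule summable_norm_cancel)
    then have "convergent (\<lambda>n. \<Sum>k<n. biter (Suc k) \<omega> - biter k \<omega>)"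
      by (simp add: summable_iff_convergent)
    then have "convergent (\<lambda>n. biter n \<omega> - biter 0 \<omega>)"
      by (subst (asm) sum_lessThan_telescope)
    then show ?case
      by (simp add: Y_def convergent_LIMSEQ_iff)
  qed
qed

lemma biter_dist: "(\<integral>\<^sup>+\<omega>. ennreal (norm (biter (n + k) \<omega> - biter n \<omega>)) \<partial>S) \<le> ennreal (c0 * r ^ n / (1 - r))"
proof -
  have "(\<integral>\<^sup>+\<omega>. ennreal (norm (biter (n + k) \<omega> - biter n \<omega>)) \<partial>S) \<le> ennreal (\<Sum>i<k. c0 * r ^ (n + i))"
  proof (induction k)
    case (Suc k)
    have "(\<integral>\<^sup>+\<omega>. ennreal (norm (biter (n + Suc k) \<omega> - biter n \<omega>)) \<partial>S) \<le>
        (\<integral>\<^sup>+\<omega>. ennreal (norm (biter (n + k) \<omega> - biter n \<omega>)) + ennreal (norm (biter (Suc (n + k)) \<omega> - biter (n + k) \<omega>)) \<partial>S)"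
    proof (rule nn_integral_mono)
      fix \<omega>
      have "norm (biter (n + Suc k) \<omega> - biter n \<omega>) \<le> norm (biter (n + k) \<omega> - biter n \<omega>) + norm (biter (Suc (n + k)) \<omega> - biter (n + k) \<omega>)"
        using norm_triangle_ineq[of "biter (n + k) \<omega> - biter n \<omega>" "biter (Suc (n + k)) \<omega> - biter (n + k) \<omega>"] by simp
      then show "ennreal (norm (biter (n + Suc k) \<omega> - biter n \<omega>)) \<le> ennreal (norm (biter (n + k) \<omega> - biter n \<omega>)) + ennreal (norm (biter (Suc (n + k)) \<omega> - biter (n + k) \<omega>))"
        by (rule ennreal_le_plusI) auto
    qed
    also have "\<dots> = (\<integral>\<^sup>+\<omega>. ennreal (norm (biter (n + k) \<omega> - biter n \<omega>)) \<partial>S) + (\<integral>\<^sup>+\<omega>. ennreal (norm (biter (Suc (n + k)) \<omega> - biter (n + k) \<omega>)) \<partial>S)"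
      by (rule nn_integral_add) measurable
    also have "\<dots> \<le> ennreal (\<Sum>i<k. c0 * r ^ (n + i)) + ennreal (c0 * r ^ (n + k))"
      by (intro add_mono Suc biter_diff)
    also have "\<dots> = ennreal (\<Sum>i<Suc k. c0 * r ^ (n + i))"
      using c0 r by (subst ennreal_plus[symmetric]) (auto intro!: sum_nonneg)
    finally show ?case .
  qed simp
  also have "(\<Sum>i<k. c0 * r ^ (n + i)) = c0 * r ^ n * (\<Sum>i<k. r ^ i)"
    by (simp add: power_add sum_distrib_left mult_ac)
  also have "\<dots> \<le> c0 * r ^ n * (\<Sum>i. r ^ i)"
    using c0 r by (intro mult_left_mono sum_le_suminf summable_geometric) auto
  also have "\<dots> = c0 * r ^ n / (1 - r)"
    using r by (subst suminf_geometric) auto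
  finally show ?thesis by (simp add: ennreal_leI)
qed

text \<open>Fatou's lemma on the preceding bound. The case n = 0 gives integrability of the norm of
  \<open>Y\<close>; large n serves the passage to the limit in the fixed point equation.\<close>

lemma Y_dist: "(\<integral>\<^sup>+\<omega>. ennreal (norm (Y \<omega> - biter n \<omega>)) \<partial>S) \<le> ennreal (c0 * r ^ n / (1 - r))"
proof -
  have "(\<integral>\<^sup>+\<omega>. ennreal (norm (Y \<omega> - biter n \<omega>)) \<partial>S) = (\<integral>\<^sup>+\<omega>. liminf (\<lambda>k. ennreal (norm (biter (n + k) \<omega> - biter n \<omega>))) \<partial>S)"
  proof (rule nn_integral_cong_AE, use biter_tendsto_Y in eventually_elim)
    case (elim \<omega>)
    then have "(\<lambda>k. biter (k + n) \<omega>) \<longlonglongrightarrow> Y \<omega>" by (rule LIMSEQ_ignore_initial_segment)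
    then have "(\<lambda>k. ennreal (norm (biter (n + k) \<omega> - biter n \<omega>))) \<longlonglongrightarrow> ennreal (norm (Y \<omega> - biter n \<omega>))"
      by (intro tendsto_ennrealI tendsto_intros) (simp add: add.commute)
    then show ?case by (intro lim_imp_Liminf[symmetric]) auto
  qed
  also have "\<dots> \<le> liminf (\<lambda>k. \<integral>\<^sup>+\<omega>. ennreal (norm (biter (n + k) \<omega> - biter n \<omega>)) \<partial>S)"
    by (rule nn_integral_liminf) measurable
  also have "\<dots> \<le> ennreal (c0 * r ^ n / (1 - r))"
  proof (rule Liminf_le)
    show "eventually (\<lambda>k. (\<integral>\<^sup>+\<omega>. ennreal (norm (biter (n + k) \<omega> - biter n \<omega>)) \<partial>S) \<le> ennreal (c0 * r ^ n / (1 - r))) sequentially"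
      by (intro always_eventually allI biter_dist)
  qed simp
  finally show ?thesis .
qed

text \<open>A pathwise limit in the recursion of \<open>biter\<close> would need continuity of
  \<open>\<Theta>\<close> in the state. Contraction in mean carries the recursion to the limit
  instead: the expected distance of the two sides is below a geometric sequence.\<close>

lemma Y_invariant: "AE p in N \<Otimes>\<^sub>M S. Y (fst p ## snd p) = \<Theta> (Y (snd p)) (fst p)"
proof -
  interpret NS: pair_sigma_finite N S by (rule pair_NS)
  interpret S: prob_space S by (rule S_prob)
  let ?d = "\<integral>\<^sup>+p. ennreal (norm (Y (fst p ## snd p) - \<Theta> (Y (snd p)) (fst p))) \<partial>(N \<Otimes>\<^sub>M S)"
  \<comment> \<open>\<open>biter (Suc n)\<close> at \<open>x ## X\<close> equals
    \<open>\<Theta> (biter n X) x\<close>; this is inserted between the two sides.\<close>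
  have bound: "?d \<le> ennreal (c0 * r ^ Suc n / (1 - r)) + ennreal r * ennreal (c0 * r ^ n / (1 - r))" for n
  proof -
    have "?d = (\<integral>\<^sup>+X. \<integral>\<^sup>+x. ennreal (norm (Y (x ## X) - \<Theta> (Y X) x)) \<partial>N \<partial>S)"
      by (subst NS.nn_integral_snd[symmetric]) auto
    also have "\<dots> \<le> (\<integral>\<^sup>+X. (\<integral>\<^sup>+x. ennreal (norm (Y (x ## X) - biter (Suc n) (x ## X))) \<partial>N)
        + (\<integral>\<^sup>+x. ennreal (norm (\<Theta> (biter n X) x - \<Theta> (Y X) x)) \<partial>N) \<partial>S)"
    proof (rule nn_integral_mono)
      fix X assume X: "X \<in> space S"
      have [measurable]: "(\<lambda>x. x ## X) \<in> measurable N S" using X by measurable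
      have "(\<integral>\<^sup>+x. ennreal (norm (Y (x ## X) - \<Theta> (Y X) x)) \<partial>N) \<le>
          (\<integral>\<^sup>+x. ennreal (norm (Y (x ## X) - biter (Suc n) (x ## X))) + ennreal (norm (\<Theta> (biter n X) x - \<Theta> (Y X) x)) \<partial>N)"
      proof (rule nn_integral_mono)
        fix x
        show "ennreal (norm (Y (x ## X) - \<Theta> (Y X) x)) \<le> ennreal (norm (Y (x ## X) - biter (Suc n) (x ## X))) + ennreal (norm (\<Theta> (biter n X) x - \<Theta> (Y X) x))"
          using norm_triangle_ineq[of "Y (x ## X) - \<Theta> (biter n X) x" "\<Theta> (biter n X) x - \<Theta> (Y X) x"]
          by (intro ennreal_le_plusI) auto
      qed
      also have "\<dots> = (\<integral>\<^sup>+x. ennreal (norm (Y (x ## X) - biter (Suc n) (x ## X))) \<partial>N) + (\<integral>\<^sup>+x. ennreal (norm (\<Theta> (biter n X) x - \<Theta> (Y X) x)) \<partial>N)"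
        by (rule nn_integral_add) measurable
      finally show "(\<integral>\<^sup>+x. ennreal (norm (Y (x ## X) - \<Theta> (Y X) x)) \<partial>N) \<le> \<dots>" .
    qed
    also have "\<dots> = (\<integral>\<^sup>+\<omega>. ennreal (norm (Y \<omega> - biter (Suc n) \<omega>)) \<partial>S) + (\<integral>\<^sup>+X. \<integral>\<^sup>+x. ennreal (norm (\<Theta> (biter n X) x - \<Theta> (Y X) x)) \<partial>N \<partial>S)"
    proof -
      have m: "(\<lambda>\<omega>. ennreal (norm (Y \<omega> - biter (Suc n) \<omega>))) \<in> borel_measurable S"
        by measurable
      have [measurable]: "(\<lambda>(X, x). ennreal (norm (Y (x ## X) - biter (Suc n) (x ## X)))) \<in> borel_measurable (S \<Otimes>\<^sub>M N)"
        using biter_measurable[of "Suc n"] unfolding split_beta by (intro measurable_compose[OF _ m]) measurable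
      show ?thesis
        unfolding nn_integral_S[OF m] by (rule nn_integral_add) measurable
    qed
    also have "\<dots> \<le> ennreal (c0 * r ^ Suc n / (1 - r)) + ennreal r * (\<integral>\<^sup>+X. ennreal (norm (biter n X - Y X)) \<partial>S)"
      by (intro add_mono Y_dist nn_integral_\<Theta>_diff_le) measurable
    also have "\<dots> \<le> ennreal (c0 * r ^ Suc n / (1 - r)) + ennreal r * ennreal (c0 * r ^ n / (1 - r))"
      using Y_dist[of n] by (intro add_left_mono mult_left_mono) (simp_all add: norm_minus_commute)
    finally show ?thesis .
  qed
  have "(\<lambda>n. ennreal (c0 * r ^ Suc n / (1 - r)) + ennreal r * ennreal (c0 * r ^ n / (1 - r))) \<longlonglongrightarrow> ennreal (c0 * 0 / (1 - r)) + ennreal r * ennreal (c0 * 0 / (1 - r))"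
    using r by (intro tendsto_add ennreal_tendsto_cmult tendsto_ennrealI tendsto_divide tendsto_mult tendsto_const
        LIMSEQ_Suc LIMSEQ_realpow_zero) auto
  then have "?d \<le> ennreal (c0 * 0 / (1 - r)) + ennreal r * ennreal (c0 * 0 / (1 - r))"
    by (rule LIMSEQ_le_const) (use bound in auto)
  then have "?d = 0" by simp
  then have "AE p in N \<Otimes>\<^sub>M S. ennreal (norm (Y (fst p ## snd p) - \<Theta> (Y (snd p)) (fst p))) = 0"
    by (subst (asm) nn_integral_0_iff_AE) auto
  then show ?thesis by eventually_elim simp
qed

section \<open>The invariant law: support, invariance, mixing and uniqueness\<close>

definition inv_meas :: "'b measure" where "inv_meas = distr S borel Y"

lemma inv_meas_prob: "prob_space inv_meas" and sets_inv_meas: "sets inv_meas = sets borel"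
proof -
  interpret S: prob_space S by (rule S_prob)
  show "prob_space inv_meas" unfolding inv_meas_def by (rule S.prob_space_distr) measurable
qed (simp add: inv_meas_def)

lemma inv_meas_integrable_norm: "integrable inv_meas norm"
proof -
  have "(\<integral>\<^sup>+\<omega>. ennreal (norm (Y \<omega>)) \<partial>S) < \<infinity>"
    using Y_dist[of 0] by (auto intro: le_less_trans)
  then have "integrable S (\<lambda>\<omega>. norm (Y \<omega>))"
    by (intro integrableI_bounded) auto
  then show ?thesis
    unfolding inv_meas_def by (subst integrable_distr_eq) auto
qed

text \<open>Almost surely \<open>Y\<close> is itself a value of \<open>\<Theta>\<close>, by its
  fixed point equation.\<close>

lemma inv_meas_AE_range:
  assumes V: "V \<in> sets borel" and \<Theta>V: "\<And>x s. \<Theta> x s \<in> V"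
  shows "AE y in inv_meas. y \<in> V"
proof -
  have "AE p in N \<Otimes>\<^sub>M S. Y (fst p ## snd p) \<in> V"
    using Y_invariant by eventually_elim (simp add: \<Theta>V)
  then have "AE \<omega> in distr (N \<Otimes>\<^sub>M S) S (\<lambda>p. fst p ## snd p). Y \<omega> \<in> V"
    using V by (subst AE_distr_iff) auto
  then show ?thesis
    unfolding S_eq_distr inv_meas_def using V by (subst AE_distr_iff) auto
qed

text \<open>\<open>Y (x ## X)\<close> has the law of \<open>Y\<close> and almost surely equals
  \<open>\<Theta> (Y X) x\<close> with x independent of X; integrating x first produces the Markov
  operator.\<close>

lemma integral_inv_meas:
  assumes "\<phi> \<in> borel_measurable borel" "\<And>x. \<bar>\<phi> x\<bar> \<le> B"
  shows "(LINT y|inv_meas. K \<phi> y) = (LINT y|inv_meas. \<phi> y)"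
proof -
  interpret NS: pair_sigma_finite N S by (rule pair_NS)
  interpret S: prob_space S by (rule S_prob)
  interpret P: pair_prob_space N S by standard
  have [measurable]: "\<phi> \<in> borel_measurable borel" by fact
  have "(LINT y|inv_meas. \<phi> y) = (LINT \<omega>|S. \<phi> (Y \<omega>))"
    unfolding inv_meas_def by (rule integral_distr) measurable
  also have "\<dots> = integral\<^sup>L (distr (N \<Otimes>\<^sub>M S) S (\<lambda>p. fst p ## snd p)) (\<lambda>\<omega>. \<phi> (Y \<omega>))"
    unfolding S_eq_distr ..
  also have "\<dots> = (LINT p|(N \<Otimes>\<^sub>M S). \<phi> (Y (fst p ## snd p)))"
    by (rule integral_distr) measurable
  also have "\<dots> = (LINT p|(N \<Otimes>\<^sub>M S). \<phi> (\<Theta> (Y (snd p)) (fst p)))"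
    by (rule integral_cong_AE) (use Y_invariant in \<open>auto elim: eventually_mono\<close>)
  also have "\<dots> = (LINT X|S. (LINT x|N. \<phi> (\<Theta> (Y X) x)))"
  proof -
    have "integrable (N \<Otimes>\<^sub>M S) (\<lambda>(x, X). \<phi> (\<Theta> (Y X) x))"
      by (rule P.integrable_const_bound[of _ B]) (use assms(2) in \<open>auto simp: split_beta\<close>)
    from NS.integral_snd[OF this] show ?thesis by (simp add: case_prod_unfold)
  qed
  also have "\<dots> = (LINT y|inv_meas. K \<phi> y)"
    unfolding K_def[symmetric] inv_meas_def by (rule integral_distr[symmetric]) measurable
  finally show ?thesis ..
qed

lemma integral_inv_meas_funpow:
  assumes "\<phi> \<in> borel_measurable borel" "\<And>x. \<bar>\<phi> x\<bar> \<le> B"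
  shows "(LINT y|inv_meas. (K ^^ m) \<phi> y) = (LINT y|inv_meas. \<phi> y)"
proof (induction m)
  case (Suc m)
  then show ?case using integral_inv_meas[OF K_funpow[OF assms]] by simp
qed simp

lemma integrable_inv_meas_dist: "integrable inv_meas (\<lambda>y. norm (x - y))"
proof -
  interpret I: prob_space inv_meas by (rule inv_meas_prob)
  have [measurable_cong]: "sets inv_meas = sets borel" by (rule sets_inv_meas)
  show ?thesis
  proof (rule Bochner_Integration.integrable_bound)
    show "integrable inv_meas (\<lambda>y. norm x + norm y)"
      using inv_meas_integrable_norm by auto
    show "(\<lambda>y. norm (x - y)) \<in> borel_measurable inv_meas" by measurable
    show "AE y in inv_meas. norm (norm (x - y)) \<le> norm (norm x + norm y)"
      by (auto intro: norm_triangle_ineq4)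
  qed
qed

text \<open>By invariance the average of \<phi> is the average of its m-th iterate, whose Lipschitz
  constant has shrunk to L r^m.\<close>

lemma mixing:
  assumes "\<phi> \<in> borel_measurable borel" "\<And>x. \<bar>\<phi> x\<bar> \<le> B"
    and L: "\<And>x y. \<bar>\<phi> x - \<phi> y\<bar> \<le> L * norm (x - y)" "0 \<le> L"
  shows "\<bar>(K ^^ m) \<phi> x - (LINT y|inv_meas. \<phi> y)\<bar> \<le> L * r ^ m * (LINT y|inv_meas. norm (x - y))"
proof -
  interpret I: prob_space inv_meas by (rule inv_meas_prob)
  have [measurable_cong]: "sets inv_meas = sets borel" by (rule sets_inv_meas)
  note K = K_funpow[OF assms(1,2)]
  have [measurable]: "(K ^^ m) \<phi> \<in> borel_measurable borel" by (rule K)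
  have i: "integrable inv_meas ((K ^^ m) \<phi>)"
    by (rule I.integrable_const_bound[of _ B]) (use K in auto)
  have "(K ^^ m) \<phi> x - (LINT y|inv_meas. \<phi> y) = (LINT y|inv_meas. (K ^^ m) \<phi> x - (K ^^ m) \<phi> y)"
    using i integral_inv_meas_funpow[OF assms(1,2), of m] I.prob_space by simp
  also have "\<bar>\<dots>\<bar> \<le> (LINT y|inv_meas. \<bar>(K ^^ m) \<phi> x - (K ^^ m) \<phi> y\<bar>)"
    by (rule integral_abs_bound)
  also have "\<dots> \<le> (LINT y|inv_meas. L * r ^ m * norm (x - y))"
    using i K_funpow_lipschitz[OF assms] integrable_inv_meas_dist[of x] by (intro integral_mono) auto
  finally show ?thesis by simp
qed

text \<open>By mixing, the iterates of \<phi> converge pointwise to a constant; dominated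
  convergence under \<mu> identifies this constant with the average of \<phi> under \<mu>.\<close>

lemma inv_meas_unique:
  assumes "prob_space \<mu>" and sets: "sets \<mu> = sets borel"
    and inv: "\<And>\<phi> B m L. L-lipschitz_on UNIV \<phi> \<Longrightarrow> (\<And>x. \<bar>\<phi> x\<bar> \<le> B) \<Longrightarrow>
      (LINT y|\<mu>. (K ^^ m) \<phi> y) = (LINT y|\<mu>. \<phi> y)"
  shows "\<mu> = inv_meas"
proof (rule measure_eqI_lipschitz)
  interpret \<mu>: prob_space \<mu> by fact
  interpret I: prob_space inv_meas by (rule inv_meas_prob)
  show "finite_measure \<mu>" "finite_measure inv_meas" by unfold_locales
  show "sets \<mu> = sets borel" "sets inv_meas = sets borel" by (fact sets, rule sets_inv_meas)
  fix \<phi> :: "'b \<Rightarrow> real" and L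
  assume L: "L-lipschitz_on UNIV \<phi>" and \<phi>: "\<And>x. 0 \<le> \<phi> x \<and> \<phi> x \<le> 1"
  have [measurable_cong]: "sets \<mu> = sets borel" by (rule sets)
  have m: "\<phi> \<in> borel_measurable borel" by (rule lipschitz_on_borel_measurable[OF L])
  have b: "\<bar>\<phi> x\<bar> \<le> 1" for x using \<phi>[of x] by simp
  have lip: "\<bar>\<phi> x - \<phi> y\<bar> \<le> L * norm (x - y)" for x y
    using lipschitz_onD[OF L, of x y] by (simp add: dist_norm)
  note K = K_funpow[OF m b]
  have [measurable]: "(K ^^ m) \<phi> \<in> borel_measurable borel" for m by (rule K)
  have "(\<lambda>m. (K ^^ m) \<phi> x) \<longlonglongrightarrow> (LINT y|inv_meas. \<phi> y)" for x
  proof (rule LIM_zero_cancel, rule Lim_null_comparison)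
    show "eventually (\<lambda>m. norm ((K ^^ m) \<phi> x - (LINT y|inv_meas. \<phi> y)) \<le> L * r ^ m * (LINT y|inv_meas. norm (x - y))) sequentially"
      using mixing[OF m b lip lipschitz_on_nonneg[OF L]] by simp
    have "(\<lambda>m. L * r ^ m * (LINT y|inv_meas. norm (x - y))) \<longlonglongrightarrow> L * 0 * (LINT y|inv_meas. norm (x - y))"
      using r by (intro tendsto_intros LIMSEQ_realpow_zero)
    then show "(\<lambda>m. L * r ^ m * (LINT y|inv_meas. norm (x - y))) \<longlonglongrightarrow> 0" by simp
  qed
  then have "(\<lambda>m. LINT y|\<mu>. (K ^^ m) \<phi> y) \<longlonglongrightarrow> (LINT y|\<mu>. (LINT y|inv_meas. \<phi> y))"
    by (intro integral_dominated_convergence[where w = "\<lambda>_. 1"]) (use K in auto)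
  then show "(LINT x|\<mu>. \<phi> x) = (LINT x|inv_meas. \<phi> x)"
    using inv[OF L b] \<mu>.prob_space by (simp add: LIMSEQ_const_iff)
qed

end

section \<open>Gaussian series with state-dependent coefficients\<close>

text \<open>The weighted inequality (a + b)^2 \<le> (1 + d) a^2 + (1 + 1/d) b^2 preserves the
  constant \<open>C\<close> in the limit; the cruder factor 2 would destroy the contraction
  later.\<close>

lemma L2_limit_le:
  fixes X :: "'n \<Rightarrow> 'b::{real_normed_vector, second_countable_topology}"
  assumes [measurable]: "X \<in> borel_measurable N" "\<And>n. Y n \<in> borel_measurable N"
    and lim: "(\<lambda>n. \<integral>\<^sup>+s. ennreal ((norm (X s - Y n s))\<^sup>2) \<partial>N) \<longlonglongrightarrow> 0"
    and bd: "\<And>n. (\<integral>\<^sup>+s. ennreal ((norm (Y n s))\<^sup>2) \<partial>N) \<le> ennreal C" and C: "0 \<le> C"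
  shows "(\<integral>\<^sup>+s. ennreal ((norm (X s))\<^sup>2) \<partial>N) \<le> ennreal C"
proof (rule ennreal_le_epsilon)
  fix e :: real assume e: "e > 0"
  \<comment> \<open>Small enough for d C \<le> e, and positive also for C = 0.\<close>
  define d where "d = e / (C + 1)"
  have d: "d > 0" using e C by (simp add: d_def)
  have le: "(norm (X s))\<^sup>2 \<le> (1 + d) * (norm (Y n s))\<^sup>2 + (1 + 1 / d) * (norm (X s - Y n s))\<^sup>2" for n s
  proof -
    define a b where "a = norm (Y n s)" and "b = norm (X s - Y n s)"
    have "norm (X s) \<le> a + b" using norm_triangle_ineq[of "Y n s" "X s - Y n s"] by (simp add: a_def b_def)
    then have "(norm (X s))\<^sup>2 \<le> (a + b)\<^sup>2" by (intro power_mono) auto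
    also have "\<dots> \<le> (1 + d) * a\<^sup>2 + (1 + 1 / d) * b\<^sup>2"
    proof -
      have "0 \<le> (d * a - b)\<^sup>2 / d" using d by simp
      also have "\<dots> = d * a\<^sup>2 - 2 * a * b + b\<^sup>2 / d"
        using d by (simp add: power2_eq_square field_simps)
      finally show ?thesis by (simp add: power2_sum algebra_simps)
    qed
    finally show ?thesis by (simp add: a_def b_def)
  qed
  have "(\<integral>\<^sup>+s. ennreal ((norm (X s))\<^sup>2) \<partial>N) \<le> ennreal (1 + d) * ennreal C
      + ennreal (1 + 1 / d) * (\<integral>\<^sup>+s. ennreal ((norm (X s - Y n s))\<^sup>2) \<partial>N)" for n
  proof -
    have "(\<integral>\<^sup>+s. ennreal ((norm (X s))\<^sup>2) \<partial>N)
      \<le> (\<integral>\<^sup>+s. ennreal (1 + d) * ennreal ((norm (Y n s))\<^sup>2) + ennreal (1 + 1 / d) * ennreal ((norm (X s - Y n s))\<^sup>2) \<partial>N)"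
    proof (rule nn_integral_mono)
      fix s
      show "ennreal ((norm (X s))\<^sup>2) \<le> ennreal (1 + d) * ennreal ((norm (Y n s))\<^sup>2) + ennreal (1 + 1 / d) * ennreal ((norm (X s - Y n s))\<^sup>2)"
        using ennreal_le_plusI[OF le[of s n]] d by (simp add: ennreal_mult del: ennreal_plus)
    qed
    also have "\<dots> = ennreal (1 + d) * (\<integral>\<^sup>+s. ennreal ((norm (Y n s))\<^sup>2) \<partial>N)
        + ennreal (1 + 1 / d) * (\<integral>\<^sup>+s. ennreal ((norm (X s - Y n s))\<^sup>2) \<partial>N)"
      by (simp add: nn_integral_add nn_integral_cmult del: ennreal_plus)
    also have "\<dots> \<le> ennreal (1 + d) * ennreal C
        + ennreal (1 + 1 / d) * (\<integral>\<^sup>+s. ennreal ((norm (X s - Y n s))\<^sup>2) \<partial>N)"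
      by (intro add_mono mult_left_mono bd) auto
    finally show ?thesis .
  qed
  moreover have "(\<lambda>n. ennreal (1 + d) * ennreal C
      + ennreal (1 + 1 / d) * (\<integral>\<^sup>+s. ennreal ((norm (X s - Y n s))\<^sup>2) \<partial>N)) \<longlonglongrightarrow> ennreal (1 + d) * ennreal C + ennreal (1 + 1 / d) * 0"
    by (intro tendsto_intros lim) (auto simp del: ennreal_plus)
  ultimately have "(\<integral>\<^sup>+s. ennreal ((norm (X s))\<^sup>2) \<partial>N) \<le> ennreal (1 + d) * ennreal C + ennreal (1 + 1 / d) * 0"
    by (intro LIMSEQ_le_const) auto
  then have "(\<integral>\<^sup>+s. ennreal ((norm (X s))\<^sup>2) \<partial>N) \<le> ennreal (1 + d) * ennreal C" by simp
  also have "\<dots> \<le> ennreal C + ennreal e"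
  proof -
    have "(1 + d) * C \<le> C + e" using e C by (simp add: d_def field_simps)
    then show ?thesis
      using ennreal_le_plusI[of "(1 + d) * C" C e] d e C by (simp add: ennreal_mult del: ennreal_plus)
  qed
  finally show "(\<integral>\<^sup>+s. ennreal ((norm (X s))\<^sup>2) \<partial>N) \<le> ennreal C + ennreal e" .
qed

lemma nn_integral_power2_norm_add_le:
  fixes X Y :: "'n \<Rightarrow> 'b::{real_normed_vector, second_countable_topology}"
  assumes [measurable]: "X \<in> borel_measurable N" "Y \<in> borel_measurable N"
  shows "(\<integral>\<^sup>+s. ennreal ((norm (X s + Y s))\<^sup>2) \<partial>N)
    \<le> 2 * (\<integral>\<^sup>+s. ennreal ((norm (X s))\<^sup>2) \<partial>N) + 2 * (\<integral>\<^sup>+s. ennreal ((norm (Y s))\<^sup>2) \<partial>N)"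
proof -
  have le: "(norm (x + y))\<^sup>2 \<le> 2 * (norm x)\<^sup>2 + 2 * (norm y)\<^sup>2" for x y :: 'b
  proof -
    have "(norm (x + y))\<^sup>2 \<le> (norm x + norm y)\<^sup>2" by (intro power_mono norm_triangle_ineq) auto
    also have "\<dots> \<le> 2 * (norm x)\<^sup>2 + 2 * (norm y)\<^sup>2"
      using zero_le_power2[of "norm x - norm y"] unfolding power2_sum power2_diff by linarith
    finally show ?thesis .
  qed
  have "(\<integral>\<^sup>+s. ennreal ((norm (X s + Y s))\<^sup>2) \<partial>N)
    \<le> (\<integral>\<^sup>+s. ennreal (2 * (norm (X s))\<^sup>2) + ennreal (2 * (norm (Y s))\<^sup>2) \<partial>N)"
    by (intro nn_integral_mono ennreal_le_plusI le) auto
  also have "\<dots> = 2 * (\<integral>\<^sup>+s. ennreal ((norm (X s))\<^sup>2) \<partial>N) + 2 * (\<integral>\<^sup>+s. ennreal ((norm (Y s))\<^sup>2) \<partial>N)"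
    by (simp add: nn_integral_add nn_integral_cmult ennreal_mult)
  finally show ?thesis .
qed

text \<open>Pins down the stochastic product, which the scheme specifies only as a mean-square
  limit.\<close>

lemma L2_limit_unique:
  fixes X X' :: "'n \<Rightarrow> 'b::{real_normed_vector, second_countable_topology}"
  assumes [measurable]: "X \<in> borel_measurable N" "X' \<in> borel_measurable N" "\<And>n. Y n \<in> borel_measurable N"
    and lim: "(\<lambda>n. \<integral>\<^sup>+s. ennreal ((norm (X s - Y n s))\<^sup>2) \<partial>N) \<longlonglongrightarrow> 0"
      "(\<lambda>n. \<integral>\<^sup>+s. ennreal ((norm (X' s - Y n s))\<^sup>2) \<partial>N) \<longlonglongrightarrow> 0"
  shows "AE s in N. X s = X' s"
proof -
  have "(\<integral>\<^sup>+s. ennreal ((norm (X s - X' s))\<^sup>2) \<partial>N) \<le> 2 * (\<integral>\<^sup>+s. ennreal ((norm (X s - Y n s))\<^sup>2) \<partial>N)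
      + 2 * (\<integral>\<^sup>+s. ennreal ((norm (X' s - Y n s))\<^sup>2) \<partial>N)" for n
    using nn_integral_power2_norm_add_le[of "\<lambda>s. X s - Y n s" N "\<lambda>s. Y n s - X' s"]
    by (simp add: norm_minus_commute)
  moreover have "(\<lambda>n. 2 * (\<integral>\<^sup>+s. ennreal ((norm (X s - Y n s))\<^sup>2) \<partial>N)
      + 2 * (\<integral>\<^sup>+s. ennreal ((norm (X' s - Y n s))\<^sup>2) \<partial>N)) \<longlonglongrightarrow> 2 * 0 + 2 * 0"
    by (intro tendsto_intros lim) auto
  ultimately have "(\<integral>\<^sup>+s. ennreal ((norm (X s - X' s))\<^sup>2) \<partial>N) \<le> 0"
    by (intro LIMSEQ_le_const) auto
  then have "(\<integral>\<^sup>+s. ennreal ((norm (X s - X' s))\<^sup>2) \<partial>N) = 0" by simp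
  then show ?thesis by (subst (asm) nn_integral_0_iff_AE) auto
qed

text \<open>Jensen's inequality from g \<le> g^2 / (2 D) + D / 2. Taking D = C + e avoids a zero
  denominator, and e is arbitrary.\<close>

lemma (in prob_space) nn_integral_le_of_power2:
  assumes [measurable]: "g \<in> borel_measurable M" and "\<And>s. 0 \<le> g s" "0 \<le> C"
    and sq: "(\<integral>\<^sup>+s. ennreal ((g s)\<^sup>2) \<partial>M) \<le> ennreal (C\<^sup>2)"
  shows "(\<integral>\<^sup>+s. ennreal (g s) \<partial>M) \<le> ennreal C"
proof (rule ennreal_le_epsilon)
  fix e :: real assume e: "e > 0"
  define D where "D = C + e"
  have D: "D > 0" "C\<^sup>2 \<le> D\<^sup>2" using e assms(3) by (auto simp: D_def intro: power_mono)
  have "g s \<le> (1 / (2 * D)) * (g s)\<^sup>2 + D / 2" for s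
  proof -
    have "0 \<le> (g s - D)\<^sup>2 / (2 * D)" using D by simp
    also have "\<dots> = (1 / (2 * D)) * (g s)\<^sup>2 + D / 2 - g s"
      using D by (simp add: power2_eq_square field_simps)
    finally show ?thesis by simp
  qed
  then have "(\<integral>\<^sup>+s. ennreal (g s) \<partial>M) \<le> (\<integral>\<^sup>+s. ennreal ((1 / (2 * D)) * (g s)\<^sup>2) + ennreal (D / 2) \<partial>M)"
    using D by (intro nn_integral_mono ennreal_le_plusI) auto
  also have "\<dots> = ennreal (1 / (2 * D)) * (\<integral>\<^sup>+s. ennreal ((g s)\<^sup>2) \<partial>M) + ennreal (D / 2)"
  proof -
    have "ennreal ((1 / (2 * D)) * (g s)\<^sup>2) = ennreal (1 / (2 * D)) * ennreal ((g s)\<^sup>2)" for s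
      using D by (intro ennreal_mult) auto
    then show ?thesis by (simp only:) (simp add: nn_integral_add nn_integral_cmult emeasure_space_1)
  qed
  also have "\<dots> \<le> ennreal (1 / (2 * D)) * ennreal (D\<^sup>2) + ennreal (D / 2)"
    using sq D by (intro add_mono mult_left_mono order_trans[OF sq] ennreal_leI) auto
  also have "\<dots> = ennreal D"
    using D by (simp add: ennreal_mult[symmetric] ennreal_plus[symmetric] power2_eq_square field_simps del: ennreal_plus)
  finally show "(\<integral>\<^sup>+s. ennreal (g s) \<partial>M) \<le> ennreal C + ennreal e"
    using assms(3) e by (simp add: D_def)
qed

text \<open>The law of independent centred normal variables of variance \<tau>;
  \<open>normal_density\<close> takes the standard deviation. Keeping the variance \<tau> makes the
  sequence directly the law of Brownian increments over one step.\<close>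

definition gauss_seq :: "real \<Rightarrow> (nat \<Rightarrow> real) measure" where
  "gauss_seq \<tau> = Pi\<^sub>M UNIV (\<lambda>_. density lborel (\<lambda>x. ennreal (normal_density 0 (sqrt \<tau>) x)))"

lemma sets_gauss_seq [measurable_cong]: "sets (gauss_seq \<tau>) = sets (Pi\<^sub>M UNIV (\<lambda>_. borel))"
  unfolding gauss_seq_def by (intro sets_PiM_cong) auto

section \<open>Moments and isometry for Gaussian sequences\<close>

context
  fixes \<tau> :: real
  assumes \<tau>: "0 < \<tau>"
begin

lemma prob_space_gauss_seq: "prob_space (gauss_seq \<tau>)"
  unfolding gauss_seq_def using \<tau> by (intro prob_space_PiM prob_space_normal_density) simp

lemma distr_gauss_seq: "distr (gauss_seq \<tau>) borel (\<lambda>s. s k) = density lborel (\<lambda>x. ennreal (normal_density 0 (sqrt \<tau>) x))"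
proof -
  have "distr (gauss_seq \<tau>) borel (\<lambda>s. s k) = distr (gauss_seq \<tau>) (density lborel (\<lambda>x. ennreal (normal_density 0 (sqrt \<tau>) x))) (\<lambda>s. s k)"
    by (rule distr_cong) auto
  also have "\<dots> = density lborel (\<lambda>x. ennreal (normal_density 0 (sqrt \<tau>) x))"
    unfolding gauss_seq_def using \<tau> by (intro distr_PiM_component prob_space_normal_density) auto
  finally show ?thesis .
qed

lemma gauss_seq_moments:
  "integrable (gauss_seq \<tau>) (\<lambda>s. s k)" "integrable (gauss_seq \<tau>) (\<lambda>s. (s k)\<^sup>2)"
  "(LINT s|gauss_seq \<tau>. s k) = 0" "(LINT s|gauss_seq \<tau>. (s k)\<^sup>2) = \<tau>"
proof -
  have m: "integrable (gauss_seq \<tau>) (\<lambda>s. g (s k)) = integrable lborel (\<lambda>x. normal_density 0 (sqrt \<tau>) x * g x)"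
    "(LINT s|gauss_seq \<tau>. g (s k)) = (LINT x|lborel. normal_density 0 (sqrt \<tau>) x * g x)"
    if [measurable]: "g \<in> borel_measurable borel" for g :: "real \<Rightarrow> real"
    using integrable_distr_eq[of "\<lambda>s. s k" "gauss_seq \<tau>" borel g] integral_distr[of "\<lambda>s. s k" "gauss_seq \<tau>" borel g]
    unfolding distr_gauss_seq by (simp_all add: integrable_density integral_density)
  have s: "0 < sqrt \<tau>" using \<tau> by simp
  show "integrable (gauss_seq \<tau>) (\<lambda>s. s k)" "integrable (gauss_seq \<tau>) (\<lambda>s. (s k)\<^sup>2)"
    using m(1)[of "\<lambda>x. x"] m(1)[of "\<lambda>x. x\<^sup>2"] integrable_normal_moment[OF s, of 0 1] integrable_normal_moment[OF s, of 0 2] by auto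
  show "(LINT s|gauss_seq \<tau>. s k) = 0" "(LINT s|gauss_seq \<tau>. (s k)\<^sup>2) = \<tau>"
    using m(2)[of "\<lambda>x. x"] m(2)[of "\<lambda>x. x\<^sup>2"] integral_normal_moment_odd[OF s, of 0 0] integral_normal_moment_even[OF s, of 0 1] \<tau>
    by (auto simp: power2_eq_square mult_ac)
qed

lemma gauss_seq_orthogonal:
  assumes "j \<noteq> k"
  shows "integrable (gauss_seq \<tau>) (\<lambda>s. s j * s k)" "(LINT s|gauss_seq \<tau>. s j * s k) = 0"
proof -
  interpret prob_space "gauss_seq \<tau>" by (rule prob_space_gauss_seq)
  have iv: "indep_vars (\<lambda>_. borel) (\<lambda>i s. s i) (UNIV :: nat set)"
  proof (subst indep_vars_iff_distr_eq_PiM)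
    have "distr (gauss_seq \<tau>) (Pi\<^sub>M UNIV (\<lambda>_. borel)) (\<lambda>s. \<lambda>i\<in>UNIV. s i) = distr (gauss_seq \<tau>) (gauss_seq \<tau>) (\<lambda>s. s)"
      by (rule distr_cong) (auto simp: sets_gauss_seq)
    also have "\<dots> = gauss_seq \<tau>" by (rule distr_id)
    finally show "distr (gauss_seq \<tau>) (Pi\<^sub>M UNIV (\<lambda>_. borel)) (\<lambda>s. \<lambda>i\<in>UNIV. s i) = Pi\<^sub>M UNIV (\<lambda>i. distr (gauss_seq \<tau>) borel (\<lambda>s. s i))"
      unfolding distr_gauss_seq by (simp add: gauss_seq_def)
  qed auto
  have iv2: "indep_vars (\<lambda>_. borel) (\<lambda>i s. s i) {j, k}" by (rule indep_vars_subset[OF iv]) simp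
  show "integrable (gauss_seq \<tau>) (\<lambda>s. s j * s k)" "(LINT s|gauss_seq \<tau>. s j * s k) = 0"
    using indep_vars_integrable[OF _ iv2] indep_vars_lebesgue_integral[OF _ iv2] assms
    by (simp_all add: gauss_seq_moments)
qed

text \<open>Ito's isometry for fixed coefficients: after expanding the square, linear terms are
  centred and only the diagonal of the double sum survives. The offset \<open>a\<close> allows state
  and noise to be estimated together.\<close>

lemma gauss_isometry:
  fixes a :: "'b::{real_inner, banach, second_countable_topology}"
  assumes "finite I"
  shows "(\<integral>\<^sup>+s. ennreal ((norm (a + (\<Sum>k\<in>I. s k *\<^sub>R d k)))\<^sup>2) \<partial>gauss_seq \<tau>) = ennreal ((norm a)\<^sup>2 + \<tau> * (\<Sum>k\<in>I. (norm (d k))\<^sup>2))"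
proof -
  interpret prob_space "gauss_seq \<tau>" by (rule prob_space_gauss_seq)
  have eq: "(norm (a + (\<Sum>k\<in>I. s k *\<^sub>R d k)))\<^sup>2 = (norm a)\<^sup>2 + 2 * (\<Sum>k\<in>I. s k * inner a (d k))
      + (\<Sum>j\<in>I. \<Sum>k\<in>I. (s j * s k) * inner (d j) (d k))" for s
    unfolding power2_norm_eq_inner
    by (simp add: inner_add_left inner_add_right inner_sum_left inner_sum_right sum_distrib_left inner_commute mult_ac)
  have int: "integrable (gauss_seq \<tau>) (\<lambda>s. s j * s k)" for j k
    using gauss_seq_orthogonal(1)[of j k] gauss_seq_moments(2)[of k] by (cases "j = k") (auto simp: power2_eq_square)
  have val: "(LINT s|gauss_seq \<tau>. s j * s k) = (if j = k then \<tau> else 0)" for j k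
    using gauss_seq_orthogonal(2)[of j k] gauss_seq_moments(4)[of k] by (cases "j = k") (auto simp: power2_eq_square)
  have i1: "integrable (gauss_seq \<tau>) (\<lambda>s. \<Sum>k\<in>I. s k * inner a (d k))"
    by (intro Bochner_Integration.integrable_sum integrable_mult_left gauss_seq_moments)
  have i2: "integrable (gauss_seq \<tau>) (\<lambda>s. \<Sum>j\<in>I. \<Sum>k\<in>I. (s j * s k) * inner (d j) (d k))"
    by (intro Bochner_Integration.integrable_sum integrable_mult_left int)
  have v1: "(LINT s|gauss_seq \<tau>. (\<Sum>k\<in>I. s k * inner a (d k))) = 0"
    by (subst Bochner_Integration.integral_sum) (auto intro!: integrable_mult_left gauss_seq_moments simp: gauss_seq_moments(3))
  have v2: "(LINT s|gauss_seq \<tau>. (\<Sum>j\<in>I. \<Sum>k\<in>I. (s j * s k) * inner (d j) (d k))) = \<tau> * (\<Sum>k\<in>I. (norm (d k))\<^sup>2)"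
  proof -
    have "(LINT s|gauss_seq \<tau>. (\<Sum>j\<in>I. \<Sum>k\<in>I. (s j * s k) * inner (d j) (d k)))
        = (\<Sum>j\<in>I. \<Sum>k\<in>I. (if j = k then \<tau> else 0) * inner (d j) (d k))"
      using int by (simp add: Bochner_Integration.integral_sum val)
    also have "\<dots> = (\<Sum>j\<in>I. \<tau> * (norm (d j))\<^sup>2)"
    proof (intro sum.cong refl)
      fix j assume "j \<in> I"
      have "(\<Sum>k\<in>I. (if j = k then \<tau> else 0) * inner (d j) (d k)) = (\<Sum>k\<in>I. if j = k then \<tau> * inner (d j) (d k) else 0)"
        by (intro sum.cong) auto
      then show "(\<Sum>k\<in>I. (if j = k then \<tau> else 0) * inner (d j) (d k)) = \<tau> * (norm (d j))\<^sup>2"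
        using \<open>j \<in> I\<close> \<open>finite I\<close> by (simp add: power2_norm_eq_inner)
    qed
    finally show ?thesis by (simp add: sum_distrib_left)
  qed
  have i: "integrable (gauss_seq \<tau>) (\<lambda>s. (norm (a + (\<Sum>k\<in>I. s k *\<^sub>R d k)))\<^sup>2)"
    unfolding eq using i1 i2 by (intro Bochner_Integration.integrable_add integrable_mult_right) auto
  have "(LINT s|gauss_seq \<tau>. (norm (a + (\<Sum>k\<in>I. s k *\<^sub>R d k)))\<^sup>2) = (norm a)\<^sup>2 + \<tau> * (\<Sum>k\<in>I. (norm (d k))\<^sup>2)"
    unfolding eq using i1 i2 v1 v2 by (simp add: prob_space)
  then show ?thesis using i by (subst nn_integral_eq_integral) auto
qed

end

text \<open>\<open>\<gamma> k x\<close> will be G(x) applied to the k-th vector of the orthonormal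
  basis of H_0. The Lipschitz bound is put on partial sums, which is what the isometry is applied
  to.\<close>

locale gaussian_series =
  fixes \<tau> L6 L7 L8 :: real and \<gamma> :: "nat \<Rightarrow> 'b::{real_inner, banach, second_countable_topology} \<Rightarrow> 'b"
  assumes \<tau>: "0 < \<tau>" and L678: "0 \<le> L6" "0 \<le> L7" "0 \<le> L8"
    and \<gamma>_measurable [measurable]: "\<And>k. \<gamma> k \<in> borel_measurable borel"
    and \<gamma>_summable: "\<And>x. summable (\<lambda>k. (norm (\<gamma> k x))\<^sup>2)"
    and \<gamma>_growth: "\<And>x. (\<Sum>k. (norm (\<gamma> k x))\<^sup>2) \<le> L7 * (norm x)\<^sup>2 + L8"
    and \<gamma>_lipschitz: "\<And>n x y. (\<Sum>k<n. (norm (\<gamma> k x - \<gamma> k y))\<^sup>2) \<le> L6 * (norm (x - y))\<^sup>2"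
begin

abbreviation "\<nu> \<equiv> gauss_seq \<tau>"

sublocale \<nu>: prob_space \<nu> by (rule prob_space_gauss_seq[OF \<tau>])

definition psum :: "nat \<Rightarrow> 'b \<Rightarrow> (nat \<Rightarrow> real) \<Rightarrow> 'b" where
  "psum n x s = (\<Sum>k<n. s k *\<^sub>R \<gamma> k x)"

lemma coord_measurable [measurable]: "(\<lambda>s. s k) \<in> borel_measurable \<nu>" by measurable

lemma psum_measurable [measurable]: "(\<lambda>p. psum n (fst p) (snd p)) \<in> borel_measurable (borel \<Otimes>\<^sub>M \<nu>)"
  unfolding psum_def by measurable

lemma psum_measurable1 [measurable]: "psum n x \<in> borel_measurable \<nu>"
  unfolding psum_def by measurable

definition tail :: "nat \<Rightarrow> 'b \<Rightarrow> real" where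
  "tail n x = (\<Sum>k. (norm (\<gamma> k x))\<^sup>2) - (\<Sum>k<n. (norm (\<gamma> k x))\<^sup>2)"

lemma tail_measurable [measurable]: "tail n \<in> borel_measurable borel"
  unfolding tail_def by measurable

lemma tail_nonneg: "0 \<le> tail n x"
  using sum_le_suminf[OF \<gamma>_summable, of "{..<n}" x] by (simp add: tail_def)

lemma tail_le: "tail n x \<le> L7 * (norm x)\<^sup>2 + L8"
  using \<gamma>_growth[of x] sum_nonneg[of "{..<n}" "\<lambda>k. (norm (\<gamma> k x))\<^sup>2"] by (simp add: tail_def)

lemma tail_tendsto: "(\<lambda>n. tail n x) \<longlonglongrightarrow> 0"
  unfolding tail_def using tendsto_diff[OF tendsto_const summable_LIMSEQ[OF \<gamma>_summable[of x]], of "\<Sum>k. (norm (\<gamma> k x))\<^sup>2"] by simp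

lemma psum_diff_eq:
  assumes "m \<le> n"
  shows "(\<integral>\<^sup>+s. ennreal ((norm (psum n x s - psum m x s))\<^sup>2) \<partial>\<nu>) = ennreal (\<tau> * (tail m x - tail n x))"
proof -
  have sum: "sum f {..<n} = sum f {..<m} + sum f {m..<n}" for f :: "nat \<Rightarrow> 'c::ab_group_add"
    using assms sum.atLeastLessThan_concat[of 0 m n f] by (simp add: lessThan_atLeast0)
  have eq: "psum n x s - psum m x s = 0 + (\<Sum>k\<in>{m..<n}. s k *\<^sub>R \<gamma> k x)" for s
    by (simp add: psum_def sum)
  show ?thesis
    unfolding eq by (subst gauss_isometry[OF \<tau>]) (simp_all add: tail_def sum)
qed

lemma psum_diff_le: "(\<integral>\<^sup>+s. ennreal ((norm (psum n x s - psum m x s))\<^sup>2) \<partial>\<nu>) \<le> ennreal (\<tau> * (tail m x + tail n x))"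
proof (cases "m \<le> n")
  case True
  then show ?thesis unfolding psum_diff_eq[OF True] using \<tau> tail_nonneg[of n x] by (intro ennreal_leI mult_left_mono) auto
next
  case False
  then have "n \<le> m" by simp
  then show ?thesis using psum_diff_eq[of n m x] \<tau> tail_nonneg[of m x]
    by (simp add: norm_minus_commute ennreal_leI)
qed

text \<open>Truncation at an index that depends measurably on the state and leaves a remainder of at
  most 4^(-j). Consecutive truncations are then close enough to converge almost surely for every
  state, while each remains jointly measurable in state and noise.\<close>

definition cut :: "nat \<Rightarrow> 'b \<Rightarrow> nat" where
  "cut j x = (LEAST n. tail n x \<le> (1/4) ^ j)"

lemma cut_measurable [measurable]: "cut j \<in> measurable borel (count_space UNIV)"
  unfolding cut_def by measurable

lemma tail_cut: "tail (cut j x) x \<le> (1/4) ^ j"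
proof -
  have "eventually (\<lambda>n. tail n x < (1/4) ^ j) sequentially"
    by (rule order_tendstoD(2)[OF tail_tendsto]) simp
  then obtain n where "tail n x \<le> (1/4) ^ j"
    by (auto simp: eventually_sequentially intro: less_imp_le)
  then show ?thesis unfolding cut_def by (rule LeastI)
qed

lemma psum_cut_measurable [measurable]: "(\<lambda>p. psum (cut j (fst p)) (fst p) (snd p)) \<in> borel_measurable (borel \<Otimes>\<^sub>M \<nu>)"
  by (rule measurable_compose_countable[where f = "\<lambda>n p. psum n (fst p) (snd p)" and g = "\<lambda>p. cut j (fst p)"]) measurable

text \<open>Where the truncations diverge, \<open>lim\<close> takes some unspecified value; for each
  state this concerns a null set of noises.\<close>

definition Z :: "'b \<Rightarrow> (nat \<Rightarrow> real) \<Rightarrow> 'b" where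
  "Z x s = lim (\<lambda>j. psum (cut j x) x s)"

lemma Z_measurable [measurable]: "(\<lambda>p. Z (fst p) (snd p)) \<in> borel_measurable (borel \<Otimes>\<^sub>M \<nu>)"
  unfolding Z_def by measurable

lemma Z_measurable1 [measurable]: "Z x \<in> borel_measurable \<nu>"
  using measurable_compose[OF measurable_Pair1'[of x borel \<nu>] Z_measurable] by simp

lemma psum_cut_converges: "AE s in \<nu>. (\<lambda>j. psum (cut j x) x s) \<longlonglongrightarrow> Z x s"
proof -
  have "AE s in \<nu>. convergent (\<lambda>j. psum (cut j x) x s)"
  proof (rule AE_convergent_of_fast)
    show "(\<integral>\<^sup>+s. ennreal ((norm (psum (cut (Suc j) x) x s - psum (cut j x) x s))\<^sup>2) \<partial>\<nu>) \<le> ennreal ((2 * \<tau>) * (1/4) ^ j)" for j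
    proof -
      have "(1/4::real) ^ Suc j \<le> (1/4) ^ j" by simp
      then have "tail (cut j x) x + tail (cut (Suc j) x) x \<le> 2 * (1/4) ^ j"
        using tail_cut[of j x] tail_cut[of "Suc j" x] by linarith
      then have "\<tau> * (tail (cut j x) x + tail (cut (Suc j) x) x) \<le> (2 * \<tau>) * (1/4) ^ j"
        using \<tau> mult_left_mono[of _ _ \<tau>] by fastforce
      then show ?thesis
        by (rule order_trans[OF psum_diff_le ennreal_leI])
    qed
  qed (use \<tau> in auto)
  then show ?thesis
    unfolding Z_def by eventually_elim (simp add: convergent_LIMSEQ_iff)
qed

text \<open>Fatou's lemma along the truncations, whose own remainders vanish. So the full sequence
  of partial sums converges in mean square to the limit of the truncations.\<close>

lemma Z_psum_le: "(\<integral>\<^sup>+s. ennreal ((norm (Z x s - psum n x s))\<^sup>2) \<partial>\<nu>) \<le> ennreal (\<tau> * tail n x)"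
proof -
  have "(\<integral>\<^sup>+s. ennreal ((norm (Z x s - psum n x s))\<^sup>2) \<partial>\<nu>)
      = (\<integral>\<^sup>+s. liminf (\<lambda>j. ennreal ((norm (psum (cut j x) x s - psum n x s))\<^sup>2)) \<partial>\<nu>)"
  proof (rule nn_integral_cong_AE)
    show "AE s in \<nu>. ennreal ((norm (Z x s - psum n x s))\<^sup>2) = liminf (\<lambda>j. ennreal ((norm (psum (cut j x) x s - psum n x s))\<^sup>2))"
      using psum_cut_converges[of x]
    proof eventually_elim
      case (elim s)
      then have "(\<lambda>j. ennreal ((norm (psum (cut j x) x s - psum n x s))\<^sup>2)) \<longlonglongrightarrow> ennreal ((norm (Z x s - psum n x s))\<^sup>2)"
        by (intro tendsto_intros)
      then show ?case by (rule lim_imp_Liminf[OF sequentially_bot, symmetric])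
    qed
  qed
  also have "\<dots> \<le> liminf (\<lambda>j. \<integral>\<^sup>+s. ennreal ((norm (psum (cut j x) x s - psum n x s))\<^sup>2) \<partial>\<nu>)"
    by (rule nn_integral_liminf) measurable
  also have "\<dots> \<le> liminf (\<lambda>j. ennreal (\<tau> * (tail n x + (1/4) ^ j)))"
  proof (intro Liminf_mono always_eventually allI)
    fix j
    have "\<tau> * (tail n x + tail (cut j x) x) \<le> \<tau> * (tail n x + (1/4) ^ j)"
      using \<tau> tail_cut[of j x] by (intro mult_left_mono) auto
    then show "(\<integral>\<^sup>+s. ennreal ((norm (psum (cut j x) x s - psum n x s))\<^sup>2) \<partial>\<nu>) \<le> ennreal (\<tau> * (tail n x + (1/4) ^ j))"
      by (rule order_trans[OF psum_diff_le ennreal_leI])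
  qed
  also have "\<dots> = ennreal (\<tau> * (tail n x + 0))"
    by (intro lim_imp_Liminf tendsto_intros LIMSEQ_power_zero) auto
  finally show ?thesis by simp
qed

lemma Z_psum_tendsto: "(\<lambda>n. \<integral>\<^sup>+s. ennreal ((norm (Z x s - psum n x s))\<^sup>2) \<partial>\<nu>) \<longlonglongrightarrow> 0"
proof (rule tendsto_sandwich[OF _ _ tendsto_const])
  have "(\<lambda>n. ennreal (\<tau> * tail n x)) \<longlonglongrightarrow> ennreal (\<tau> * 0)"
    by (intro tendsto_intros tail_tendsto)
  then show "(\<lambda>n. ennreal (\<tau> * tail n x)) \<longlonglongrightarrow> 0" by simp
qed (auto simp: Z_psum_le)

lemma Z_growth: "(\<integral>\<^sup>+s. ennreal ((norm (Z x s))\<^sup>2) \<partial>\<nu>) \<le> ennreal (\<tau> * (L7 * (norm x)\<^sup>2 + L8))"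
  using Z_psum_le[of x 0] ennreal_leI[OF mult_left_mono[OF tail_le[of 0 x], of \<tau>]] \<tau>
  by (simp add: psum_def)

text \<open>The isometry holds for partial sums, and \<open>L2_limit_le\<close> passes to the limit
  without enlarging the constant.\<close>

lemma Z_contraction:
  "(\<integral>\<^sup>+s. ennreal ((norm (a + (Z x s - Z y s)))\<^sup>2) \<partial>\<nu>) \<le> ennreal ((norm a)\<^sup>2 + \<tau> * (L6 * (norm (x - y))\<^sup>2))"
proof (rule L2_limit_le[where Y = "\<lambda>n s. a + (psum n x s - psum n y s)"])
  have eq: "a + (Z x s - Z y s) - (a + (psum n x s - psum n y s)) = (Z x s - psum n x s) + (psum n y s - Z y s)" for n s by simp
  show "(\<lambda>n. \<integral>\<^sup>+s. ennreal ((norm (a + (Z x s - Z y s) - (a + (psum n x s - psum n y s))))\<^sup>2) \<partial>\<nu>) \<longlonglongrightarrow> 0"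
    unfolding eq
  proof (rule tendsto_sandwich[OF _ _ tendsto_const])
    show "\<forall>\<^sub>F n in sequentially. (\<integral>\<^sup>+s. ennreal ((norm ((Z x s - psum n x s) + (psum n y s - Z y s)))\<^sup>2) \<partial>\<nu>)
      \<le> 2 * (\<integral>\<^sup>+s. ennreal ((norm (Z x s - psum n x s))\<^sup>2) \<partial>\<nu>) + 2 * (\<integral>\<^sup>+s. ennreal ((norm (Z y s - psum n y s))\<^sup>2) \<partial>\<nu>)"
    proof (intro always_eventually allI)
      fix n
      show "(\<integral>\<^sup>+s. ennreal ((norm ((Z x s - psum n x s) + (psum n y s - Z y s)))\<^sup>2) \<partial>\<nu>)
      \<le> 2 * (\<integral>\<^sup>+s. ennreal ((norm (Z x s - psum n x s))\<^sup>2) \<partial>\<nu>) + 2 * (\<integral>\<^sup>+s. ennreal ((norm (Z y s - psum n y s))\<^sup>2) \<partial>\<nu>)"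
        using nn_integral_power2_norm_add_le[of "\<lambda>s. Z x s - psum n x s" \<nu> "\<lambda>s. psum n y s - Z y s"]
        unfolding norm_minus_commute[of "psum n y _" "Z y _"] by simp
    qed
    have "(\<lambda>n. 2 * (\<integral>\<^sup>+s. ennreal ((norm (Z x s - psum n x s))\<^sup>2) \<partial>\<nu>) + 2 * (\<integral>\<^sup>+s. ennreal ((norm (Z y s - psum n y s))\<^sup>2) \<partial>\<nu>)) \<longlonglongrightarrow> 2 * 0 + 2 * 0"
      by (intro tendsto_intros Z_psum_tendsto) auto
    then show "(\<lambda>n. 2 * (\<integral>\<^sup>+s. ennreal ((norm (Z x s - psum n x s))\<^sup>2) \<partial>\<nu>) + 2 * (\<integral>\<^sup>+s. ennreal ((norm (Z y s - psum n y s))\<^sup>2) \<partial>\<nu>)) \<longlonglongrightarrow> 0"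
      by simp
  qed auto
  show "(\<integral>\<^sup>+s. ennreal ((norm (a + (psum n x s - psum n y s)))\<^sup>2) \<partial>\<nu>) \<le> ennreal ((norm a)\<^sup>2 + \<tau> * (L6 * (norm (x - y))\<^sup>2))" for n
  proof -
    have "a + (psum n x s - psum n y s) = a + (\<Sum>k<n. s k *\<^sub>R (\<gamma> k x - \<gamma> k y))" for s
      by (simp add: psum_def sum_subtractf scaleR_diff_right)
    then have "(\<integral>\<^sup>+s. ennreal ((norm (a + (psum n x s - psum n y s)))\<^sup>2) \<partial>\<nu>)
        = ennreal ((norm a)\<^sup>2 + \<tau> * (\<Sum>k<n. (norm (\<gamma> k x - \<gamma> k y))\<^sup>2))"
      by (simp add: gauss_isometry[OF \<tau>] del: ennreal_plus)
    also have "\<dots> \<le> ennreal ((norm a)\<^sup>2 + \<tau> * (L6 * (norm (x - y))\<^sup>2))"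
      using \<tau> by (intro ennreal_leI add_left_mono mult_left_mono \<gamma>_lipschitz) auto
    finally show ?thesis .
  qed
qed (use \<tau> L678 in auto)

end

text \<open>\<open>A\<close> will be the projection followed by the solution map of the implicit
  equation; its contraction has to outweigh the mean-square expansion 1 + \<tau> L6 of the
  noise.\<close>

locale gaussian_step = gaussian_series \<tau> L6 L7 L8 \<gamma>
  for \<tau> L6 L7 L8 :: real and \<gamma> :: "nat \<Rightarrow> 'b::{real_inner, banach, second_countable_topology} \<Rightarrow> 'b" +
  fixes A :: "'b \<Rightarrow> 'b" and \<kappa> :: real
  assumes A_contraction: "\<And>x y. (1 + \<tau> * \<kappa>) * norm (A x - A y) \<le> norm (x - y)"
    and \<kappa>: "L6 < 2 * \<kappa>" and \<tau>_le: "\<tau> \<le> 1"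
begin

lemma \<kappa>_pos: "0 < \<kappa>" using \<kappa> L678 by simp

lemma A_lipschitz: "norm (A x - A y) \<le> norm (x - y)"
proof -
  have "norm (A x - A y) \<le> (1 + \<tau> * \<kappa>) * norm (A x - A y)"
    using mult_right_mono[of 1 "1 + \<tau> * \<kappa>" "norm (A x - A y)"] \<tau> \<kappa>_pos by simp
  then show ?thesis using A_contraction[of x y] by simp
qed

lemma A_measurable [measurable]: "A \<in> borel_measurable borel"
proof (rule borel_measurable_continuous_onI)
  have "1-lipschitz_on UNIV A" by (rule lipschitz_onI) (auto simp: dist_norm A_lipschitz)
  then show "continuous_on UNIV A" by (rule lipschitz_on_continuous_on)
qed

definition \<Theta> :: "'b \<Rightarrow> (nat \<Rightarrow> real) \<Rightarrow> 'b" where "\<Theta> x s = A (x + Z x s)"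

definition rate :: real where "rate = (2 * \<kappa> - L6) / (2 * \<kappa> + 1)"

definition r :: real where "r = exp (- rate * \<tau> / 2)"

lemma rate_pos: "0 < rate" using \<kappa> \<kappa>_pos by (simp add: rate_def)

text \<open>By the choice of \<open>rate\<close>, 1 + \<tau> L6 = 1 + 2 \<tau> \<kappa> - \<tau>
  rate (1 + 2 \<kappa>). Since \<tau> \<le> 1, this is at most (1 + 2 \<tau> \<kappa>) (1 - rate
  \<tau>); the exponential bounds the second factor and the square (1 + \<tau> \<kappa>)^2 the
  first.\<close>

lemma contraction_factor: "1 + \<tau> * L6 \<le> (1 + \<tau> * \<kappa>)\<^sup>2 * r\<^sup>2"
proof -
  have r2: "r\<^sup>2 = exp (- rate * \<tau>)" by (simp add: r_def power2_eq_square exp_add[symmetric])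
  have rate_eq: "rate * (1 + 2 * \<kappa>) = 2 * \<kappa> - L6"
    using \<kappa>_pos by (simp add: rate_def add.commute)
  have "rate * \<tau> * (2 * \<tau> * \<kappa>) \<le> rate * \<tau> * (2 * \<kappa>)"
    using rate_pos \<tau> \<tau>_le \<kappa>_pos by (intro mult_left_mono) auto
  then have "1 + \<tau> * L6 \<le> 1 + 2 * \<tau> * \<kappa> - rate * \<tau> * (1 + 2 * \<tau> * \<kappa>)"
    using arg_cong[OF rate_eq, of "\<lambda>u. \<tau> * u"] by (simp add: algebra_simps)
  also have "\<dots> = (1 + 2 * \<tau> * \<kappa>) * (1 - rate * \<tau>)" by (simp add: algebra_simps)
  also have "\<dots> \<le> (1 + 2 * \<tau> * \<kappa>) * exp (- rate * \<tau>)"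
    using exp_ge_add_one_self[of "- rate * \<tau>"] \<tau> \<kappa>_pos by (intro mult_left_mono) auto
  also have "\<dots> \<le> (1 + \<tau> * \<kappa>)\<^sup>2 * exp (- rate * \<tau>)"
    by (intro mult_right_mono) (auto simp: power2_sum power_mult_distrib)
  finally show ?thesis by (simp add: r2)
qed

lemma \<Theta>_measurable: "(\<lambda>p. \<Theta> (fst p) (snd p)) \<in> borel_measurable (borel \<Otimes>\<^sub>M \<nu>)"
  unfolding \<Theta>_def by measurable

lemma norm_\<Theta>_le: "norm (\<Theta> x s) \<le> norm (A 0) + norm x + norm (Z x s)"
  using A_lipschitz[of "x + Z x s" 0] norm_triangle_ineq[of "\<Theta> x s - A 0" "A 0"] norm_triangle_ineq[of x "Z x s"]
  by (simp add: \<Theta>_def)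

text \<open>The sharp constant comes in mean square, through the isometry; the contraction in mean
  asked of the kernel is then a case of Jensen's inequality.\<close>

lemma \<Theta>_contraction_power2:
  "(\<integral>\<^sup>+s. ennreal ((norm (\<Theta> x s - \<Theta> y s))\<^sup>2) \<partial>\<nu>) \<le> ennreal ((r * norm (x - y))\<^sup>2)"
proof -
  define c where "c = 1 + \<tau> * \<kappa>"
  have c: "0 < c" using \<tau> \<kappa>_pos by (simp add: c_def add_pos_pos)
  have "(norm (\<Theta> x s - \<Theta> y s))\<^sup>2 \<le> (1 / c\<^sup>2) * (norm ((x - y) + (Z x s - Z y s)))\<^sup>2" for s
  proof -
    have "norm (\<Theta> x s - \<Theta> y s) \<le> norm ((x - y) + (Z x s - Z y s)) / c"
      using A_contraction[of "x + Z x s" "y + Z y s"] c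
      by (simp add: \<Theta>_def c_def field_simps)
    then have "(norm (\<Theta> x s - \<Theta> y s))\<^sup>2 \<le> (norm ((x - y) + (Z x s - Z y s)) / c)\<^sup>2"
      by (intro power_mono) auto
    then show ?thesis by (simp add: power_divide)
  qed
  then have "(\<integral>\<^sup>+s. ennreal ((norm (\<Theta> x s - \<Theta> y s))\<^sup>2) \<partial>\<nu>)
      \<le> (\<integral>\<^sup>+s. ennreal (1 / c\<^sup>2) * ennreal ((norm ((x - y) + (Z x s - Z y s)))\<^sup>2) \<partial>\<nu>)"
    by (intro nn_integral_mono) (auto simp: ennreal_mult[symmetric] intro!: ennreal_leI)
  also have "\<dots> = ennreal (1 / c\<^sup>2) * (\<integral>\<^sup>+s. ennreal ((norm ((x - y) + (Z x s - Z y s)))\<^sup>2) \<partial>\<nu>)"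
    by (rule nn_integral_cmult) measurable
  also have "\<dots> \<le> ennreal (1 / c\<^sup>2) * ennreal ((norm (x - y))\<^sup>2 + \<tau> * (L6 * (norm (x - y))\<^sup>2))"
    by (intro mult_left_mono Z_contraction) auto
  also have "\<dots> = ennreal ((1 / c\<^sup>2) * ((norm (x - y))\<^sup>2 + \<tau> * (L6 * (norm (x - y))\<^sup>2)))"
    using \<tau> L678 by (intro ennreal_mult[symmetric]) auto
  also have "\<dots> \<le> ennreal ((r * norm (x - y))\<^sup>2)"
  proof (rule ennreal_leI)
    have "(1 + \<tau> * L6) * (norm (x - y))\<^sup>2 \<le> (c\<^sup>2 * r\<^sup>2) * (norm (x - y))\<^sup>2"
      using contraction_factor by (intro mult_right_mono) (auto simp: c_def)
    then show "(1 / c\<^sup>2) * ((norm (x - y))\<^sup>2 + \<tau> * (L6 * (norm (x - y))\<^sup>2)) \<le> (r * norm (x - y))\<^sup>2"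
      using c by (simp add: field_simps power_mult_distrib)
  qed
  finally show ?thesis .
qed

sublocale contractive_kernel \<nu> \<Theta> r
proof
  have [measurable]: "\<Theta> x \<in> borel_measurable \<nu>" for x
    using measurable_compose[OF measurable_Pair1'[of x borel \<nu>] \<Theta>_measurable] by simp
  show "(\<lambda>p. \<Theta> (fst p) (snd p)) \<in> borel_measurable (borel \<Otimes>\<^sub>M \<nu>)" by (rule \<Theta>_measurable)
  show "0 \<le> r" "r < 1" using rate_pos \<tau> by (simp_all add: r_def)
  show "(\<integral>\<^sup>+s. ennreal (norm (\<Theta> x s - \<Theta> y s)) \<partial>\<nu>) \<le> ennreal (r * norm (x - y))" for x y
    by (rule \<nu>.nn_integral_le_of_power2) (use \<Theta>_contraction_power2 in \<open>auto simp: r_def\<close>)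
  have "(\<integral>\<^sup>+s. ennreal (norm (\<Theta> 0 s)) \<partial>\<nu>) \<le> (\<integral>\<^sup>+s. ennreal (norm (A 0)) + ennreal (norm (Z 0 s)) \<partial>\<nu>)"
    using norm_\<Theta>_le[of 0] by (intro nn_integral_mono ennreal_le_plusI) auto
  also have "\<dots> = ennreal (norm (A 0)) + (\<integral>\<^sup>+s. ennreal (norm (Z 0 s)) \<partial>\<nu>)"
    by (simp add: nn_integral_add \<nu>.emeasure_space_1)
  finally have "(\<integral>\<^sup>+s. ennreal (norm (\<Theta> 0 s)) \<partial>\<nu>) \<le> ennreal (norm (A 0)) + (\<integral>\<^sup>+s. ennreal (norm (Z 0 s)) \<partial>\<nu>)" .
  also have "\<dots> \<le> ennreal (norm (A 0)) + ennreal (sqrt (\<tau> * L8))"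
  proof (rule add_left_mono, rule \<nu>.nn_integral_le_of_power2)
    show "(\<integral>\<^sup>+s. ennreal ((norm (Z 0 s))\<^sup>2) \<partial>\<nu>) \<le> ennreal ((sqrt (\<tau> * L8))\<^sup>2)"
      using Z_growth[of 0] \<tau> L678 by simp
  qed (use \<tau> L678 in simp_all)
  also have "\<dots> < \<infinity>" by simp
  finally show "(\<integral>\<^sup>+s. ennreal (norm (\<Theta> 0 s)) \<partial>\<nu>) < \<infinity>" .
qed

end

text \<open>The state \<open>X\<close> before the step is independent of the noise \<open>\<xi>\<close> driving it.\<close>

locale gaussian_transition = gaussian_step \<tau> L6 L7 L8 \<gamma> A \<kappa> + M: prob_space M
  for \<tau> L6 L7 L8 :: real and \<gamma> :: "nat \<Rightarrow> 'b::{real_inner, banach, second_countable_topology} \<Rightarrow> 'b"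
    and A :: "'b \<Rightarrow> 'b" and \<kappa> :: real and M :: "'w measure" +
  fixes X :: "'w \<Rightarrow> 'b" and \<xi> :: "'w \<Rightarrow> nat \<Rightarrow> real"
  assumes X_measurable [measurable]: "X \<in> borel_measurable M"
    and \<xi>_measurable [measurable]: "\<xi> \<in> measurable M \<nu>"
    and joint: "distr M (borel \<Otimes>\<^sub>M \<nu>) (\<lambda>\<omega>. (X \<omega>, \<xi> \<omega>)) = distr M borel X \<Otimes>\<^sub>M \<nu>"
    and X_moment: "(\<integral>\<^sup>+\<omega>. ennreal ((norm (X \<omega>))\<^sup>2) \<partial>M) < \<infinity>"
begin

text \<open>Freezing the state: since the joint law is a product, the noise may be integrated first
  with the state held fixed.\<close>

lemma nn_integral_joint:
  assumes h: "(\<lambda>p. h (fst p) (snd p)) \<in> borel_measurable (borel \<Otimes>\<^sub>M \<nu>)"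
  shows "(\<integral>\<^sup>+\<omega>. h (X \<omega>) (\<xi> \<omega>) \<partial>M) = (\<integral>\<^sup>+\<omega>. (\<integral>\<^sup>+s. h (X \<omega>) s \<partial>\<nu>) \<partial>M)"
proof -
  have h': "(\<lambda>p. h (fst p) (snd p)) \<in> borel_measurable (distr M borel X \<Otimes>\<^sub>M \<nu>)"
    using h by (subst measurable_cong_sets[OF sets_pair_measure_cong[OF sets_distr refl] refl])
  have "(\<integral>\<^sup>+\<omega>. h (X \<omega>) (\<xi> \<omega>) \<partial>M) = (\<integral>\<^sup>+p. h (fst p) (snd p) \<partial>distr M (borel \<Otimes>\<^sub>M \<nu>) (\<lambda>\<omega>. (X \<omega>, \<xi> \<omega>)))"
    by (subst nn_integral_distr) (use h in auto)
  also have "\<dots> = (\<integral>\<^sup>+x. (\<integral>\<^sup>+s. h x s \<partial>\<nu>) \<partial>distr M borel X)"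
    unfolding joint using \<nu>.nn_integral_fst[OF h'] by simp
  also have "\<dots> = (\<integral>\<^sup>+\<omega>. (\<integral>\<^sup>+s. h (X \<omega>) s \<partial>\<nu>) \<partial>M)"
    using \<nu>.borel_measurable_nn_integral_fst[OF h] by (subst nn_integral_distr) auto
  finally show ?thesis .
qed

lemma Z_compose [measurable]: "(\<lambda>\<omega>. Z (X \<omega>) (\<xi> \<omega>)) \<in> borel_measurable M"
  using measurable_compose[OF measurable_Pair[OF X_measurable \<xi>_measurable] Z_measurable] by simp

lemma psum_compose [measurable]: "(\<lambda>\<omega>. psum n (X \<omega>) (\<xi> \<omega>)) \<in> borel_measurable M"
  using measurable_compose[OF measurable_Pair[OF X_measurable \<xi>_measurable] psum_measurable[of n]] by simp

text \<open>The Markov property of one step, by the same freezing for bounded signed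
  observables.\<close>

lemma integral_\<Theta>:
  assumes \<phi>: "\<phi> \<in> borel_measurable borel" "\<And>x. \<bar>\<phi> x\<bar> \<le> B"
  shows "(LINT \<omega>|M. \<phi> (\<Theta> (X \<omega>) (\<xi> \<omega>))) = (LINT \<omega>|M. K \<phi> (X \<omega>))"
proof -
  have [measurable]: "\<phi> \<in> borel_measurable borel" by fact
  interpret D: prob_space "distr M borel X" by (rule M.prob_space_distr) measurable
  interpret P: pair_prob_space "distr M borel X" \<nu> ..
  have m: "(\<lambda>p. \<phi> (\<Theta> (fst p) (snd p))) \<in> borel_measurable (borel \<Otimes>\<^sub>M \<nu>)"
    using \<Theta>_measurable by measurable
  have m': "(\<lambda>p. \<phi> (\<Theta> (fst p) (snd p))) \<in> borel_measurable (distr M borel X \<Otimes>\<^sub>M \<nu>)"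
    using m by (subst measurable_cong_sets[OF sets_pair_measure_cong[OF sets_distr refl] refl])
  have "(LINT \<omega>|M. \<phi> (\<Theta> (X \<omega>) (\<xi> \<omega>))) = (LINT p|distr M (borel \<Otimes>\<^sub>M \<nu>) (\<lambda>\<omega>. (X \<omega>, \<xi> \<omega>)). \<phi> (\<Theta> (fst p) (snd p)))"
    using m by (subst integral_distr) auto
  also have "\<dots> = (LINT x|distr M borel X. (LINT s|\<nu>. \<phi> (\<Theta> x s)))"
    unfolding joint
  proof (subst P.integral_fst'[symmetric])
    show "integrable (distr M borel X \<Otimes>\<^sub>M \<nu>) (\<lambda>p. \<phi> (\<Theta> (fst p) (snd p)))"
      by (rule P.integrable_const_bound[of _ B]) (use m' \<phi>(2) in auto)
  qed simp
  also have "\<dots> = (LINT \<omega>|M. K \<phi> (X \<omega>))"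
    unfolding K_def[symmetric] by (rule integral_distr) (use K_measurable in measurable)
  finally show ?thesis .
qed

lemma Z_moment: "(\<integral>\<^sup>+\<omega>. ennreal ((norm (Z (X \<omega>) (\<xi> \<omega>)))\<^sup>2) \<partial>M) < \<infinity>"
proof -
  have "(\<integral>\<^sup>+\<omega>. ennreal ((norm (Z (X \<omega>) (\<xi> \<omega>)))\<^sup>2) \<partial>M) = (\<integral>\<^sup>+\<omega>. (\<integral>\<^sup>+s. ennreal ((norm (Z (X \<omega>) s))\<^sup>2) \<partial>\<nu>) \<partial>M)"
    by (rule nn_integral_joint[where h = "\<lambda>x s. ennreal ((norm (Z x s))\<^sup>2)"]) measurable
  also have "\<dots> \<le> (\<integral>\<^sup>+\<omega>. ennreal (\<tau> * L7) * ennreal ((norm (X \<omega>))\<^sup>2) + ennreal (\<tau> * L8) \<partial>M)"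
  proof (rule nn_integral_mono)
    fix \<omega>
    have "ennreal (\<tau> * (L7 * (norm (X \<omega>))\<^sup>2 + L8)) = ennreal (\<tau> * L7) * ennreal ((norm (X \<omega>))\<^sup>2) + ennreal (\<tau> * L8)"
      using \<tau> L678 by (simp add: ennreal_mult[symmetric] ennreal_plus[symmetric] algebra_simps del: ennreal_plus)
    then show "(\<integral>\<^sup>+s. ennreal ((norm (Z (X \<omega>) s))\<^sup>2) \<partial>\<nu>) \<le> ennreal (\<tau> * L7) * ennreal ((norm (X \<omega>))\<^sup>2) + ennreal (\<tau> * L8)"
      using Z_growth[of "X \<omega>"] by simp
  qed
  also have "\<dots> = ennreal (\<tau> * L7) * (\<integral>\<^sup>+\<omega>. ennreal ((norm (X \<omega>))\<^sup>2) \<partial>M) + ennreal (\<tau> * L8)"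
    by (simp add: nn_integral_add nn_integral_cmult M.emeasure_space_1)
  also have "\<dots> < \<infinity>" using X_moment by (auto simp: ennreal_mult_less_top)
  finally show ?thesis .
qed

lemma \<Theta>_moment: "(\<integral>\<^sup>+\<omega>. ennreal ((norm (\<Theta> (X \<omega>) (\<xi> \<omega>)))\<^sup>2) \<partial>M) < \<infinity>"
proof -
  have "(norm (\<Theta> (X \<omega>) (\<xi> \<omega>)))\<^sup>2 \<le> (norm (norm (A 0) + (norm (X \<omega>) + norm (Z (X \<omega>) (\<xi> \<omega>)))))\<^sup>2" for \<omega>
    using norm_\<Theta>_le[of "X \<omega>" "\<xi> \<omega>"] by (intro power_mono) auto
  then have "(\<integral>\<^sup>+\<omega>. ennreal ((norm (\<Theta> (X \<omega>) (\<xi> \<omega>)))\<^sup>2) \<partial>M)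
      \<le> (\<integral>\<^sup>+\<omega>. ennreal ((norm (norm (A 0) + (norm (X \<omega>) + norm (Z (X \<omega>) (\<xi> \<omega>)))))\<^sup>2) \<partial>M)"
    by (intro nn_integral_mono ennreal_leI)
  also have "\<dots> \<le> 2 * (\<integral>\<^sup>+\<omega>. ennreal ((norm (norm (A 0)))\<^sup>2) \<partial>M)
      + 2 * (\<integral>\<^sup>+\<omega>. ennreal ((norm (norm (X \<omega>) + norm (Z (X \<omega>) (\<xi> \<omega>))))\<^sup>2) \<partial>M)"
    by (rule nn_integral_power2_norm_add_le) measurable
  also have "\<dots> \<le> 2 * (\<integral>\<^sup>+\<omega>. ennreal ((norm (norm (A 0)))\<^sup>2) \<partial>M)
      + 2 * (2 * (\<integral>\<^sup>+\<omega>. ennreal ((norm (norm (X \<omega>)))\<^sup>2) \<partial>M) + 2 * (\<integral>\<^sup>+\<omega>. ennreal ((norm (norm (Z (X \<omega>) (\<xi> \<omega>))))\<^sup>2) \<partial>M))"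
    by (intro add_left_mono mult_left_mono nn_integral_power2_norm_add_le) auto
  also have "\<dots> < \<infinity>"
    using X_moment Z_moment by (auto simp: M.emeasure_space_1 ennreal_mult_less_top)
  finally show ?thesis .
qed

text \<open>The composed series satisfies the defining limit of the stochastic product. For a frozen
  state the error is at most \<tau> times the remainder, which tends to 0 and is dominated through
  the linear growth bound and the second moment of the state.\<close>

lemma Z_psum_tendsto_joint:
  "(\<lambda>n. \<integral>\<^sup>+\<omega>. ennreal ((norm (Z (X \<omega>) (\<xi> \<omega>) - psum n (X \<omega>) (\<xi> \<omega>)))\<^sup>2) \<partial>M) \<longlonglongrightarrow> 0"
proof -
  have eq: "(\<integral>\<^sup>+\<omega>. ennreal ((norm (Z (X \<omega>) (\<xi> \<omega>) - psum n (X \<omega>) (\<xi> \<omega>)))\<^sup>2) \<partial>M)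
      = (\<integral>\<^sup>+\<omega>. (\<integral>\<^sup>+s. ennreal ((norm (Z (X \<omega>) s - psum n (X \<omega>) s))\<^sup>2) \<partial>\<nu>) \<partial>M)" for n
    by (rule nn_integral_joint[where h = "\<lambda>x s. ennreal ((norm (Z x s - psum n x s))\<^sup>2)"]) measurable
  have "(\<lambda>n. \<integral>\<^sup>+\<omega>. ennreal (\<tau> * tail n (X \<omega>)) \<partial>M) \<longlonglongrightarrow> (\<integral>\<^sup>+\<omega>. 0 \<partial>M)"
  proof (rule nn_integral_dominated_convergence[where w = "\<lambda>\<omega>. ennreal (\<tau> * L7) * ennreal ((norm (X \<omega>))\<^sup>2) + ennreal (\<tau> * L8)"])
    have "(\<integral>\<^sup>+\<omega>. ennreal (\<tau> * L7) * ennreal ((norm (X \<omega>))\<^sup>2) + ennreal (\<tau> * L8) \<partial>M)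
        = ennreal (\<tau> * L7) * (\<integral>\<^sup>+\<omega>. ennreal ((norm (X \<omega>))\<^sup>2) \<partial>M) + ennreal (\<tau> * L8)"
      by (simp add: nn_integral_add nn_integral_cmult M.emeasure_space_1)
    then show "(\<integral>\<^sup>+\<omega>. ennreal (\<tau> * L7) * ennreal ((norm (X \<omega>))\<^sup>2) + ennreal (\<tau> * L8) \<partial>M) < \<infinity>"
      using X_moment by (auto simp: ennreal_mult_less_top)
    show "AE \<omega> in M. ennreal (\<tau> * tail n (X \<omega>)) \<le> ennreal (\<tau> * L7) * ennreal ((norm (X \<omega>))\<^sup>2) + ennreal (\<tau> * L8)" for n
    proof (rule AE_I2)
      fix \<omega>
      have "ennreal (\<tau> * (L7 * (norm (X \<omega>))\<^sup>2 + L8)) = ennreal (\<tau> * L7) * ennreal ((norm (X \<omega>))\<^sup>2) + ennreal (\<tau> * L8)"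
        using \<tau> L678 by (simp add: ennreal_mult[symmetric] ennreal_plus[symmetric] algebra_simps del: ennreal_plus)
      then show "ennreal (\<tau> * tail n (X \<omega>)) \<le> ennreal (\<tau> * L7) * ennreal ((norm (X \<omega>))\<^sup>2) + ennreal (\<tau> * L8)"
        using ennreal_leI[OF mult_left_mono[OF tail_le[of n "X \<omega>"], of \<tau>]] \<tau> by simp
    qed
    show "AE \<omega> in M. (\<lambda>n. ennreal (\<tau> * tail n (X \<omega>))) \<longlonglongrightarrow> 0"
    proof (rule AE_I2)
      fix \<omega>
      have "(\<lambda>n. ennreal (\<tau> * tail n (X \<omega>))) \<longlonglongrightarrow> ennreal (\<tau> * 0)"
        by (intro tendsto_intros tail_tendsto)
      then show "(\<lambda>n. ennreal (\<tau> * tail n (X \<omega>))) \<longlonglongrightarrow> 0" by simp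
    qed
  qed measurable
  then have lim: "(\<lambda>n. \<integral>\<^sup>+\<omega>. ennreal (\<tau> * tail n (X \<omega>)) \<partial>M) \<longlonglongrightarrow> 0" by simp
  show ?thesis
    unfolding eq
    by (rule tendsto_sandwich[OF _ _ tendsto_const lim]) (auto intro!: always_eventually nn_integral_mono Z_psum_le)
qed

end

section \<open>Increments of the Wiener process\<close>

locale wiener_noise = prob_space M for M :: "'w measure" +
  fixes F :: "real \<Rightarrow> 'w measure" and e :: "nat \<Rightarrow> 'a::euclidean_space L2" and qk :: "nat \<Rightarrow> real"
    and \<beta> :: "nat \<Rightarrow> real \<Rightarrow> 'w \<Rightarrow> real" and W :: "real \<Rightarrow> 'w \<Rightarrow> 'a L2"
  assumes filtered: "filtered_prob_space M F" and wiener: "wiener_process M F e qk \<beta> W"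
    and orthonormal: "\<And>i j. inner (e i) (e j) = (if i = j then 1 else 0)"
    and qk_pos: "\<And>k. 0 < qk k"
begin

text \<open>Adaptedness and independence of the past are given for \<open>W\<close>, not for the
  single Brownian motions. Coordinates written as a measurable function of an increment of
  \<open>W\<close> inherit both.\<close>

definition wcoeff :: "'a L2 \<Rightarrow> nat \<Rightarrow> real" where
  "wcoeff v = (\<lambda>k. inner v (e k) / sqrt (qk k))"

lemma wcoeff_measurable [measurable]: "wcoeff \<in> measurable borel (Pi\<^sub>M UNIV (\<lambda>_. borel))"
  unfolding wcoeff_def by (rule measurable_PiM_single') (auto simp: space_PiM)

lemma subalgebra_F: "0 \<le> t \<Longrightarrow> subalgebra M (F t)"
  using filtered by (simp add: filtered_prob_space_def)

lemma F_mono: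
  assumes "0 \<le> s" "s \<le> t" "X \<in> measurable (F s) N"
  shows "X \<in> measurable (F t) N"
proof -
  have "sets (F s) \<subseteq> sets (F t)" "space (F s) = space (F t)"
    using assms(1,2) filtered subalgebra_F[of s] subalgebra_F[of t] by (auto simp: filtered_prob_space_def subalgebra_def)
  then show ?thesis using assms(3) by (auto simp: measurable_def)
qed

lemma W_adapted: "0 \<le> t \<Longrightarrow> W t \<in> borel_measurable (F t)"
  using wiener by (simp add: wiener_process_def)

lemma W_measurable: "0 \<le> t \<Longrightarrow> W t \<in> borel_measurable M"
  using measurable_from_subalg[OF subalgebra_F W_adapted] .

lemma \<beta>_measurable: "0 \<le> t \<Longrightarrow> \<beta> k t \<in> borel_measurable M"
  using wiener by (simp add: wiener_process_def brownian_motion_def)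

lemma wcoeff_W:
  assumes "0 \<le> t"
  shows "AE \<omega> in M. wcoeff (W t \<omega>) = (\<lambda>k. \<beta> k t \<omega>)"
proof -
  have "AE \<omega> in M. (\<lambda>k. (sqrt (qk k) * \<beta> k t \<omega>) *\<^sub>R e k) sums W t \<omega>"
    using wiener assms by (simp add: wiener_process_def)
  then show ?thesis
  proof eventually_elim
    case (elim \<omega>)
    show ?case
    proof
      fix k
      have "(\<lambda>j. inner ((sqrt (qk j) * \<beta> j t \<omega>) *\<^sub>R e j) (e k)) sums inner (W t \<omega>) (e k)"
        by (rule bounded_linear.sums[OF bounded_linear_inner_left elim])
      moreover have "(\<lambda>j. inner ((sqrt (qk j) * \<beta> j t \<omega>) *\<^sub>R e j) (e k)) = (\<lambda>j. if j = k then sqrt (qk k) * \<beta> k t \<omega> else 0)"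
        by (auto simp: orthonormal)
      ultimately have "inner (W t \<omega>) (e k) = sqrt (qk k) * \<beta> k t \<omega>"
        using sums_unique2[OF _ sums_single[of k "\<lambda>_. sqrt (qk k) * \<beta> k t \<omega>"]] by auto
      then show "wcoeff (W t \<omega>) k = \<beta> k t \<omega>"
        using qk_pos[of k] by (simp add: wcoeff_def)
    qed
  qed
qed

definition noise :: "real \<Rightarrow> real \<Rightarrow> 'w \<Rightarrow> nat \<Rightarrow> real" where
  "noise s t \<omega> = wcoeff (W t \<omega> - W s \<omega>)"

lemma noise_adapted:
  assumes "0 \<le> s" "s \<le> t"
  shows "noise s t \<in> measurable (F t) (gauss_seq \<tau>)"
proof -
  have [measurable]: "W t \<in> borel_measurable (F t)" "W s \<in> borel_measurable (F t)"
    using assms by (auto intro: W_adapted F_mono[OF assms])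
  have "noise s t \<in> measurable (F t) (Pi\<^sub>M UNIV (\<lambda>_. borel))"
    unfolding noise_def[abs_def] by measurable
  then show ?thesis by (subst measurable_cong_sets[OF refl sets_gauss_seq])
qed

lemma noise_measurable:
  "0 \<le> s \<Longrightarrow> s \<le> t \<Longrightarrow> noise s t \<in> measurable M (gauss_seq \<tau>)"
  using measurable_from_subalg[OF subalgebra_F noise_adapted] by simp

text \<open>Almost surely the coordinates are increments of the Brownian motions
  \<open>\<beta> k\<close>, which are independent over k and Gaussian with variance t - s.\<close>

lemma distr_noise:
  assumes st: "0 \<le> s" "s < t"
  shows "distr M (gauss_seq (t - s)) (noise s t) = gauss_seq (t - s)"
proof -
  have t: "0 \<le> t" using st by simp
  define D where "D k \<omega> = \<beta> k t \<omega> - \<beta> k s \<omega>" for k \<omega>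
  have [measurable]: "D k \<in> borel_measurable M" for k
    unfolding D_def using \<beta>_measurable[OF st(1)] \<beta>_measurable[OF t] by measurable
  have "indep_vars (\<lambda>_. Pi\<^sub>M {0..} (\<lambda>_. borel)) (\<lambda>k \<omega>. \<lambda>t\<in>{0..}. \<beta> k t \<omega>) UNIV"
    using wiener by (simp add: wiener_process_def)
  then have "indep_vars (\<lambda>_. borel) (\<lambda>k \<omega>. (\<lambda>p. p t - p s) (\<lambda>t\<in>{0..}. \<beta> k t \<omega>)) UNIV"
  proof (rule indep_vars_compose2)
    have [measurable]: "(\<lambda>p. p u :: real) \<in> borel_measurable (Pi\<^sub>M {0..} (\<lambda>_. borel))" if "0 \<le> u" for u :: real
      using measurable_component_singleton[of u "{0..}" "\<lambda>_. borel"] that by simp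
    show "(\<lambda>p. p t - p s :: real) \<in> borel_measurable (Pi\<^sub>M {0..} (\<lambda>_. borel))"
      using st t by measurable
  qed
  then have "indep_vars (\<lambda>_. borel) D UNIV"
    using st by (simp add: D_def[abs_def])
  then have "distr M (Pi\<^sub>M UNIV (\<lambda>_. borel)) (\<lambda>\<omega>. \<lambda>k\<in>UNIV. D k \<omega>) = Pi\<^sub>M UNIV (\<lambda>k. distr M borel (D k))"
    by (subst (asm) indep_vars_iff_distr_eq_PiM) auto
  also have "(\<lambda>k. distr M borel (D k)) = (\<lambda>k. density lborel (\<lambda>x. ennreal (normal_density 0 (sqrt (t - s)) x)))"
  proof
    fix k
    have "distributed M lborel (D k) (\<lambda>x. ennreal (normal_density 0 (sqrt (t - s)) x))"
      using wiener st by (simp add: wiener_process_def brownian_motion_def D_def[abs_def])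
    then have "distr M lborel (D k) = density lborel (\<lambda>x. ennreal (normal_density 0 (sqrt (t - s)) x))"
      by (rule distributed_distr_eq_density)
    moreover have "distr M lborel (D k) = distr M borel (D k)" by (rule distr_cong) auto
    ultimately show "distr M borel (D k) = density lborel (\<lambda>x. ennreal (normal_density 0 (sqrt (t - s)) x))" by simp
  qed
  also have "Pi\<^sub>M UNIV \<dots> = gauss_seq (t - s)" by (simp add: gauss_seq_def)
  finally have *: "distr M (Pi\<^sub>M UNIV (\<lambda>_. borel)) (\<lambda>\<omega> k. D k \<omega>) = gauss_seq (t - s)" by simp
  have "distr M (gauss_seq (t - s)) (noise s t) = distr M (Pi\<^sub>M UNIV (\<lambda>_. borel)) (noise s t)"
    by (rule distr_cong) (auto simp: sets_gauss_seq)
  also have "\<dots> = distr M (Pi\<^sub>M UNIV (\<lambda>_. borel)) (\<lambda>\<omega> k. D k \<omega>)"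
  proof (rule distr_cong_AE)
    show "AE \<omega> in M. noise s t \<omega> = (\<lambda>k. D k \<omega>)"
      using wcoeff_W[OF st(1)] wcoeff_W[OF t]
    proof eventually_elim
      case (elim \<omega>)
      have "noise s t \<omega> = (\<lambda>k. wcoeff (W t \<omega>) k - wcoeff (W s \<omega>) k)"
        by (simp add: noise_def wcoeff_def inner_diff_left diff_divide_distrib)
      then show ?case unfolding elim by (simp add: D_def)
    qed
    show "noise s t \<in> measurable M (Pi\<^sub>M UNIV (\<lambda>_. borel))"
      using noise_measurable[of s t 1] st by (subst measurable_cong_sets[OF refl sets_gauss_seq, symmetric]) simp
    show "(\<lambda>\<omega> k. D k \<omega>) \<in> measurable M (Pi\<^sub>M UNIV (\<lambda>_. borel))"
      by (rule measurable_PiM_single') (auto simp: space_PiM)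
  qed simp_all
  finally show ?thesis unfolding * .
qed

text \<open>Independence of the increment from the past passes to every adapted \<open>X\<close>
  and, by push-forward, to the coordinates of the increment. Equality with a product measure is the
  form that Fubini's theorem takes up.\<close>

lemma joint_noise:
  fixes X :: "'w \<Rightarrow> 'a L2"
  assumes st: "0 \<le> s" "s < t" and X: "X \<in> borel_measurable (F s)"
  shows "distr M (borel \<Otimes>\<^sub>M gauss_seq (t - s)) (\<lambda>\<omega>. (X \<omega>, noise s t \<omega>)) = distr M borel X \<Otimes>\<^sub>M gauss_seq (t - s)"
proof -
  have t: "0 \<le> t" "s \<le> t" using st by auto
  define \<Delta> where "\<Delta> \<omega> = W t \<omega> - W s \<omega>" for \<omega>
  have [measurable]: "\<Delta> \<in> borel_measurable M"
    unfolding \<Delta>_def using W_measurable[OF st(1)] W_measurable[OF t(1)] by measurable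
  have [measurable]: "X \<in> borel_measurable M" by (rule measurable_from_subalg[OF subalgebra_F[OF st(1)] X])
  have sp: "space (F s) = space M" using subalgebra_F[OF st(1)] by (simp add: subalgebra_def)
  have ind: "indep_set (sets (F s)) {\<Delta> -` B \<inter> space M | B. B \<in> sets borel}"
    using wiener st unfolding wiener_process_def \<Delta>_def by auto
  have stable: "Int_stable {f -` A \<inter> space M |A. A \<in> sets borel}" for f :: "'w \<Rightarrow> 'a L2"
  proof (rule Int_stableI)
    fix a b assume "a \<in> {f -` A \<inter> space M |A. A \<in> sets borel}" "b \<in> {f -` A \<inter> space M |A. A \<in> sets borel}"
    then obtain A B where AB: "A \<in> sets borel" "B \<in> sets borel" "a = f -` A \<inter> space M" "b = f -` B \<inter> space M"
      by (elim CollectE exE conjE) (rule that)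
    show "a \<inter> b \<in> {f -` A \<inter> space M |A. A \<in> sets borel}"
      unfolding AB(3,4) by (intro CollectI exI[of _ "A \<inter> B"] conjI sets.Int AB) auto
  qed
  have "indep_var borel X borel \<Delta>"
    unfolding indep_var_eq
  proof (intro conjI indep_set_sigma_sets)
    show "random_variable borel X" "random_variable borel \<Delta>" by fact+
    show "indep_set {X -` A \<inter> space M |A. A \<in> sets borel} {\<Delta> -` A \<inter> space M |A. A \<in> sets borel}"
      unfolding indep_sets2_eq
    proof (intro conjI ballI)
      show "{X -` A \<inter> space M |A. A \<in> sets borel} \<subseteq> events" "{\<Delta> -` A \<inter> space M |A. A \<in> sets borel} \<subseteq> events"
        by (auto intro: measurable_sets)
      fix a b assume "a \<in> {X -` A \<inter> space M |A. A \<in> sets borel}" and b: "b \<in> {\<Delta> -` A \<inter> space M |A. A \<in> sets borel}"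
      then have "a \<in> sets (F s)" using measurable_sets[OF X] by (auto simp: sp)
      then show "prob (a \<inter> b) = prob a * prob b" using ind b by (simp add: indep_sets2_eq)
    qed
    show "Int_stable {X -` A \<inter> space M |A. A \<in> sets borel}" "Int_stable {\<Delta> -` A \<inter> space M |A. A \<in> sets borel}"
      by (rule stable)+
  qed
  then have joint: "distr M borel X \<Otimes>\<^sub>M distr M borel \<Delta> = distr M (borel \<Otimes>\<^sub>M borel) (\<lambda>\<omega>. (X \<omega>, \<Delta> \<omega>))"
    unfolding indep_var_distribution_eq by simp
  have noise_eq: "noise s t = (\<lambda>\<omega>. wcoeff (\<Delta> \<omega>))"
    by (simp add: noise_def[abs_def] \<Delta>_def[abs_def])
  have c [measurable]: "wcoeff \<in> measurable borel (gauss_seq (t - s))"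
    using wcoeff_measurable by (subst measurable_cong_sets[OF refl sets_gauss_seq])
  have g: "distr (distr M borel \<Delta>) (gauss_seq (t - s)) wcoeff = gauss_seq (t - s)"
    using distr_noise[OF st] by (simp add: distr_distr comp_def noise_def[abs_def] \<Delta>_def)
  have "distr M borel X \<Otimes>\<^sub>M gauss_seq (t - s)
      = distr (distr M borel X) borel (\<lambda>x. x) \<Otimes>\<^sub>M distr (distr M borel \<Delta>) (gauss_seq (t - s)) wcoeff"
    unfolding g by (simp add: distr_distr comp_def)
  also have "\<dots> = distr (distr M borel X \<Otimes>\<^sub>M distr M borel \<Delta>) (borel \<Otimes>\<^sub>M gauss_seq (t - s)) (\<lambda>(x, y). (x, wcoeff y))"
  proof (rule pair_measure_distr)
    show "sigma_finite_measure (distr (distr M borel \<Delta>) (gauss_seq (t - s)) wcoeff)"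
      unfolding g using st by (intro prob_space_imp_sigma_finite prob_space_gauss_seq) simp
  qed simp_all
  also have "\<dots> = distr M (borel \<Otimes>\<^sub>M gauss_seq (t - s)) (\<lambda>\<omega>. (X \<omega>, noise s t \<omega>))"
    unfolding joint noise_eq by (subst distr_distr) (simp_all add: comp_def)
  finally show ?thesis by simp
qed

end

section \<open>The scheme as a Markov chain\<close>

locale galerkin_scheme = galerkin_step U T f L1 \<tau> + wiener_noise M F e qk \<beta> W
  for U :: "'a::euclidean_space set" and T f L1 \<tau> and M :: "'w measure" and F e qk \<beta>
    and W :: "real \<Rightarrow> 'w \<Rightarrow> 'a L2" +
  fixes G :: "'a L2 \<Rightarrow> 'a L2 \<Rightarrow> 'a L2" and L6 L7 L8 :: real
  assumes e_in: "\<And>k. e k \<in> L2_on U"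
    and G_L20: "\<And>x. x \<in> L2_on U \<Longrightarrow> G x \<in> L20 (L2_on U) e qk"
    and L678: "0 \<le> L6" "0 \<le> L7" "0 \<le> L8"
    and G1: "\<And>x y. x \<in> L2_on U \<Longrightarrow> y \<in> L2_on U \<Longrightarrow>
      (L20_norm e qk (\<lambda>u. G x u - G y u))\<^sup>2 \<le> L6 * (norm (x - y))\<^sup>2"
    and G2: "\<And>x. x \<in> L2_on U \<Longrightarrow> (L20_norm e qk (G x))\<^sup>2 \<le> L7 * (norm x)\<^sup>2 + L8"
    and \<tau>_le: "\<tau> \<le> 1"
    and dissipative: "L6 < 2 * (first_eigenvalue U - L1)"
begin

section \<open>Noise coefficients of the scheme\<close>

lemma cov_sqrt_scaled: "cov_sqrt e qk (c *\<^sub>R e k) = (c * sqrt (qk k)) *\<^sub>R e k"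
proof -
  have "(\<lambda>j. (sqrt (qk j) * inner (c *\<^sub>R e k) (e j)) *\<^sub>R e j) = (\<lambda>j. if j = k then (c * sqrt (qk k)) *\<^sub>R e k else 0)"
    by (auto simp: orthonormal)
  moreover have "(\<lambda>j. if j = k then (c * sqrt (qk k)) *\<^sub>R e k else 0) sums ((c * sqrt (qk k)) *\<^sub>R e k)"
    by (rule sums_single)
  ultimately show ?thesis unfolding cov_sqrt_def by (simp add: sums_unique[symmetric])
qed

text \<open>Conditions on \<open>G\<close> are available on H only; the inner projection yields
  coefficients that are Lipschitz on the whole type and unchanged on the finite element space. The
  vectors \<open>cov_sqrt e qk (e k)\<close> are the orthonormal basis of H_0.\<close>

definition \<gamma> :: "nat \<Rightarrow> 'a L2 \<Rightarrow> 'a L2" where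
  "\<gamma> k x = G (pr x) (cov_sqrt e qk (e k))"

lemma pr_L2_on: "pr x \<in> L2_on U" by (rule fe_space_L2_on[OF pr_in_V])

lemma \<gamma>_summable: "summable (\<lambda>k. (norm (\<gamma> k x))\<^sup>2)"
  using G_L20[OF pr_L2_on[of x]] by (simp add: L20_def \<gamma>_def)

lemma \<gamma>_growth: "(\<Sum>k. (norm (\<gamma> k x))\<^sup>2) \<le> L7 * (norm x)\<^sup>2 + L8"
proof -
  have "(L20_norm e qk (G (pr x)))\<^sup>2 = (\<Sum>k. (norm (\<gamma> k x))\<^sup>2)"
    unfolding L20_norm_def \<gamma>_def[symmetric] by (intro real_sqrt_pow2 suminf_nonneg \<gamma>_summable) simp
  moreover have "L7 * (norm (pr x))\<^sup>2 \<le> L7 * (norm x)\<^sup>2"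
    using L678 by (intro mult_left_mono power_mono norm_pr_le) auto
  ultimately show ?thesis using G2[OF pr_L2_on[of x]] by linarith
qed

lemma \<gamma>_lipschitz: "(\<Sum>k<n. (norm (\<gamma> k x - \<gamma> k y))\<^sup>2) \<le> L6 * (norm (x - y))\<^sup>2"
proof -
  have le: "(norm (u - v))\<^sup>2 \<le> 2 * (norm u)\<^sup>2 + 2 * (norm v)\<^sup>2" for u v :: "'a L2"
  proof -
    have "(norm (u - v))\<^sup>2 \<le> (norm u + norm v)\<^sup>2" by (intro power_mono norm_triangle_ineq4) auto
    also have "\<dots> \<le> 2 * (norm u)\<^sup>2 + 2 * (norm v)\<^sup>2"
      using zero_le_power2[of "norm u - norm v"] unfolding power2_sum power2_diff by linarith
    finally show ?thesis .
  qed
  \<comment> \<open>Needed before \<open>L20_norm\<close> can be read as a genuine infinite sum; it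
    follows from summability for the two Hilbert-Schmidt operators separately.\<close>
  have s: "summable (\<lambda>k. (norm (\<gamma> k x - \<gamma> k y))\<^sup>2)"
    by (rule summable_comparison_test'[of "\<lambda>k. 2 * (norm (\<gamma> k x))\<^sup>2 + 2 * (norm (\<gamma> k y))\<^sup>2" 0])
      (use le in \<open>auto intro!: summable_add summable_mult \<gamma>_summable\<close>)
  have "(\<Sum>k<n. (norm (\<gamma> k x - \<gamma> k y))\<^sup>2) \<le> (\<Sum>k. (norm (\<gamma> k x - \<gamma> k y))\<^sup>2)"
    by (rule sum_le_suminf[OF s]) auto
  also have "\<dots> = (L20_norm e qk (\<lambda>u. G (pr x) u - G (pr y) u))\<^sup>2"
    unfolding L20_norm_def \<gamma>_def[symmetric] by (intro real_sqrt_pow2[symmetric] suminf_nonneg s) simp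
  also have "\<dots> \<le> L6 * (norm (pr x - pr y))\<^sup>2" by (rule G1[OF pr_L2_on pr_L2_on])
  also have "\<dots> \<le> L6 * (norm (x - y))\<^sup>2"
    using L678 by (intro mult_left_mono power_mono pr_lipschitz) auto
  finally show ?thesis .
qed

lemma \<gamma>_measurable: "\<gamma> k \<in> borel_measurable borel"
proof (rule borel_measurable_continuous_onI)
  have "norm (\<gamma> k x - \<gamma> k y) \<le> sqrt L6 * norm (x - y)" for x y
  proof (rule power2_le_imp_le)
    have "(norm (\<gamma> k x - \<gamma> k y))\<^sup>2 \<le> (\<Sum>k<Suc k. (norm (\<gamma> k x - \<gamma> k y))\<^sup>2)"
      by (simp add: sum_nonneg)
    also have "\<dots> \<le> L6 * (norm (x - y))\<^sup>2" by (rule \<gamma>_lipschitz)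
    finally show "(norm (\<gamma> k x - \<gamma> k y))\<^sup>2 \<le> (sqrt L6 * norm (x - y))\<^sup>2"
      using L678 by (simp add: power_mult_distrib)
  qed (use L678 in simp)
  then have "(sqrt L6)-lipschitz_on UNIV (\<gamma> k)"
    using L678 by (intro lipschitz_onI) (auto simp: dist_norm)
  then show "continuous_on UNIV (\<gamma> k)" by (rule lipschitz_on_continuous_on)
qed

sublocale gs: gaussian_step \<tau> L6 L7 L8 \<gamma> "\<lambda>x. \<Psi> (pr x)" "first_eigenvalue U - L1"
proof
  show "(1 + \<tau> * (first_eigenvalue U - L1)) * norm (\<Psi> (pr x) - \<Psi> (pr y)) \<le> norm (x - y)" for x y
    using order_trans[OF \<Psi>_lipschitz[OF pr_in_V pr_in_V] pr_lipschitz] by (simp add: cc_def)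
qed (use \<tau>_pos L678 \<tau>_le dissipative in \<open>auto intro: \<gamma>_measurable \<gamma>_summable \<gamma>_growth \<gamma>_lipschitz\<close>)

lemma \<Theta>_in_V: "gs.\<Theta> x s \<in> V"
  unfolding gs.\<Theta>_def by (rule \<Psi>(1)[OF pr_in_V])

lemma scheme_step_iff:
  assumes "x \<in> V" "x' \<in> V"
  shows "x' = x + \<tau> *\<^sub>R discrete_laplacian U V x' + \<tau> *\<^sub>R galerkin_proj V (nemytskii_drift U f x')
      + galerkin_proj V (L2_functional z) \<longleftrightarrow> x' = \<Psi> (pr (x + z))"
proof -
  have "pr (x + z) = x + pr z"
    using pr_diff[of "x + z" x] pr_id[OF assms(1)] by (simp add: algebra_simps)
  then have "x' = \<Psi> (pr (x + z)) \<longleftrightarrow> x' = (x + pr z) + \<tau> *\<^sub>R discrete_laplacian U V x' + \<tau> *\<^sub>R galerkin_proj V (nemytskii_drift U f x')"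
    using step_eq_iff[OF pr_in_V[of "x + z"] assms(2)] by simp
  then show ?thesis by (simp only: galerkin_proj_L2) (simp add: add_ac)
qed

text \<open>The noise coordinates divide by \<open>sqrt (qk k)\<close> and the coefficients multiply
  by it, so the partial sums of the Gaussian series are exactly those in the definition of the
  stochastic product.\<close>

lemma psum_noise:
  assumes "x \<in> V"
  shows "gs.psum n x (noise s t \<omega>) = (\<Sum>k<n. inner (W t \<omega> - W s \<omega>) (e k) *\<^sub>R G x (e k))"
  unfolding gs.psum_def
proof (intro sum.cong refl)
  fix k
  have q: "0 < sqrt (qk k)" using qk_pos by simp
  \<comment> \<open>Linearity of \<open>G x\<close> is given on H_0, so \<open>e k\<close> has to be
    exhibited there before the scalar can be pulled out.\<close>
  have H0: "e k \<in> H0_space (L2_on U) e qk"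
  proof -
    have "(1 / sqrt (qk k)) *\<^sub>R e k \<in> L2_on U"
      by (rule subspace_scale[OF L2_on_subspace e_in])
    moreover have "e k = cov_sqrt e qk ((1 / sqrt (qk k)) *\<^sub>R e k)"
      using q by (simp add: cov_sqrt_scaled)
    ultimately show ?thesis unfolding H0_space_def by (rule rev_image_eqI)
  qed
  have "bounded_linear_between (H0_space (L2_on U) e qk) (H0_norm (L2_on U) e qk) (L2_on U) (G x)"
    using G_L20[OF fe_space_L2_on[OF assms]] by (simp add: L20_def)
  then have "G x (sqrt (qk k) *\<^sub>R e k) = sqrt (qk k) *\<^sub>R G x (e k)"
    using H0 unfolding bounded_linear_between_def by simp
  then have "\<gamma> k x = sqrt (qk k) *\<^sub>R G x (e k)"
    using cov_sqrt_scaled[of 1 k] by (simp add: \<gamma>_def pr_id[OF assms])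
  then show "noise s t \<omega> k *\<^sub>R \<gamma> k x = inner (W t \<omega> - W s \<omega>) (e k) *\<^sub>R G x (e k)"
    using q by (simp add: noise_def wcoeff_def)
qed

abbreviation xi :: "nat \<Rightarrow> 'w \<Rightarrow> nat \<Rightarrow> real" where
  "xi m \<equiv> noise (real m * \<tau>) (real (Suc m) * \<tau>)"

lemma step_times: "0 \<le> real m * \<tau>" "real m * \<tau> < real (Suc m) * \<tau>" "real m * \<tau> \<le> real (Suc m) * \<tau>"
  "real (Suc m) * \<tau> - real m * \<tau> = \<tau>"
  using \<tau>_pos by (simp_all add: algebra_simps)

lemma transition:
  assumes X: "X \<in> borel_measurable (F (real m * \<tau>))" and mom: "(\<integral>\<^sup>+\<omega>. ennreal ((norm (X \<omega>))\<^sup>2) \<partial>M) < \<infinity>"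
  shows "gaussian_transition \<tau> L6 L7 L8 \<gamma> (\<lambda>x. \<Psi> (pr x)) (first_eigenvalue U - L1) M X (xi m)"
proof (intro gaussian_transition.intro gaussian_transition_axioms.intro)
  show "gaussian_step \<tau> L6 L7 L8 \<gamma> (\<lambda>x. \<Psi> (pr x)) (first_eigenvalue U - L1)" by (rule gs.gaussian_step_axioms)
  show "prob_space M" by (rule prob_space_axioms)
  show "X \<in> borel_measurable M" by (rule measurable_from_subalg[OF subalgebra_F[OF step_times(1)] X])
  show "xi m \<in> measurable M (gauss_seq \<tau>)" by (rule noise_measurable[OF step_times(1,3)])
  show "distr M (borel \<Otimes>\<^sub>M gauss_seq \<tau>) (\<lambda>\<omega>. (X \<omega>, xi m \<omega>)) = distr M borel X \<Otimes>\<^sub>M gauss_seq \<tau>"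
    using joint_noise[OF step_times(1,2) X] unfolding step_times(4) .
qed (rule mom)

section \<open>Existence and uniqueness of solutions of the scheme\<close>

abbreviation solution :: "'a L2 \<Rightarrow> (nat \<Rightarrow> 'w \<Rightarrow> 'a L2) \<Rightarrow> bool" where
  "solution \<equiv> scheme_solution U f G e M F W \<tau> V"

lemma product_sum_eq:
  assumes "\<And>\<omega>. \<omega> \<in> space M \<Longrightarrow> X \<omega> \<in> V"
  shows "(\<integral>\<^sup>+\<omega>. ennreal ((norm (Z \<omega> - (\<Sum>k<n. inner (W (real (Suc m) * \<tau>) \<omega> - W (real m * \<tau>) \<omega>) (e k) *\<^sub>R G (X \<omega>) (e k))))\<^sup>2) \<partial>M)
    = (\<integral>\<^sup>+\<omega>. ennreal ((norm (Z \<omega> - gs.psum n (X \<omega>) (xi m \<omega>)))\<^sup>2) \<partial>M)"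
proof (rule nn_integral_cong)
  fix \<omega> assume "\<omega> \<in> space M"
  then have "X \<omega> \<in> V" by (rule assms)
  show "ennreal ((norm (Z \<omega> - (\<Sum>k<n. inner (W (real (Suc m) * \<tau>) \<omega> - W (real m * \<tau>) \<omega>) (e k) *\<^sub>R G (X \<omega>) (e k))))\<^sup>2)
    = ennreal ((norm (Z \<omega> - gs.psum n (X \<omega>) (xi m \<omega>)))\<^sup>2)"
    unfolding psum_noise[OF \<open>X \<omega> \<in> V\<close>] by (rule refl)
qed

text \<open>Guarantees that the choice in \<open>scheme_process\<close> picks a solution. Forward
  iterates of the random map are adapted, since the noise of a step is known at its end, and keep
  second moments, on which the mean-square limit of each step relies.\<close>

lemma solution_exists: "\<exists>X. solution x X"
proof -
  define X where "X = rec_nat (\<lambda>\<omega>::'w. pr x) (\<lambda>m Y \<omega>. gs.\<Theta> (Y \<omega>) (xi m \<omega>))"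
  have X0: "X 0 = (\<lambda>\<omega>. pr x)" and XS: "X (Suc m) = (\<lambda>\<omega>. gs.\<Theta> (X m \<omega>) (xi m \<omega>))" for m
    by (simp_all add: X_def)
  have V: "X m \<omega> \<in> V" for m \<omega>
    by (cases m) (simp_all add: X0 XS pr_in_V \<Theta>_in_V)
  have ad: "X m \<in> borel_measurable (F (real m * \<tau>))" for m
  proof (induction m)
    case (Suc m)
    show ?case
      unfolding XS
      by (rule gs.\<Theta>_compose[OF F_mono[OF step_times(1,3) Suc] noise_adapted[OF step_times(1,3)]])
  qed (simp add: X0)
  have mom: "(\<integral>\<^sup>+\<omega>. ennreal ((norm (X m \<omega>))\<^sup>2) \<partial>M) < \<infinity>" for m
  proof (induction m)
    case (Suc m)
    interpret gaussian_transition \<tau> L6 L7 L8 \<gamma> "\<lambda>x. \<Psi> (pr x)" "first_eigenvalue U - L1" M "X m" "xi m"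
      by (rule transition[OF ad Suc])
    show ?case unfolding XS by (rule \<Theta>_moment)
  qed (simp add: X0 emeasure_space_1)
  have "solution x X"
    unfolding scheme_solution_def
  proof (intro conjI allI ballI)
    show "X 0 \<omega> = galerkin_proj V (L2_functional x)" for \<omega> by (simp add: X0 galerkin_proj_L2)
    fix m
    interpret gaussian_transition \<tau> L6 L7 L8 \<gamma> "\<lambda>x. \<Psi> (pr x)" "first_eigenvalue U - L1" M "X m" "xi m"
      by (rule transition[OF ad mom])
    show "\<exists>Z. is_stochastic_product M e (\<lambda>\<omega>. G (X m \<omega>)) (\<lambda>\<omega>. W (real (Suc m) * \<tau>) \<omega> - W (real m * \<tau>) \<omega>) Z \<and>
        (AE \<omega> in M. X (Suc m) \<omega> = X m \<omega> + \<tau> *\<^sub>R discrete_laplacian U V (X (Suc m) \<omega>)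
           + \<tau> *\<^sub>R galerkin_proj V (nemytskii_drift U f (X (Suc m) \<omega>))
           + galerkin_proj V (L2_functional (Z \<omega>)))"
    proof (rule exI[of _ "\<lambda>\<omega>. gs.Z (X m \<omega>) (xi m \<omega>)"], rule conjI)
      show "is_stochastic_product M e (\<lambda>\<omega>. G (X m \<omega>)) (\<lambda>\<omega>. W (real (Suc m) * \<tau>) \<omega> - W (real m * \<tau>) \<omega>) (\<lambda>\<omega>. gs.Z (X m \<omega>) (xi m \<omega>))"
        unfolding is_stochastic_product_def product_sum_eq[of "X m", OF V] using Z_compose Z_psum_tendsto_joint by (rule conjI)
      have "X (Suc m) \<omega> = \<Psi> (pr (X m \<omega> + gs.Z (X m \<omega>) (xi m \<omega>)))" for \<omega>
        by (simp add: XS gs.\<Theta>_def)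
      then show "AE \<omega> in M. X (Suc m) \<omega> = X m \<omega> + \<tau> *\<^sub>R discrete_laplacian U V (X (Suc m) \<omega>)
           + \<tau> *\<^sub>R galerkin_proj V (nemytskii_drift U f (X (Suc m) \<omega>))
           + galerkin_proj V (L2_functional (gs.Z (X m \<omega>) (xi m \<omega>)))"
        by (intro AE_I2) (subst scheme_step_iff[OF V V])
    qed
  qed (use ad V in auto)
  then show ?thesis by (intro exI[of _ X])
qed

text \<open>Any admissible stochastic product coincides almost surely with the Gaussian series, by
  uniqueness of mean-square limits; strong monotonicity then determines the next state.\<close>

lemma solution_step:
  assumes sol: "solution x X" and mom: "(\<integral>\<^sup>+\<omega>. ennreal ((norm (X m \<omega>))\<^sup>2) \<partial>M) < \<infinity>"
  shows "AE \<omega> in M. X (Suc m) \<omega> = gs.\<Theta> (X m \<omega>) (xi m \<omega>)"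
proof -
  have ad: "X m \<in> borel_measurable (F (real m * \<tau>))" using sol by (simp add: scheme_solution_def)
  have V: "X m \<omega> \<in> V" if "\<omega> \<in> space M" for m \<omega>
    using sol that by (simp add: scheme_solution_def)
  interpret gaussian_transition \<tau> L6 L7 L8 \<gamma> "\<lambda>x. \<Psi> (pr x)" "first_eigenvalue U - L1" M "X m" "xi m"
    by (rule transition[OF ad mom])
  have "\<exists>Z. is_stochastic_product M e (\<lambda>\<omega>. G (X m \<omega>)) (\<lambda>\<omega>. W (real (Suc m) * \<tau>) \<omega> - W (real m * \<tau>) \<omega>) Z \<and>
        (AE \<omega> in M. X (Suc m) \<omega> = X m \<omega> + \<tau> *\<^sub>R discrete_laplacian U V (X (Suc m) \<omega>)
           + \<tau> *\<^sub>R galerkin_proj V (nemytskii_drift U f (X (Suc m) \<omega>))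
           + galerkin_proj V (L2_functional (Z \<omega>)))"
    using sol unfolding scheme_solution_def by (elim conjE) (erule spec)
  then obtain Z where prod: "is_stochastic_product M e (\<lambda>\<omega>. G (X m \<omega>)) (\<lambda>\<omega>. W (real (Suc m) * \<tau>) \<omega> - W (real m * \<tau>) \<omega>) Z"
    and eq: "AE \<omega> in M. X (Suc m) \<omega> = X m \<omega> + \<tau> *\<^sub>R discrete_laplacian U V (X (Suc m) \<omega>)
           + \<tau> *\<^sub>R galerkin_proj V (nemytskii_drift U f (X (Suc m) \<omega>))
           + galerkin_proj V (L2_functional (Z \<omega>))"
    by (elim exE conjE)
  have ps: "(\<integral>\<^sup>+\<omega>. ennreal ((norm (Z \<omega> - (\<Sum>k<n. inner (W (real (Suc m) * \<tau>) \<omega> - W (real m * \<tau>) \<omega>) (e k) *\<^sub>R G (X m \<omega>) (e k))))\<^sup>2) \<partial>M)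
      = (\<integral>\<^sup>+\<omega>. ennreal ((norm (Z \<omega> - gs.psum n (X m \<omega>) (xi m \<omega>)))\<^sup>2) \<partial>M)" for n
    by (rule product_sum_eq) (rule V)
  have Zm: "Z \<in> borel_measurable M"
    and lim: "(\<lambda>n. \<integral>\<^sup>+\<omega>. ennreal ((norm (Z \<omega> - gs.psum n (X m \<omega>) (xi m \<omega>)))\<^sup>2) \<partial>M) \<longlonglongrightarrow> 0"
    using prod unfolding is_stochastic_product_def ps by blast+
  have "AE \<omega> in M. Z \<omega> = gs.Z (X m \<omega>) (xi m \<omega>)"
    by (rule L2_limit_unique[OF Zm Z_compose psum_compose lim Z_psum_tendsto_joint])
  from eq AE_space this show ?thesis
  proof eventually_elim
    case (elim \<omega>)
    then have "X m \<omega> \<in> V" "X (Suc m) \<omega> \<in> V" by (auto intro: V)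
    from elim(1)[unfolded scheme_step_iff[OF this]] show ?case
      unfolding elim(3) by (simp only: gs.\<Theta>_def)
  qed
qed

text \<open>The moment at one time allows \<open>solution_step\<close> to be applied there, and the
  step propagates the moment to the next time.\<close>

lemma solution_moment:
  assumes sol: "solution x X"
  shows "(\<integral>\<^sup>+\<omega>. ennreal ((norm (X m \<omega>))\<^sup>2) \<partial>M) < \<infinity>"
proof (induction m)
  case 0
  have "(\<integral>\<^sup>+\<omega>. ennreal ((norm (X 0 \<omega>))\<^sup>2) \<partial>M) = (\<integral>\<^sup>+\<omega>. ennreal ((norm (pr x))\<^sup>2) \<partial>M)"
    using sol by (intro nn_integral_cong) (simp add: scheme_solution_def galerkin_proj_L2)
  then show ?case by (simp add: emeasure_space_1)
next
  case (Suc m)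
  have ad: "X m \<in> borel_measurable (F (real m * \<tau>))" using sol by (simp add: scheme_solution_def)
  interpret gaussian_transition \<tau> L6 L7 L8 \<gamma> "\<lambda>x. \<Psi> (pr x)" "first_eigenvalue U - L1" M "X m" "xi m"
    by (rule transition[OF ad Suc])
  have "(\<integral>\<^sup>+\<omega>. ennreal ((norm (X (Suc m) \<omega>))\<^sup>2) \<partial>M) = (\<integral>\<^sup>+\<omega>. ennreal ((norm (gs.\<Theta> (X m \<omega>) (xi m \<omega>)))\<^sup>2) \<partial>M)"
    using solution_step[OF sol Suc] by (intro nn_integral_cong_AE) (auto elim: eventually_mono)
  then show ?case using \<Theta>_moment by simp
qed

text \<open>The last step is integrated out first, so the induction runs over all bounded
  observables. The right-hand side does not involve the chosen solution.\<close>

lemma solution_expectation: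
  assumes sol: "solution x X" and \<phi>: "\<phi> \<in> borel_measurable borel" "\<And>x. \<bar>\<phi> x\<bar> \<le> B"
  shows "(LINT \<omega>|M. \<phi> (X m \<omega>)) = (gs.K ^^ m) \<phi> (pr x)"
  using \<phi>
proof (induction m arbitrary: \<phi>)
  case 0
  have "(LINT \<omega>|M. \<phi> (X 0 \<omega>)) = (LINT \<omega>|M. \<phi> (pr x))"
    using sol by (intro Bochner_Integration.integral_cong) (auto simp: scheme_solution_def galerkin_proj_L2)
  then show ?case by (simp add: prob_space)
next
  case (Suc m)
  have [measurable]: "\<phi> \<in> borel_measurable borel" by fact
  have ad: "X m \<in> borel_measurable (F (real m * \<tau>))" for m using sol by (simp add: scheme_solution_def)
  have Xm [measurable]: "X m \<in> borel_measurable M" for m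
    using measurable_from_subalg[OF subalgebra_F[OF step_times(1)] ad] .
  interpret gaussian_transition \<tau> L6 L7 L8 \<gamma> "\<lambda>x. \<Psi> (pr x)" "first_eigenvalue U - L1" M "X m" "xi m"
    by (rule transition[OF ad solution_moment[OF sol]])
  have "(LINT \<omega>|M. \<phi> (X (Suc m) \<omega>)) = (LINT \<omega>|M. \<phi> (gs.\<Theta> (X m \<omega>) (xi m \<omega>)))"
  proof (rule integral_cong_AE)
    show "AE \<omega> in M. \<phi> (X (Suc m) \<omega>) = \<phi> (gs.\<Theta> (X m \<omega>) (xi m \<omega>))"
      by (rule eventually_mono[OF solution_step[OF sol solution_moment[OF sol], of m]]) simp
    show "(\<lambda>\<omega>. \<phi> (gs.\<Theta> (X m \<omega>) (xi m \<omega>))) \<in> borel_measurable M"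
      by (rule measurable_compose[OF gs.\<Theta>_compose[OF X_measurable \<xi>_measurable] Suc.prems(1)])
  qed measurable
  also have "\<dots> = (LINT \<omega>|M. gs.K \<phi> (X m \<omega>))"
    by (rule integral_\<Theta>[OF Suc.prems])
  also have "\<dots> = (gs.K ^^ m) (gs.K \<phi>) (pr x)"
    by (rule Suc.IH) (intro gs.K_measurable gs.K_bounded Suc.prems)+
  finally show ?case by (simp add: funpow_swap1)
qed

section \<open>The semigroup as powers of the Markov operator\<close>

abbreviation P :: "nat \<Rightarrow> ('a L2 \<Rightarrow> real) \<Rightarrow> 'a L2 \<Rightarrow> real" where
  "P \<equiv> scheme_semigroup U f G e M F W \<tau> V"

lemma process_solution: "solution x (scheme_process U f G e M F W \<tau> V x)"
  unfolding scheme_process_def by (rule someI_ex[OF solution_exists])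

lemma P_eq:
  assumes "\<phi> \<in> borel_measurable borel" "\<And>x. \<bar>\<phi> x\<bar> \<le> B"
  shows "P m \<phi> x = (gs.K ^^ m) \<phi> (pr x)"
  unfolding scheme_semigroup_def by (rule solution_expectation[OF process_solution assms])

text \<open>An observable may be continuous on the finite element space only. The process stays
  there, so composing with the projection changes no expectation and provides a Borel function on
  the whole space.\<close>

lemma P_pr: "P m \<phi> x = P m (\<lambda>y. \<phi> (pr y)) x"
  unfolding scheme_semigroup_def
proof (rule Bochner_Integration.integral_cong[OF refl])
  fix \<omega> assume "\<omega> \<in> space M"
  then have "scheme_process U f G e M F W \<tau> V x m \<omega> \<in> V"
    using process_solution[of x] by (simp add: scheme_solution_def)
  then show "\<phi> (scheme_process U f G e M F W \<tau> V x m \<omega>) = \<phi> (pr (scheme_process U f G e M F W \<tau> V x m \<omega>))"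
    by (simp add: pr_id)
qed

section \<open>The invariant measure\<close>

definition inv_V :: "'a L2 measure" where "inv_V = restrict_space gs.inv_meas V"

lemma V_borel: "V \<in> sets borel" using V_closed by (rule borel_closed)

lemma V_inv: "V \<inter> space gs.inv_meas \<in> sets gs.inv_meas"
proof -
  have "space gs.inv_meas = UNIV" using sets_eq_imp_space_eq[OF gs.sets_inv_meas] by simp
  then show ?thesis using V_borel gs.sets_inv_meas by simp
qed

lemma AE_inv: "AE y in gs.inv_meas. y \<in> V"
  by (rule gs.inv_meas_AE_range[OF V_borel \<Theta>_in_V])

lemma inv_borel:
  fixes g :: "'a L2 \<Rightarrow> real"
  shows "g \<in> borel_measurable borel \<Longrightarrow> g \<in> borel_measurable gs.inv_meas"
  by (subst measurable_cong_sets[OF gs.sets_inv_meas refl])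

lemma sets_inv_V: "sets inv_V = sets (restrict_space borel V)"
  unfolding inv_V_def by (rule sets_restrict_space_cong[OF gs.sets_inv_meas])

lemma prob_inv_V: "prob_space inv_V"
proof
  interpret I: prob_space gs.inv_meas by (rule gs.inv_meas_prob)
  have "space inv_V = V \<inter> space gs.inv_meas" by (simp add: inv_V_def space_restrict_space)
  then have "emeasure inv_V (space inv_V) = emeasure gs.inv_meas (V \<inter> space gs.inv_meas)"
    unfolding inv_V_def by (simp add: emeasure_restrict_space[OF V_inv])
  also have "\<dots> = emeasure gs.inv_meas (space gs.inv_meas)"
    by (rule emeasure_eq_AE) (use AE_inv V_inv in auto)
  finally show "emeasure inv_V (space inv_V) = 1" by (simp add: I.emeasure_space_1)
qed

text \<open>The invariant law has no mass off \<open>V\<close>, and on \<open>V\<close> the function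
  agrees with its composition with the projection.\<close>

lemma integral_inv_V:
  fixes g :: "'a L2 \<Rightarrow> real"
  assumes g: "(\<lambda>y. g (pr y)) \<in> borel_measurable borel"
  shows "(LINT y|inv_V. g y) = (LINT y|gs.inv_meas. g (pr y))"
proof -
  have "(LINT y|inv_V. g y) = (LINT y|gs.inv_meas. indicator V y *\<^sub>R g (pr y))"
    unfolding inv_V_def integral_restrict_space[OF V_inv]
    by (intro Bochner_Integration.integral_cong refl) (auto simp: indicator_def pr_id)
  also have "\<dots> = (LINT y|gs.inv_meas. g (pr y))"
  proof (rule integral_cong_AE)
    have "(\<lambda>y. indicator V y *\<^sub>R g (pr y)) \<in> borel_measurable borel"
      using g V_borel by measurable
    then show "(\<lambda>y. indicator V y *\<^sub>R g (pr y)) \<in> borel_measurable gs.inv_meas" by (rule inv_borel)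
    show "(\<lambda>y. g (pr y)) \<in> borel_measurable gs.inv_meas" by (rule inv_borel[OF g])
    show "AE y in gs.inv_meas. indicator V y *\<^sub>R g (pr y) = g (pr y)"
      using AE_inv by eventually_elim simp
  qed
  finally show ?thesis .
qed

lemma integral_inv_V':
  fixes g :: "'a L2 \<Rightarrow> real"
  assumes g: "g \<in> borel_measurable borel"
  shows "(LINT y|inv_V. g y) = (LINT y|gs.inv_meas. g y)"
proof -
  have pm: "pr \<in> borel_measurable borel" by (rule borel_measurable_continuous_onI[OF pr_continuous])
  have gp: "(\<lambda>y. g (pr y)) \<in> borel_measurable borel" by (rule measurable_compose[OF pm g])
  have "AE y in gs.inv_meas. g (pr y) = g y"
    using AE_inv by eventually_elim (simp add: pr_id)
  then have "(LINT y|gs.inv_meas. g (pr y)) = (LINT y|gs.inv_meas. g y)"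
    by (intro integral_cong_AE inv_borel gp g)
  then show ?thesis using integral_inv_V[OF gp] by simp
qed

lemma pr_compose_borel:
  assumes "continuous_on V \<phi>"
  shows "(\<lambda>y. \<phi> (pr y)) \<in> borel_measurable borel"
proof (rule borel_measurable_continuous_onI)
  show "continuous_on UNIV (\<lambda>y. \<phi> (pr y))"
    by (rule continuous_on_compose2[OF assms pr_continuous]) (auto simp: pr_in_V)
qed

lemma inv_V_invariant: "invariant_measure V P inv_V"
  unfolding invariant_measure_def
proof (intro conjI allI impI)
  fix \<phi> :: "'a L2 \<Rightarrow> real" and m
  assume "continuous_on V \<phi> \<and> bounded (\<phi> ` V)"
  then obtain B where c: "continuous_on V \<phi>" and B: "\<And>y. y \<in> V \<Longrightarrow> \<bar>\<phi> y\<bar> \<le> B"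
    by (auto simp: bounded_iff)
  define \<psi> where "\<psi> y = \<phi> (pr y)" for y
  have \<psi>: "\<psi> \<in> borel_measurable borel" "\<bar>\<psi> y\<bar> \<le> B" for y
    using pr_compose_borel[OF c] B[OF pr_in_V] by (simp_all add: \<psi>_def[abs_def])
  have P\<phi>: "P m \<phi> x = (gs.K ^^ m) \<psi> (pr x)" for x
    using P_pr[of m \<phi> x] P_eq[OF \<psi>] by (simp add: \<psi>_def[abs_def])
  have Km: "(gs.K ^^ m) \<psi> \<in> borel_measurable borel" by (rule gs.K_funpow(1)[OF \<psi>])
  have pm: "pr \<in> borel_measurable borel" by (rule borel_measurable_continuous_onI[OF pr_continuous])
  have Kp: "(\<lambda>y. (gs.K ^^ m) \<psi> (pr y)) \<in> borel_measurable borel" by (rule measurable_compose[OF pm Km])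
  have "(LINT x|inv_V. P m \<phi> x) = (LINT x|inv_V. (gs.K ^^ m) \<psi> (pr x))" by (simp add: P\<phi>)
  also have "\<dots> = (LINT x|gs.inv_meas. (gs.K ^^ m) \<psi> (pr x))" by (rule integral_inv_V'[OF Kp])
  also have "\<dots> = (LINT x|gs.inv_meas. (gs.K ^^ m) \<psi> x)"
  proof (rule integral_cong_AE)
    show "AE x in gs.inv_meas. (gs.K ^^ m) \<psi> (pr x) = (gs.K ^^ m) \<psi> x"
      using AE_inv by eventually_elim (simp add: pr_id)
  qed (intro inv_borel Kp Km)+
  also have "\<dots> = (LINT x|gs.inv_meas. \<psi> x)" by (rule gs.integral_inv_meas_funpow[OF \<psi>])
  also have "\<dots> = (LINT x|inv_V. \<phi> x)"
    using integral_inv_V[OF pr_compose_borel[OF c]] by (simp add: \<psi>_def)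
  finally show "(LINT x|inv_V. P m \<phi> x) = (LINT x|inv_V. \<phi> x)" .
qed (rule prob_inv_V sets_inv_V)+

text \<open>An invariant measure is pushed to the whole space by the inclusion and tested on
  Lipschitz functions, on which the semigroup is a power of the Markov operator. Uniqueness there
  transfers back to \<open>V\<close>.\<close>

lemma inv_V_unique:
  assumes \<mu>: "invariant_measure V P \<mu>"
  shows "\<mu> = inv_V"
proof -
  have sets: "sets \<mu> = sets (restrict_space borel V)" and "prob_space \<mu>"
    and inv: "\<And>\<phi> m. continuous_on V \<phi> \<Longrightarrow> bounded (\<phi> ` V) \<Longrightarrow> (LINT x|\<mu>. P m \<phi> x) = (LINT x|\<mu>. \<phi> x)"
    using \<mu> by (simp_all add: invariant_measure_def)
  interpret \<mu>: prob_space \<mu> by fact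
  have sp: "space \<mu> = V" using sets_eq_imp_space_eq[OF sets] by (simp add: space_restrict_space)
  have id: "g \<in> borel_measurable borel \<Longrightarrow> g \<in> borel_measurable \<mu>" for g :: "'a L2 \<Rightarrow> 'c::topological_space"
    by (subst measurable_cong_sets[OF sets refl]) (rule measurable_restrict_space1)
  have idm: "(\<lambda>x. x) \<in> borel_measurable \<mu>" by (rule id) simp
  define \<mu>' where "\<mu>' = distr \<mu> borel (\<lambda>x. x)"
  have "\<mu>' = gs.inv_meas"
  proof (rule gs.inv_meas_unique)
    show "prob_space \<mu>'" unfolding \<mu>'_def by (rule \<mu>.prob_space_distr[OF idm])
    show "sets \<mu>' = sets borel" by (simp add: \<mu>'_def)
    fix \<phi> :: "'a L2 \<Rightarrow> real" and B m L
    assume L: "L-lipschitz_on UNIV \<phi>" and B: "\<And>x. \<bar>\<phi> x\<bar> \<le> B"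
    have c: "continuous_on UNIV \<phi>" by (rule lipschitz_on_continuous_on[OF L])
    have \<phi>: "\<phi> \<in> borel_measurable borel" by (rule borel_measurable_continuous_onI[OF c])
    have Km: "(gs.K ^^ m) \<phi> \<in> borel_measurable borel" by (rule gs.K_funpow(1)[OF \<phi> B])
    have "(LINT y|\<mu>'. (gs.K ^^ m) \<phi> y) = (LINT y|\<mu>. (gs.K ^^ m) \<phi> y)"
      unfolding \<mu>'_def by (rule integral_distr[OF idm Km])
    also have "\<dots> = (LINT y|\<mu>. P m \<phi> y)"
      by (intro Bochner_Integration.integral_cong refl) (simp add: sp pr_id P_eq[OF \<phi> B])
    also have "\<dots> = (LINT y|\<mu>. \<phi> y)"
      by (rule inv[OF continuous_on_subset[OF c subset_UNIV]]) (auto simp: bounded_iff intro!: exI[of _ B] B)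
    also have "\<dots> = (LINT y|\<mu>'. \<phi> y)"
      unfolding \<mu>'_def by (rule integral_distr[OF idm \<phi>, symmetric])
    finally show "(LINT y|\<mu>'. (gs.K ^^ m) \<phi> y) = (LINT y|\<mu>'. \<phi> y)" .
  qed
  show ?thesis
  proof (rule measure_eqI)
    show "sets \<mu> = sets inv_V" by (simp add: sets sets_inv_V)
    fix A assume A: "A \<in> sets \<mu>"
    have AV: "A \<subseteq> V" "A \<in> sets borel"
      using A V_borel unfolding sets by (auto simp: sets_restrict_space_iff)
    have "emeasure \<mu> A = emeasure \<mu>' A"
      unfolding \<mu>'_def using AV sp by (subst emeasure_distr[OF idm]) (auto simp: Int_absorb2)
    also have "\<dots> = emeasure inv_V A"
      unfolding \<open>\<mu>' = gs.inv_meas\<close> inv_V_def by (rule emeasure_restrict_space[OF V_inv AV(1), symmetric])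
    finally show "emeasure \<mu> A = emeasure inv_V A" .
  qed
qed

lemma Lip_seminorm:
  assumes \<phi>: "\<phi> \<in> Lip_b (L2_on U)"
  shows "0 \<le> Lip_seminorm (L2_on U) \<phi>"
    and "x \<in> L2_on U \<Longrightarrow> y \<in> L2_on U \<Longrightarrow> \<bar>\<phi> x - \<phi> y\<bar> \<le> Lip_seminorm (L2_on U) \<phi> * norm (x - y)"
proof -
  define D where "D = {\<bar>\<phi> x - \<phi> y\<bar> / norm (x - y) | x y. x \<in> L2_on U \<and> y \<in> L2_on U \<and> x \<noteq> y}"
  obtain C where C: "C-lipschitz_on (L2_on U) \<phi>" using \<phi> by (auto simp: Lip_b_def)
  have "d \<le> C" if "d \<in> D" for d
    using that lipschitz_onD[OF C] by (auto simp: D_def dist_norm divide_le_eq)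
  then have bdd: "bdd_above D" by (rule bdd_aboveI)
  have up: "\<bar>\<phi> x - \<phi> y\<bar> / norm (x - y) \<le> Lip_seminorm (L2_on U) \<phi>" if "x \<in> L2_on U" "y \<in> L2_on U" "x \<noteq> y" for x y
    unfolding Lip_seminorm_def D_def[symmetric]
    by (rule cSup_upper[OF _ bdd]) (use that in \<open>auto simp: D_def\<close>)
  show "\<bar>\<phi> x - \<phi> y\<bar> \<le> Lip_seminorm (L2_on U) \<phi> * norm (x - y)" if "x \<in> L2_on U" "y \<in> L2_on U"
    using up[OF that] by (cases "x = y") (auto simp: divide_le_eq)
  \<comment> \<open>The supremum is over a nonempty set: 0 and the unit vector \<open>e 0\<close>
    are distinct points of H.\<close>
  have "e 0 \<noteq> 0" using orthonormal[of 0 0] by auto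
  then show "0 \<le> Lip_seminorm (L2_on U) \<phi>"
    using up[OF e_in[of 0] subspace_0[OF L2_on_subspace]] order_trans[OF divide_nonneg_nonneg[OF abs_ge_zero norm_ge_zero]] by blast
qed

lemma inv_V_mixing:
  assumes x: "x \<in> L2_on U" and \<phi>: "\<phi> \<in> Lip_b (L2_on U)"
  shows "integrable inv_V (\<lambda>y. norm (x - y))"
    and "\<bar>P m \<phi> x - (LINT y|inv_V. \<phi> y)\<bar>
      \<le> exp (- gs.rate * (real m * \<tau>) / 2) * Lip_seminorm (L2_on U) \<phi> * (LINT y|inv_V. norm (x - y))"
proof -
  let ?L = "Lip_seminorm (L2_on U) \<phi>"
  have nm: "(\<lambda>y. norm (z - y)) \<in> borel_measurable borel" for z :: "'a L2" by measurable
  show "integrable inv_V (\<lambda>y. norm (x - y))"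
    unfolding inv_V_def integrable_restrict_space[OF V_inv]
    using integrable_mult_indicator[OF V_inv gs.integrable_inv_meas_dist[of x]]
    by (rule iffD1[OF Bochner_Integration.integrable_cong[OF refl], rotated]) (auto simp: indicator_def)
  obtain B where B: "\<And>y. y \<in> L2_on U \<Longrightarrow> \<bar>\<phi> y\<bar> \<le> B"
    using \<phi> by (auto simp: Lip_b_def bounded_iff)
  obtain C where C: "C-lipschitz_on (L2_on U) \<phi>" using \<phi> by (auto simp: Lip_b_def)
  have c: "continuous_on V \<phi>"
    by (rule continuous_on_subset[OF lipschitz_on_continuous_on[OF C]]) (auto intro: fe_space_L2_on)
  define \<psi> where "\<psi> y = \<phi> (pr y)" for y
  have \<psi>: "\<psi> \<in> borel_measurable borel" "\<bar>\<psi> y\<bar> \<le> B" for y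
    using pr_compose_borel[OF c] B[OF pr_L2_on] by (simp_all add: \<psi>_def[abs_def])
  have lip: "\<bar>\<psi> y - \<psi> z\<bar> \<le> ?L * norm (y - z)" for y z
    unfolding \<psi>_def
    by (rule order_trans[OF Lip_seminorm(2)[OF \<phi> pr_L2_on pr_L2_on] mult_left_mono[OF pr_lipschitz Lip_seminorm(1)[OF \<phi>]]])
  have "P m \<phi> x = (gs.K ^^ m) \<psi> (pr x)"
    using P_pr[of m \<phi> x] P_eq[OF \<psi>] by (simp add: \<psi>_def[abs_def])
  moreover have "(LINT y|inv_V. \<phi> y) = (LINT y|gs.inv_meas. \<psi> y)"
    using integral_inv_V[OF pr_compose_borel[OF c]] by (simp add: \<psi>_def)
  ultimately have "\<bar>P m \<phi> x - (LINT y|inv_V. \<phi> y)\<bar> \<le> ?L * gs.r ^ m * (LINT y|gs.inv_meas. norm (pr x - y))"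
    using gs.mixing[OF \<psi> lip Lip_seminorm(1)[OF \<phi>], of m "pr x"] by simp
  \<comment> \<open>The chain starts at \<open>pr x\<close>. Almost every y lies in \<open>V\<close>
    and is fixed by the projection, so projecting x does not increase the distance to y.\<close>
  also have "\<dots> \<le> ?L * gs.r ^ m * (LINT y|gs.inv_meas. norm (x - y))"
  proof (rule mult_left_mono)
    show "(LINT y|gs.inv_meas. norm (pr x - y)) \<le> (LINT y|gs.inv_meas. norm (x - y))"
    proof (rule integral_mono_AE[OF gs.integrable_inv_meas_dist gs.integrable_inv_meas_dist])
      show "AE y in gs.inv_meas. norm (pr x - y) \<le> norm (x - y)"
        using AE_inv
      proof eventually_elim
        case (elim y)
        then show ?case using pr_lipschitz[of x y] by (simp add: pr_id)
      qed
    qed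
    show "0 \<le> ?L * gs.r ^ m" using Lip_seminorm(1)[OF \<phi>] by (simp add: gs.r_def)
  qed
  also have "gs.r ^ m = exp (- gs.rate * (real m * \<tau>) / 2)"
    unfolding gs.r_def by (simp add: exp_of_nat_mult[symmetric] mult_ac)
  also have "(LINT y|gs.inv_meas. norm (x - y)) = (LINT y|inv_V. norm (x - y))"
    by (rule integral_inv_V'[OF nm, symmetric])
  finally show "\<bar>P m \<phi> x - (LINT y|inv_V. \<phi> y)\<bar>
      \<le> exp (- gs.rate * (real m * \<tau>) / 2) * ?L * (LINT y|inv_V. norm (x - y))"
    by (simp add: mult_ac)
qed

end

theorem theorem3p2:
  fixes \<O> :: "'a::euclidean_space set"
    and f g :: "real \<Rightarrow> real"
    and L1 L2 L3 L4 L5 L6 L7 L8 q :: real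
    and Q :: "'a L2 \<Rightarrow> 'a L2" and gk :: "nat \<Rightarrow> 'a L2" and qk :: "nat \<Rightarrow> real"
    and M :: "'w measure" and F :: "real \<Rightarrow> 'w measure"
    and \<beta> :: "nat \<Rightarrow> real \<Rightarrow> 'w \<Rightarrow> real" and W :: "real \<Rightarrow> 'w \<Rightarrow> 'a L2"
    and G :: "'a L2 \<Rightarrow> 'a L2 \<Rightarrow> 'a L2"
    and T :: "real \<Rightarrow> 'a set set"
    and \<tau> h :: real
  defines "H \<equiv> L2_on \<O>"
    and "lam1 \<equiv> first_eigenvalue \<O>"
  assumes dim: "DIM('a) \<in> {1, 2, 3}"
    and domain: "open \<O>" "bounded \<O>" "\<O> \<noteq> {}" "smooth_boundary \<O>"
    and noise: "covariance_operator H Q gk qk"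
      "filtered_prob_space M F" "wiener_process M F gk qk \<beta> W"
    and f_diff: "\<And>\<xi>. f differentiable (at \<xi>)"
    and q: "1 \<le> q" "DIM('a) = 3 \<Longrightarrow> q \<le> 3"
    and F1: "\<And>\<xi> \<eta>. (f \<xi> - f \<eta>) * (\<xi> - \<eta>) \<le> L1 * (\<xi> - \<eta>)\<^sup>2"
    and F2: "\<And>\<xi>. f \<xi> * \<xi> \<le> L2 * \<bar>\<xi>\<bar>\<^sup>2 + L3"
    and F3: "\<And>\<xi>. \<bar>deriv f \<xi>\<bar> \<le> L4 * (if q = 1 then 1 else \<bar>\<xi>\<bar> powr (q - 1)) + L5"
    and G: "nemytskii_diffusion \<O> gk qk g G"
    and L678: "0 \<le> L6" "0 \<le> L7" "0 \<le> L8"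
    and G1: "\<And>x y. x \<in> H \<Longrightarrow> y \<in> H \<Longrightarrow>
      (L20_norm gk qk (\<lambda>u. G x u - G y u))\<^sup>2 \<le> L6 * (norm (x - y))\<^sup>2"
    and G2: "\<And>x. x \<in> H \<Longrightarrow> (L20_norm gk qk (G x))\<^sup>2 \<le> L7 * (norm x)\<^sup>2 + L8"
    and mesh: "regular_mesh_family \<O> T"
    and dissipative: "max (L1 + L6 / 2) (L2 + L7 / 2) < lam1"
    and \<tau>: "0 < \<tau>" "\<tau> < 1"
    and h: "0 < h" "h < 1"
  defines "V \<equiv> fe_space \<O> (T h)"
    and "P \<equiv> scheme_semigroup \<O> f G gk M F W \<tau> (fe_space \<O> (T h))"
    and "\<gamma>6 \<equiv> (2 * (lam1 - L1) - L6) / (2 * (lam1 - L1) + 1)"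
  shows "\<gamma>6 > 0 \<and>
    (\<exists>\<pi>. invariant_measure V P \<pi> \<and>
      (\<forall>\<mu>. invariant_measure V P \<mu> \<longrightarrow> \<mu> = \<pi>) \<and>
      (\<forall>m. \<forall>x\<in>H. \<forall>\<phi>\<in>Lip_b H.
        integrable \<pi> (\<lambda>y. norm (x - y)) \<and>
        \<bar>P m \<phi> x - (LINT y|\<pi>. \<phi> y)\<bar>
          \<le> exp (- \<gamma>6 * (real m * \<tau>) / 2) * Lip_seminorm H \<phi> * (LINT y|\<pi>. norm (x - y))))"
proof -
  have orth: "inner (gk i) (gk j) = (if i = j then 1 else 0)" and gk_in: "gk i \<in> L2_on \<O>" for i j
    using noise(1) by (auto simp: covariance_operator_def orthonormal_basis_of_def H_def)
  \<comment> \<open>Positive definiteness of \<open>Q\<close>, evaluated at the unit eigenvector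
    \<open>gk k\<close>.\<close>
  have qk_pos: "0 < qk k" for k
  proof -
    have "gk k \<noteq> 0" using orth[of k k] by auto
    moreover have "\<forall>u\<in>L2_on \<O>. u \<noteq> 0 \<longrightarrow> 0 < inner (Q u) u"
      using noise(1) unfolding covariance_operator_def H_def by (elim conjE)
    ultimately have "0 < inner (Q (gk k)) (gk k)" using gk_in[of k] by blast
    moreover have "Q (gk k) = qk k *\<^sub>R gk k" using noise(1) by (simp add: covariance_operator_def)
    ultimately show ?thesis by (simp add: orth)
  qed
  have "is_mesh \<O> h (T h)" using mesh h by (simp add: regular_mesh_family_def)
  then have tri: "triangulation (T h)" and cover: "closure \<O> \<subseteq> \<Union>(T h)" by (simp_all add: is_mesh_def)
  have fin: "finite (T h)" using tri by (simp add: triangulation_def)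
  have closed: "closed S" if "S \<in> T h" for S
  proof -
    obtain n where "n simplex S" using tri \<open>S \<in> T h\<close> unfolding triangulation_def by blast
    then show ?thesis by (rule closed_simplex)
  qed
  have f_cont: "continuous_on UNIV f"
    using f_diff by (intro differentiable_imp_continuous_on) (simp add: differentiable_on_def differentiable_at_withinI)
  have M: "prob_space M" using noise(2) by (simp add: filtered_prob_space_def)
  have L1: "L1 < first_eigenvalue \<O>" and diss: "L6 < 2 * (first_eigenvalue \<O> - L1)"
    using dissipative L678 by (auto simp: lam1_def)
  interpret S: galerkin_scheme \<O> "T h" f L1 \<tau> M F gk qk \<beta> W G L6 L7 L8
  proof (intro galerkin_scheme.intro galerkin_step.intro fe_mesh.intro bounded_open.intro fe_mesh_axioms.intro
      galerkin_step_axioms.intro wiener_noise.intro wiener_noise_axioms.intro galerkin_scheme_axioms.intro M)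
    show "G x \<in> L20 (L2_on \<O>) gk qk" if "x \<in> L2_on \<O>" for x
      using G that by (simp add: nemytskii_diffusion_def)
    show "\<exists>K\<ge>0. \<forall>a b. \<bar>a\<bar> \<le> R \<longrightarrow> \<bar>b\<bar> \<le> R \<longrightarrow> \<bar>f a - f b\<bar> \<le> K * \<bar>a - b\<bar>" for R
      by (rule locally_lipschitz_if_deriv_growth[OF f_diff q(1) F3])
    show "(f a - f b) * (a - b) \<le> L1 * (a - b)\<^sup>2" for a b by (rule F1)
    show "(L20_norm gk qk (\<lambda>u. G x u - G y u))\<^sup>2 \<le> L6 * (norm (x - y))\<^sup>2"
      if "x \<in> L2_on \<O>" "y \<in> L2_on \<O>" for x y
      using G1 that by (simp add: H_def)
    show "(L20_norm gk qk (G x))\<^sup>2 \<le> L7 * (norm x)\<^sup>2 + L8" if "x \<in> L2_on \<O>" for x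
      using G2 that by (simp add: H_def)
  qed (use domain fin closed cover f_cont \<tau> L1 diss noise orth qk_pos gk_in L678 in simp_all)
  have rate: "S.gs.rate = \<gamma>6" by (simp add: S.gs.rate_def \<gamma>6_def lam1_def)
  show ?thesis
  proof (intro conjI exI[of _ S.inv_V] allI impI ballI)
    show "\<gamma>6 > 0" using S.gs.rate_pos unfolding rate .
    show "invariant_measure V P S.inv_V" unfolding V_def P_def by (rule S.inv_V_invariant)
    show "\<mu> = S.inv_V" if "invariant_measure V P \<mu>" for \<mu>
      by (rule S.inv_V_unique) (use that in \<open>simp only: V_def P_def\<close>)
    fix m x \<phi> assume x: "x \<in> H" and \<phi>: "\<phi> \<in> Lip_b H"
    show "integrable S.inv_V (\<lambda>y. norm (x - y))"
      using S.inv_V_mixing(1) x \<phi> unfolding H_def .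
    show "\<bar>P m \<phi> x - (LINT y|S.inv_V. \<phi> y)\<bar>
        \<le> exp (- \<gamma>6 * (real m * \<tau>) / 2) * Lip_seminorm H \<phi> * (LINT y|S.inv_V. norm (x - y))"
      using S.inv_V_mixing(2)[of x \<phi> m] x \<phi> unfolding H_def P_def rate by blast
  qed
qed

end
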